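(* Let $A$ be an $\mathcal{O}_K$-flat pseudoaffinoid $\mathcal{O}_K$-algebra such that $\pi\notin A^\times$, and let $T$ be a topologically nilpotent unit of $A$. If $\phi:k((T))\langle X_1,\dots,X_r\rangle\rightarrow A/\pi A$ is a finite injection of $k((T))$-affinoid algebras, then, for a sufficiently large natural number $n$, $\phi$ can be lifted to a finite injection $\Phi:D_n\langle X_1,\dots,X_r\rangle\rightarrow A\langle\pi/T^n\rangle$ of pseudoaffinoid $\mathcal{O}_K$-algebras.
   Context: $K$ is a discretely valued complete nonarchimedean field, $\mathcal{O}_K$ its ring of integers, $\pi$ a uniformiser, $k$ the residue field. A pseudoaffinoid $\mathcal{O}_K$-algebra is a complete Tate (Huber) $\mathcal{O}_K$-algebra $A$ having a noetherian ring of definition $A_0$ which is formally of finite type over $\mathcal{O}_K$, i.e. $A_0$ is a complete noetherian adic $\mathcal{O}_K$-algebra (with continuous structure map) whose reduction $A_0/A_0^{\circ\circ}$ by the ideal of topologically nilpotent elements is a finitely generated $k$-algebra. Homomorphisms of pseudoaffinoid $\mathcal{O}_K$-algebras are continuous $\mathcal{O}_K$-algebra homomorphisms. The ring $A/\pi A$ is regarded as a $k((T))$-affinoid algebra via the continuous $k$-homomorphism $k((T))\to A/\pi A$ sending the variable $T$ to the class of the unit $T\in A$. For a natural number $n\geq 1$, $D_n=\mathcal{O}_K[[T]]\langle \pi/T^n\rangle[1/T]$ is the ring of functions on the rational subset $\{|\pi|\le|T^n|\neq0\}$ of $\operatorname{Spa}(\mathcal{O}_K[[T]],\mathcal{O}_K[[T]])$,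 where $\mathcal{O}_K[[T]]$ carries the $(\pi,T)$-adic topology; $D_n\langle X_1,\dots,X_r\rangle$ is the ring of convergent power series over it. One has $D_n\langle X_1,\dots,X_r\rangle/\pi\cong k((T))\langle X_1,\dots,X_r\rangle$. $A\langle\pi/T^n\rangle$ is the rational localisation of $A$ corresponding to $\{|\pi|\le|T^n|\}\subseteq\operatorname{Spa}(A,A^\circ)$; one has $A\langle\pi/T^n\rangle/\pi\cong A/\pi A$. "Lifted" means that the reduction of $\Phi$ modulo $\pi$ is $\phi$ under these identifications. *)

theory Defs
  imports
    "HOL-Algebra.Algebra"
    "HOL-Analysis.Abstract_Limits"
    "HOL-Analysis.T1_Spaces"
    "HOL-Library.Poly_Mapping"
begin

section \<open>Topological rings\<close>

record 'a top_ring = "'a ring" +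
  opens :: "'a topology"

definition topological_ring :: "('a, 'b) top_ring_scheme \<Rightarrow> bool" where
  "topological_ring R \<longleftrightarrow>
     cring R \<and> topspace (opens R) = carrier R \<and>
     continuous_map (prod_topology (opens R) (opens R)) (opens R) (\<lambda>(x, y). x \<oplus>\<^bsub>R\<^esub> y) \<and>
     continuous_map (opens R) (opens R) (\<lambda>x. \<ominus>\<^bsub>R\<^esub> x) \<and>
     continuous_map (prod_topology (opens R) (opens R)) (opens R) (\<lambda>(x, y). x \<otimes>\<^bsub>R\<^esub> y)"

definition cont_ring_hom ::
    "('a, 'c) top_ring_scheme \<Rightarrow> ('b, 'd) top_ring_scheme \<Rightarrow> ('a \<Rightarrow> 'b) set" where
  "cont_ring_hom R S = {h \<in> ring_hom R S. continuous_map (opens R) (opens S) h}"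

definition with_topology :: "('a, 'b) ring_scheme \<Rightarrow> 'a topology \<Rightarrow> 'a top_ring" where
  "with_topology R \<tau> =
     \<lparr>carrier = carrier R, monoid.mult = monoid.mult R, one = one R,
      ring.zero = ring.zero R, ring.add = ring.add R, opens = \<tau>\<rparr>"

definition sub_top_ring :: "('a, 'b) top_ring_scheme \<Rightarrow> 'a set \<Rightarrow> 'a top_ring" where
  "sub_top_ring R H = with_topology (R\<lparr>carrier := H\<rparr>) (subtopology (opens R) H)"

definition quot_top_ring :: "('a, 'b) top_ring_scheme \<Rightarrow> 'a set \<Rightarrow> 'a set top_ring" where
  "quot_top_ring R I = with_topology (R Quot I)
     (topology (\<lambda>W. W \<subseteq> carrier (R Quot I) \<and>
        openin (opens R) {x \<in> carrier R. I +>\<^bsub>R\<^esub> x \<in> W}))"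

text \<open>The translation-invariant topology in which the family \<open>B\<close> of subsets (in all uses below a
  downward directed family with a cofinal family of additive subgroups) is a basis of
  neighbourhoods of zero.\<close>

definition zero_basis_topology :: "('a, 'b) ring_scheme \<Rightarrow> 'a set set \<Rightarrow> 'a topology" where
  "zero_basis_topology R B = topology (\<lambda>W. W \<subseteq> carrier R \<and>
     (\<forall>x\<in>W. \<exists>U\<in>B. {x \<oplus>\<^bsub>R\<^esub> u | u. u \<in> U} \<subseteq> W))"

definition adic_topology :: "('a, 'b) ring_scheme \<Rightarrow> 'a set \<Rightarrow> 'a topology" where
  "adic_topology R I = zero_basis_topology R {I [^]\<^bsub>ideals_set R\<^esub> (m::nat) | m. True}"

definition top_nilpotent :: "('a, 'b) top_ring_scheme \<Rightarrow> 'a \<Rightarrow> bool" where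
  "top_nilpotent R x \<longleftrightarrow>
     x \<in> carrier R \<and> limitin (opens R) (\<lambda>j::nat. x [^]\<^bsub>R\<^esub> j) \<zero>\<^bsub>R\<^esub> sequentially"

definition cauchy_seq :: "('a, 'b) top_ring_scheme \<Rightarrow> (nat \<Rightarrow> 'a) \<Rightarrow> bool" where
  "cauchy_seq R a \<longleftrightarrow>
     (\<forall>i. a i \<in> carrier R) \<and>
     (\<forall>U. openin (opens R) U \<and> \<zero>\<^bsub>R\<^esub> \<in> U \<longrightarrow>
        (\<exists>N. \<forall>i\<ge>N. \<forall>j\<ge>N. a i \<ominus>\<^bsub>R\<^esub> a j \<in> U))"

text \<open>Sequences suffice for completeness and completion, since all topological rings considered
  here have a countable basis of neighbourhoods of zero.\<close>

definition complete_top_ring :: "('a, 'b) top_ring_scheme \<Rightarrow> bool" where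
  "complete_top_ring R \<longleftrightarrow>
     Hausdorff_space (opens R) \<and>
     (\<forall>a. cauchy_seq R a \<longrightarrow> (\<exists>x. limitin (opens R) a x sequentially))"

definition cauchy_ring :: "('a, 'b) top_ring_scheme \<Rightarrow> (nat \<Rightarrow> 'a) ring" where
  "cauchy_ring R =
     \<lparr>carrier = {a. cauchy_seq R a},
      monoid.mult = (\<lambda>a b i. a i \<otimes>\<^bsub>R\<^esub> b i), one = (\<lambda>_. \<one>\<^bsub>R\<^esub>),
      ring.zero = (\<lambda>_. \<zero>\<^bsub>R\<^esub>),
      ring.add = (\<lambda>a b i. a i \<oplus>\<^bsub>R\<^esub> b i)\<rparr>"

definition null_seqs :: "('a, 'b) top_ring_scheme \<Rightarrow> (nat \<Rightarrow> 'a) set" where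
  "null_seqs R = {a. cauchy_seq R a \<and> limitin (opens R) a \<zero>\<^bsub>R\<^esub> sequentially}"

definition completion :: "('a, 'b) top_ring_scheme \<Rightarrow> (nat \<Rightarrow> 'a) set top_ring" where
  "completion R = (let C = cauchy_ring R Quot null_seqs R in
     with_topology C (zero_basis_topology C
       {{c \<in> carrier C. \<exists>a\<in>c. \<forall>i. a i \<in> U} | U. openin (opens R) U \<and> \<zero>\<^bsub>R\<^esub> \<in> U}))"

definition completion_map :: "('a, 'b) top_ring_scheme \<Rightarrow> 'a \<Rightarrow> (nat \<Rightarrow> 'a) set" where
  "completion_map R x = null_seqs R +>\<^bsub>cauchy_ring R\<^esub> (\<lambda>_. x)"


section \<open>Rings of series\<close>

text \<open>Families indexed by \<open>'i\<close> lying in the set \<open>S\<close>, with the convolution product. The index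
  types used are \<open>nat\<close> (power series), \<open>int\<close> (Laurent series) and \<open>nat \<Rightarrow>\<^sub>0 nat\<close> (multi-indices).
  Every sum occurring for these is finite.\<close>

definition series_ring ::
    "('a, 'b) ring_scheme \<Rightarrow> ('i::comm_monoid_add \<Rightarrow> 'a) set \<Rightarrow> ('i \<Rightarrow> 'a) ring" where
  "series_ring R S =
     \<lparr>carrier = S,
      monoid.mult = (\<lambda>f g m. finsum R (\<lambda>(i, j). f i \<otimes>\<^bsub>R\<^esub> g j)
                {(i, j). i + j = m \<and> f i \<noteq> \<zero>\<^bsub>R\<^esub> \<and> g j \<noteq> \<zero>\<^bsub>R\<^esub>}),
      one = (\<lambda>i. if i = 0 then \<one>\<^bsub>R\<^esub> else \<zero>\<^bsub>R\<^esub>),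
      ring.zero = (\<lambda>_. \<zero>\<^bsub>R\<^esub>),
      ring.add = (\<lambda>f g i. f i \<oplus>\<^bsub>R\<^esub> g i)\<rparr>"

definition series_const :: "('a, 'b) ring_scheme \<Rightarrow> 'a \<Rightarrow> ('i::zero \<Rightarrow> 'a)" where
  "series_const R c = (\<lambda>i. if i = 0 then c else \<zero>\<^bsub>R\<^esub>)"

definition series_monom :: "('a, 'b) ring_scheme \<Rightarrow> 'i \<Rightarrow> ('i \<Rightarrow> 'a)" where
  "series_monom R m = (\<lambda>i. if i = m then \<one>\<^bsub>R\<^esub> else \<zero>\<^bsub>R\<^esub>)"

definition power_series_ring :: "('a, 'b) ring_scheme \<Rightarrow> (nat \<Rightarrow> 'a) ring" where
  "power_series_ring R = series_ring R {f. \<forall>i. f i \<in> carrier R}"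

text \<open>\<open>k((T))\<close> with the \<open>T\<close>-adic topology.\<close>

definition laurent_series_ring :: "('a, 'b) ring_scheme \<Rightarrow> (int \<Rightarrow> 'a) top_ring" where
  "laurent_series_ring k =
     (let L = series_ring k {f. (\<forall>i. f i \<in> carrier k) \<and> (\<exists>m. \<forall>i<m. f i = \<zero>\<^bsub>k\<^esub>)} in
      with_topology L (zero_basis_topology L {{f \<in> carrier L. \<forall>i<m. f i = \<zero>\<^bsub>k\<^esub>} | m. True}))"

text \<open>\<open>R\<langle>X\<^sub>1,\<dots>,X\<^sub>r\<rangle>\<close>: series in the variables with numbers \<open>0,\<dots>,r-1\<close> whose coefficients tend to
  zero, with the topology of uniform convergence of the coefficients.\<close>

definition tate_algebra :: "nat \<Rightarrow> ('a, 'b) top_ring_scheme \<Rightarrow> ((nat \<Rightarrow>\<^sub>0 nat) \<Rightarrow> 'a) top_ring" where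
  "tate_algebra r R =
     (let P = series_ring R
        {f. (\<forall>\<nu>. f \<nu> \<in> carrier R) \<and>
            (\<forall>\<nu>. \<not> Poly_Mapping.keys \<nu> \<subseteq> {..<r} \<longrightarrow> f \<nu> = \<zero>\<^bsub>R\<^esub>) \<and>
            (\<forall>U. openin (opens R) U \<and> \<zero>\<^bsub>R\<^esub> \<in> U \<longrightarrow> finite {\<nu>. f \<nu> \<notin> U})} in
      with_topology P (zero_basis_topology P
        {{f \<in> carrier P. \<forall>\<nu>. f \<nu> \<in> U} | U. openin (opens R) U \<and> \<zero>\<^bsub>R\<^esub> \<in> U}))"


section \<open>Rational localisation\<close>

text \<open>\<open>fraction R s a m\<close> is the class of the fraction \<open>a / s^m\<close> in \<open>R[1/s]\<close>.\<close>

definition fraction :: "('a, 'b) ring_scheme \<Rightarrow> 'a \<Rightarrow> 'a \<Rightarrow> nat \<Rightarrow> ('a \<times> nat) set" where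
  "fraction R s a m = {(b, l). b \<in> carrier R \<and>
     (\<exists>j::nat. s [^]\<^bsub>R\<^esub> j \<otimes>\<^bsub>R\<^esub> (s [^]\<^bsub>R\<^esub> m \<otimes>\<^bsub>R\<^esub> b) = s [^]\<^bsub>R\<^esub> j \<otimes>\<^bsub>R\<^esub> (s [^]\<^bsub>R\<^esub> l \<otimes>\<^bsub>R\<^esub> a))}"

definition localisation :: "('a, 'b) ring_scheme \<Rightarrow> 'a \<Rightarrow> ('a \<times> nat) set ring" where
  "localisation R s =
     \<lparr>carrier = {fraction R s a m | a m. a \<in> carrier R},
      monoid.mult = (\<lambda>x y. \<Union>(a, m)\<in>x. \<Union>(b, l)\<in>y. fraction R s (a \<otimes>\<^bsub>R\<^esub> b) (m + l)),
      one = fraction R s \<one>\<^bsub>R\<^esub> 0,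
      ring.zero = fraction R s \<zero>\<^bsub>R\<^esub> 0,
      ring.add = (\<lambda>x y. \<Union>(a, m)\<in>x. \<Union>(b, l)\<in>y.
               fraction R s (s [^]\<^bsub>R\<^esub> l \<otimes>\<^bsub>R\<^esub> a \<oplus>\<^bsub>R\<^esub> s [^]\<^bsub>R\<^esub> m \<otimes>\<^bsub>R\<^esub> b) (m + l))\<rparr>"

text \<open>Huber's ring \<open>R(f/s)\<close>: the ring \<open>R[1/s]\<close> in which, for a pair of definition \<open>(R\<^sub>0, I)\<close>, the
  subgroups \<open>I^m \<cdot> R\<^sub>0[f/s]\<close> form a basis of neighbourhoods of zero. To avoid choosing a pair, all
  subgroups \<open>\<Sum>\<^sub>j U \<cdot> (f/s)^j\<close> for open subgroups \<open>U\<close> are used; \<open>U = I^m\<close> gives the former.\<close>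

definition loc_zero_nbhd :: "('a, 'b) ring_scheme \<Rightarrow> 'a \<Rightarrow> 'a \<Rightarrow> 'a set \<Rightarrow> ('a \<times> nat) set set" where
  "loc_zero_nbhd R f s U = generate (add_monoid (localisation R s))
     {fraction R s (u \<otimes>\<^bsub>R\<^esub> f [^]\<^bsub>R\<^esub> j) j | u j. u \<in> U}"

definition top_localisation ::
    "('a, 'b) top_ring_scheme \<Rightarrow> 'a \<Rightarrow> 'a \<Rightarrow> ('a \<times> nat) set top_ring" where
  "top_localisation R f s = with_topology (localisation R s)
     (zero_basis_topology (localisation R s)
       {loc_zero_nbhd R f s U | U. additive_subgroup U R \<and> openin (opens R) U})"

text \<open>\<open>R\<langle>f/s\<rangle>\<close>, functions on the rational subset \<open>|f| \<le> |s| \<noteq> 0\<close>, with its canonical map.\<close>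

definition rational_localisation ::
    "('a, 'b) top_ring_scheme \<Rightarrow> 'a \<Rightarrow> 'a \<Rightarrow> (nat \<Rightarrow> ('a \<times> nat) set) set top_ring" where
  "rational_localisation R f s = completion (top_localisation R f s)"

definition rational_localisation_map ::
    "('a, 'b) top_ring_scheme \<Rightarrow> 'a \<Rightarrow> 'a \<Rightarrow> 'a \<Rightarrow> (nat \<Rightarrow> ('a \<times> nat) set) set" where
  "rational_localisation_map R f s x = completion_map (top_localisation R f s) (fraction R s x 0)"


section \<open>Flatness\<close>

text \<open>The tensor product \<open>N \<otimes>\<^sub>R M\<close>: the list \<open>[(x\<^sub>1, m\<^sub>1), \<dots>]\<close> stands for \<open>\<Sum> x\<^sub>i \<otimes> m\<^sub>i\<close>, and the
  relation below is the congruence making these sums a bilinear abelian group.\<close>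

inductive tensor_eq ::
    "('r, 'c) ring_scheme \<Rightarrow> ('r, 'n, 'd) module_scheme \<Rightarrow> ('r, 'm, 'e) module_scheme \<Rightarrow>
     ('n \<times> 'm) list \<Rightarrow> ('n \<times> 'm) list \<Rightarrow> bool"
  for R N M where
  refl: "tensor_eq R N M xs xs"
| sym: "tensor_eq R N M xs ys \<Longrightarrow> tensor_eq R N M ys xs"
| trans: "tensor_eq R N M xs ys \<Longrightarrow> tensor_eq R N M ys zs \<Longrightarrow> tensor_eq R N M xs zs"
| cong: "tensor_eq R N M xs ys \<Longrightarrow> set us \<subseteq> carrier N \<times> carrier M \<Longrightarrow>
    set vs \<subseteq> carrier N \<times> carrier M \<Longrightarrow> tensor_eq R N M (us @ xs @ vs) (us @ ys @ vs)"
| comm: "p \<in> carrier N \<times> carrier M \<Longrightarrow> q \<in> carrier N \<times> carrier M \<Longrightarrow>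
    tensor_eq R N M [p, q] [q, p]"
| zero: "m \<in> carrier M \<Longrightarrow> tensor_eq R N M [(\<zero>\<^bsub>N\<^esub>, m)] []"
| add_left: "x \<in> carrier N \<Longrightarrow> y \<in> carrier N \<Longrightarrow> m \<in> carrier M \<Longrightarrow>
    tensor_eq R N M [(x \<oplus>\<^bsub>N\<^esub> y, m)] [(x, m), (y, m)]"
| add_right: "x \<in> carrier N \<Longrightarrow> m \<in> carrier M \<Longrightarrow> m' \<in> carrier M \<Longrightarrow>
    tensor_eq R N M [(x, m \<oplus>\<^bsub>M\<^esub> m')] [(x, m), (x, m')]"
| balanced: "r \<in> carrier R \<Longrightarrow> x \<in> carrier N \<Longrightarrow> m \<in> carrier M \<Longrightarrow>
    tensor_eq R N M [(r \<odot>\<^bsub>N\<^esub> x, m)] [(x, r \<odot>\<^bsub>M\<^esub> m)]"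

definition linear_maps ::
    "('r, 'c) ring_scheme \<Rightarrow> ('r, 'n, 'd) module_scheme \<Rightarrow> ('r, 'm, 'e) module_scheme \<Rightarrow>
     ('n \<Rightarrow> 'm) set" where
  "linear_maps R N M = {f \<in> hom (add_monoid N) (add_monoid M).
     \<forall>r\<in>carrier R. \<forall>x\<in>carrier N. f (r \<odot>\<^bsub>N\<^esub> x) = r \<odot>\<^bsub>M\<^esub> f x}"

text \<open>\<open>M\<close> is flat if tensoring with \<open>M\<close> preserves injectivity of linear maps \<open>N \<rightarrow> N'\<close>. As one
  cannot quantify over types, \<open>N\<close> and \<open>N'\<close> have elements of type \<open>(nat \<Rightarrow> 'r) set\<close>; every finitely
  generated module, being a quotient of some \<open>R^d\<close>, has a copy on this type, and since tensor
  products commute with direct limits this is no restriction.\<close>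

definition flat_module :: "('r, 'c) ring_scheme \<Rightarrow> ('r, 'm, 'e) module_scheme \<Rightarrow> bool" where
  "flat_module R M \<longleftrightarrow> Module.module R M \<and>
     (\<forall>(N :: ('r, (nat \<Rightarrow> 'r) set) module) (N' :: ('r, (nat \<Rightarrow> 'r) set) module) f.
        Module.module R N \<and> Module.module R N' \<and>
        f \<in> linear_maps R N N' \<and> inj_on f (carrier N) \<longrightarrow>
        (\<forall>xs ys. set xs \<subseteq> carrier N \<times> carrier M \<and> set ys \<subseteq> carrier N \<times> carrier M \<and>
           tensor_eq R N' M (map (apfst f) xs) (map (apfst f) ys) \<longrightarrow> tensor_eq R N M xs ys))"

definition module_via :: "('a, 'b) ring_scheme \<Rightarrow> ('r \<Rightarrow> 'a) \<Rightarrow> ('r, 'a) module" where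
  "module_via A \<eta> =
     \<lparr>carrier = carrier A, monoid.mult = monoid.mult A, one = one A,
      ring.zero = ring.zero A, ring.add = ring.add A,
      smult = (\<lambda>r a. \<eta> r \<otimes>\<^bsub>A\<^esub> a)\<rparr>"

definition flat_via :: "('r, 'c) ring_scheme \<Rightarrow> ('a, 'b) ring_scheme \<Rightarrow> ('r \<Rightarrow> 'a) \<Rightarrow> bool" where
  "flat_via R A \<eta> \<longleftrightarrow> flat_module R (module_via A \<eta>)"

definition module_finite :: "('a, 'c) ring_scheme \<Rightarrow> ('b, 'd) ring_scheme \<Rightarrow> ('a \<Rightarrow> 'b) \<Rightarrow> bool" where
  "module_finite R S h \<longleftrightarrow>
     (\<exists>E. finite E \<and> E \<subseteq> carrier S \<and>
        (\<forall>y\<in>carrier S. \<exists>c. c \<in> E \<rightarrow> carrier R \<and> y = (\<Oplus>\<^bsub>S\<^esub>e\<in>E. h (c e) \<otimes>\<^bsub>S\<^esub> e)))"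


section \<open>Discretely valued fields\<close>

text \<open>The normalised valuation \<open>v\<close> is meaningful on nonzero elements only.\<close>

definition valued_field_ring :: "('k, 'm) ring_scheme \<Rightarrow> ('k \<Rightarrow> int) \<Rightarrow> 'k top_ring" where
  "valued_field_ring K v = with_topology K
     (zero_basis_topology K {{x \<in> carrier K. x = \<zero>\<^bsub>K\<^esub> \<or> m \<le> v x} | m. True})"

definition complete_discretely_valued_field :: "('k, 'm) ring_scheme \<Rightarrow> ('k \<Rightarrow> int) \<Rightarrow> bool" where
  "complete_discretely_valued_field K v \<longleftrightarrow>
     field K \<and>
     v ` (carrier K - {\<zero>\<^bsub>K\<^esub>}) = UNIV \<and>
     (\<forall>x\<in>carrier K - {\<zero>\<^bsub>K\<^esub>}. \<forall>y\<in>carrier K - {\<zero>\<^bsub>K\<^esub>}. v (x \<otimes>\<^bsub>K\<^esub> y) = v x + v y) \<and>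
     (\<forall>x\<in>carrier K - {\<zero>\<^bsub>K\<^esub>}. \<forall>y\<in>carrier K - {\<zero>\<^bsub>K\<^esub>}.
        x \<oplus>\<^bsub>K\<^esub> y \<noteq> \<zero>\<^bsub>K\<^esub> \<longrightarrow> min (v x) (v y) \<le> v (x \<oplus>\<^bsub>K\<^esub> y)) \<and>
     complete_top_ring (valued_field_ring K v)"

definition ring_of_integers :: "('k, 'm) ring_scheme \<Rightarrow> ('k \<Rightarrow> int) \<Rightarrow> 'k top_ring" where
  "ring_of_integers K v =
     sub_top_ring (valued_field_ring K v) {x \<in> carrier K. x = \<zero>\<^bsub>K\<^esub> \<or> 0 \<le> v x}"

definition uniformiser :: "('k, 'm) ring_scheme \<Rightarrow> ('k \<Rightarrow> int) \<Rightarrow> 'k \<Rightarrow> bool" where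
  "uniformiser K v \<pi> \<longleftrightarrow> \<pi> \<in> carrier K \<and> \<pi> \<noteq> \<zero>\<^bsub>K\<^esub> \<and> v \<pi> = 1"

definition max_ideal :: "('k, 'm) ring_scheme \<Rightarrow> ('k \<Rightarrow> int) \<Rightarrow> 'k set" where
  "max_ideal K v = {x \<in> carrier K. x = \<zero>\<^bsub>K\<^esub> \<or> 0 < v x}"

definition residue_field :: "('k, 'm) ring_scheme \<Rightarrow> ('k \<Rightarrow> int) \<Rightarrow> 'k set ring" where
  "residue_field K v = ring_of_integers K v Quot max_ideal K v"

definition residue :: "('k, 'm) ring_scheme \<Rightarrow> ('k \<Rightarrow> int) \<Rightarrow> 'k \<Rightarrow> 'k set" where
  "residue K v x = max_ideal K v +>\<^bsub>ring_of_integers K v\<^esub> x"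


section \<open>Pseudoaffinoid algebras\<close>

text \<open>An algebra over the topological ring \<open>R\<close> is a topological ring together with its structure map
  \<open>\<eta>\<close>.\<close>

definition ring_of_definition :: "('a, 'b) top_ring_scheme \<Rightarrow> 'a set \<Rightarrow> bool" where
  "ring_of_definition A A0 \<longleftrightarrow>
     subring A0 A \<and> openin (opens A) A0 \<and>
     (\<exists>S. finite S \<and> S \<subseteq> A0 \<and>
        opens (sub_top_ring A A0) =
        adic_topology (sub_top_ring A A0) (Idl\<^bsub>sub_top_ring A A0\<^esub> S))"

definition tate_ring :: "('a, 'b) top_ring_scheme \<Rightarrow> bool" where
  "tate_ring A \<longleftrightarrow>
     topological_ring A \<and> (\<exists>A0. ring_of_definition A A0) \<and> (\<exists>u\<in>Units A. top_nilpotent A u)"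

text \<open>For \<open>R\<close> the ring of integers, the residue field acts on the reduction of \<open>B\<close> through \<open>R\<close>, so
  its image is that of \<open>R\<close>.\<close>

definition formally_of_finite_type ::
    "('r, 'c) top_ring_scheme \<Rightarrow> ('a, 'b) top_ring_scheme \<Rightarrow> ('r \<Rightarrow> 'a) \<Rightarrow> bool" where
  "formally_of_finite_type R B \<eta> \<longleftrightarrow>
     topological_ring B \<and> complete_top_ring B \<and> noetherian_ring B \<and>
     (\<exists>I. ideal I B \<and> opens B = adic_topology B I) \<and>
     \<eta> \<in> cont_ring_hom R B \<and>
     (let N = {x \<in> carrier B. top_nilpotent B x} in
       \<exists>S. finite S \<and> S \<subseteq> carrier (B Quot N) \<and>
         generate_ring (B Quot N) ((\<lambda>x. N +>\<^bsub>B\<^esub> \<eta> x) ` carrier R \<union> S) = carrier (B Quot N))"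

definition pseudoaffinoid ::
    "('r, 'c) top_ring_scheme \<Rightarrow> ('a, 'b) top_ring_scheme \<Rightarrow> ('r \<Rightarrow> 'a) \<Rightarrow> bool" where
  "pseudoaffinoid R A \<eta> \<longleftrightarrow>
     tate_ring A \<and> complete_top_ring A \<and> \<eta> \<in> cont_ring_hom R A \<and>
     (\<exists>A0. ring_of_definition A A0 \<and> formally_of_finite_type R (sub_top_ring A A0) \<eta>)"

definition cont_algebra_hom ::
    "('r, 'c) ring_scheme \<Rightarrow> ('a, 'd) top_ring_scheme \<Rightarrow> ('r \<Rightarrow> 'a) \<Rightarrow>
     ('b, 'e) top_ring_scheme \<Rightarrow> ('r \<Rightarrow> 'b) \<Rightarrow> ('a \<Rightarrow> 'b) set" where
  "cont_algebra_hom R A \<eta> B \<theta> = {h \<in> cont_ring_hom A B. \<forall>x\<in>carrier R. h (\<eta> x) = \<theta> x}"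

definition finite_injection ::
    "('r, 'c) ring_scheme \<Rightarrow> ('a, 'd) top_ring_scheme \<Rightarrow> ('r \<Rightarrow> 'a) \<Rightarrow>
     ('b, 'e) top_ring_scheme \<Rightarrow> ('r \<Rightarrow> 'b) \<Rightarrow> ('a \<Rightarrow> 'b) \<Rightarrow> bool" where
  "finite_injection R A \<eta> B \<theta> h \<longleftrightarrow>
     h \<in> cont_algebra_hom R A \<eta> B \<theta> \<and> inj_on h (carrier A) \<and> module_finite A B h"


section \<open>The rings \<open>D\<^sub>n\<close>\<close>

definition OT_ring :: "('k, 'm) ring_scheme \<Rightarrow> ('k \<Rightarrow> int) \<Rightarrow> 'k \<Rightarrow> (nat \<Rightarrow> 'k) top_ring" where
  "OT_ring K v \<pi> = (let R = ring_of_integers K v; P = power_series_ring R in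
     with_topology P (adic_topology P (Idl\<^bsub>P\<^esub> {series_const R \<pi>, series_monom R 1})))"

definition D_ring ::
    "('k, 'm) ring_scheme \<Rightarrow> ('k \<Rightarrow> int) \<Rightarrow> 'k \<Rightarrow> nat \<Rightarrow>
     (nat \<Rightarrow> ((nat \<Rightarrow> 'k) \<times> nat) set) set top_ring" where
  "D_ring K v \<pi> n = rational_localisation (OT_ring K v \<pi>)
     (series_const (ring_of_integers K v) \<pi>) (series_monom (ring_of_integers K v) n)"

definition D_map ::
    "('k, 'm) ring_scheme \<Rightarrow> ('k \<Rightarrow> int) \<Rightarrow> 'k \<Rightarrow> nat \<Rightarrow>
     (nat \<Rightarrow> 'k) \<Rightarrow> (nat \<Rightarrow> ((nat \<Rightarrow> 'k) \<times> nat) set) set" where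
  "D_map K v \<pi> n = rational_localisation_map (OT_ring K v \<pi>)
     (series_const (ring_of_integers K v) \<pi>) (series_monom (ring_of_integers K v) n)"

definition DX_ring where
  "DX_ring K v \<pi> n r = tate_algebra r (D_ring K v \<pi> n)"

definition DX_structure where
  "DX_structure K v \<pi> n x =
     series_const (D_ring K v \<pi> n) (D_map K v \<pi> n (series_const (ring_of_integers K v) x))"

text \<open>The (unique) continuous homomorphism \<open>D\<^sub>n \<rightarrow> k((T))\<close> extending the coefficientwise reduction of
  power series. Applied to coefficients, it induces the identification of
  \<open>D\<^sub>n\<langle>X\<^sub>1,\<dots>,X\<^sub>r\<rangle>/\<pi>\<close> with \<open>k((T))\<langle>X\<^sub>1,\<dots>,X\<^sub>r\<rangle>\<close>.\<close>

definition is_D_reduction ::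
    "('k, 'm) ring_scheme \<Rightarrow> ('k \<Rightarrow> int) \<Rightarrow> 'k \<Rightarrow> nat \<Rightarrow>
     ((nat \<Rightarrow> ((nat \<Rightarrow> 'k) \<times> nat) set) set \<Rightarrow> (int \<Rightarrow> 'k set)) \<Rightarrow> bool" where
  "is_D_reduction K v \<pi> n \<rho> \<longleftrightarrow>
     \<rho> \<in> cont_ring_hom (D_ring K v \<pi> n) (laurent_series_ring (residue_field K v)) \<and>
     (\<forall>F\<in>carrier (OT_ring K v \<pi>).
        \<rho> (D_map K v \<pi> n F) =
        (\<lambda>i. if i < 0 then \<zero>\<^bsub>residue_field K v\<^esub> else residue K v (F (nat i))))"


section \<open>Reduction modulo \<open>\<pi>\<close>\<close>

text \<open>\<open>p\<close> is the image of \<open>\<pi>\<close> in \<open>A\<close>.\<close>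

definition mod_ring :: "('a, 'b) top_ring_scheme \<Rightarrow> 'a \<Rightarrow> 'a set top_ring" where
  "mod_ring A p = quot_top_ring A (PIdl\<^bsub>A\<^esub> p)"

definition mod_class :: "('a, 'b) top_ring_scheme \<Rightarrow> 'a \<Rightarrow> 'a \<Rightarrow> 'a set" where
  "mod_class A p x = PIdl\<^bsub>A\<^esub> p +>\<^bsub>A\<^esub> x"

text \<open>The (unique) continuous homomorphism of algebras \<open>k((T)) \<rightarrow> A/\<pi>A\<close> over the residue field \<open>k\<close>
  that sends the variable to the class of \<open>T\<close>.\<close>

definition is_laurent_structure_map ::
    "('k, 'm) ring_scheme \<Rightarrow> ('k \<Rightarrow> int) \<Rightarrow> 'k \<Rightarrow> ('a, 'b) top_ring_scheme \<Rightarrow> ('k \<Rightarrow> 'a) \<Rightarrow> 'a \<Rightarrow>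
     ((int \<Rightarrow> 'k set) \<Rightarrow> 'a set) \<Rightarrow> bool" where
  "is_laurent_structure_map K v \<pi> A \<eta> T \<sigma> \<longleftrightarrow>
     \<sigma> \<in> cont_ring_hom (laurent_series_ring (residue_field K v)) (mod_ring A (\<eta> \<pi>)) \<and>
     (\<forall>x\<in>carrier (ring_of_integers K v).
        \<sigma> (series_const (residue_field K v) (residue K v x)) = mod_class A (\<eta> \<pi>) (\<eta> x)) \<and>
     \<sigma> (series_monom (residue_field K v) 1) = mod_class A (\<eta> \<pi>) T"

definition loc_ring :: "('a, 'b) top_ring_scheme \<Rightarrow> 'a \<Rightarrow> 'a \<Rightarrow> nat \<Rightarrow> (nat \<Rightarrow> ('a \<times> nat) set) set top_ring"
  where "loc_ring A p T n = rational_localisation A p (T [^]\<^bsub>A\<^esub> n)"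

definition loc_map :: "('a, 'b) top_ring_scheme \<Rightarrow> 'a \<Rightarrow> 'a \<Rightarrow> nat \<Rightarrow> 'a \<Rightarrow> (nat \<Rightarrow> ('a \<times> nat) set) set"
  where "loc_map A p T n = rational_localisation_map A p (T [^]\<^bsub>A\<^esub> n)"

text \<open>The reduction of \<open>\<Phi>\<close> modulo \<open>\<pi>\<close> is \<open>\<phi>\<close>, where the residue ring of the source is identified with
  \<open>k((T))\<langle>X\<^sub>1,\<dots>,X\<^sub>r\<rangle>\<close> through \<open>\<rho>\<close>, and \<open>A/\<pi>A\<close> with the residue ring of \<open>A\<langle>\<pi>/T^n\<rangle>\<close> through the
  localisation map.\<close>

definition lifts where
  "lifts K v \<pi> r A \<eta> T n \<phi> \<Phi> \<longleftrightarrow>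
     (\<exists>\<rho>. is_D_reduction K v \<pi> n \<rho> \<and>
       (\<forall>F\<in>carrier (DX_ring K v \<pi> n r). \<forall>a\<in>carrier A.
          \<phi> (\<lambda>\<nu>. \<rho> (F \<nu>)) = mod_class A (\<eta> \<pi>) a \<longrightarrow>
          mod_class (loc_ring A (\<eta> \<pi>) T n) (loc_map A (\<eta> \<pi>) T n (\<eta> \<pi>)) (\<Phi> F) =
          mod_class (loc_ring A (\<eta> \<pi>) T n) (loc_map A (\<eta> \<pi>) T n (\<eta> \<pi>))
            (loc_map A (\<eta> \<pi>) T n a)))"

end

theory Submission imports Defs begin

text \<open>Topologies are described by \<open>\<int>\<close>-indexed filtrations \<open>Fil m = T^m Fil 0\<close>. On \<open>A\<close> take
  \<open>Fil 0 = A\<^sub>0[T]\<close>; the ring \<open>A\<langle>\<pi>/T^n\<rangle>\<close> is the completion of \<open>A\<close> for the coarser filtration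
  \<open>Lev m = Fil m + \<pi> Fil (m - n) + \<pi>^2 Fil (m - 2n) + \<dots>\<close>. As \<open>A\<^sub>0\<close> is noetherian and \<open>A\<close> is flat, division
  by \<open>\<pi>\<close> loses only a bounded amount of filtration, on \<open>A\<close> and on every level, hence also on the completions;
  so \<open>\<pi>\<close> is a nonzerodivisor there and generates a closed ideal.

  Lift the images of the variables under \<open>\<phi>\<close> to elements \<open>x\<close> of \<open>A\<close>. Modulo \<open>\<pi>\<close> they are power bounded, hence
  (\<open>A\<^sub>0\<close> being noetherian) integral over \<open>Fil 0\<close>, so for large \<open>n\<close> all monomials \<open>x^\<nu>\<close> lie in one \<open>Lev c\<close>. Then
  \<open>F \<mapsto> \<Sum> F\<^sub>\<nu> x^\<nu>\<close> is a continuous homomorphism on \<open>D\<^sub>n\<langle>X\<rangle>\<close>, and it lifts \<open>\<phi>\<close>.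

  Injectivity: if the image of \<open>F\<close> vanishes, so does \<open>\<phi>\<close> of the reduction of \<open>F\<close>; hence \<open>F\<close> is divisible by
  \<open>\<pi>\<close> and the quotient is again in the kernel, while \<open>D\<^sub>n\<close> is \<open>\<pi>\<close>-adically separated.
  Finiteness: a Baire category argument makes the generators \<open>e\<close> of \<open>A/\<pi>A\<close> generate it with bounded denominators,
  that is, up to \<open>Fil 1 + \<pi>A\<close>. For large \<open>n\<close> the part of the error in \<open>\<pi>A\<close> lies in \<open>Lev 1\<close>, and
  successive approximation expresses every element of \<open>A\<langle>\<pi>/T^n\<rangle>\<close> by the lifted generators.\<close>

section \<open>Filtered rings\<close>

text \<open>The obstacle is that division by \<open>p\<close> is never free. It loses
  \<open>M1\<close> on \<open>Fil\<close>, but \<open>max M1 n\<close> at level \<open>n\<close>, at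
  least as much as multiplication by \<open>p\<close> gains there. An unknown multiple
  \<open>p z\<close> can therefore not be estimated at the level \<open>n\<close> where it is
  wanted. \<open>K2\<close> divides at an auxiliary level \<open>n0\<close>, fixed in advance by the
  bounds on the monomials, and only afterwards lets \<open>n\<close> grow; levels increase with
  \<open>n\<close>, so every constant survives. All bounds are additive shifts (\<open>k0\<close>,
  \<open>M1\<close>, \<open>M2\<close>, \<open>c0\<close>, \<open>M\<close>) because every map
  involved respects multiplication by powers of \<open>T\<close>: an estimate in one degree holds in
  all degrees. Arbitrary lifts of classes agree with images under the lifted map only modulo
  \<open>p\<close>. Finiteness therefore works with the set \<open>QQ\<close> of finite sums, whose
  preimages are known exactly. The source needs a filtration of its own, as \<open>T\<close> is no
  unit in the power series ring: \<open>FilL\<close> weighs coefficients in \<open>K((T))\<close>,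
  with weight 1 for \<open>T\<close> and \<open>n\<close> for \<open>\<pi>\<close>.
  Non-invertibility of \<open>\<pi>\<close> in \<open>A\<close> enters in
  \<open>power_bounded\<close>, where it excludes a relation of degree zero.\<close>

declare pow_nat [simp del]

definition tpow :: "('a, 'b) ring_scheme => 'a => int => 'a" where
  "tpow R t m = (if 0 \<le> m then t [^]\<^bsub>R\<^esub> nat m else (inv\<^bsub>R\<^esub> t) [^]\<^bsub>R\<^esub> nat (- m))"

lemma (in cring) tpow_closed [simp]: "t \<in> Units R ==> tpow R t m \<in> carrier R"
  by (simp add: tpow_def Units_closed)

lemma (in cring) tpow_0 [simp]: "tpow R t 0 = \<one>"
  by (simp add: tpow_def)

lemma (in cring) tpow_nat: "tpow R t (int n) = t [^] n"
  by (simp add: tpow_def)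

lemma (in cring) tpow_1 [simp]: "t \<in> Units R ==> tpow R t 1 = t"
  by (simp add: tpow_def Units_closed)

lemma (in cring) tpow_plus1:
  assumes "t \<in> Units R"
  shows "tpow R t (m + 1) = t \<otimes> tpow R t m"
proof (cases "0 \<le> m")
  case True
  thus ?thesis using assms
    by (simp add: tpow_def nat_add_distrib m_comm Units_closed)
next
  case False
  then obtain k where mk: "m = - int (Suc k)" using negD [of m] by auto
  hence "- m = int (Suc k)" "- (m + 1) = int k" by auto
  hence k: "nat (- m) = Suc k" "nat (- (m + 1)) = k" by (simp_all only: nat_int)
  have i: "inv t \<in> carrier R" using assms by simp
  have "t \<otimes> ((inv t) [^] k \<otimes> inv t) = (inv t) [^] k \<otimes> (t \<otimes> inv t)"
    using i assms Units_closed by (intro m_lcomm) auto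
  hence *: "t \<otimes> ((inv t) [^] k \<otimes> inv t) = (inv t) [^] k"
    using assms i by simp
  have m: "tpow R t m = (inv t) [^] k \<otimes> inv t"
    by (simp only: tpow_def False if_False k nat_pow_Suc)
  have m1: "tpow R t (m + 1) = (inv t) [^] k"
  proof (cases "m + 1 = 0")
    case True
    thus ?thesis by (simp add: mk)
  next
    case F: False
    hence "\<not> 0 \<le> m + 1" using False by linarith
    thus ?thesis by (simp only: tpow_def if_False k)
  qed
  show ?thesis unfolding m m1 using * by simp
qed

lemma (in cring) tpow_add:
  assumes t: "t \<in> Units R"
  shows "tpow R t (m + l) = tpow R t m \<otimes> tpow R t l"
proof (induction m rule: int_induct [where k = 0])
  case base
  thus ?case using t by simp
next
  case (step1 i)
  have "tpow R t (i + 1 + l) = t \<otimes> tpow R t (i + l)"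
    using tpow_plus1 [OF t, of "i + l"] by (simp add: algebra_simps)
  thus ?case using step1 t Units_closed by (simp add: tpow_plus1 m_assoc)
next
  case (step2 i)
  have "t \<otimes> tpow R t (i - 1 + l) = tpow R t (i + l)"
    using tpow_plus1 [OF t, of "i - 1 + l"] by (simp add: algebra_simps)
  also have "\<dots> = t \<otimes> (tpow R t (i - 1) \<otimes> tpow R t l)"
    using step2 tpow_plus1 [OF t, of "i - 1"] t Units_closed by (simp add: m_assoc)
  finally show ?case using t by (simp add: Units_l_cancel)
qed

lemma (in cring) tpow_inverse:
  assumes "t \<in> Units R"
  shows "tpow R t m \<otimes> tpow R t (- m) = \<one>" "tpow R t (- m) \<otimes> tpow R t m = \<one>"
  using tpow_add [OF assms, of m "- m"] tpow_add [OF assms, of "- m" m] by simp_all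

lemma (in cring) tpow_cancel:
  assumes "t \<in> Units R" "x \<in> carrier R"
  shows "tpow R t m \<otimes> (tpow R t (- m) \<otimes> x) = x" "tpow R t (- m) \<otimes> (tpow R t m \<otimes> x) = x"
  using assms tpow_inverse [OF assms(1)] by (simp_all flip: m_assoc)

lemma (in cring) tpow_Units: "t \<in> Units R ==> tpow R t m \<in> Units R"
  using tpow_inverse [of t m] tpow_closed [of t m] tpow_closed [of t "- m"] unfolding Units_def [of R]
  by (intro CollectI conjI bexI [of _ "tpow R t (- m)"]) auto

text \<open>Upwards the recursion determines the family, downwards \<open>t\<close> can be
  cancelled. It lets homomorphic images and Laurent monomials be recognised as powers of a unit
  without computing inverses.\<close>

lemma (in cring) tpow_unique:
  assumes t: "t \<in> Units R" and c: "\<And>m. f m \<in> carrier R" and 0: "f 0 = \<one>"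
    and s: "\<And>m. f (m + 1) = t \<otimes> f m"
  shows "f m = tpow R t m"
proof (induction m rule: int_induct [where k = 0])
  case base
  thus ?case using 0 by simp
next
  case (step1 i)
  thus ?case using s tpow_plus1 t by simp
next
  case (step2 i)
  have "t \<otimes> f (i - 1) = t \<otimes> tpow R t (i - 1)"
    using step2 s [of "i - 1"] tpow_plus1 [OF t, of "i - 1"] by simp
  thus ?case using t c by (simp add: Units_l_cancel)
qed

lemma ring_hom_Units:
  assumes "cring R" "cring S" "h \<in> ring_hom R S" "t \<in> Units R"
  shows "h t \<in> Units S"
proof -
  interpret R: cring R by fact
  interpret S: cring S by fact
  have "h t \<otimes>\<^bsub>S\<^esub> h (inv\<^bsub>R\<^esub> t) = \<one>\<^bsub>S\<^esub>" "h (inv\<^bsub>R\<^esub> t) \<otimes>\<^bsub>S\<^esub> h t = \<one>\<^bsub>S\<^esub>"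
    using ring_hom_mult [OF assms(3), of t "inv\<^bsub>R\<^esub> t"] ring_hom_mult [OF assms(3), of "inv\<^bsub>R\<^esub> t" t]
      ring_hom_one [OF assms(3)] assms(4) R.Units_closed by simp_all
  moreover have "h t \<in> carrier S" "h (inv\<^bsub>R\<^esub> t) \<in> carrier S"
    using ring_hom_closed [OF assms(3)] assms(4) R.Units_closed by simp_all
  ultimately show ?thesis unfolding Units_def by blast
qed

lemma ring_hom_tpow:
  assumes "cring R" "cring S" "h \<in> ring_hom R S" "t \<in> Units R"
  shows "h (tpow R t m) = tpow S (h t) m"
proof -
  interpret R: cring R by fact
  interpret S: cring S by fact
  show ?thesis
    by (rule S.tpow_unique)
      (use assms ring_hom_closed [OF assms(3)] ring_hom_mult [OF assms(3)] ring_hom_one [OF assms(3)] R.Units_closed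
        in \<open>auto simp: ring_hom_Units R.tpow_plus1\<close>)
qed

lemma ring_hom_a_inv:
  assumes "ring R" "ring S" "h \<in> ring_hom R S" "x \<in> carrier R"
  shows "h (\<ominus>\<^bsub>R\<^esub> x) = \<ominus>\<^bsub>S\<^esub> h x"
proof -
  interpret R: ring R by fact
  interpret S: ring S by fact
  have "h (\<ominus>\<^bsub>R\<^esub> x) \<oplus>\<^bsub>S\<^esub> h x = \<zero>\<^bsub>S\<^esub>"
    using ring_hom_add [OF assms(3), of "\<ominus>\<^bsub>R\<^esub> x" x] ring_hom_zero [OF assms(3,1,2)] assms(4)
    by (simp add: R.l_neg)
  thus ?thesis using S.minus_equality [of "h (\<ominus>\<^bsub>R\<^esub> x)" "h x"] ring_hom_closed [OF assms(3)] assms(4) by simp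
qed

lemma ring_hom_minus:
  assumes "ring R" "ring S" "h \<in> ring_hom R S" "x \<in> carrier R" "y \<in> carrier R"
  shows "h (x \<ominus>\<^bsub>R\<^esub> y) = h x \<ominus>\<^bsub>S\<^esub> h y"
  using assms ring_hom_a_inv [OF assms(1-3)] ring_hom_add [OF assms(3)]
    abelian_group.a_inv_closed [OF ring.is_abelian_group [OF assms(1)]]
  by (simp add: a_minus_def)

lemma ring_hom_zero':
  assumes "ring R" "ring S" "h \<in> ring_hom R S"
  shows "h \<zero>\<^bsub>R\<^esub> = \<zero>\<^bsub>S\<^esub>"
  by (rule ring_hom_zero) fact+

lemma ring_hom_finsum:
  assumes "ring R" "ring S" "h \<in> ring_hom R S" "u \<in> I \<rightarrow> carrier R"
  shows "h (finsum R u I) = finsum S (\<lambda>i. h (u i)) I"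
proof -
  interpret R: ring R by fact
  interpret S: ring S by fact
  show ?thesis using assms(4)
  proof (induction I rule: infinite_finite_induct)
    case (infinite A)
    thus ?case using ring_hom_zero' [OF assms(1-3)] by (simp add: R.finsum_infinite S.finsum_infinite)
  next
    case empty
    thus ?case using ring_hom_zero' [OF assms(1-3)] by simp
  next
    case (insert x F)
    thus ?case using ring_hom_closed [OF assms(3)] ring_hom_add [OF assms(3)]
      by (simp add: R.finsum_insert S.finsum_insert Pi_iff R.finsum_closed)
  qed
qed

locale filt_ring = cring R for R (structure) +
  fixes Fil :: "int => 'a set" and t :: 'a
  assumes Fil_sub: "Fil m \<subseteq> carrier R"
    and Fil_zero [simp]: "\<zero> \<in> Fil m"
    and Fil_add: "x \<in> Fil m ==> y \<in> Fil m ==> x \<oplus> y \<in> Fil m"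
    and Fil_neg: "x \<in> Fil m ==> \<ominus> x \<in> Fil m"
    and Fil_mono: "m \<le> l ==> Fil l \<subseteq> Fil m"
    and Fil_mult: "x \<in> Fil m ==> y \<in> Fil l ==> x \<otimes> y \<in> Fil (m + l)"
    and Fil_one: "\<one> \<in> Fil 0"
    and Fil_exh: "x \<in> carrier R ==> \<exists>m. x \<in> Fil m"
    and t_unit: "t \<in> Units R" and t_Fil: "t \<in> Fil 1" and inv_t_Fil: "inv t \<in> Fil (- 1)"
begin

lemma Fil_carrier [simp, intro]: "x \<in> Fil m ==> x \<in> carrier R"
  using Fil_sub by auto

lemma Fil_monoD: "x \<in> Fil l ==> m \<le> l ==> x \<in> Fil m"
  using Fil_mono by auto

lemma Fil_minus: "x \<in> Fil m ==> y \<in> Fil m ==> x \<ominus> y \<in> Fil m"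
  by (simp add: a_minus_def Fil_add Fil_neg)

lemma Fil_mult0: "x \<in> Fil 0 ==> y \<in> Fil m ==> x \<otimes> y \<in> Fil m"
  using Fil_mult [of x 0 y m] by simp

lemma Fil_mult_eq: "x \<in> Fil m ==> y \<in> Fil l ==> m + l = k ==> x \<otimes> y \<in> Fil k"
  using Fil_mult by auto

lemma Fil_finsum: "(\<And>i. i \<in> I ==> u i \<in> Fil m) ==> finsum R u I \<in> Fil m"
proof (induction I rule: infinite_finite_induct)
  case (insert x F)
  hence "finsum R u (insert x F) = u x \<oplus> finsum R u F"
    by (intro finsum_insert) auto
  thus ?case using insert by (simp add: Fil_add)
qed (auto simp: finsum_infinite)

lemma Fil_npow: "x \<in> Fil 0 ==> x [^] (n::nat) \<in> Fil 0"
  by (induction n) (auto simp: Fil_one intro: Fil_mult0)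

lemma tpow_Fil: "tpow R t m \<in> Fil m"
proof (induction m rule: int_induct [where k = 0])
  case base
  thus ?case by (simp add: Fil_one)
next
  case (step1 i)
  thus ?case using Fil_mult [OF t_Fil, of "tpow R t i" i] tpow_plus1 [OF t_unit, of i] by (simp add: add.commute)
next
  case (step2 i)
  have "tpow R t (i - 1) = inv t \<otimes> tpow R t i"
    using tpow_plus1 [OF t_unit, of "i - 1"] t_unit Units_closed [OF t_unit]
    by (simp add: m_assoc [symmetric])
  thus ?case using Fil_mult [OF inv_t_Fil step2(2)] by (simp add: add.commute)
qed

lemma tpow_carrier [simp]: "tpow R t m \<in> carrier R"
  using t_unit by simp

lemma t_carrier [simp]: "t \<in> carrier R"
  using t_unit by auto

lemma tpow_Fil_iff: "x \<in> carrier R ==> tpow R t m \<otimes> x \<in> Fil l \<longleftrightarrow> x \<in> Fil (l - m)"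
proof
  assume x: "x \<in> carrier R" and "tpow R t m \<otimes> x \<in> Fil l"
  hence "tpow R t (- m) \<otimes> (tpow R t m \<otimes> x) \<in> Fil (- m + l)"
    by (intro Fil_mult tpow_Fil)
  thus "x \<in> Fil (l - m)" using tpow_cancel(2) [OF t_unit x, of m] by simp
next
  assume "x \<in> Fil (l - m)"
  hence "tpow R t m \<otimes> x \<in> Fil (m + (l - m))" by (intro Fil_mult tpow_Fil)
  thus "tpow R t m \<otimes> x \<in> Fil l" by simp
qed

lemma Fil_tpowE:
  assumes "x \<in> Fil m" obtains y where "y \<in> Fil 0" "x = tpow R t m \<otimes> y"
proof
  show "tpow R t (- m) \<otimes> x \<in> Fil 0" using Fil_mult [OF tpow_Fil assms, of "- m"] by simp
  show "x = tpow R t m \<otimes> (tpow R t (- m) \<otimes> x)" using tpow_cancel(1) [OF t_unit, of x m] assms by simp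
qed

text \<open>The free bound \<open>b\<close> serves to ask for a nonpositive exponent, or for one
  below an exponent already found.\<close>

lemma Fil_exh_le: "x \<in> carrier R ==> \<exists>c\<le>b. x \<in> Fil c"
proof -
  assume "x \<in> carrier R"
  then obtain m where "x \<in> Fil m" using Fil_exh by blast
  thus ?thesis by (intro exI [of _ "min m b"]) (auto intro: Fil_monoD)
qed

text \<open>Congruence modulo \<open>Fil m\<close>. The carrier conditions are built in, so that
  chains of congruences compose without side conditions.\<close>

definition cg :: "int => 'a => 'a => bool" where
  "cg m x y \<longleftrightarrow> x \<in> carrier R \<and> y \<in> carrier R \<and> x \<ominus> y \<in> Fil m"

lemma cgI: "x \<in> carrier R ==> y \<in> carrier R ==> x \<ominus> y \<in> Fil m ==> cg m x y"
  by (simp add: cg_def)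

lemma cg_carrier: "cg m x y ==> x \<in> carrier R" "cg m x y ==> y \<in> carrier R"
  by (simp_all add: cg_def)

lemma cg_refl [simp]: "x \<in> carrier R ==> cg m x x"
  by (simp add: cg_def r_right_minus_eq [THEN iffD2])

lemma cg_sym: "cg m x y ==> cg m y x"
proof -
  assume a: "cg m x y"
  hence "y \<ominus> x = \<ominus> (x \<ominus> y)" unfolding cg_def by algebra
  thus ?thesis using a by (simp add: cg_def Fil_neg)
qed

lemma cg_trans [trans]: "cg m x y ==> cg m y z ==> cg m x z"
proof -
  assume a: "cg m x y" "cg m y z"
  hence "x \<ominus> z = (x \<ominus> y) \<oplus> (y \<ominus> z)" unfolding cg_def by algebra
  thus ?thesis using a by (simp add: cg_def Fil_add)
qed

lemma cg_mono: "cg l x y ==> m \<le> l ==> cg m x y"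
  by (auto simp: cg_def intro: Fil_monoD)

lemma cg_add: "cg m x x' ==> cg m y y' ==> cg m (x \<oplus> y) (x' \<oplus> y')"
proof -
  assume a: "cg m x x'" "cg m y y'"
  hence "(x \<oplus> y) \<ominus> (x' \<oplus> y') = (x \<ominus> x') \<oplus> (y \<ominus> y')" unfolding cg_def by algebra
  thus ?thesis using a by (simp add: cg_def Fil_add)
qed

lemma cg_minus: "cg m x x' ==> cg m y y' ==> cg m (x \<ominus> y) (x' \<ominus> y')"
proof -
  assume a: "cg m x x'" "cg m y y'"
  hence "(x \<ominus> y) \<ominus> (x' \<ominus> y') = (x \<ominus> x') \<ominus> (y \<ominus> y')" unfolding cg_def by algebra
  thus ?thesis using a by (simp add: cg_def Fil_minus)
qed

text \<open>From \<open>x y - x' y' = x (y - y') + (x - x') y'\<close>: one factor of each product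
  has to be bounded, and its bound is charged to the precision of the other congruence.\<close>

lemma cg_mult:
  assumes "cg m x x'" "cg l y y'" "x \<in> Fil c" "y' \<in> Fil d" "k \<le> c + l" "k \<le> m + d"
  shows "cg k (x \<otimes> y) (x' \<otimes> y')"
proof -
  have "(x \<otimes> y) \<ominus> (x' \<otimes> y') = x \<otimes> (y \<ominus> y') \<oplus> (x \<ominus> x') \<otimes> y'"
    using assms unfolding cg_def by algebra
  moreover have "x \<otimes> (y \<ominus> y') \<in> Fil k" "(x \<ominus> x') \<otimes> y' \<in> Fil k"
    using assms Fil_mult [of x c "y \<ominus> y'" l] Fil_mult [of "x \<ominus> x'" m y' d]
    by (auto simp: cg_def intro: Fil_monoD)
  ultimately show ?thesis using assms by (simp add: cg_def Fil_add)
qed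

lemma cg_mult_left: "cg m x y ==> z \<in> Fil c ==> cg (c + m) (z \<otimes> x) (z \<otimes> y)"
proof -
  assume a: "cg m x y" "z \<in> Fil c"
  hence "z \<otimes> x \<ominus> z \<otimes> y = z \<otimes> (x \<ominus> y)" unfolding cg_def using Fil_carrier [of z] by algebra
  thus ?thesis using a by (simp add: cg_def Fil_mult)
qed

lemma cg_Fil: "cg m x y ==> y \<in> Fil l ==> l \<le> m ==> x \<in> Fil l"
proof -
  assume a: "cg m x y" "y \<in> Fil l" "l \<le> m"
  hence "x = (x \<ominus> y) \<oplus> y" unfolding cg_def by algebra
  thus ?thesis using a by (metis Fil_add Fil_monoD cg_def)
qed

lemma cg_zero_iff: "cg m x \<zero> \<longleftrightarrow> x \<in> Fil m"
  by (auto simp: cg_def a_minus_def)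

lemma cg_finsum_superset:
  assumes "finite J" "I \<subseteq> J" "\<And>i. i \<in> J ==> u i \<in> carrier R" "\<And>i. i \<in> J - I ==> u i \<in> Fil m"
  shows "cg m (finsum R u J) (finsum R u I)"
proof -
  have "finsum R u (I \<union> (J - I)) = finsum R u I \<oplus> finsum R u (J - I)"
    using assms by (intro finsum_Un_disjoint) (auto intro: finite_subset)
  moreover have "I \<union> (J - I) = J" using assms by auto
  moreover have f: "finsum R u (J - I) \<in> Fil m" using assms by (intro Fil_finsum) auto
  moreover have c: "finsum R u I \<in> carrier R" using assms by (intro finsum_closed) auto
  ultimately have "cg m (finsum R u J) (finsum R u I \<oplus> \<zero>)"
    using cg_add [of m "finsum R u I" "finsum R u I" "finsum R u (J - I)" \<zero>] cg_zero_iff by auto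
  thus ?thesis using c by simp
qed

section \<open>Unordered sums of families tending to zero\<close>

definition nullfam :: "('i => 'a) => bool" where
  "nullfam u \<longleftrightarrow> (\<forall>i. u i \<in> carrier R) \<and> (\<forall>m. finite {i. u i \<notin> Fil m})"

text \<open>The sum is pinned down by its congruences with finite partial sums, at all precisions at
  once. No enumeration of the index type is involved, so the same notion serves power series and
  series in several variables.\<close>

definition fsum :: "('i => 'a) => 'a" where
  "fsum u = (THE s. s \<in> carrier R \<and> (\<forall>m I. finite I \<and> {i. u i \<notin> Fil m} \<subseteq> I --> cg m s (finsum R u I)))"

lemma nullfam_bdd:
  assumes "nullfam u" shows "\<exists>c\<le>b. \<forall>i. u i \<in> Fil c"
proof -
  let ?B = "{i. u i \<notin> Fil b}"
  have "finite ?B" using assms by (simp add: nullfam_def)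
  hence "\<exists>c\<le>b. \<forall>i\<in>?B. u i \<in> Fil c"
  proof (induction rule: finite_induct)
    case (insert x F)
    then obtain c where c: "c \<le> b" "\<forall>i\<in>F. u i \<in> Fil c" by auto
    obtain d where d: "d \<le> c" "u x \<in> Fil d"
      using Fil_exh_le [of "u x" c] assms by (auto simp: nullfam_def)
    thus ?case using c by (intro exI [of _ d]) (auto intro: Fil_monoD)
  qed auto
  then obtain c where c: "c \<le> b" "\<forall>i\<in>?B. u i \<in> Fil c" by blast
  have "u i \<in> Fil c" for i using c Fil_monoD [of "u i" b c] by (cases "u i \<in> Fil b") auto
  thus ?thesis using c by blast
qed

end

text \<open>Convergence is demanded only of sequences whose \<open>m\<close>-th step lies in
  \<open>Fil m\<close>; in return the rate of convergence is part of the conclusion.\<close>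

locale complete_filt_ring = filt_ring +
  assumes sep: "x \<in> carrier R ==> (\<And>m. x \<in> Fil m) ==> x = \<zero>"
    and fast_complete: "(\<And>m::nat. s m \<in> carrier R) ==> (\<And>m. cg (int m) (s (Suc m)) (s m)) ==>
      \<exists>y\<in>carrier R. \<forall>m. cg (int m) y (s m)"
begin

lemma sep_nat: "x \<in> carrier R ==> (\<And>m::nat. x \<in> Fil (int m)) ==> x = \<zero>"
proof (rule sep)
  fix m assume "\<And>m::nat. x \<in> Fil (int m)"
  hence "x \<in> Fil (int (nat m))" .
  thus "x \<in> Fil m" by (rule Fil_monoD) auto
qed

lemma cg_eq:
  assumes "x \<in> carrier R" "y \<in> carrier R" "\<And>m::nat. cg (int m) x y" shows "x = y"
proof -
  have "x \<ominus> y = \<zero>" using assms by (intro sep_nat) (auto simp: cg_def)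
  thus ?thesis using assms by (simp add: r_right_minus_eq)
qed

text \<open>Multiplication by a power of \<open>t\<close> normalises the rate of
  convergence.\<close>

lemma fast_complete_shift:
  assumes "\<And>m::nat. s m \<in> carrier R" "\<And>m. cg (int m + k) (s (Suc m)) (s m)"
  shows "\<exists>y\<in>carrier R. \<forall>m. cg (int m + k) y (s m)"
proof -
  let ?f = "\<lambda>m. tpow R t (- k) \<otimes> s m"
  have "\<exists>y\<in>carrier R. \<forall>m. cg (int m) y (?f m)"
  proof (rule fast_complete)
    fix m
    show "cg (int m) (?f (Suc m)) (?f m)"
      using cg_mult_left [OF assms(2) [of m] tpow_Fil [of "- k"]] by simp
  qed (use assms in auto)
  then obtain y where y: "y \<in> carrier R" "\<And>m. cg (int m) y (?f m)" by auto
  have "cg (int m + k) (tpow R t k \<otimes> y) (s m)" for m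
    using cg_mult_left [OF y(2) [of m] tpow_Fil [of k]] tpow_cancel(1) [OF t_unit assms(1)]
    by (simp add: add.commute)
  thus ?thesis using y by (intro bexI [of _ "tpow R t k \<otimes> y"]) auto
qed

text \<open>\<open>f j\<close> is the tail of the series from \<open>j\<close> on. The tails are
  kept, and not only the total, because the recursion and the bound together identify a limit
  without any further continuity argument; \<open>tate_tail_sums\<close> and \<open>cmb_surj\<close>
  rely on this.\<close>

lemma tail_sums:
  assumes c: "\<And>j::nat. c j \<in> Fil (int j + k)"
  shows "\<exists>f. \<forall>j. f j \<in> Fil (int j + k) \<and> f j = c j \<oplus> f (Suc j)"
proof -
  define s where "s m = finsum R c {..<m}" for m
  have cc: "c j \<in> carrier R" for j using c by auto
  have sc [simp]: "s m \<in> carrier R" for m unfolding s_def using cc by (intro finsum_closed) auto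
  have s_Suc: "s (Suc m) = s m \<oplus> c m" for m
    unfolding s_def using cc by (simp add: lessThan_Suc finsum_insert Pi_iff finsum_closed a_comm)
  have "cg (int m + k) (s (Suc m)) (s m)" for m
  proof -
    have "s m \<oplus> c m \<ominus> s m = c m" using sc cc by algebra
    thus ?thesis using c s_Suc cc by (simp add: cg_def)
  qed
  then obtain y where y: "y \<in> carrier R" "\<And>m. cg (int m + k) y (s m)"
    using fast_complete_shift [of s k] by auto
  define f where "f j = y \<ominus> s j" for j
  have "f j \<in> Fil (int j + k)" for j using y by (simp add: f_def cg_def)
  moreover have "f j = c j \<oplus> f (Suc j)" for j
    unfolding f_def s_Suc using y(1) sc [of j] cc [of j] by algebra
  ultimately show ?thesis by blast
qed

text \<open>The partial sums over the finite exceptional sets \<open>?B (int m)\<close> change only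
  by members of \<open>Fil m\<close> when \<open>m\<close> increases, so they converge at the
  prescribed rate.\<close>

lemma fsum_ex1:
  assumes "nullfam u"
  shows "\<exists>!s. s \<in> carrier R \<and> (\<forall>m I. finite I \<and> {i. u i \<notin> Fil m} \<subseteq> I --> cg m s (finsum R u I))"
proof -
  have uc: "u i \<in> carrier R" and fin: "finite {i. u i \<notin> Fil m}" for i m
    using assms by (auto simp: nullfam_def)
  let ?B = "\<lambda>m. {i. u i \<notin> Fil m}"
  let ?s = "\<lambda>m::nat. finsum R u (?B (int m))"
  have B_mono: "m \<le> l ==> ?B m \<subseteq> ?B l" for m l by (auto intro: Fil_monoD)
  have "\<exists>y\<in>carrier R. \<forall>m. cg (int m) y (?s m)"
  proof (rule fast_complete)
    fix m
    show "?s m \<in> carrier R" using uc by (intro finsum_closed) auto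
    show "cg (int m) (?s (Suc m)) (?s m)"
      by (rule cg_finsum_superset) (use uc fin B_mono [of "int m" "int (Suc m)"] in auto)
  qed
  then obtain y where y: "y \<in> carrier R" "\<And>m. cg (int m) y (?s m)" by auto
  have *: "cg m y (finsum R u I)" if I: "finite I" "?B m \<subseteq> I" for m I
  proof -
    let ?l = "nat m"
    let ?J = "I \<union> ?B (int ?l)"
    have "cg m y (?s ?l)" using y(2) [of ?l] by (rule cg_mono) auto
    also have "cg m (?s ?l) (finsum R u ?J)"
      by (rule cg_sym, rule cg_finsum_superset) (use uc fin I in \<open>auto intro: Fil_monoD [of _ "int ?l" m]\<close>)
    also have "cg m (finsum R u ?J) (finsum R u I)"
      by (rule cg_finsum_superset) (use uc fin I in auto)
    finally show ?thesis .
  qed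
  show ?thesis
  proof (rule ex1I [of _ y])
    show "y \<in> carrier R \<and> (\<forall>m I. finite I \<and> ?B m \<subseteq> I --> cg m y (finsum R u I))"
      using y(1) * by blast
  next
    fix z assume z: "z \<in> carrier R \<and> (\<forall>m I. finite I \<and> ?B m \<subseteq> I --> cg m z (finsum R u I))"
    show "z = y"
    proof (rule cg_eq)
      fix m :: nat
      have "cg (int m) z (?s m)" using z fin by blast
      also have "cg (int m) (?s m) y" by (rule cg_sym) (rule y(2))
      finally show "cg (int m) z y" .
    qed (use z y in auto)
  qed
qed

lemma fsum_closed: "nullfam u ==> fsum u \<in> carrier R"
  and fsum_cg: "nullfam u ==> finite I ==> {i. u i \<notin> Fil m} \<subseteq> I ==> cg m (fsum u) (finsum R u I)"
  using theI' [OF fsum_ex1, of u] unfolding fsum_def by auto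

lemma fsum_eqI:
  assumes "nullfam u" "z \<in> carrier R"
    and "\<And>m::nat. \<exists>J. finite J \<and> (\<forall>I. finite I --> J \<subseteq> I --> cg (int m) z (finsum R u I))"
  shows "fsum u = z"
proof (rule cg_eq)
  fix m :: nat
  obtain J where J: "finite J" "\<And>I. finite I ==> J \<subseteq> I ==> cg (int m) z (finsum R u I)" using assms(3) by blast
  let ?I = "J \<union> {i. u i \<notin> Fil (int m)}"
  have "finite ?I" using J assms by (auto simp: nullfam_def)
  hence "cg (int m) (fsum u) (finsum R u ?I)" "cg (int m) z (finsum R u ?I)"
    using fsum_cg [of u ?I "int m"] assms(1) J by simp_all
  thus "cg (int m) (fsum u) z" by (meson cg_trans cg_sym)
qed (use assms fsum_closed in auto)

lemma fsum_Fil: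
  assumes "nullfam u" "\<And>i. u i \<in> Fil m" shows "fsum u \<in> Fil m"
proof -
  have "cg m (fsum u) (finsum R u {})" using assms by (intro fsum_cg) auto
  thus ?thesis by (simp add: cg_zero_iff)
qed

lemma nullfam_add: "nullfam u ==> nullfam w ==> nullfam (\<lambda>i. u i \<oplus> w i)"
proof -
  assume a: "nullfam u" "nullfam w"
  have "finite {i. u i \<oplus> w i \<notin> Fil m}" for m
    by (rule finite_subset [of _ "{i. u i \<notin> Fil m} \<union> {i. w i \<notin> Fil m}"])
      (use a Fil_add in \<open>auto simp: nullfam_def\<close>)
  thus ?thesis using a by (auto simp: nullfam_def)
qed

lemma fsum_add:
  assumes "nullfam u" "nullfam w"
  shows "fsum (\<lambda>i. u i \<oplus> w i) = fsum u \<oplus> fsum w"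
proof (rule fsum_eqI)
  fix m :: nat
  let ?J = "{i. u i \<notin> Fil (int m)} \<union> {i. w i \<notin> Fil (int m)}"
  have "cg (int m) (fsum u \<oplus> fsum w) (finsum R (\<lambda>i. u i \<oplus> w i) I)" if "finite I" "?J \<subseteq> I" for I
  proof -
    have "finsum R (\<lambda>i. u i \<oplus> w i) I = finsum R u I \<oplus> finsum R w I"
      using assms by (intro finsum_addf) (auto simp: nullfam_def)
    thus ?thesis using fsum_cg [OF assms(1), of I "int m"] fsum_cg [OF assms(2), of I "int m"] that
      by (auto intro: cg_add)
  qed
  moreover have "finite ?J" using assms by (auto simp: nullfam_def)
  ultimately show "\<exists>J. finite J \<and> (\<forall>I. finite I --> J \<subseteq> I -->
      cg (int m) (fsum u \<oplus> fsum w) (finsum R (\<lambda>i. u i \<oplus> w i) I))" by blast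
qed (use assms nullfam_add fsum_closed in auto)

lemma nullfam_finite: "finite S ==> (\<And>i. u i \<in> carrier R) ==> (\<And>i. i \<notin> S ==> u i = \<zero>) ==> nullfam u"
  unfolding nullfam_def by (auto elim!: rev_finite_subset) (metis Fil_zero)

lemma fsum_finite:
  assumes "finite S" "\<And>i. u i \<in> carrier R" "\<And>i. i \<notin> S ==> u i = \<zero>"
  shows "fsum u = finsum R u S"
proof (rule fsum_eqI)
  show "nullfam u" using assms by (rule nullfam_finite)
  show "finsum R u S \<in> carrier R" using assms by (intro finsum_closed) auto
  fix m :: nat
  have "cg (int m) (finsum R u S) (finsum R u I)" if "finite I" "S \<subseteq> I" for I
    by (rule cg_sym, rule cg_finsum_superset) (use that assms in auto)
  thus "\<exists>J. finite J \<and> (\<forall>I. finite I --> J \<subseteq> I --> cg (int m) (finsum R u S) (finsum R u I))"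
    using assms(1) by blast
qed

lemma fsum_single:
  assumes "c \<in> carrier R"
  shows "fsum (\<lambda>i. if i = j then c else \<zero>) = c"
  using fsum_finite [of "{j}" "\<lambda>i. if i = j then c else \<zero>"] assms
  by (auto simp: finsum_insert)

end

lemma (in cring) finsum_product:
  assumes "finite I" "finite J" "\<And>i. u i \<in> carrier R" "\<And>j. w j \<in> carrier R"
  shows "finsum R (\<lambda>(i, j). u i \<otimes> w j) (I \<times> J) = finsum R u I \<otimes> finsum R w J"
  using assms(1)
proof (induction I rule: finite_induct)
  case empty
  thus ?case using assms finsum_closed by auto
next
  case (insert x F)
  let ?p = "\<lambda>(i, j). u i \<otimes> w j"
  have "finsum R ?p (insert x F \<times> J) = finsum R ?p ((Pair x ` J) \<union> F \<times> J)"
    by (rule arg_cong [of _ _ "finsum R ?p"]) auto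
  also have "\<dots> = finsum R ?p (Pair x ` J) \<oplus> finsum R ?p (F \<times> J)"
    using insert assms by (intro finsum_Un_disjoint) auto
  also have "finsum R ?p (Pair x ` J) = finsum R (\<lambda>j. u x \<otimes> w j) J"
    using assms by (subst finsum_reindex) (auto simp: inj_on_def)
  also have "\<dots> = u x \<otimes> finsum R w J"
    using assms by (intro finsum_rdistr [symmetric]) auto
  also have "u x \<otimes> finsum R w J \<oplus> finsum R ?p (F \<times> J) = (u x \<oplus> finsum R u F) \<otimes> finsum R w J"
    using insert assms finsum_closed [of w J] finsum_closed [of u F] by (simp add: l_distr Pi_iff)
  also have "u x \<oplus> finsum R u F = finsum R u (insert x F)"
    using insert assms by (simp add: finsum_insert Pi_iff)
  finally show ?case .
qed

text \<open>Cauchy product over a commutative index monoid with finitely many relevant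
  decompositions of each index. Pairs outside the finite rectangle \<open>I m \<times> J m\<close>
  contribute members of \<open>Fil m\<close>, so the product of the partial sums and the sum of the
  convolution both reduce to \<open>Z \<inter> (I m \<times> J m)\<close>.\<close>

lemma (in complete_filt_ring) fsum_mult:
  fixes u w :: "'i::comm_monoid_add => 'a"
  assumes u: "nullfam u" and w: "nullfam w"
    and fin: "\<And>q. finite {(i, j). i + j = q \<and> P i j}"
    and P: "\<And>i j. \<not> P i j ==> u i \<otimes> w j = \<zero>"
    and z: "\<And>q. z q = finsum R (\<lambda>(i, j). u i \<otimes> w j) {(i, j). i + j = q \<and> P i j}"
  shows "nullfam z \<and> fsum z = fsum u \<otimes> fsum w"
proof -
  let ?p = "\<lambda>(i, j). u i \<otimes> w j"
  let ?S = "\<lambda>q. {(i, j). i + j = q \<and> P i j}"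
  have uc: "u i \<in> carrier R" and wc: "w i \<in> carrier R" for i using u w by (auto simp: nullfam_def)
  obtain c where c: "c \<le> 0" "\<And>i. u i \<in> Fil c" using nullfam_bdd [OF u] by blast
  obtain d where d: "d \<le> 0" "\<And>i. w i \<in> Fil d" using nullfam_bdd [OF w] by blast
  \<comment> \<open>Precision \<open>m\<close> of a product costs precision \<open>m - d\<close> in
    the first factor, \<open>d\<close> bounding the second one, and \<open>m - c\<close> in the
    second.\<close>
  define I where "I m = {i. u i \<notin> Fil (m - d)}" for m
  define J where "J m = {j. w j \<notin> Fil (m - c)}" for m
  have fI: "finite (I m)" "finite (J m)" for m using u w by (auto simp: nullfam_def I_def J_def)
  have small: "?p x \<in> Fil m" if x: "x \<notin> I m \<times> J m" for x m
  proof (cases x)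
    case (Pair i j)
    then consider "u i \<in> Fil (m - d)" | "w j \<in> Fil (m - c)" using x Pair by (auto simp: I_def J_def)
    thus ?thesis
    proof cases
      case 1
      thus ?thesis using Fil_mult_eq [OF 1 d(2) [of j], of m] Pair by simp
    next
      case 2
      thus ?thesis using Fil_mult_eq [OF c(2) [of i] 2, of m] Pair by simp
    qed
  qed
  have zc: "z q \<in> carrier R" for q unfolding z using uc wc by (intro finsum_closed) auto
  \<comment> \<open>Indices reached from the rectangle; at all others the convolution already lies
    in \<open>Fil m\<close>.\<close>
  define Q where "Q m = (\<lambda>(i, j). i + j) ` (I m \<times> J m)" for m
  have fQ: "finite (Q m)" for m unfolding Q_def using fI by auto
  have zQ: "z q \<in> Fil m" if "q \<notin> Q m" for q m
    unfolding z by (rule Fil_finsum, rule small) (use that in \<open>auto simp: Q_def\<close>)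
  have nz: "nullfam z"
    unfolding nullfam_def
  proof (intro conjI allI)
    fix m show "finite {q. z q \<notin> Fil m}" by (rule finite_subset [OF _ fQ [of m]]) (use zQ in blast)
  qed (fact zc)
  moreover have "fsum z = fsum u \<otimes> fsum w"
  proof (rule fsum_eqI)
    show "fsum u \<otimes> fsum w \<in> carrier R" using fsum_closed u w by auto
    fix n :: nat
    define m where "m = int n"
    have "cg m (fsum u \<otimes> fsum w) (finsum R z K)" if K: "finite K" "Q m \<subseteq> K" for K
    proof -
      define Z where "Z = (\<Union>q\<in>K. ?S q)"
      have fZ: "finite Z" unfolding Z_def using K fin by auto
      have "finsum R ?p Z = finsum R (\<lambda>q. finsum R ?p (?S q)) K"
        unfolding Z_def by (rule add.finprod_UN_disjoint) (use K fin uc wc in \<open>auto simp: pairwise_def disjnt_def\<close>)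
      hence zZ: "finsum R z K = finsum R ?p Z" unfolding z [abs_def] by simp
      have "cg m (fsum u \<otimes> fsum w) (finsum R u (I m) \<otimes> finsum R w (J m))"
      proof (rule cg_mult [of "m - d" _ _ "m - c" _ _ c d])
        show "cg (m - d) (fsum u) (finsum R u (I m))" by (rule fsum_cg) (use u fI in \<open>auto simp: I_def\<close>)
        show "cg (m - c) (fsum w) (finsum R w (J m))" by (rule fsum_cg) (use w fI in \<open>auto simp: J_def\<close>)
        show "fsum u \<in> Fil c" using fsum_Fil u c by auto
        show "finsum R w (J m) \<in> Fil d" by (rule Fil_finsum) (rule d)
      qed auto
      also have "finsum R u (I m) \<otimes> finsum R w (J m) = finsum R ?p (I m \<times> J m)"
        using finsum_product [of "I m" "J m" u w] fI uc wc by simp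
      also have "cg m (finsum R ?p (I m \<times> J m)) (finsum R ?p (Z \<inter> (I m \<times> J m)))"
      proof (rule cg_finsum_superset)
        fix x assume x: "x \<in> I m \<times> J m - Z \<inter> (I m \<times> J m)"
        obtain i j where ij: "x = (i, j)" by force
        have "i + j \<in> K" using x ij K(2) by (auto simp: Q_def)
        hence "\<not> P i j" using x ij by (auto simp: Z_def)
        hence "u i \<otimes> w j = \<zero>" by (rule P)
      thus "?p x \<in> Fil m" using ij by simp
      qed (use fI uc wc in auto)
      also have "cg m (finsum R ?p (Z \<inter> (I m \<times> J m))) (finsum R ?p Z)"
        by (rule cg_sym, rule cg_finsum_superset) (use fZ uc wc small in auto)
      finally show ?thesis using zZ by simp
    qed
    thus "\<exists>J. finite J \<and> (\<forall>I. finite I --> J \<subseteq> I --> cg (int n) (fsum u \<otimes> fsum w) (finsum R z I))"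
      by (intro exI [of _ "Q m"] conjI allI impI fQ) (auto simp: m_def)
  qed (fact nz)
  ultimately show ?thesis by blast
qed

text \<open>Horner form of a finite sum \<open>a_0 + p a_1 + p^2 a_2 + ...\<close> with
  \<open>a_i \<in> Fil (m - i n)\<close>. As an inductive predicate it yields the closure properties
  by one-step inductions, without exponents or index sets.\<close>

inductive level for R :: "('a, 'b) ring_scheme" (structure) and Fil :: "int => 'a set" and p :: 'a and n :: int where
  base: "a \<in> Fil m ==> level R Fil p n m a"
| step: "a \<in> Fil m ==> level R Fil p n (m - n) y ==> level R Fil p n m (a \<oplus> p \<otimes> y)"

definition Lev :: "('a, 'b) ring_scheme => (int => 'a set) => 'a => int => int => 'a set" where
  "Lev R Fil p n m = {x. level R Fil p n m x}"

locale filt_ring_elem = filt_ring +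
  fixes p
  assumes p_Fil: "p \<in> Fil 0"
begin

lemma p_carrier [simp]: "p \<in> carrier R" using p_Fil by auto

lemma level_carrier: "level R Fil p n m x ==> x \<in> carrier R"
  by (induction rule: level.induct) auto

lemma level_p: "level R Fil p n (m - n) y ==> level R Fil p n m (p \<otimes> y)"
proof -
  assume y: "level R Fil p n (m - n) y"
  hence "level R Fil p n m (\<zero> \<oplus> p \<otimes> y)" by (intro level.step) auto
  thus ?thesis using level_carrier [OF y] by simp
qed

lemma level_add: "level R Fil p n m x ==> level R Fil p n m y ==> level R Fil p n m (x \<oplus> y)"
proof (induction arbitrary: y rule: level.induct)
  case (base a m)
  from base(2,1) show ?case
  proof cases
    case base': base
    thus ?thesis using base by (auto intro: level.base Fil_add)
  next
    case (step b y')
    have "a \<oplus> (b \<oplus> p \<otimes> y') = (a \<oplus> b) \<oplus> p \<otimes> y'"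
      using base step Fil_carrier level_carrier by (simp add: a_assoc)
    thus ?thesis using base step by (auto intro: level.step Fil_add)
  qed
next
  case (step a m x')
  from step(4) show ?case
  proof cases
    case base
    have "(a \<oplus> p \<otimes> x') \<oplus> y = (a \<oplus> y) \<oplus> p \<otimes> x'"
      using Fil_carrier [OF base] Fil_carrier [OF step(1)] level_carrier [OF step(2)] p_carrier by algebra
    thus ?thesis using base step by (auto intro: level.step Fil_add)
  next
    case s: (step b y')
    have "a \<in> carrier R" "b \<in> carrier R" "x' \<in> carrier R" "y' \<in> carrier R" "p \<in> carrier R"
      using s step(1) level_carrier [OF step(2)] level_carrier by auto
    hence "(a \<oplus> p \<otimes> x') \<oplus> (b \<oplus> p \<otimes> y') = (a \<oplus> b) \<oplus> p \<otimes> (x' \<oplus> y')" by algebra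
    thus ?thesis using s step.IH [OF s(3)] step(1) by (auto intro: level.step Fil_add)
  qed
qed

lemma level_neg: "level R Fil p n m x ==> level R Fil p n m (\<ominus> x)"
proof (induction rule: level.induct)
  case (step a m y)
  have "a \<in> carrier R" "y \<in> carrier R" "p \<in> carrier R" using step level_carrier by auto
  hence "\<ominus> (a \<oplus> p \<otimes> y) = \<ominus> a \<oplus> p \<otimes> (\<ominus> y)" by algebra
  thus ?case using step by (auto intro: level.step Fil_neg)
qed (auto intro: level.base Fil_neg)

lemma level_mono: "level R Fil p n l x ==> m \<le> l ==> level R Fil p n m x"
proof (induction arbitrary: m rule: level.induct)
  case (step a l y)
  thus ?case by (intro level.step) (auto intro: Fil_monoD)
qed (auto intro: level.base Fil_monoD)

lemma level_base_mult: "level R Fil p n l y ==> a \<in> Fil m ==> level R Fil p n (m + l) (a \<otimes> y)"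
proof (induction rule: level.induct)
  case (step b l y)
  have "a \<in> carrier R" "b \<in> carrier R" "y \<in> carrier R" "p \<in> carrier R" using step level_carrier by auto
  hence e: "a \<otimes> (b \<oplus> p \<otimes> y) = a \<otimes> b \<oplus> p \<otimes> (a \<otimes> y)" by algebra
  have "level R Fil p n (m + l - n) (a \<otimes> y)" using step.IH [OF step.prems] by (simp add: algebra_simps)
  thus ?case unfolding e using step by (intro level.step Fil_mult)
qed (auto intro: level.base Fil_mult)

lemma level_mult:
  assumes "level R Fil p n m x" "level R Fil p n l y"
  shows "level R Fil p n (m + l) (x \<otimes> y)"
  using assms
proof (induction rule: level.induct)
  case (base a m)
  thus ?case by (rule level_base_mult [rotated])
next
  case (step a m x')
  have c: "a \<in> carrier R" "x' \<in> carrier R" "y \<in> carrier R" "p \<in> carrier R"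
    using step level_carrier by auto
  hence e: "(a \<oplus> p \<otimes> x') \<otimes> y = a \<otimes> y \<oplus> p \<otimes> (x' \<otimes> y)" by algebra
  have "level R Fil p n (m + l - n) (x' \<otimes> y)" using step by (simp add: algebra_simps)
  thus ?case unfolding e using step by (intro level_add level_p level_base_mult)
qed

lemma level_filt_ring: "filt_ring R (Lev R Fil p n) t"
proof (intro filt_ring.intro filt_ring_axioms.intro)
  show "cring R" by (rule is_cring)
  show "\<exists>m. x \<in> Lev R Fil p n m" if "x \<in> carrier R" for x
    using Fil_exh [OF that] by (auto simp: Lev_def intro: level.base)
qed (auto simp: Lev_def level_carrier intro: level.base level_add level_neg level_mono level_mult Fil_one t_unit t_Fil inv_t_Fil)

lemma Fil_Lev: "Fil m \<subseteq> Lev R Fil p n m"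
  by (auto simp: Lev_def intro: level.base)

text \<open>A larger \<open>n\<close> relaxes the condition on every coefficient. Bounds obtained at
  one fixed level thus persist at all larger ones with the same \<open>m\<close>.\<close>

lemma level_mono_n: "level R Fil p n m x ==> n \<le> n' ==> level R Fil p n' m x"
proof (induction rule: level.induct)
  case (step a m y)
  thus ?case by (intro level.step) (auto intro: level_mono)
qed (auto intro: level.base)

end

text \<open>\<open>M\<close> bounds the filtration lost in dividing by \<open>p\<close>. In a
  separated ring such a bound makes \<open>p\<close> a nonzerodivisor, and in a complete one it
  makes the ideal generated by \<open>p\<close> closed.\<close>

locale filt_ring_elem_reg = filt_ring_elem +
  fixes M :: int
  assumes p_reg: "x \<in> carrier R ==> p \<otimes> x \<in> Fil m ==> x \<in> Fil (m - M)"
begin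

text \<open>If \<open>p x = a + p y\<close> with \<open>a \<in> Fil m\<close>, then
  \<open>p (x - y) = a\<close>, and dividing costs \<open>M\<close>, while \<open>y\<close> already
  has level \<open>m - n\<close>. Hence the loss is the maximum of \<open>M\<close> and
  \<open>n\<close> and not their sum.\<close>

lemma level_p_reg:
  assumes x: "x \<in> carrier R" and px: "level R Fil p n m (p \<otimes> x)"
  shows "level R Fil p n (m - max M n) x"
  using px
proof cases
  case base
  thus ?thesis using p_reg [OF x] by (intro level.base) (auto intro: Fil_monoD [of _ "m - M"])
next
  case (step a y)
  have c: "a \<in> carrier R" "y \<in> carrier R" "p \<in> carrier R" using step level_carrier by auto
  have "p \<otimes> (x \<ominus> y) = p \<otimes> x \<ominus> p \<otimes> y" using x c by algebra
  also have "\<dots> = a" unfolding step(1) using x c by algebra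
  finally have "x \<ominus> y \<in> Fil (m - M)" using p_reg [of "x \<ominus> y"] step(2) x c by auto
  hence "level R Fil p n (m - max M n) (x \<ominus> y)" by (intro level.base) (auto intro: Fil_monoD)
  moreover have "level R Fil p n (m - max M n) y" using step(3) by (rule level_mono) auto
  moreover have "x = (x \<ominus> y) \<oplus> y" using x c by algebra
  ultimately show ?thesis using level_add by metis
qed

lemma level_reg: "filt_ring_elem_reg R (Lev R Fil p n) t p (max M n)"
proof -
  interpret L: filt_ring R "Lev R Fil p n" t by (rule level_filt_ring)
  show ?thesis
    by unfold_locales (use p_Fil Fil_Lev level_p_reg in \<open>auto simp: Lev_def\<close>)
qed

text \<open>The approximate quotients form a Cauchy sequence because division loses only
  \<open>M\<close>, and their limit is an exact quotient. Exact divisibility is obtained in this way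
  in \<open>A\<close>, in \<open>B\<close> and in \<open>D\<close>.\<close>

lemma p_multiple_closed:
  assumes "complete_filt_ring R Fil t"
    and x: "x \<in> carrier R" and ex: "\<And>m::nat. \<exists>y\<in>carrier R. cg (int m) x (p \<otimes> y)"
  shows "\<exists>y\<in>carrier R. x = p \<otimes> y"
proof -
  interpret complete_filt_ring R Fil t by fact
  obtain y where y: "\<And>m. y m \<in> carrier R" "\<And>m::nat. cg (int m) x (p \<otimes> y m)" using ex by metis
  have "cg (int m + (- M)) (y (Suc m)) (y m)" for m
  proof (rule cgI)
    have "cg (int m) (p \<otimes> y (Suc m)) (p \<otimes> y m)"
      using cg_trans [OF cg_sym [OF cg_mono [OF y(2) [of "Suc m"], of "int m"]] y(2) [of m]] by simp
    moreover have "p \<otimes> (y (Suc m) \<ominus> y m) = p \<otimes> y (Suc m) \<ominus> p \<otimes> y m"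
      using y(1) [of m] y(1) [of "Suc m"] p_carrier by algebra
    ultimately show "y (Suc m) \<ominus> y m \<in> Fil (int m + - M)"
      using p_reg [of "y (Suc m) \<ominus> y m" "int m"] y(1) by (simp add: cg_def)
  qed (use y in auto)
  then obtain z where z: "z \<in> carrier R" "\<And>m. cg (int m + (- M)) z (y m)"
    using fast_complete_shift [of y "- M"] y(1) by blast
  have "x = p \<otimes> z"
  proof (rule cg_eq)
    fix m :: nat
    \<comment> \<open>The approximate quotients are known only up to the shift by \<open>M\<close>,
      so the index is raised; the maximum covers a negative \<open>M\<close>.\<close>
    define l where "l = m + nat (max M 0)"
    have "cg (int m) x (p \<otimes> y l)" using y(2) [of l] by (rule cg_mono) (simp add: l_def)
    moreover have "cg (int m) (p \<otimes> z) (p \<otimes> y l)"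
      using cg_mult_left [OF z(2) [of l] p_Fil] by (rule cg_mono) (auto simp: l_def)
    ultimately show "cg (int m) x (p \<otimes> z)" by (meson cg_trans cg_sym)
  qed (use x z in auto)
  thus ?thesis using z by blast
qed

end

text \<open>Extension by continuity along a map with dense image. Because \<open>i\<close> reflects
  the filtration exactly and \<open>h\<close> preserves degrees, no modulus of continuity has to be
  carried along; neither \<open>R\<close> nor \<open>C\<close> is assumed separated.\<close>

lemma hom_extension:
  assumes R: "filt_ring R FilR tR" and C: "filt_ring C FilC tC" and S: "complete_filt_ring S FilS tS"
    and i: "i \<in> ring_hom R C" and iF: "\<And>x m. x \<in> carrier R ==> i x \<in> FilC m \<longleftrightarrow> x \<in> FilR m"
    and dense: "\<And>y m. y \<in> carrier C ==> \<exists>x\<in>carrier R. filt_ring.cg C FilC m y (i x)"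
    and h: "h \<in> ring_hom R S" and hF: "\<And>x m. x \<in> FilR m ==> h x \<in> FilS m"
  shows "\<exists>g\<in>ring_hom C S. (\<forall>m y. y \<in> FilC m --> g y \<in> FilS m) \<and> (\<forall>x\<in>carrier R. g (i x) = h x)"
proof -
  interpret R: filt_ring R FilR tR by fact
  interpret C: filt_ring C FilC tC by fact
  interpret S: complete_filt_ring S FilS tS by fact
  note ic = ring_hom_closed [OF i] and hc = ring_hom_closed [OF h]
  have i_cg: "R.cg m x x'" if "C.cg m (i x) (i x')" "x \<in> carrier R" "x' \<in> carrier R" for m x x'
    using that iF [of "x \<ominus>\<^bsub>R\<^esub> x'" m] ring_hom_minus [OF R.ring_axioms C.ring_axioms i]
    by (auto simp: C.cg_def R.cg_def)
  have h_cg: "S.cg m (h x) (h x')" if "R.cg m x x'" for m x x'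
    using that hF [of "x \<ominus>\<^bsub>R\<^esub> x'" m] ring_hom_minus [OF R.ring_axioms S.ring_axioms h] hc
    by (auto simp: S.cg_def R.cg_def)
  \<comment> \<open>\<open>ap y z\<close> tests \<open>z\<close> against all approximations of
    \<open>y\<close> at once, which makes the value independent of the sequence used to construct
    it.\<close>
  define ap where "ap y z \<longleftrightarrow> z \<in> carrier S \<and> (\<forall>m. \<forall>x\<in>carrier R. C.cg m y (i x) --> S.cg m z (h x))" for y z
  have ex: "\<exists>z. ap y z" if y: "y \<in> carrier C" for y
  proof -
    have "\<forall>m::nat. \<exists>x. x \<in> carrier R \<and> C.cg (int m) y (i x)" using dense [OF y] by blast
    then obtain x where x: "\<And>m. x m \<in> carrier R" "\<And>m::nat. C.cg (int m) y (i (x m))" by metis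
    have d: "S.cg m (h x') (h (x l))" if "C.cg m y (i x')" "x' \<in> carrier R" "m \<le> int l" for m l x'
      using C.cg_trans [OF C.cg_sym [OF that(1)] C.cg_mono [OF x(2) [of l] that(3)]] that x by (intro h_cg i_cg) auto
    have "\<exists>z\<in>carrier S. \<forall>m. S.cg (int m) z (h (x m))"
    proof (rule S.fast_complete)
      fix m show "S.cg (int m) (h (x (Suc m))) (h (x m))"
        by (rule d) (use x C.cg_mono [OF x(2) [of "Suc m"]] in auto)
    qed (use x hc in auto)
    then obtain z where z: "z \<in> carrier S" "\<And>m. S.cg (int m) z (h (x m))" by blast
    have "ap y z" unfolding ap_def
    proof (intro conjI allI ballI impI)
      fix m x' assume x': "x' \<in> carrier R" "C.cg m y (i x')"
      have "S.cg m z (h (x (nat m)))" using z(2) [of "nat m"] by (rule S.cg_mono) simp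
      moreover have "S.cg m (h x') (h (x (nat m)))" by (rule d) (use x' in auto)
      ultimately show "S.cg m z (h x')" by (meson S.cg_trans S.cg_sym)
    qed (fact z)
    thus ?thesis by blast
  qed
  define g where "g y = (SOME z. ap y z)" for y
  have g: "ap y (g y)" if "y \<in> carrier C" for y unfolding g_def by (rule someI_ex) (rule ex [OF that])
  have gc: "g y \<in> carrier S" if "y \<in> carrier C" for y using g [OF that] by (simp add: ap_def)
  have gcg: "S.cg m (g y) (h x)" if "C.cg m y (i x)" "x \<in> carrier R" for m x y
    using g [of y] that C.cg_carrier [OF that(1)] by (auto simp: ap_def)
  have eqI: "g y = z" if y: "y \<in> carrier C" "z \<in> carrier S"
    and *: "\<And>m::nat. \<exists>x\<in>carrier R. C.cg (int m) y (i x) \<and> S.cg (int m) z (h x)" for y z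
  proof (rule S.cg_eq)
    fix m :: nat
    from * obtain x where "x \<in> carrier R" "C.cg (int m) y (i x)" "S.cg (int m) z (h x)" by blast
    thus "S.cg (int m) (g y) z" using gcg by (meson S.cg_trans S.cg_sym)
  qed (use y gc in auto)
  have gi: "g (i x) = h x" if "x \<in> carrier R" for x
    by (rule eqI) (use that ic hc in \<open>auto intro!: bexI [of _ x]\<close>)
  have gF: "g y \<in> FilS m" if "y \<in> FilC m" for y m
  proof -
    have "C.cg m y (i \<zero>\<^bsub>R\<^esub>)" using that C.cg_zero_iff ring_hom_zero' [OF R.ring_axioms C.ring_axioms i] by simp
    hence "S.cg m (g y) (h \<zero>\<^bsub>R\<^esub>)" by (rule gcg) simp
    thus ?thesis using S.cg_zero_iff ring_hom_zero' [OF R.ring_axioms S.ring_axioms h] by simp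
  qed
  have "g \<in> ring_hom C S"
  proof (rule ring_hom_memI)
    show "g y \<in> carrier S" if "y \<in> carrier C" for y using gc that .
    show "g \<one>\<^bsub>C\<^esub> = \<one>\<^bsub>S\<^esub>" using gi [of "\<one>\<^bsub>R\<^esub>"] ring_hom_one [OF i] ring_hom_one [OF h] by simp
  next
    fix y y' assume y: "y \<in> carrier C" "y' \<in> carrier C"
    show "g (y \<oplus>\<^bsub>C\<^esub> y') = g y \<oplus>\<^bsub>S\<^esub> g y'"
    proof (rule eqI)
      fix m :: nat
      obtain x x' where x: "x \<in> carrier R" "C.cg (int m) y (i x)" "x' \<in> carrier R" "C.cg (int m) y' (i x')"
        using dense y by metis
      thus "\<exists>x\<in>carrier R. C.cg (int m) (y \<oplus>\<^bsub>C\<^esub> y') (i x) \<and> S.cg (int m) (g y \<oplus>\<^bsub>S\<^esub> g y') (h x)"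
        using ring_hom_add [OF i] ring_hom_add [OF h]
        by (intro bexI [of _ "x \<oplus>\<^bsub>R\<^esub> x'"]) (auto intro!: C.cg_add S.cg_add gcg)
    qed (use y gc in auto)
    show "g (y \<otimes>\<^bsub>C\<^esub> y') = g y \<otimes>\<^bsub>S\<^esub> g y'"
    proof (rule eqI)
      fix m :: nat
      obtain c1 where c1: "c1 \<le> 0" "y \<in> FilC c1" using C.Fil_exh_le y by blast
      obtain c2 where c2: "c2 \<le> c1" "y' \<in> FilC c2" using C.Fil_exh_le y by blast
      \<comment> \<open>\<open>c\<close> bounds both factors; precision \<open>l = m - c\<close> in
        each of them yields precision \<open>m\<close> in the product.\<close>
      define c l where "c = c2" and "l = int m - c2"
      have c: "c \<le> 0" "y \<in> FilC c" "y' \<in> FilC c" using c1 c2 by (auto simp: c_def intro: C.Fil_monoD)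
      obtain x x' where x: "x \<in> carrier R" "C.cg l y (i x)" "x' \<in> carrier R" "C.cg l y' (i x')"
        using dense y by metis
      have lc: "c \<le> l" using c by (simp add: l_def c_def)
      have F: "i x' \<in> FilC c" using C.cg_Fil [OF C.cg_sym [OF x(4)] c(3) lc] .
      have "C.cg (int m) (y \<otimes>\<^bsub>C\<^esub> y') (i x \<otimes>\<^bsub>C\<^esub> i x')"
        by (rule C.cg_mult [OF x(2) x(4) c(2) F]) (auto simp: l_def c_def)
      moreover have "S.cg (int m) (g y \<otimes>\<^bsub>S\<^esub> g y') (h x \<otimes>\<^bsub>S\<^esub> h x')"
      proof (rule S.cg_mult [of l _ _ l _ _ c c])
        show "g y \<in> FilS c" using gF c by blast
        show "h x' \<in> FilS c" using F iF [OF x(3)] hF by blast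
      qed (use gcg x in \<open>auto simp: l_def c_def\<close>)
      ultimately show "\<exists>x\<in>carrier R. C.cg (int m) (y \<otimes>\<^bsub>C\<^esub> y') (i x) \<and> S.cg (int m) (g y \<otimes>\<^bsub>S\<^esub> g y') (h x)"
        using ring_hom_mult [OF i x(1,3)] ring_hom_mult [OF h x(1,3)] x
        by (intro bexI [of _ "x \<otimes>\<^bsub>R\<^esub> x'"]) auto
    qed (use y gc in auto)
  qed
  thus ?thesis using gi gF by blast
qed

section \<open>Topologies defined by filtrations\<close>

lemma with_topology_simps [simp]:
  "carrier (with_topology R \<tau>) = carrier R"
  "monoid.mult (with_topology R \<tau>) = monoid.mult R"
  "one (with_topology R \<tau>) = one R"
  "ring.zero (with_topology R \<tau>) = ring.zero R"
  "ring.add (with_topology R \<tau>) = ring.add R"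
  "opens (with_topology R \<tau>) = \<tau>"
  by (simp_all add: with_topology_def)

lemma with_topology_ops [simp]:
  "a_inv (with_topology R \<tau>) = a_inv R"
  "a_minus (with_topology R \<tau>) = a_minus R"
  "finsum (with_topology R \<tau>) = finsum R"
  "Units (with_topology R \<tau>) = Units R"
  "m_inv (with_topology R \<tau>) = m_inv R"
  "a_r_coset (with_topology R \<tau>) = a_r_coset R"
  by (simp_all add: a_inv_def a_minus_def finsum_def finprod_def Units_def m_inv_def a_r_coset_def r_coset_def fun_eq_iff)

lemma with_topology_npow [simp]: "x [^]\<^bsub>with_topology R \<tau>\<^esub> (n::nat) = x [^]\<^bsub>R\<^esub> n"
  by (simp add: nat_pow_def)

lemma cring_with_topology: "cring R ==> cring (with_topology R \<tau>)"
proof -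
  assume "cring R"
  then interpret cring R .
  show ?thesis
  proof (intro cringI abelian_groupI comm_monoidI)
    fix x assume "x \<in> carrier (with_topology R \<tau>)"
    thus "\<exists>y\<in>carrier (with_topology R \<tau>). y \<oplus>\<^bsub>with_topology R \<tau>\<^esub> x = \<zero>\<^bsub>with_topology R \<tau>\<^esub>"
      by (auto intro: bexI [of _ "\<ominus>\<^bsub>R\<^esub> x"] l_neg)
  qed (auto simp: a_assoc m_assoc l_distr intro: a_comm m_comm)
qed

text \<open>An explicit criterion for openness, so that all later topological arguments take place
  in the filtration and forget the neighbourhood basis from which the topology was built.\<close>

definition filt_top :: "('a, 'b) top_ring_scheme => (int => 'a set) => bool" where
  "filt_top R Fil \<longleftrightarrow> (\<forall>W. openin (opens R) W \<longleftrightarrow>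
     W \<subseteq> carrier R \<and> (\<forall>x\<in>W. \<exists>m. \<forall>u\<in>Fil m. x \<oplus>\<^bsub>R\<^esub> u \<in> W))"

text \<open>The bridge to the given topologies: a basis of neighbourhoods of zero that is cofinal
  with the filtration produces the same open sets. The predicate has to be shown to be that of a
  topology before \<open>topology\<close> can be unfolded.\<close>

lemma filt_top_zero_basis:
  assumes mono: "\<And>m l. m \<le> l ==> Fil l \<subseteq> Fil m"
    and 1: "\<And>U. U \<in> B ==> \<exists>m. Fil m \<subseteq> U" and 2: "\<And>m. \<exists>U\<in>B. U \<subseteq> Fil m"
  shows "filt_top (with_topology R (zero_basis_topology R B)) Fil"
proof -
  define P where "P W \<longleftrightarrow> W \<subseteq> carrier R \<and> (\<forall>x\<in>W. \<exists>m. \<forall>u\<in>Fil m. x \<oplus>\<^bsub>R\<^esub> u \<in> W)" for W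
  have "(\<exists>U\<in>B. {x \<oplus>\<^bsub>R\<^esub> u |u. u \<in> U} \<subseteq> W) \<longleftrightarrow> (\<exists>m. \<forall>u\<in>Fil m. x \<oplus>\<^bsub>R\<^esub> u \<in> W)" for x W
  proof
    assume "\<exists>U\<in>B. {x \<oplus>\<^bsub>R\<^esub> u |u. u \<in> U} \<subseteq> W"
    then obtain U where U: "U \<in> B" "{x \<oplus>\<^bsub>R\<^esub> u |u. u \<in> U} \<subseteq> W" by blast
    obtain m where "Fil m \<subseteq> U" using 1 U by blast
    thus "\<exists>m. \<forall>u\<in>Fil m. x \<oplus>\<^bsub>R\<^esub> u \<in> W" using U by blast
  next
    assume "\<exists>m. \<forall>u\<in>Fil m. x \<oplus>\<^bsub>R\<^esub> u \<in> W"
    then obtain m where m: "\<forall>u\<in>Fil m. x \<oplus>\<^bsub>R\<^esub> u \<in> W" by blast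
    obtain U where "U \<in> B" "U \<subseteq> Fil m" using 2 by blast
    thus "\<exists>U\<in>B. {x \<oplus>\<^bsub>R\<^esub> u |u. u \<in> U} \<subseteq> W" using m by blast
  qed
  hence z: "zero_basis_topology R B = topology P"
    unfolding zero_basis_topology_def P_def by simp
  have "istopology P"
    unfolding istopology_def
  proof (intro conjI allI impI)
    fix S T assume "P S" "P T"
    show "P (S \<inter> T)" unfolding P_def
    proof (intro conjI ballI)
      fix x assume "x \<in> S \<inter> T"
      then obtain m l where "\<forall>u\<in>Fil m. x \<oplus>\<^bsub>R\<^esub> u \<in> S" "\<forall>u\<in>Fil l. x \<oplus>\<^bsub>R\<^esub> u \<in> T"
        using \<open>P S\<close> \<open>P T\<close> unfolding P_def by blast
      thus "\<exists>m. \<forall>u\<in>Fil m. x \<oplus>\<^bsub>R\<^esub> u \<in> S \<inter> T"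
        using mono [of m "max m l"] mono [of l "max m l"] by (intro exI [of _ "max m l"]) auto
    qed (use \<open>P S\<close> in \<open>auto simp: P_def\<close>)
  next
    fix \<K> assume K: "\<forall>K\<in>\<K>. P K"
    show "P (\<Union> \<K>)" unfolding P_def
    proof (intro conjI ballI)
      show "\<Union> \<K> \<subseteq> carrier R" using K by (auto simp: P_def)
      fix x assume "x \<in> \<Union> \<K>"
      then obtain S where "S \<in> \<K>" "x \<in> S" by blast
      then obtain m where "\<forall>u\<in>Fil m. x \<oplus>\<^bsub>R\<^esub> u \<in> S" using K \<open>S \<in> \<K>\<close> unfolding P_def by blast
      thus "\<exists>m. \<forall>u\<in>Fil m. x \<oplus>\<^bsub>R\<^esub> u \<in> \<Union> \<K>" using \<open>S \<in> \<K>\<close> by blast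
    qed
  qed
  thus ?thesis unfolding filt_top_def z by (simp add: topology_inverse' P_def)
qed

lemma filt_top_topspace:
  assumes "filt_top R Fil" "\<And>x m u. x \<in> carrier R ==> u \<in> Fil m ==> x \<oplus>\<^bsub>R\<^esub> u \<in> carrier R"
  shows "topspace (opens R) = carrier R"
proof (rule subset_antisym)
  show "topspace (opens R) \<subseteq> carrier R" using assms(1) openin_topspace unfolding filt_top_def by blast
  have "openin (opens R) (carrier R)" using assms unfolding filt_top_def by blast
  thus "carrier R \<subseteq> topspace (opens R)" by (rule openin_subset)
qed

lemma filt_top_continuous:
  assumes R: "filt_top R FilR" and S: "filt_top S FilS"
    and cR: "\<And>x m u. x \<in> carrier R ==> u \<in> FilR m ==> u \<in> carrier R \<and> x \<oplus>\<^bsub>R\<^esub> u \<in> carrier R"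
    and cS: "\<And>x m u. x \<in> carrier S ==> u \<in> FilS m ==> x \<oplus>\<^bsub>S\<^esub> u \<in> carrier S"
    and hc: "\<And>x. x \<in> carrier R ==> h x \<in> carrier S"
    and ha: "\<And>x y. x \<in> carrier R ==> y \<in> carrier R ==> h (x \<oplus>\<^bsub>R\<^esub> y) = h x \<oplus>\<^bsub>S\<^esub> h y"
    and hF: "\<And>m. \<exists>l. \<forall>u\<in>FilR l. h u \<in> FilS m"
  shows "continuous_map (opens R) (opens S) h"
proof -
  have tR: "topspace (opens R) = carrier R" using R cR by (intro filt_top_topspace [of R FilR]) auto
  have tS: "topspace (opens S) = carrier S" using S cS by (intro filt_top_topspace [of S FilS]) auto
  show ?thesis
    unfolding continuous_map_def tR tS
  proof (intro conjI allI impI)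
    fix V assume V: "openin (opens S) V"
    show "openin (opens R) {x \<in> carrier R. h x \<in> V}"
      unfolding R [unfolded filt_top_def, rule_format]
    proof (intro conjI ballI)
      fix x assume x: "x \<in> {x \<in> carrier R. h x \<in> V}"
      then obtain m where m: "\<And>u. u \<in> FilS m ==> h x \<oplus>\<^bsub>S\<^esub> u \<in> V"
        using V unfolding S [unfolded filt_top_def, rule_format] by blast
      obtain l where l: "\<And>u. u \<in> FilR l ==> h u \<in> FilS m" using hF by blast
      show "\<exists>m. \<forall>u\<in>FilR m. x \<oplus>\<^bsub>R\<^esub> u \<in> {x \<in> carrier R. h x \<in> V}"
      proof (intro exI [of _ l] ballI)
        fix u assume u: "u \<in> FilR l"
        thus "x \<oplus>\<^bsub>R\<^esub> u \<in> {x \<in> carrier R. h x \<in> V}"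
          using m [OF l [OF u]] x cR [of x u l] ha [of x u] by auto
      qed
    qed auto
  qed (use hc in auto)
qed

locale filt_top_ring = filt_ring R Fil t for R :: "('a, 'b) top_ring_scheme" (structure) and Fil t +
  assumes ft: "filt_top R Fil"
begin

lemma topspace_carrier: "topspace (opens R) = carrier R"
  by (rule filt_top_topspace [OF ft]) auto

lemma openin_iff: "openin (opens R) W \<longleftrightarrow> W \<subseteq> carrier R \<and> (\<forall>x\<in>W. \<exists>m. \<forall>u\<in>Fil m. x \<oplus> u \<in> W)"
  using ft by (simp add: filt_top_def)

lemma openin_ball: "x \<in> carrier R ==> openin (opens R) {y. cg m y x}"
  unfolding openin_iff
proof (intro conjI ballI)
  fix y assume "y \<in> {y. cg m y x}"
  hence y: "cg m y x" by simp
  have "cg m (y \<oplus> u) x" if u: "u \<in> Fil m" for u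
  proof -
    have "cg m (y \<oplus> u) (x \<oplus> \<zero>)" using y u by (intro cg_add) (auto simp: cg_zero_iff)
    thus ?thesis using cg_carrier [OF y] by simp
  qed
  thus "\<exists>l. \<forall>u\<in>Fil l. y \<oplus> u \<in> {y. cg m y x}" by auto
qed (auto simp: cg_def)

lemma openin_Fil: "openin (opens R) (Fil m)"
  using openin_ball [of \<zero> m] by (simp add: cg_zero_iff)

lemma openin_zeroD:
  assumes "openin (opens R) U" "\<zero> \<in> U" shows "\<exists>m. Fil m \<subseteq> U"
proof -
  obtain m where "\<And>u. u \<in> Fil m ==> \<zero> \<oplus> u \<in> U"
    using assms(2) assms(1) [unfolded openin_iff] by blast
  thus ?thesis by (intro exI [of _ m]) auto
qed

lemma cauchy_seq_iff:
  "cauchy_seq R a \<longleftrightarrow> (\<forall>i. a i \<in> carrier R) \<and> (\<forall>m. \<exists>N. \<forall>i\<ge>N. \<forall>j\<ge>N. cg m (a i) (a j))"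
proof
  assume a: "cauchy_seq R a"
  hence c: "a i \<in> carrier R" for i by (simp add: cauchy_seq_def)
  have "\<exists>N. \<forall>i\<ge>N. \<forall>j\<ge>N. cg m (a i) (a j)" for m
    using a openin_Fil [of m] c unfolding cauchy_seq_def cg_def by (auto dest: spec [of _ "Fil m"])
  thus "(\<forall>i. a i \<in> carrier R) \<and> (\<forall>m. \<exists>N. \<forall>i\<ge>N. \<forall>j\<ge>N. cg m (a i) (a j))" using c by blast
next
  assume a: "(\<forall>i. a i \<in> carrier R) \<and> (\<forall>m. \<exists>N. \<forall>i\<ge>N. \<forall>j\<ge>N. cg m (a i) (a j))"
  show "cauchy_seq R a" unfolding cauchy_seq_def
  proof (intro conjI allI impI)
    fix U assume "openin (opens R) U \<and> \<zero> \<in> U"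
    then obtain m where m: "Fil m \<subseteq> U" using openin_zeroD by blast
    obtain N where "\<forall>i\<ge>N. \<forall>j\<ge>N. cg m (a i) (a j)" using a by blast
    thus "\<exists>N. \<forall>i\<ge>N. \<forall>j\<ge>N. a i \<ominus> a j \<in> U" using m unfolding cg_def by (intro exI [of _ N]) auto
  qed (use a in auto)
qed

lemma limitin_iff:
  assumes "\<And>i. a i \<in> carrier R"
  shows "limitin (opens R) a x sequentially \<longleftrightarrow> x \<in> carrier R \<and> (\<forall>m. \<exists>N. \<forall>i\<ge>N. cg m (a i) x)"
proof
  assume a: "limitin (opens R) a x sequentially"
  hence x: "x \<in> carrier R" by (simp add: limitin_def topspace_carrier)
  have "\<exists>N. \<forall>i\<ge>N. cg m (a i) x" for m
  proof -
    have "eventually (\<lambda>i. a i \<in> {y. cg m y x}) sequentially"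
      using a openin_ball [OF x, of m] cg_refl [OF x, of m] unfolding limitin_def by blast
    thus ?thesis by (simp add: eventually_sequentially)
  qed
  thus "x \<in> carrier R \<and> (\<forall>m. \<exists>N. \<forall>i\<ge>N. cg m (a i) x)" using x by blast
next
  assume a: "x \<in> carrier R \<and> (\<forall>m. \<exists>N. \<forall>i\<ge>N. cg m (a i) x)"
  show "limitin (opens R) a x sequentially"
    unfolding limitin_def topspace_carrier eventually_sequentially
  proof (intro conjI allI impI)
    fix U assume U: "openin (opens R) U \<and> x \<in> U"
    then obtain m where m: "\<And>u. u \<in> Fil m ==> x \<oplus> u \<in> U"
      unfolding openin_iff by blast
    obtain N where N: "\<And>i. i \<ge> N ==> cg m (a i) x" using a by blast
    show "\<exists>N. \<forall>n\<ge>N. a n \<in> U"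
    proof (intro exI allI impI)
      fix n assume n: "n \<ge> N"
      have "x \<oplus> (a n \<ominus> x) = a n" using a assms [of n] by algebra
      thus "a n \<in> U" using m [of "a n \<ominus> x"] N [OF n] by (auto simp: cg_def)
    qed
  qed (use a in auto)
qed

lemma null_seqs_iff:
  "a \<in> null_seqs R \<longleftrightarrow> (\<forall>i. a i \<in> carrier R) \<and> (\<forall>m. \<exists>N. \<forall>i\<ge>N. a i \<in> Fil m)"
proof
  assume "a \<in> null_seqs R"
  thus "(\<forall>i. a i \<in> carrier R) \<and> (\<forall>m. \<exists>N. \<forall>i\<ge>N. a i \<in> Fil m)"
    using limitin_iff [of a \<zero>] by (auto simp: null_seqs_def cauchy_seq_iff cg_zero_iff)
next
  assume a: "(\<forall>i. a i \<in> carrier R) \<and> (\<forall>m. \<exists>N. \<forall>i\<ge>N. a i \<in> Fil m)"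
  have "cauchy_seq R a" unfolding cauchy_seq_iff
  proof (intro conjI allI)
    fix m
    obtain N where "\<And>i. i \<ge> N ==> a i \<in> Fil m" using a by blast
    thus "\<exists>N. \<forall>i\<ge>N. \<forall>j\<ge>N. cg m (a i) (a j)"
      using a by (intro exI [of _ N]) (auto intro!: cgI Fil_minus)
  qed (use a in blast)
  thus "a \<in> null_seqs R" using a limitin_iff [of a \<zero>] by (simp add: null_seqs_def cg_zero_iff)
qed

text \<open>Finitely many terms are bounded one by one, and all later ones are congruent to
  \<open>a N\<close> modulo \<open>Fil b\<close>; the condition \<open>c \<le> b\<close> lets the
  bound of \<open>a N\<close> pass to them.\<close>

lemma cauchy_bdd:
  assumes "cauchy_seq R a" shows "\<exists>c\<le>b. \<forall>i. a i \<in> Fil c"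
proof -
  have ac: "a i \<in> carrier R" for i using assms by (simp add: cauchy_seq_iff)
  obtain N where N: "\<And>i. i \<ge> N ==> cg b (a i) (a N)" using assms unfolding cauchy_seq_iff by blast
  have "\<exists>c\<le>b. \<forall>i<n. a i \<in> Fil c" for n
  proof (induction n)
    case (Suc n)
    then obtain c where c: "c \<le> b" "\<forall>i<n. a i \<in> Fil c" by blast
    obtain d where d: "d \<le> c" "a n \<in> Fil d" using Fil_exh_le [OF ac] by blast
    thus ?case using c by (intro exI [of _ d]) (auto simp: less_Suc_eq intro: Fil_monoD)
  qed auto
  then obtain c where c: "c \<le> b" "\<forall>i<Suc N. a i \<in> Fil c" by blast
  have "a i \<in> Fil c" for i
    using c N [of i] cg_Fil [of b "a i" "a N" c] by (cases "i < Suc N") auto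
  thus ?thesis using c by blast
qed

lemma cauchy_add: "cauchy_seq R a ==> cauchy_seq R b ==> cauchy_seq R (\<lambda>i. a i \<oplus> b i)"
  unfolding cauchy_seq_iff
proof (intro conjI allI; elim conjE)
  fix m assume *: "\<forall>m. \<exists>N. \<forall>i\<ge>N. \<forall>j\<ge>N. cg m (a i) (a j)" "\<forall>m. \<exists>N. \<forall>i\<ge>N. \<forall>j\<ge>N. cg m (b i) (b j)"
  obtain N M where "\<And>i j. i \<ge> N ==> j \<ge> N ==> cg m (a i) (a j)" "\<And>i j. i \<ge> M ==> j \<ge> M ==> cg m (b i) (b j)"
    using * by meson
  thus "\<exists>N. \<forall>i\<ge>N. \<forall>j\<ge>N. cg m (a i \<oplus> b i) (a j \<oplus> b j)"
    by (intro exI [of _ "max N M"]) (auto intro: cg_add)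
qed auto

lemma cauchy_mult: "cauchy_seq R a ==> cauchy_seq R b ==> cauchy_seq R (\<lambda>i. a i \<otimes> b i)"
proof -
  assume ab: "cauchy_seq R a" "cauchy_seq R b"
  obtain c where c: "c \<le> 0" "\<And>i. a i \<in> Fil c" using cauchy_bdd [OF ab(1)] by blast
  obtain d where d: "d \<le> 0" "\<And>i. b i \<in> Fil d" using cauchy_bdd [OF ab(2)] by blast
  show ?thesis unfolding cauchy_seq_iff
  proof (intro conjI allI)
    fix m
    obtain N where N: "\<And>i j. i \<ge> N ==> j \<ge> N ==> cg (m - d) (a i) (a j)"
      using ab(1) unfolding cauchy_seq_iff by meson
    obtain M where M: "\<And>i j. i \<ge> M ==> j \<ge> M ==> cg (m - c) (b i) (b j)"
      using ab(2) unfolding cauchy_seq_iff by meson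
    show "\<exists>N. \<forall>i\<ge>N. \<forall>j\<ge>N. cg m (a i \<otimes> b i) (a j \<otimes> b j)"
      by (intro exI [of _ "max N M"] allI impI, rule cg_mult [OF N M c(2) d(2)]) auto
  qed (use ab in \<open>auto simp: cauchy_seq_iff\<close>)
qed

lemma cauchy_neg: "cauchy_seq R a ==> cauchy_seq R (\<lambda>i. \<ominus> a i)"
proof -
  assume a: "cauchy_seq R a"
  have "cg m (\<ominus> a i) (\<ominus> a j)" if "cg m (a i) (a j)" for m i j
    using cg_minus [OF cg_refl [OF zero_closed] that] cg_carrier [OF that] by (simp add: a_minus_def)
  thus ?thesis using a unfolding cauchy_seq_iff by (metis a_inv_closed)
qed

lemma cauchy_const: "x \<in> carrier R ==> cauchy_seq R (\<lambda>_. x)"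
  by (auto simp: cauchy_seq_iff)

lemma cauchy_ring_simps [simp]:
  "carrier (cauchy_ring R) = {a. cauchy_seq R a}"
  "a \<otimes>\<^bsub>cauchy_ring R\<^esub> b = (\<lambda>i. a i \<otimes> b i)"
  "a \<oplus>\<^bsub>cauchy_ring R\<^esub> b = (\<lambda>i. a i \<oplus> b i)"
  "\<one>\<^bsub>cauchy_ring R\<^esub> = (\<lambda>_. \<one>)" "\<zero>\<^bsub>cauchy_ring R\<^esub> = (\<lambda>_. \<zero>)"
  by (simp_all add: cauchy_ring_def)

lemma cauchy_carrier: "cauchy_seq R a ==> a i \<in> carrier R"
  by (simp add: cauchy_seq_iff)

lemma cauchy_ring_cring: "cring (cauchy_ring R)"
proof (intro cringI abelian_groupI comm_monoidI)
  fix a assume a: "a \<in> carrier (cauchy_ring R)"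
  thus "\<exists>b\<in>carrier (cauchy_ring R). b \<oplus>\<^bsub>cauchy_ring R\<^esub> a = \<zero>\<^bsub>cauchy_ring R\<^esub>"
    by (intro bexI [of _ "\<lambda>i. \<ominus> a i"]) (auto simp: cauchy_neg cauchy_carrier l_neg)
qed (auto simp: cauchy_add cauchy_mult cauchy_const cauchy_carrier a_assoc m_assoc l_distr fun_eq_iff
      intro: a_comm m_comm cauchy_carrier)

lemma cauchy_ring_neg: "cauchy_seq R a ==> \<ominus>\<^bsub>cauchy_ring R\<^esub> a = (\<lambda>i. \<ominus> a i)"
proof -
  assume a: "cauchy_seq R a"
  interpret C: cring "cauchy_ring R" by (rule cauchy_ring_cring)
  show ?thesis by (rule C.minus_equality) (use a in \<open>auto simp: cauchy_neg cauchy_carrier l_neg\<close>)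
qed

lemma null_cauchy: "a \<in> null_seqs R ==> cauchy_seq R a"
  by (simp add: null_seqs_def)

text \<open>The ideal property rests on boundedness of Cauchy sequences: a bounded factor shifts the
  filtration of a null sequence by a constant only.\<close>

lemma null_seqs_ideal: "ideal (null_seqs R) (cauchy_ring R)"
proof -
  interpret C: cring "cauchy_ring R" by (rule cauchy_ring_cring)
  have m: "(\<lambda>i. x i \<otimes> a i) \<in> null_seqs R" if a: "a \<in> null_seqs R" and x: "cauchy_seq R x" for a x
  proof -
    obtain c where c: "\<And>i. x i \<in> Fil c" using cauchy_bdd [OF x] by blast
    have "\<exists>N. \<forall>i\<ge>N. x i \<otimes> a i \<in> Fil m" for m
    proof -
      obtain N where "\<And>i. i \<ge> N ==> a i \<in> Fil (m - c)" using a unfolding null_seqs_iff by meson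
      hence "\<forall>i\<ge>N. x i \<otimes> a i \<in> Fil m" using Fil_mult_eq [OF c, of _ "m - c" m] by simp
      thus ?thesis by blast
    qed
    thus ?thesis using a x by (auto simp: null_seqs_iff cauchy_carrier)
  qed
  show ?thesis
  proof (rule idealI [OF C.ring_axioms])
    show "subgroup (null_seqs R) (add_monoid (cauchy_ring R))"
    proof (rule C.add.subgroupI)
      show "null_seqs R \<subseteq> carrier (cauchy_ring R)" using null_cauchy by auto
      have "(\<lambda>_. \<zero>) \<in> null_seqs R" by (auto simp: null_seqs_iff)
      thus "null_seqs R \<noteq> {}" by blast
    next
      fix a assume "a \<in> null_seqs R"
      thus "\<ominus>\<^bsub>cauchy_ring R\<^esub> a \<in> null_seqs R"
        using cauchy_ring_neg [OF null_cauchy, of a] unfolding null_seqs_iff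
        by (auto 4 4 intro: Fil_neg)
    next
      fix a b assume ab: "a \<in> null_seqs R" "b \<in> null_seqs R"
      have "\<exists>N. \<forall>i\<ge>N. a i \<oplus> b i \<in> Fil m" for m
      proof -
        obtain N M where "\<And>i. i \<ge> N ==> a i \<in> Fil m" "\<And>i. i \<ge> M ==> b i \<in> Fil m"
          using ab unfolding null_seqs_iff by meson
        thus ?thesis by (intro exI [of _ "max N M"]) (auto intro: Fil_add)
      qed
      thus "a \<oplus>\<^bsub>cauchy_ring R\<^esub> b \<in> null_seqs R"
        using ab by (auto simp: null_seqs_iff)
    qed
  next
    fix a x assume a: "a \<in> null_seqs R" and x: "x \<in> carrier (cauchy_ring R)"
    thus l: "x \<otimes>\<^bsub>cauchy_ring R\<^esub> a \<in> null_seqs R" using m by simp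
    have "a \<otimes>\<^bsub>cauchy_ring R\<^esub> x = x \<otimes>\<^bsub>cauchy_ring R\<^esub> a"
      using x null_cauchy [OF a] by (intro C.m_comm) auto
    thus "a \<otimes>\<^bsub>cauchy_ring R\<^esub> x \<in> null_seqs R" using l by simp
  qed
qed

end

lemma (in ideal) coset_eq_iff:
  assumes "a \<in> carrier R" "b \<in> carrier R"
  shows "I +> a = I +> b \<longleftrightarrow> a \<ominus> b \<in> I"
proof
  assume "I +> a = I +> b"
  hence "a \<in> I +> b" using a_rcos_self [OF assms(1)] by simp
  then obtain i where i: "i \<in> I" "a = i \<oplus> b" by (auto simp: a_r_coset_def')
  have "i \<oplus> b \<ominus> b = i" using i assms a_Hcarr [OF i(1)] by (simp add: a_minus_def a_assoc r_neg)
  thus "a \<ominus> b \<in> I" using i by simp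
next
  assume i: "a \<ominus> b \<in> I"
  have "a \<ominus> b \<oplus> b = a" using assms by (simp add: a_minus_def a_assoc l_neg)
  hence "a \<in> I +> b" using i unfolding a_r_coset_def' by (auto intro!: bexI [of _ "a \<ominus> b"])
  thus "I +> a = I +> b" using a_repr_independence [OF _ assms(2)] is_additive_subgroup additive_subgroup.a_subgroup
    by metis
qed

lemma ring_hom_with_topology: "ring_hom R (with_topology S \<tau>) = ring_hom R S"
  "ring_hom (with_topology S \<tau>) R = ring_hom S R"
  by (simp_all add: ring_hom_def)

section \<open>The completion as a complete filtered ring\<close>

context filt_top_ring
begin

definition cls :: "(nat => 'a) => (nat => 'a) set" where
  "cls a = null_seqs R +>\<^bsub>cauchy_ring R\<^esub> a"

text \<open>The shape of the basic neighbourhoods in \<open>completion\<close>: one representative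
  lies in \<open>Fil m\<close> from the start. \<open>cls_CFil_iff\<close> turns this into an
  eventual condition on any given representative.\<close>

definition CFil :: "int => (nat => 'a) set set" where
  "CFil m = {c \<in> carrier (completion R). \<exists>a\<in>c. \<forall>i. a i \<in> Fil m}"

lemma completion_map_cls: "completion_map R x = cls (\<lambda>_. x)"
  by (simp add: completion_map_def cls_def)

lemma completion_cring: "cring (completion R)"
  unfolding completion_def Let_def
  by (intro cring_with_topology ideal.quotient_is_cring null_seqs_ideal cauchy_ring_cring)

lemma cls_hom: "cls \<in> ring_hom (cauchy_ring R) (completion R)"
  using ideal.rcos_ring_hom [OF null_seqs_ideal]
  by (simp add: completion_def Let_def ring_hom_with_topology cls_def [abs_def])

lemma completion_carrierE:
  assumes "c \<in> carrier (completion R)" obtains a where "cauchy_seq R a" "c = cls a"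
  using assms that by (auto simp: completion_def Let_def FactRing_def A_RCOSETS_def' cls_def)

lemma cls_closed [simp]: "cauchy_seq R a ==> cls a \<in> carrier (completion R)"
  using ring_hom_closed [OF cls_hom] by simp

lemma cls_add: "cauchy_seq R a ==> cauchy_seq R b ==> cls a \<oplus>\<^bsub>completion R\<^esub> cls b = cls (\<lambda>i. a i \<oplus> b i)"
  using ring_hom_add [OF cls_hom, of a b] by simp

lemma cls_mult: "cauchy_seq R a ==> cauchy_seq R b ==> cls a \<otimes>\<^bsub>completion R\<^esub> cls b = cls (\<lambda>i. a i \<otimes> b i)"
  using ring_hom_mult [OF cls_hom, of a b] by simp

lemma cls_zero: "\<zero>\<^bsub>completion R\<^esub> = cls (\<lambda>_. \<zero>)"
  using ring_hom_zero' [OF cring.axioms(1) [OF cauchy_ring_cring] cring.axioms(1) [OF completion_cring] cls_hom] by simp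

lemma cls_one: "\<one>\<^bsub>completion R\<^esub> = cls (\<lambda>_. \<one>)"
  using ring_hom_one [OF cls_hom] by simp

lemma cls_neg: "cauchy_seq R a ==> \<ominus>\<^bsub>completion R\<^esub> cls a = cls (\<lambda>i. \<ominus> a i)"
  using ring_hom_a_inv [OF cring.axioms(1) [OF cauchy_ring_cring] cring.axioms(1) [OF completion_cring] cls_hom, of a]
    cauchy_ring_neg [of a] by simp

lemma cls_minus: "cauchy_seq R a ==> cauchy_seq R b ==> cls a \<ominus>\<^bsub>completion R\<^esub> cls b = cls (\<lambda>i. a i \<ominus> b i)"
  using cls_add [of a "\<lambda>i. \<ominus> b i"] cls_neg [of b] cauchy_neg [of b] by (simp add: a_minus_def)

lemma cls_eq_iff:
  assumes a: "cauchy_seq R a" and b: "cauchy_seq R b"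
  shows "cls a = cls b \<longleftrightarrow> (\<lambda>i. a i \<ominus> b i) \<in> null_seqs R"
proof -
  have "a \<ominus>\<^bsub>cauchy_ring R\<^esub> b = (\<lambda>i. a i \<ominus> b i)"
    using cauchy_ring_neg [OF b] by (simp add: a_minus_def)
  thus ?thesis
    using ideal.coset_eq_iff [OF null_seqs_ideal, of a b] a b by (simp add: cls_def)
qed

lemma cls_CFil_iff:
  assumes a: "cauchy_seq R a"
  shows "cls a \<in> CFil m \<longleftrightarrow> (\<exists>N. \<forall>i\<ge>N. a i \<in> Fil m)"
proof
  assume "cls a \<in> CFil m"
  then obtain b where b: "b \<in> cls a" "\<And>i. b i \<in> Fil m" by (auto simp: CFil_def)
  then obtain n where n: "n \<in> null_seqs R" "b = (\<lambda>i. n i \<oplus> a i)"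
    by (auto simp: cls_def a_r_coset_def')
  obtain N where N: "\<And>i. i \<ge> N ==> n i \<in> Fil m" using n(1) unfolding null_seqs_iff by blast
  have "a i \<in> Fil m" if "i \<ge> N" for i
  proof -
    have "n i \<oplus> a i \<ominus> n i = a i"
      using Fil_carrier [OF N [OF that]] cauchy_carrier [OF a, of i] by algebra
    moreover have "n i \<oplus> a i \<ominus> n i \<in> Fil m" using b(2) [of i] N [OF that] n(2) by (auto intro: Fil_minus)
    ultimately show ?thesis by simp
  qed
  thus "\<exists>N. \<forall>i\<ge>N. a i \<in> Fil m" by blast
next
  assume "\<exists>N. \<forall>i\<ge>N. a i \<in> Fil m"
  then obtain N where N: "\<And>i. i \<ge> N ==> a i \<in> Fil m" by blast
  \<comment> \<open>Adding this null sequence deletes the first \<open>N\<close> terms and gives a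
    representative lying entirely in \<open>Fil m\<close>.\<close>
  define n where "n i = (if i < N then \<ominus> a i else \<zero>)" for i
  have n: "n \<in> null_seqs R" unfolding null_seqs_iff
    using cauchy_carrier [OF a] by (auto simp: n_def intro: exI [of _ N])
  have "(\<lambda>i. n i \<oplus> a i) \<in> cls a" using n by (auto simp: cls_def a_r_coset_def')
  moreover have "n i \<oplus> a i \<in> Fil m" for i using N cauchy_carrier [OF a] by (auto simp: n_def l_neg)
  ultimately show "cls a \<in> CFil m" using a unfolding CFil_def by (intro CollectI conjI bexI [of _ "\<lambda>i. n i \<oplus> a i"]) auto
qed

text \<open>Constant sequences are eventually in \<open>Fil m\<close> only if they are so
  throughout. The map thus reflects the filtration even where it is not injective, and estimates in
  the completion can be carried back.\<close>

lemma completion_map_CFil_iff: "x \<in> carrier R ==> completion_map R x \<in> CFil m \<longleftrightarrow> x \<in> Fil m"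
  using cls_CFil_iff [OF cauchy_const, of x m] by (auto simp: completion_map_cls)

lemma completion_map_hom: "completion_map R \<in> ring_hom R (completion R)"
proof (rule ring_hom_memI)
  show "completion_map R \<one> = \<one>\<^bsub>completion R\<^esub>" by (simp add: completion_map_cls cls_one)
qed (simp_all add: completion_map_cls cauchy_const cls_mult cls_add)

lemma completion_filt_ring: "filt_ring (completion R) CFil (completion_map R t)"
proof -
  interpret C: cring "completion R" by (rule completion_cring)
  have cE: "\<exists>a N. cauchy_seq R a \<and> c = cls a \<and> (\<forall>i\<ge>N. a i \<in> Fil m)" if "c \<in> CFil m" for c m
  proof -
    have "c \<in> carrier (completion R)" using that by (simp add: CFil_def)
    then obtain a where "cauchy_seq R a" "c = cls a" by (rule completion_carrierE)
    thus ?thesis using cls_CFil_iff [of a m] that by auto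
  qed
  show ?thesis
  proof (intro filt_ring.intro filt_ring_axioms.intro)
    show "cring (completion R)" by (rule completion_cring)
    show "CFil m \<subseteq> carrier (completion R)" for m by (auto simp: CFil_def)
    show "\<zero>\<^bsub>completion R\<^esub> \<in> CFil m" for m
      unfolding cls_zero by (subst cls_CFil_iff) (auto intro: cauchy_const)
    show "\<one>\<^bsub>completion R\<^esub> \<in> CFil 0"
      unfolding cls_one by (subst cls_CFil_iff) (auto intro: cauchy_const Fil_one)
    show "CFil l \<subseteq> CFil m" if "m \<le> l" for l m
      using that by (auto simp: CFil_def intro: Fil_monoD)
    show "\<ominus>\<^bsub>completion R\<^esub> x \<in> CFil m" if x: "x \<in> CFil m" for x m
    proof -
      obtain a N where a: "cauchy_seq R a" "x = cls a" "\<forall>i\<ge>N. a i \<in> Fil m" using cE [OF x] by blast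
      hence "\<exists>N. \<forall>i\<ge>N. \<ominus> a i \<in> Fil m" by (intro exI [of _ N]) (auto intro: Fil_neg)
      thus ?thesis unfolding a(2) cls_neg [OF a(1)] cls_CFil_iff [OF cauchy_neg [OF a(1)]] .
    qed
    show "x \<oplus>\<^bsub>completion R\<^esub> y \<in> CFil m" if x: "x \<in> CFil m" and y: "y \<in> CFil m" for x y m
    proof -
      obtain a N where a: "cauchy_seq R a" "x = cls a" "\<forall>i\<ge>N. a i \<in> Fil m" using cE [OF x] by blast
      obtain b M where b: "cauchy_seq R b" "y = cls b" "\<forall>i\<ge>M. b i \<in> Fil m" using cE [OF y] by blast
      have "\<exists>N. \<forall>i\<ge>N. a i \<oplus> b i \<in> Fil m" using a(3) b(3) by (intro exI [of _ "max N M"]) (auto intro: Fil_add)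
      thus ?thesis
        unfolding a(2) b(2) cls_add [OF a(1) b(1)] cls_CFil_iff [OF cauchy_add [OF a(1) b(1)]] .
    qed
    show "x \<otimes>\<^bsub>completion R\<^esub> y \<in> CFil (m + l)" if x: "x \<in> CFil m" and y: "y \<in> CFil l" for x y m l
    proof -
      obtain a N where a: "cauchy_seq R a" "x = cls a" "\<forall>i\<ge>N. a i \<in> Fil m" using cE [OF x] by blast
      obtain b M where b: "cauchy_seq R b" "y = cls b" "\<forall>i\<ge>M. b i \<in> Fil l" using cE [OF y] by blast
      have "\<exists>N. \<forall>i\<ge>N. a i \<otimes> b i \<in> Fil (m + l)" using a(3) b(3) by (intro exI [of _ "max N M"]) (auto intro: Fil_mult)
      thus ?thesis
        unfolding a(2) b(2) cls_mult [OF a(1) b(1)] cls_CFil_iff [OF cauchy_mult [OF a(1) b(1)]] .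
    qed
    show "\<exists>m. x \<in> CFil m" if x: "x \<in> carrier (completion R)" for x
    proof -
      obtain a where a: "cauchy_seq R a" "x = cls a" using x by (rule completion_carrierE)
      thus ?thesis using cauchy_bdd [OF a(1), of 0] cls_CFil_iff [OF a(1)] by auto
    qed
    show u: "completion_map R t \<in> Units (completion R)"
      using ring_hom_Units [OF is_cring completion_cring completion_map_hom t_unit] .
    show "completion_map R t \<in> CFil 1" using completion_map_CFil_iff t_Fil by simp
    have "completion_map R t \<otimes>\<^bsub>completion R\<^esub> completion_map R (inv t) = \<one>\<^bsub>completion R\<^esub>"
      using ring_hom_mult [OF completion_map_hom, of t "inv t"] ring_hom_one [OF completion_map_hom] t_unit by simp
    hence "inv\<^bsub>completion R\<^esub> completion_map R t = completion_map R (inv t)"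
      using u ring_hom_closed [OF completion_map_hom, of "inv t"] t_unit C.comm_inv_char [of "completion_map R t" "completion_map R (inv t)"]
      by (simp add: C.Units_closed)
    thus "inv\<^bsub>completion R\<^esub> completion_map R t \<in> CFil (- 1)"
      using completion_map_CFil_iff [of "inv t" "- 1"] inv_t_Fil t_unit by simp
  qed
qed

lemma completion_dense:
  assumes "y \<in> carrier (completion R)"
  shows "\<exists>x\<in>carrier R. filt_ring.cg (completion R) CFil m y (completion_map R x)"
proof -
  interpret C: filt_ring "completion R" CFil "completion_map R t" by (rule completion_filt_ring)
  obtain a where a: "cauchy_seq R a" "y = cls a" using assms by (rule completion_carrierE)
  obtain N where N: "\<And>i j. i \<ge> N ==> j \<ge> N ==> cg m (a i) (a j)" using a(1) unfolding cauchy_seq_iff by meson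
  have aN: "cauchy_seq R (\<lambda>_. a N)" using a(1) by (intro cauchy_const cauchy_carrier)
  have ca: "cauchy_seq R (\<lambda>i. a i \<ominus> a N)"
    using cauchy_add [OF a(1) cauchy_neg [OF aN]] by (simp add: a_minus_def)
  have "\<exists>M. \<forall>i\<ge>M. a i \<ominus> a N \<in> Fil m" using N [of _ N] by (intro exI [of _ N]) (auto simp: cg_def)
  hence "y \<ominus>\<^bsub>completion R\<^esub> completion_map R (a N) \<in> CFil m"
    unfolding a(2) completion_map_cls cls_minus [OF a(1) aN] cls_CFil_iff [OF ca] .
  thus ?thesis using a aN by (intro bexI [of _ "a N"] C.cgI) (auto simp: completion_map_cls cauchy_carrier)
qed

text \<open>Each member of the sequence is replaced by the class of a constant \<open>y m\<close>,
  at precision \<open>m\<close>. The constants form a Cauchy sequence in \<open>R\<close>, whose own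
  class is the limit.\<close>

lemma completion_complete: "complete_filt_ring (completion R) CFil (completion_map R t)"
proof -
  interpret C: filt_ring "completion R" CFil "completion_map R t" by (rule completion_filt_ring)
  note mc = ring_hom_closed [OF completion_map_hom]
  have icg: "cg m x y" if "C.cg m (completion_map R x) (completion_map R y)" "x \<in> carrier R" "y \<in> carrier R" for m x y
    using that completion_map_CFil_iff [of "x \<ominus> y" m]
      ring_hom_minus [OF ring_axioms C.ring_axioms completion_map_hom, of x y]
    by (simp add: C.cg_def cg_def)
  show ?thesis
  proof (intro complete_filt_ring.intro complete_filt_ring_axioms.intro completion_filt_ring)
    fix x assume x: "x \<in> carrier (completion R)" "\<And>m. x \<in> CFil m"
    obtain a where a: "cauchy_seq R a" "x = cls a" using x(1) by (rule completion_carrierE)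
    have "\<forall>m. \<exists>N. \<forall>i\<ge>N. a i \<in> Fil m" using x(2) unfolding a(2) cls_CFil_iff [OF a(1)] by blast
    hence "(\<lambda>i. a i \<ominus> \<zero>) \<in> null_seqs R"
      using cauchy_carrier [OF a(1)] by (simp add: null_seqs_iff a_minus_def)
    thus "x = \<zero>\<^bsub>completion R\<^esub>" unfolding a(2) cls_zero
      by (subst cls_eq_iff) (use a in \<open>auto intro: cauchy_const\<close>)
  next
    fix s :: "nat => (nat => 'a) set"
    assume s: "\<And>m. s m \<in> carrier (completion R)" and sc: "\<And>m. C.cg (int m) (s (Suc m)) (s m)"
    have "\<forall>m. \<exists>x. x \<in> carrier R \<and> C.cg (int m) (s m) (completion_map R x)"
      using completion_dense [OF s] by blast
    then obtain y where y: "\<And>m. y m \<in> carrier R" "\<And>m. C.cg (int m) (s m) (completion_map R (y m))" by metis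
    have step: "cg (int m) (y (Suc m)) (y m)" for m
    proof (rule icg)
      have "C.cg (int m) (completion_map R (y (Suc m))) (s (Suc m))"
        using C.cg_sym [OF y(2) [of "Suc m"]] by (rule C.cg_mono) simp
      also have "C.cg (int m) (s (Suc m)) (s m)" by (rule sc)
      also have "C.cg (int m) (s m) (completion_map R (y m))" by (rule y(2))
      finally show "C.cg (int m) (completion_map R (y (Suc m))) (completion_map R (y m))" .
    qed (use y in auto)
    have far: "cg (int N) (y (N + k)) (y N)" for N k
    proof (induction k)
      case 0
      thus ?case using y by simp
    next
      case (Suc k)
      have "cg (int N) (y (Suc (N + k))) (y (N + k))" using step [of "N + k"] by (rule cg_mono) simp
      thus ?case using Suc cg_trans by auto
    qed
    have ycg: "cg m (y i) (y N)" if "m \<le> int N" "i \<ge> N" for m i N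
      using cg_mono [OF far [of N "i - N"] that(1)] that(2) by simp
    have cy: "cauchy_seq R y" unfolding cauchy_seq_iff
    proof (intro conjI allI)
      fix m
      have "cg m (y i) (y j)" if "i \<ge> nat m" "j \<ge> nat m" for i j
        using cg_trans [OF ycg [of m "nat m" i] cg_sym [OF ycg [of m "nat m" j]]] that by simp
      thus "\<exists>N. \<forall>i\<ge>N. \<forall>j\<ge>N. cg m (y i) (y j)" by blast
    qed (fact y)
    have "C.cg (int m) (cls y) (s m)" for m
    proof -
      have cm: "cauchy_seq R (\<lambda>_. y m)" using y by (intro cauchy_const)
      have ca: "cauchy_seq R (\<lambda>i. y i \<ominus> y m)"
        using cauchy_add [OF cy cauchy_neg [OF cm]] by (simp add: a_minus_def)
      have "\<exists>M. \<forall>i\<ge>M. y i \<ominus> y m \<in> Fil (int m)" using ycg [of "int m" m] by (auto simp: cg_def)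
      hence "cls y \<ominus>\<^bsub>completion R\<^esub> completion_map R (y m) \<in> CFil (int m)"
        unfolding completion_map_cls cls_minus [OF cy cm] cls_CFil_iff [OF ca] .
      hence "C.cg (int m) (cls y) (completion_map R (y m))" using cy y mc by (intro C.cgI) auto
      thus ?thesis using y(2) [of m] by (meson C.cg_sym C.cg_trans)
    qed
    thus "\<exists>y\<in>carrier (completion R). \<forall>m. C.cg (int m) y (s m)" using cy by (intro bexI [of _ "cls y"]) auto
  qed
qed

lemma completion_filt_top: "filt_top (completion R) CFil"
proof -
  define Q where "Q = cauchy_ring R Quot null_seqs R"
  define B where "B = {{c \<in> carrier Q. \<exists>a\<in>c. \<forall>i. a i \<in> U} |U. openin (opens R) U \<and> \<zero> \<in> U}"
  have cQ: "completion R = with_topology Q (zero_basis_topology Q B)"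
    by (simp add: completion_def Let_def Q_def B_def)
  have Cf: "CFil m = {c \<in> carrier Q. \<exists>a\<in>c. \<forall>i. a i \<in> Fil m}" for m
    unfolding CFil_def cQ by simp
  show ?thesis unfolding cQ
  proof (rule filt_top_zero_basis)
    show "CFil l \<subseteq> CFil m" if "m \<le> l" for m l using that by (auto simp: CFil_def intro: Fil_monoD)
    show "\<exists>m. CFil m \<subseteq> U" if U: "U \<in> B" for U
    proof -
      obtain V where V: "openin (opens R) V" "\<zero> \<in> V" "U = {c \<in> carrier Q. \<exists>a\<in>c. \<forall>i. a i \<in> V}"
        using U by (auto simp: B_def)
      obtain m where "Fil m \<subseteq> V" using openin_zeroD V by blast
      hence "CFil m \<subseteq> U" unfolding V(3) Cf by blast
      thus ?thesis by blast
    qed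
    show "\<exists>U\<in>B. U \<subseteq> CFil m" for m
    proof (intro bexI [of _ "CFil m"])
      show "CFil m \<in> B" unfolding B_def Cf
        using openin_Fil [of m] Fil_zero [of m] by (intro CollectI exI [of _ "Fil m"]) simp
    qed simp
  qed
qed

end

section \<open>Series rings and localisation\<close>

text \<open>The product of \<open>series_ring\<close> under a name. Only pairs of nonzero
  coefficients are summed: for Laurent series \<open>i + j = m\<close> alone has infinitely many
  solutions, and \<open>finsum\<close> over an infinite set is zero.\<close>

definition conv :: "('a, 'b) ring_scheme => ('i::comm_monoid_add => 'a) => ('i => 'a) => 'i => 'a" where
  "conv R f g m = finsum R (\<lambda>(i, j). f i \<otimes>\<^bsub>R\<^esub> g j) {(i, j). i + j = m \<and> f i \<noteq> \<zero>\<^bsub>R\<^esub> \<and> g j \<noteq> \<zero>\<^bsub>R\<^esub>}"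

lemma series_ring_simps [simp]:
  "carrier (series_ring R S) = S"
  "f \<otimes>\<^bsub>series_ring R S\<^esub> g = conv R f g"
  "one (series_ring R S) = series_const R (one R)"
  "ring.zero (series_ring R S) = (\<lambda>_. ring.zero R)"
  "f \<oplus>\<^bsub>series_ring R S\<^esub> g = (\<lambda>i. f i \<oplus>\<^bsub>R\<^esub> g i)"
  by (simp_all add: series_ring_def conv_def fun_eq_iff series_const_def)

context cring
begin

lemma conv_closed: "(\<And>i. f i \<in> carrier R) ==> (\<And>i. g i \<in> carrier R) ==> conv R f g m \<in> carrier R"
  unfolding conv_def by (intro finsum_closed) auto

text \<open>Trades the index set, which depends on the supports, for any convenient finite set of
  decompositions; convolutions can then be added and compared termwise.\<close>

lemma conv_superset:
  assumes "\<And>i. f i \<in> carrier R" "\<And>i. g i \<in> carrier R"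
    and "finite Z" "{(i, j). i + j = m \<and> f i \<noteq> \<zero> \<and> g j \<noteq> \<zero>} \<subseteq> Z" "Z \<subseteq> {(i, j). i + j = m}"
  shows "conv R f g m = finsum R (\<lambda>(i, j). f i \<otimes> g j) Z"
  unfolding conv_def
proof (rule add.finprod_mono_neutral_cong_left)
  fix x assume x: "x \<in> Z - {(i, j). i + j = m \<and> f i \<noteq> \<zero> \<and> g j \<noteq> \<zero>}"
  obtain i j where ij: "x = (i, j)" by force
  hence "f i = \<zero> \<or> g j = \<zero>" using x assms(5) by auto
  thus "(case x of (i, j) => f i \<otimes> g j) = \<zero>" using ij assms(1) [of i] assms(2) [of j] by auto
qed (use assms in auto)

lemma conv_single:
  fixes g :: "'i::cancel_comm_monoid_add => 'a"
  assumes c: "c \<in> carrier R" and g: "\<And>j. g j \<in> carrier R"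
  shows "conv R (\<lambda>i. if i = a then c else \<zero>) g (a + b) = c \<otimes> g b"
proof -
  have "conv R (\<lambda>i. if i = a then c else \<zero>) g (a + b)
      = finsum R (\<lambda>(i, j). (if i = a then c else \<zero>) \<otimes> g j) {(a, b)}"
    by (rule conv_superset) (use c g in \<open>auto split: if_splits\<close>)
  also have "\<dots> = c \<otimes> g b" using c g by (simp add: finsum_insert)
  finally show ?thesis .
qed

lemma conv_single_0:
  assumes "\<nexists>b. m = a + b"
  shows "conv R (\<lambda>i. if i = a then c else \<zero>) g m = \<zero>"
proof -
  have "{(i, j). i + j = m \<and> (if i = a then c else \<zero>) \<noteq> \<zero> \<and> g j \<noteq> \<zero>} = {}"
    using assms by (auto split: if_splits)
  thus ?thesis unfolding conv_def by (simp only: finsum_empty)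
qed

lemma conv_const:
  fixes g :: "'i::cancel_comm_monoid_add => 'a"
  assumes "c \<in> carrier R" "\<And>j. g j \<in> carrier R"
  shows "conv R (series_const R c) g = (\<lambda>i. c \<otimes> g i)"
  using conv_single [of c g 0] assms by (simp add: series_const_def fun_eq_iff)

end

text \<open>The finiteness conditions isolate what the index monoid and the supports contribute:
  \<open>fin2\<close> makes products of two series finite sums, \<open>fin3\<close> does the same
  for the triple sums behind associativity.\<close>

locale series_cring = cring R for R (structure) +
  fixes S :: "('i::comm_monoid_add => 'a) set"
  assumes S_carrier: "f \<in> S ==> f i \<in> carrier R"
    and S_zero: "(\<lambda>_. \<zero>) \<in> S" and S_one: "series_const R \<one> \<in> S"
    and S_add: "f \<in> S ==> g \<in> S ==> (\<lambda>i. f i \<oplus> g i) \<in> S"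
    and S_neg: "f \<in> S ==> (\<lambda>i. \<ominus> f i) \<in> S"
    and S_mult: "f \<in> S ==> g \<in> S ==> conv R f g \<in> S"
    and fin2: "f \<in> S ==> g \<in> S ==> finite {(i, j). i + j = m \<and> f i \<noteq> \<zero> \<and> g j \<noteq> \<zero>}"
    and fin3: "f \<in> S ==> g \<in> S ==> h \<in> S ==>
      finite {(i, j, l). i + j + l = m \<and> f i \<noteq> \<zero> \<and> g j \<noteq> \<zero> \<and> h l \<noteq> \<zero>}"
begin

lemma conv_comm:
  assumes f: "f \<in> S" and g: "g \<in> S" shows "conv R f g = conv R g f"
proof
  fix m
  let ?A = "{(i, j). i + j = m \<and> g i \<noteq> \<zero> \<and> f j \<noteq> \<zero>}"
  have "{(i, j). i + j = m \<and> f i \<noteq> \<zero> \<and> g j \<noteq> \<zero>} = prod.swap ` ?A"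
    by (auto simp: add.commute image_iff)
  hence "conv R f g m = finsum R (\<lambda>(i, j). f i \<otimes> g j) (prod.swap ` ?A)" by (simp add: conv_def)
  also have "\<dots> = finsum R (\<lambda>x. (\<lambda>(i, j). f i \<otimes> g j) (prod.swap x)) ?A"
    using S_carrier [OF f] S_carrier [OF g] by (intro finsum_reindex) auto
  also have "\<dots> = conv R g f m" unfolding conv_def
    using S_carrier [OF f] S_carrier [OF g] by (intro finsum_cong') (auto intro: m_comm)
  finally show "conv R f g m = conv R g f m" .
qed

text \<open>The triple product as a single sum. Associativity follows from
  \<open>(f g) h = tri f g h\<close>, cyclic invariance of \<open>tri\<close> and commutativity, so
  that only one bracketing is ever expanded.\<close>

definition tri :: "('i => 'a) => ('i => 'a) => ('i => 'a) => 'i => 'a" where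
  "tri f g h m = finsum R (\<lambda>(i, j, l). f i \<otimes> g j \<otimes> h l)
     {(i, j, l). i + j + l = m \<and> f i \<noteq> \<zero> \<and> g j \<noteq> \<zero> \<and> h l \<noteq> \<zero>}"

lemma tri_rotate:
  assumes f: "f \<in> S" and g: "g \<in> S" and h: "h \<in> S" shows "tri f g h m = tri g h f m"
proof -
  let ?A = "{(i, j, l). i + j + l = m \<and> g i \<noteq> \<zero> \<and> h j \<noteq> \<zero> \<and> f l \<noteq> \<zero>}"
  let ?r = "\<lambda>(i, j, l). (l, i, j)"
  note c = S_carrier [OF f] S_carrier [OF g] S_carrier [OF h]
  have "{(i, j, l). i + j + l = m \<and> f i \<noteq> \<zero> \<and> g j \<noteq> \<zero> \<and> h l \<noteq> \<zero>} = ?r ` ?A"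
    by (auto simp: add.commute add.left_commute image_iff)
  hence "tri f g h m = finsum R (\<lambda>(i, j, l). f i \<otimes> g j \<otimes> h l) (?r ` ?A)" by (simp add: tri_def)
  also have "\<dots> = finsum R (\<lambda>x. (\<lambda>(i, j, l). f i \<otimes> g j \<otimes> h l) (?r x)) ?A"
    using c by (intro finsum_reindex) (auto simp: inj_on_def)
  also have "\<dots> = tri g h f m" unfolding tri_def
    using c by (intro finsum_cong') (auto simp: m_ac)
  finally show ?thesis .
qed

lemma conv_conv:
  assumes f: "f \<in> S" and g: "g \<in> S" and h: "h \<in> S"
  shows "conv R (conv R f g) h m = tri f g h m"
proof -
  note c = S_carrier [OF f] S_carrier [OF g] S_carrier [OF h]
  define A where "A = {(i, j, l). i + j + l = m \<and> f i \<noteq> \<zero> \<and> g j \<noteq> \<zero> \<and> h l \<noteq> \<zero>}"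
  define K where "K = (\<lambda>(i, j, l). (i + j, l)) ` A"
  \<comment> \<open>The fibre over \<open>(q, l)\<close> consists of the decompositions of
    \<open>q\<close>; summing over it gives the inner convolution times \<open>h l\<close>.\<close>
  define F where "F x = {y \<in> A. (\<lambda>(i, j, l). (i + j, l)) y = x}" for x
  let ?p = "\<lambda>(i, j, l). f i \<otimes> g j \<otimes> h l"
  have fA: "finite A" unfolding A_def by (rule fin3 [OF f g h])
  have "finsum R ?p (\<Union> (F ` K)) = finsum R (\<lambda>x. finsum R ?p (F x)) K"
  proof (rule add.finprod_UN_disjoint)
    show "finite K" using fA by (simp add: K_def)
    show "finite (F x)" for x using fA by (simp add: F_def)
    show "pairwise (\<lambda>i j. disjnt (F i) (F j)) K" by (auto simp: pairwise_def disjnt_def F_def)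
  qed (use c in auto)
  moreover have "\<Union> (F ` K) = A" by (auto simp: F_def K_def)
  moreover have "finsum R (\<lambda>x. finsum R ?p (F x)) K = finsum R (\<lambda>(q, l). conv R f g q \<otimes> h l) K"
  proof (rule finsum_cong')
    fix x assume x: "x \<in> K"
    obtain q l where ql: "x = (q, l)" by force
    have hl: "h l \<noteq> \<zero>" "q + l = m" using x ql by (auto simp: K_def A_def)
    have "F (q, l) = (\<lambda>(i, j). (i, j, l)) ` {(i, j). i + j = q \<and> f i \<noteq> \<zero> \<and> g j \<noteq> \<zero>}"
      using hl by (auto simp: F_def A_def)
    hence "finsum R ?p (F x) = finsum R (\<lambda>y. ?p ((\<lambda>(i, j). (i, j, l)) y)) {(i, j). i + j = q \<and> f i \<noteq> \<zero> \<and> g j \<noteq> \<zero>}"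
      unfolding ql using c by (simp only:) (intro finsum_reindex; auto simp: inj_on_def)
    also have "\<dots> = finsum R (\<lambda>y. (\<lambda>(i, j). f i \<otimes> g j) y \<otimes> h l) {(i, j). i + j = q \<and> f i \<noteq> \<zero> \<and> g j \<noteq> \<zero>}"
      using c by (intro finsum_cong') auto
    also have "\<dots> = conv R f g q \<otimes> h l" unfolding conv_def
      using c fin2 [OF f g] by (intro finsum_ldistr [symmetric]) auto
    finally show "finsum R ?p (F x) = (case x of (q, l) => conv R f g q \<otimes> h l)" using ql by simp
  qed (use c in \<open>auto intro!: m_closed conv_closed\<close>)
  moreover have "conv R (conv R f g) h m = finsum R (\<lambda>(q, l). conv R f g q \<otimes> h l) K"
  proof (rule conv_superset)
    show "{(i, j). i + j = m \<and> conv R f g i \<noteq> \<zero> \<and> h j \<noteq> \<zero>} \<subseteq> K"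
    proof clarify
      fix q l assume ql: "m = q + l" "conv R f g q \<noteq> \<zero>" "h l \<noteq> \<zero>"
      have "{(i, j). i + j = q \<and> f i \<noteq> \<zero> \<and> g j \<noteq> \<zero>} \<noteq> {}"
        using ql(2) unfolding conv_def by (metis finsum_empty)
      then obtain i j where "i + j = q" "f i \<noteq> \<zero>" "g j \<noteq> \<zero>" by auto
      thus "(q, l) \<in> K" using ql by (auto simp: K_def A_def image_iff)
    qed
    show "K \<subseteq> {(i, j). i + j = m}" by (auto simp: K_def A_def)
  qed (use c fA in \<open>auto simp: K_def intro!: conv_closed\<close>)
  ultimately show ?thesis by (simp add: tri_def A_def)
qed

lemma conv_assoc:
  assumes "f \<in> S" "g \<in> S" "h \<in> S" shows "conv R (conv R f g) h = conv R f (conv R g h)"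
proof
  fix m
  have "conv R f (conv R g h) m = conv R (conv R g h) f m" using conv_comm assms S_mult by metis
  thus "conv R (conv R f g) h m = conv R f (conv R g h) m"
    using assms by (simp add: conv_conv tri_rotate [of f g h])
qed

lemma conv_add_left:
  assumes f: "f \<in> S" and f': "f' \<in> S" and g: "g \<in> S"
  shows "conv R (\<lambda>i. f i \<oplus> f' i) g = (\<lambda>m. conv R f g m \<oplus> conv R f' g m)"
proof
  fix m
  note c = S_carrier [OF f] S_carrier [OF f'] S_carrier [OF g]
  define Z where "Z = {(i, j). i + j = m \<and> f i \<noteq> \<zero> \<and> g j \<noteq> \<zero>} \<union> {(i, j). i + j = m \<and> f' i \<noteq> \<zero> \<and> g j \<noteq> \<zero>}
    \<union> {(i, j). i + j = m \<and> f i \<oplus> f' i \<noteq> \<zero> \<and> g j \<noteq> \<zero>}"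
  have fZ: "finite Z" unfolding Z_def using fin2 [OF f g] fin2 [OF f' g] fin2 [OF S_add [OF f f'] g] by auto
  have "conv R (\<lambda>i. f i \<oplus> f' i) g m = finsum R (\<lambda>(i, j). (f i \<oplus> f' i) \<otimes> g j) Z"
    by (rule conv_superset) (use c fZ in \<open>auto simp: Z_def\<close>)
  also have "\<dots> = finsum R (\<lambda>x. (\<lambda>(i, j). f i \<otimes> g j) x \<oplus> (\<lambda>(i, j). f' i \<otimes> g j) x) Z"
    using c by (intro finsum_cong') (auto simp: l_distr)
  also have "\<dots> = finsum R (\<lambda>(i, j). f i \<otimes> g j) Z \<oplus> finsum R (\<lambda>(i, j). f' i \<otimes> g j) Z"
    using c by (intro finsum_addf) auto
  also have "finsum R (\<lambda>(i, j). f i \<otimes> g j) Z = conv R f g m"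
    by (rule conv_superset [symmetric]) (use c fZ in \<open>auto simp: Z_def\<close>)
  also have "finsum R (\<lambda>(i, j). f' i \<otimes> g j) Z = conv R f' g m"
    by (rule conv_superset [symmetric]) (use c fZ in \<open>auto simp: Z_def\<close>)
  finally show "conv R (\<lambda>i. f i \<oplus> f' i) g m = conv R f g m \<oplus> conv R f' g m" .
qed

lemma conv_one:
  assumes f: "f \<in> S" shows "conv R (series_const R \<one>) f = f"
proof
  fix m
  have c: "series_const R \<one> i \<in> carrier R" "f i \<in> carrier R" for i :: 'i
    using S_carrier [OF f] by (simp_all add: series_const_def)
  have 1: "{(i, j). i + j = m \<and> series_const R \<one> i \<noteq> \<zero> \<and> f j \<noteq> \<zero>} \<subseteq> {(0, m)}"
    by (auto simp: series_const_def split: if_splits)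
  have 2: "{(0, m)} \<subseteq> {(i, j). i + j = m}" by simp
  show "conv R (series_const R \<one>) f m = f m"
    unfolding conv_superset [OF c finite.insertI [OF finite.emptyI] 1 2]
    using c by (simp add: finsum_insert series_const_def)
qed

lemma series_ring_cring: "cring (series_ring R S)"
proof (intro cringI abelian_groupI comm_monoidI)
  fix f assume f: "f \<in> carrier (series_ring R S)"
  thus "\<exists>g\<in>carrier (series_ring R S). g \<oplus>\<^bsub>series_ring R S\<^esub> f = \<zero>\<^bsub>series_ring R S\<^esub>"
    using S_carrier [of f] by (intro bexI [of _ "\<lambda>i. \<ominus> f i"]) (auto simp: S_neg l_neg)
next
  fix f g h assume "f \<in> carrier (series_ring R S)" "g \<in> carrier (series_ring R S)" "h \<in> carrier (series_ring R S)"
  thus "(f \<otimes>\<^bsub>series_ring R S\<^esub> g) \<otimes>\<^bsub>series_ring R S\<^esub> h = f \<otimes>\<^bsub>series_ring R S\<^esub> (g \<otimes>\<^bsub>series_ring R S\<^esub> h)"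
    by (simp add: conv_assoc)
next
  fix f g assume "f \<in> carrier (series_ring R S)" "g \<in> carrier (series_ring R S)"
  thus "f \<otimes>\<^bsub>series_ring R S\<^esub> g = g \<otimes>\<^bsub>series_ring R S\<^esub> f" by (simp add: conv_comm [of f g])
qed (auto simp: S_zero S_one S_add S_mult S_carrier a_assoc conv_add_left conv_one fun_eq_iff intro: a_comm S_carrier)

lemma series_ring_neg: "f \<in> S ==> \<ominus>\<^bsub>series_ring R S\<^esub> f = (\<lambda>i. \<ominus> f i)"
proof -
  assume f: "f \<in> S"
  interpret C: cring "series_ring R S" by (rule series_ring_cring)
  show ?thesis by (rule C.minus_equality) (use f S_carrier [of f] in \<open>auto simp: S_neg l_neg\<close>)
qed

lemma series_ring_minus: "f \<in> S ==> g \<in> S ==> f \<ominus>\<^bsub>series_ring R S\<^esub> g = (\<lambda>i. f i \<ominus> g i)"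
  by (simp add: a_minus_def series_ring_neg)

end

lemma (in cring) power_series_cring: "series_cring R {f :: nat => 'a. \<forall>i. f i \<in> carrier R}"
proof unfold_locales
  fix f g h :: "nat => 'a" and m :: nat
  show "finite {(i, j). i + j = m \<and> f i \<noteq> \<zero> \<and> g j \<noteq> \<zero>}"
    by (rule finite_subset [of _ "{..m} \<times> {..m}"]) auto
  show "finite {(i, j, l). i + j + l = m \<and> f i \<noteq> \<zero> \<and> g j \<noteq> \<zero> \<and> h l \<noteq> \<zero>}"
    by (rule finite_subset [of _ "{..m} \<times> {..m} \<times> {..m}"]) auto
qed (auto simp: series_const_def conv_closed)

section \<open>Laurent series with the filtration by order\<close>

definition laurent_Fil :: "('a, 'b) ring_scheme => int => (int => 'a) set" where
  "laurent_Fil k m = {f. (\<forall>i. f i \<in> carrier k) \<and> (\<forall>i<m. f i = \<zero>\<^bsub>k\<^esub>)}"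

context cring
begin

lemma laurent_series_cring:
  "series_cring R {f :: int => 'a. (\<forall>i. f i \<in> carrier R) \<and> (\<exists>m. \<forall>i<m. f i = \<zero>)}"
proof unfold_locales
  fix f g h :: "int => 'a" and m :: int
  assume f: "f \<in> {f. (\<forall>i. f i \<in> carrier R) \<and> (\<exists>m. \<forall>i<m. f i = \<zero>)}"
    and g: "g \<in> {f. (\<forall>i. f i \<in> carrier R) \<and> (\<exists>m. \<forall>i<m. f i = \<zero>)}"
  obtain a b where a: "\<And>i. f i \<noteq> \<zero> ==> a \<le> i" and b: "\<And>i. g i \<noteq> \<zero> ==> b \<le> i"
  proof -
    obtain a b where "\<forall>i<a. f i = \<zero>" "\<forall>i<b. g i = \<zero>" using f g by blast
    thus thesis by (intro that [of a b]) (auto simp: not_less [symmetric])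
  qed
  show "finite {(i, j). i + j = m \<and> f i \<noteq> \<zero> \<and> g j \<noteq> \<zero>}"
    by (rule finite_subset [of _ "{a..m - b} \<times> {b..m - a}"]) (use a b in force)+
  have "f i \<oplus> g i = \<zero>" if "i < min a b" for i using that a [of i] b [of i] by force
  thus "(\<lambda>i. f i \<oplus> g i) \<in> {f. (\<forall>i. f i \<in> carrier R) \<and> (\<exists>m. \<forall>i<m. f i = \<zero>)}"
    using f g by blast
  have "conv R f g i = \<zero>" if "i < a + b" for i
  proof -
    have "{(i', j). i' + j = i \<and> f i' \<noteq> \<zero> \<and> g j \<noteq> \<zero>} = {}" using that a b by force
    thus ?thesis unfolding conv_def by (simp only: finsum_empty)
  qed
  thus "conv R f g \<in> {f. (\<forall>i. f i \<in> carrier R) \<and> (\<exists>m. \<forall>i<m. f i = \<zero>)}"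
    using f g conv_closed by blast
  assume h: "h \<in> {f. (\<forall>i. f i \<in> carrier R) \<and> (\<exists>m. \<forall>i<m. f i = \<zero>)}"
  obtain c where c: "\<And>i. h i \<noteq> \<zero> ==> c \<le> i"
  proof -
    obtain c where "\<forall>i<c. h i = \<zero>" using h by blast
    thus thesis by (intro that [of c]) (auto simp: not_less [symmetric])
  qed
  show "finite {(i, j, l). i + j + l = m \<and> f i \<noteq> \<zero> \<and> g j \<noteq> \<zero> \<and> h l \<noteq> \<zero>}"
    by (rule finite_subset [of _ "{a..m - b - c} \<times> {b..m - a - c} \<times> {c..m - a - b}"]) (use a b c in force)+
qed (auto simp: series_const_def)

lemma laurent_carrier: "carrier (laurent_series_ring R) = {f. (\<forall>i. f i \<in> carrier R) \<and> (\<exists>m. \<forall>i<m. f i = \<zero>)}"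
  and laurent_mult: "f \<otimes>\<^bsub>laurent_series_ring R\<^esub> g = conv R f g"
  and laurent_add: "f \<oplus>\<^bsub>laurent_series_ring R\<^esub> g = (\<lambda>i. f i \<oplus> g i)"
  and laurent_one: "\<one>\<^bsub>laurent_series_ring R\<^esub> = series_const R \<one>"
  and laurent_zero: "\<zero>\<^bsub>laurent_series_ring R\<^esub> = (\<lambda>_. \<zero>)"
  by (simp_all add: laurent_series_ring_def Let_def)

lemma laurent_cring: "cring (laurent_series_ring R)"
  unfolding laurent_series_ring_def Let_def
  by (intro cring_with_topology series_cring.series_ring_cring laurent_series_cring)

lemma laurent_neg:
  "f \<in> carrier (laurent_series_ring R) ==> \<ominus>\<^bsub>laurent_series_ring R\<^esub> f = (\<lambda>i. \<ominus> f i)"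
  using series_cring.series_ring_neg [OF laurent_series_cring, of f]
  by (simp add: laurent_carrier) (simp add: laurent_series_ring_def Let_def)

lemma laurent_minus:
  "f \<in> carrier (laurent_series_ring R) ==> g \<in> carrier (laurent_series_ring R) ==>
    f \<ominus>\<^bsub>laurent_series_ring R\<^esub> g = (\<lambda>i. f i \<ominus> g i)"
  using series_cring.series_ring_minus [OF laurent_series_cring, of f g]
  by (simp add: laurent_carrier) (simp add: laurent_series_ring_def Let_def)

lemma monom_mult:
  assumes "\<And>j. g j \<in> carrier R"
  shows "conv R (series_monom R a) g = (\<lambda>i::int. g (i - a))"
proof
  fix i
  show "conv R (series_monom R a) g i = g (i - a)"
    using conv_single [OF one_closed assms, where a = a and b = "i - a"] assms by (simp add: series_monom_def)
qed

lemma laurent_Fil_sub: "laurent_Fil R m \<subseteq> carrier (laurent_series_ring R)"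
  by (auto simp: laurent_Fil_def laurent_carrier)

lemma laurent_tpow:
  shows laurent_t_unit: "series_monom R 1 \<in> Units (laurent_series_ring R)"
    and laurent_tpow_eq: "tpow (laurent_series_ring R) (series_monom R 1) m = series_monom R m"
    and laurent_inv_t: "inv\<^bsub>laurent_series_ring R\<^esub> series_monom R 1 = series_monom R (- 1)"
proof -
  interpret L: cring "laurent_series_ring R" by (rule laurent_cring)
  have c: "series_monom R m \<in> carrier (laurent_series_ring R)" for m :: int
    by (auto simp: laurent_carrier series_monom_def intro: exI [of _ m])
  have m: "series_monom R a \<otimes>\<^bsub>laurent_series_ring R\<^esub> series_monom R b = series_monom R (a + b)" for a b :: int
    unfolding laurent_mult by (subst monom_mult) (auto simp: series_monom_def fun_eq_iff)
  have 0: "series_monom R (0::int) = \<one>\<^bsub>laurent_series_ring R\<^esub>"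
    by (auto simp: laurent_one series_monom_def series_const_def)
  show u: "series_monom R 1 \<in> Units (laurent_series_ring R)"
    unfolding Units_def using c [of 1] c [of "- 1"] m [of 1 "- 1"] m [of "- 1" 1] 0
    by (auto intro!: bexI [of _ "series_monom R (- 1)"])
  show "inv\<^bsub>laurent_series_ring R\<^esub> series_monom R 1 = series_monom R (- 1)"
    using L.comm_inv_char [OF c c, of 1 "- 1"] m [of 1 "- 1"] 0 by simp
  show "tpow (laurent_series_ring R) (series_monom R 1) m = series_monom R m"
    by (rule L.tpow_unique [OF u, symmetric]) (use c 0 m in \<open>auto simp: add.commute\<close>)
qed

lemma laurent_complete: "complete_filt_ring (laurent_series_ring R) (laurent_Fil R) (series_monom R 1)"
proof -
  let ?L = "laurent_series_ring R"
  interpret L: cring ?L by (rule laurent_cring)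
  have f: "filt_ring ?L (laurent_Fil R) (series_monom R 1)"
  proof (intro filt_ring.intro filt_ring_axioms.intro laurent_cring laurent_Fil_sub laurent_t_unit)
    fix f assume "f \<in> carrier ?L"
    thus "\<exists>m. f \<in> laurent_Fil R m" by (auto simp: laurent_carrier laurent_Fil_def)
  next
    fix f m assume fm: "f \<in> laurent_Fil R m"
    hence "\<ominus>\<^bsub>?L\<^esub> f = (\<lambda>i. \<ominus> f i)" using laurent_neg laurent_Fil_sub by blast
    thus "\<ominus>\<^bsub>?L\<^esub> f \<in> laurent_Fil R m" using fm by (simp add: laurent_Fil_def)
  next
    fix f g m l assume fg: "f \<in> laurent_Fil R m" "g \<in> laurent_Fil R l"
    have "conv R f g i = \<zero>" if "i < m + l" for i
    proof -
      have "{(i', j). i' + j = i \<and> f i' \<noteq> \<zero> \<and> g j \<noteq> \<zero>} = {}"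
        using that fg by (force simp: laurent_Fil_def not_less [symmetric])
      thus ?thesis unfolding conv_def by (simp only: finsum_empty)
    qed
    thus "f \<otimes>\<^bsub>?L\<^esub> g \<in> laurent_Fil R (m + l)"
      using fg unfolding laurent_mult by (auto simp: laurent_Fil_def intro!: conv_closed)
  next
    show "inv\<^bsub>?L\<^esub> series_monom R 1 \<in> laurent_Fil R (- 1)"
      unfolding laurent_inv_t by (auto simp: laurent_Fil_def series_monom_def)
  qed (auto simp: laurent_Fil_def laurent_zero laurent_one laurent_add series_const_def series_monom_def)
  interpret L: filt_ring ?L "laurent_Fil R" "series_monom R 1" by (rule f)
  have cgD: "x i = y i" if "L.cg m x y" "i < m" for x y m i
  proof -
    have "x i \<ominus> y i = \<zero>" using that laurent_minus [of x y] by (auto simp: L.cg_def laurent_Fil_def)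
    moreover have "x i \<in> carrier R" "y i \<in> carrier R" using that by (auto simp: L.cg_def laurent_carrier)
    ultimately show ?thesis by (simp add: r_right_minus_eq)
  qed
  have cgI: "L.cg m x y" if "x \<in> carrier ?L" "y \<in> carrier ?L" "\<And>i. i < m ==> x i = y i" for x y m
    using that laurent_minus [of x y] unfolding L.cg_def
    by (auto simp: laurent_carrier laurent_Fil_def r_right_minus_eq)
  show ?thesis
  proof (intro complete_filt_ring.intro complete_filt_ring_axioms.intro f)
    fix x assume x: "x \<in> carrier ?L" "\<And>m. x \<in> laurent_Fil R m"
    hence "x i = \<zero>" for i using x(2) [of "i + 1"] by (simp add: laurent_Fil_def)
    thus "x = \<zero>\<^bsub>?L\<^esub>" by (auto simp: laurent_zero)
  next
    fix s :: "nat => int => 'a"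
    assume s: "\<And>m. s m \<in> carrier ?L" "\<And>m. L.cg (int m) (s (Suc m)) (s m)"
    have far: "s (n + k) i = s n i" if "i < int n" for n k i
      by (induction k) (use that cgD [OF s(2)] in auto)
    \<comment> \<open>Coefficient \<open>i\<close> no longer changes from step \<open>i + 1\<close>
      on. For negative \<open>i\<close> the step is truncated to 0, where the coefficient is already
      final.\<close>
    define y where "y i = s (nat (i + 1)) i" for i
    have y: "y i = s n i" if "i < int n" for i n
    proof (cases "0 \<le> i")
      case True
      hence "s (nat (i + 1) + (n - nat (i + 1))) i = s (nat (i + 1)) i" by (intro far) auto
      thus ?thesis using True that by (simp add: y_def)
    next
      case False
      hence "nat (i + 1) = 0" by simp
      thus ?thesis using far [of i 0 n] False unfolding y_def by simp
    qed
    obtain a where a: "\<And>i. i < a ==> s 0 i = \<zero>" using s(1) [of 0] by (auto simp: laurent_carrier)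
    have "y i = \<zero>" if "i < min a 0" for i using y [of i 0] a [of i] that by simp
    moreover have "y i \<in> carrier R" for i using s(1) by (simp add: y_def laurent_carrier)
    ultimately have yc: "y \<in> carrier ?L" unfolding laurent_carrier by blast
    thus "\<exists>y\<in>carrier ?L. \<forall>m. L.cg (int m) y (s m)"
      using y s(1) by (intro bexI [of _ y]) (auto intro!: cgI)
  qed
qed

lemma laurent_filt_top: "filt_top (laurent_series_ring R) (laurent_Fil R)"
proof -
  have e: "{f. ((\<forall>i. f i \<in> carrier R) \<and> (\<exists>m. \<forall>i<m. f i = \<zero>)) \<and> (\<forall>i<m. f i = \<zero>)} = laurent_Fil R m" for m
    by (auto simp: laurent_Fil_def)
  show ?thesis
    unfolding laurent_series_ring_def Let_def
    by (rule filt_top_zero_basis) (auto simp: e, auto simp: laurent_Fil_def)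
qed

end

lemma localisation_carrier [simp]: "carrier (localisation R s) = {fraction R s a m | a m. a \<in> carrier R}"
  by (simp add: localisation_def)

text \<open>For regular \<open>s\<close> the auxiliary power of \<open>s\<close> in
  \<open>fraction\<close> cancels, which leaves the plain rule of cross-multiplication.\<close>

locale regular_localisation = cring R for R (structure) +
  fixes s
  assumes s_carrier [simp]: "s \<in> carrier R"
    and s_reg: "x \<in> carrier R ==> y \<in> carrier R ==> s \<otimes> x = s \<otimes> y ==> x = y"
begin

abbreviation L where "L \<equiv> localisation R s"
abbreviation fr where "fr \<equiv> fraction R s"

lemma s_pow_reg: "x \<in> carrier R ==> y \<in> carrier R ==> s [^] (j::nat) \<otimes> x = s [^] j \<otimes> y ==> x = y"
proof (induction j arbitrary: x y)
  case (Suc j)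
  hence "s [^] j \<otimes> (s \<otimes> x) = s [^] j \<otimes> (s \<otimes> y)" by (simp add: m_assoc)
  hence "s \<otimes> x = s \<otimes> y" by (rule Suc.IH [rotated 2]) (use Suc in auto)
  thus ?case by (rule s_reg [rotated 2]) (use Suc in auto)
qed simp

lemma mem_fraction: "a \<in> carrier R ==> (b, l) \<in> fr a m \<longleftrightarrow> b \<in> carrier R \<and> s [^] m \<otimes> b = s [^] l \<otimes> a"
proof
  assume a: "a \<in> carrier R" and "(b, l) \<in> fr a m"
  then obtain j :: nat where b: "b \<in> carrier R" and j: "s [^] j \<otimes> (s [^] m \<otimes> b) = s [^] j \<otimes> (s [^] l \<otimes> a)"
    by (auto simp: fraction_def)
  have "s [^] m \<otimes> b = s [^] l \<otimes> a" by (rule s_pow_reg [OF _ _ j]) (use a b in auto)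
  thus "b \<in> carrier R \<and> s [^] m \<otimes> b = s [^] l \<otimes> a" using b by simp
next
  assume "b \<in> carrier R \<and> s [^] m \<otimes> b = s [^] l \<otimes> a"
  thus "(b, l) \<in> fr a m" unfolding fraction_def by simp
qed

lemma fraction_eq_iff:
  assumes a: "a \<in> carrier R" and b: "b \<in> carrier R"
  shows "fr a m = fr b l \<longleftrightarrow> s [^] m \<otimes> b = s [^] l \<otimes> a"
proof
  assume "fr a m = fr b l"
  hence "(b, l) \<in> fr a m" using mem_fraction [OF b, of b l l] b by simp
  thus "s [^] m \<otimes> b = s [^] l \<otimes> a" using mem_fraction a by simp
next
  have sub: "(c, q) \<in> fr b' l'" if e: "s [^] m' \<otimes> b' = s [^] l' \<otimes> a'" and c: "(c, q) \<in> fr a' m'"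
    and a': "a' \<in> carrier R" and b': "b' \<in> carrier R" for a' b' c and m' l' q :: nat
  proof -
    have c': "c \<in> carrier R" "s [^] m' \<otimes> c = s [^] q \<otimes> a'" using c mem_fraction [OF a'] by auto
    have "s [^] m' \<otimes> (s [^] l' \<otimes> c) = s [^] l' \<otimes> (s [^] m' \<otimes> c)" using c' by (simp add: m_lcomm)
    also have "\<dots> = s [^] q \<otimes> (s [^] l' \<otimes> a')" unfolding c'(2) using a' by (simp add: m_lcomm)
    also have "\<dots> = s [^] m' \<otimes> (s [^] q \<otimes> b')" unfolding e [symmetric] using b' by (simp add: m_lcomm)
    finally have e': "s [^] m' \<otimes> (s [^] l' \<otimes> c) = s [^] m' \<otimes> (s [^] q \<otimes> b')" .
    have "s [^] l' \<otimes> c = s [^] q \<otimes> b'" by (rule s_pow_reg [OF _ _ e']) (use c'(1) b' in auto)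
    thus ?thesis using mem_fraction [OF b'] c'(1) by simp
  qed
  assume e: "s [^] m \<otimes> b = s [^] l \<otimes> a"
  show "fr a m = fr b l"
  proof (intro subset_antisym subrelI)
    show "(c, q) \<in> fr b l" if "(c, q) \<in> fr a m" for c q by (rule sub [OF e that a b])
    show "(c, q) \<in> fr a m" if "(c, q) \<in> fr b l" for c q by (rule sub [OF e [symmetric] that b a])
  qed
qed

lemma fraction_refl: "a \<in> carrier R ==> (a, m) \<in> fr a m"
  by (simp add: mem_fraction)

lemma frac_mult:
  assumes a: "a \<in> carrier R" and b: "b \<in> carrier R"
  shows "fr a m \<otimes>\<^bsub>L\<^esub> fr b l = fr (a \<otimes> b) (m + l)"
proof -
  \<comment> \<open>All representatives give the same fraction, so the union in the definition of
    \<open>localisation\<close> collapses to one class.\<close>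
  have "fr (a' \<otimes> b') (m' + l') = fr (a \<otimes> b) (m + l)"
    if "(a', m') \<in> fr a m" "(b', l') \<in> fr b l" for a' m' b' l'
  proof (subst fraction_eq_iff)
    have c: "a' \<in> carrier R" "b' \<in> carrier R" and e: "s [^] m \<otimes> a' = s [^] m' \<otimes> a" "s [^] l \<otimes> b' = s [^] l' \<otimes> b"
      using that mem_fraction a b by auto
    note d = nat_pow_closed [OF s_carrier, of m] nat_pow_closed [OF s_carrier, of m']
      nat_pow_closed [OF s_carrier, of l] nat_pow_closed [OF s_carrier, of l']
    show "a' \<otimes> b' \<in> carrier R" "a \<otimes> b \<in> carrier R" using a b c by auto
    have "s [^] (m' + l') \<otimes> (a \<otimes> b) = (s [^] m' \<otimes> a) \<otimes> (s [^] l' \<otimes> b)"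
      unfolding nat_pow_mult [OF s_carrier, symmetric] using a b d by algebra
    also have "\<dots> = (s [^] m \<otimes> a') \<otimes> (s [^] l \<otimes> b')" using e by simp
    also have "\<dots> = s [^] (m + l) \<otimes> (a' \<otimes> b')"
      unfolding nat_pow_mult [OF s_carrier, symmetric] using c d by algebra
    finally show "s [^] (m' + l') \<otimes> (a \<otimes> b) = s [^] (m + l) \<otimes> (a' \<otimes> b')" .
  qed
  hence "(\<Union>(a', m')\<in>fr a m. \<Union>(b', l')\<in>fr b l. fr (a' \<otimes> b') (m' + l')) = fr (a \<otimes> b) (m + l)"
    using fraction_refl [OF a, of m] fraction_refl [OF b, of l] by fast
  thus ?thesis by (simp add: localisation_def)
qed

lemma frac_add:
  assumes a: "a \<in> carrier R" and b: "b \<in> carrier R"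
  shows "fr a m \<oplus>\<^bsub>L\<^esub> fr b l = fr (s [^] l \<otimes> a \<oplus> s [^] m \<otimes> b) (m + l)"
proof -
  have "fr (s [^] l' \<otimes> a' \<oplus> s [^] m' \<otimes> b') (m' + l') = fr (s [^] l \<otimes> a \<oplus> s [^] m \<otimes> b) (m + l)"
    if "(a', m') \<in> fr a m" "(b', l') \<in> fr b l" for a' m' b' l'
  proof (subst fraction_eq_iff)
    have c: "a' \<in> carrier R" "b' \<in> carrier R" and e: "s [^] m \<otimes> a' = s [^] m' \<otimes> a" "s [^] l \<otimes> b' = s [^] l' \<otimes> b"
      using that mem_fraction a b by auto
    note d = nat_pow_closed [OF s_carrier, of m] nat_pow_closed [OF s_carrier, of m']
      nat_pow_closed [OF s_carrier, of l] nat_pow_closed [OF s_carrier, of l']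
    show "s [^] l' \<otimes> a' \<oplus> s [^] m' \<otimes> b' \<in> carrier R" "s [^] l \<otimes> a \<oplus> s [^] m \<otimes> b \<in> carrier R" using a b c by auto
    have "s [^] (m' + l') \<otimes> (s [^] l \<otimes> a \<oplus> s [^] m \<otimes> b)
        = s [^] l' \<otimes> s [^] l \<otimes> (s [^] m' \<otimes> a) \<oplus> s [^] m' \<otimes> s [^] m \<otimes> (s [^] l' \<otimes> b)"
      unfolding nat_pow_mult [OF s_carrier, symmetric] using a b d by algebra
    also have "\<dots> = s [^] l' \<otimes> s [^] l \<otimes> (s [^] m \<otimes> a') \<oplus> s [^] m' \<otimes> s [^] m \<otimes> (s [^] l \<otimes> b')" using e by simp
    also have "\<dots> = s [^] (m + l) \<otimes> (s [^] l' \<otimes> a' \<oplus> s [^] m' \<otimes> b')"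
      unfolding nat_pow_mult [OF s_carrier, symmetric] using c d by algebra
    finally show "s [^] (m' + l') \<otimes> (s [^] l \<otimes> a \<oplus> s [^] m \<otimes> b) = s [^] (m + l) \<otimes> (s [^] l' \<otimes> a' \<oplus> s [^] m' \<otimes> b')" .
  qed
  hence "(\<Union>(a', m')\<in>fr a m. \<Union>(b', l')\<in>fr b l. fr (s [^] l' \<otimes> a' \<oplus> s [^] m' \<otimes> b') (m' + l'))
      = fr (s [^] l \<otimes> a \<oplus> s [^] m \<otimes> b) (m + l)"
    using fraction_refl [OF a, of m] fraction_refl [OF b, of l] by fast
  thus ?thesis by (simp add: localisation_def)
qed

lemma frac_one: "\<one>\<^bsub>L\<^esub> = fr \<one> 0" and frac_zero: "\<zero>\<^bsub>L\<^esub> = fr \<zero> 0"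
  by (simp_all add: localisation_def)

lemma localisation_cring: "cring L"
proof -
  have d: "s [^] (m::nat) \<in> carrier R" for m by simp
  have add_assoc: "fr a m \<oplus>\<^bsub>L\<^esub> fr b l \<oplus>\<^bsub>L\<^esub> fr c q = fr a m \<oplus>\<^bsub>L\<^esub> (fr b l \<oplus>\<^bsub>L\<^esub> fr c q)"
    if "a \<in> carrier R" "b \<in> carrier R" "c \<in> carrier R" for a b c m l q
  proof -
    have "s [^] q \<otimes> (s [^] l \<otimes> a \<oplus> s [^] m \<otimes> b) \<oplus> s [^] (m + l) \<otimes> c
      = s [^] (l + q) \<otimes> a \<oplus> s [^] m \<otimes> (s [^] q \<otimes> b \<oplus> s [^] l \<otimes> c)"
      unfolding nat_pow_mult [OF s_carrier, symmetric] using that d [of m] d [of l] d [of q] by algebra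
    thus ?thesis using that by (simp add: frac_add add.assoc)
  qed
  have distr: "(fr a m \<oplus>\<^bsub>L\<^esub> fr b l) \<otimes>\<^bsub>L\<^esub> fr c q = fr a m \<otimes>\<^bsub>L\<^esub> fr c q \<oplus>\<^bsub>L\<^esub> fr b l \<otimes>\<^bsub>L\<^esub> fr c q"
    if "a \<in> carrier R" "b \<in> carrier R" "c \<in> carrier R" for a b c m l q
  proof -
    have "s [^] (m + l + q) \<otimes> (s [^] (l + q) \<otimes> (a \<otimes> c) \<oplus> s [^] (m + q) \<otimes> (b \<otimes> c))
      = s [^] (m + q + (l + q)) \<otimes> ((s [^] l \<otimes> a \<oplus> s [^] m \<otimes> b) \<otimes> c)"
      unfolding nat_pow_mult [OF s_carrier, symmetric] using that d [of m] d [of l] d [of q] by algebra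
    thus ?thesis using that by (simp add: frac_add frac_mult fraction_eq_iff)
  qed
  show ?thesis
  proof (intro cringI abelian_groupI comm_monoidI)
    fix x assume "x \<in> carrier L"
    then obtain a m where x: "x = fr a m" "a \<in> carrier R" by auto
    have "fr (\<ominus> a) m \<oplus>\<^bsub>L\<^esub> x = \<zero>\<^bsub>L\<^esub>"
    proof -
      have "s [^] m \<otimes> (\<ominus> a) \<oplus> s [^] m \<otimes> a = \<zero>" using x(2) d [of m] by algebra
      thus ?thesis using x by (simp add: frac_add frac_zero fraction_eq_iff)
    qed
    thus "\<exists>y\<in>carrier L. y \<oplus>\<^bsub>L\<^esub> x = \<zero>\<^bsub>L\<^esub>" using x by (intro bexI [of _ "fr (\<ominus> a) m"]) auto
  next
    fix x y assume "x \<in> carrier L" "y \<in> carrier L"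
    then obtain a m b l where x: "x = fr a m" "a \<in> carrier R" "y = fr b l" "b \<in> carrier R" by auto
    show "x \<oplus>\<^bsub>L\<^esub> y = y \<oplus>\<^bsub>L\<^esub> x" using x by (simp add: frac_add add.commute a_comm)
    show "x \<otimes>\<^bsub>L\<^esub> y = y \<otimes>\<^bsub>L\<^esub> x" using x by (simp add: frac_mult add.commute m_comm)
    show "x \<oplus>\<^bsub>L\<^esub> y \<in> carrier L" using x by (auto simp: frac_add)
    show "x \<otimes>\<^bsub>L\<^esub> y \<in> carrier L" using x by (auto simp: frac_mult)
  next
    fix x y z assume "x \<in> carrier L" "y \<in> carrier L" "z \<in> carrier L"
    then obtain a m b l c q where x: "x = fr a m" "a \<in> carrier R" "y = fr b l" "b \<in> carrier R" "z = fr c q" "c \<in> carrier R"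
      by auto
    show "x \<oplus>\<^bsub>L\<^esub> y \<oplus>\<^bsub>L\<^esub> z = x \<oplus>\<^bsub>L\<^esub> (y \<oplus>\<^bsub>L\<^esub> z)" using x add_assoc by simp
    show "x \<otimes>\<^bsub>L\<^esub> y \<otimes>\<^bsub>L\<^esub> z = x \<otimes>\<^bsub>L\<^esub> (y \<otimes>\<^bsub>L\<^esub> z)" using x by (simp add: frac_mult m_assoc add.assoc)
    show "(x \<oplus>\<^bsub>L\<^esub> y) \<otimes>\<^bsub>L\<^esub> z = x \<otimes>\<^bsub>L\<^esub> z \<oplus>\<^bsub>L\<^esub> y \<otimes>\<^bsub>L\<^esub> z" using x distr by simp
  qed (auto simp: frac_one frac_zero frac_add frac_mult)
qed

lemma frac_hom: "(\<lambda>a. fr a 0) \<in> ring_hom R L"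
  by (rule ring_hom_memI) (auto simp: frac_mult frac_add frac_one)

lemma frac_eq: "a \<in> carrier R ==> b \<in> carrier R ==> fr (s [^] l \<otimes> a) (m + l) = fr a m"
  by (subst fraction_eq_iff) (auto simp: m_assoc [symmetric] nat_pow_mult)

lemma frac_inj: "a \<in> carrier R ==> b \<in> carrier R ==> fr a 0 = fr b 0 \<longleftrightarrow> a = b"
  by (auto simp: fraction_eq_iff)

lemma frac_s_mult: "a \<in> carrier R ==> fr (s [^] m) 0 \<otimes>\<^bsub>L\<^esub> fr a m = fr a 0"
  by (simp add: frac_mult fraction_eq_iff)

end

text \<open>Transport of a filtration along a surjective homomorphism. It is applied to the
  bijection between \<open>A\<close> and its localisation at a power of the unit
  \<open>T\<close>.\<close>

lemma filt_ring_image: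
  assumes "filt_ring R Fil t" "cring S" "h \<in> ring_hom R S"
    and surj: "\<And>y. y \<in> carrier S ==> \<exists>x\<in>carrier R. y = h x"
  shows "filt_ring S (\<lambda>m. h ` Fil m) (h t)"
proof -
  interpret R: filt_ring R Fil t by fact
  interpret S: cring S by fact
  note h = ring_hom_closed [OF assms(3)] ring_hom_add [OF assms(3)] ring_hom_mult [OF assms(3)] ring_hom_one [OF assms(3)]
    ring_hom_zero' [OF R.ring_axioms S.ring_axioms assms(3)] ring_hom_a_inv [OF R.ring_axioms S.ring_axioms assms(3)]
  have u: "h t \<in> Units S" by (rule ring_hom_Units [OF R.is_cring assms(2,3) R.t_unit])
  have i: "inv\<^bsub>S\<^esub> h t = h (inv\<^bsub>R\<^esub> t)"
  proof (rule S.comm_inv_char)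
    show "h t \<otimes>\<^bsub>S\<^esub> h (inv\<^bsub>R\<^esub> t) = \<one>\<^bsub>S\<^esub>" using h(3) [of t "inv\<^bsub>R\<^esub> t"] R.t_unit h(4) by simp
  qed (use h(1) R.t_unit in auto)
  show ?thesis
  proof (intro filt_ring.intro filt_ring_axioms.intro u)
    show "cring S" by fact
    show "h ` Fil m \<subseteq> carrier S" for m using h(1) by auto
    show "\<zero>\<^bsub>S\<^esub> \<in> h ` Fil m" for m using h(5) R.Fil_zero by (metis imageI)
    show "\<one>\<^bsub>S\<^esub> \<in> h ` Fil 0" using h(4) R.Fil_one by (metis imageI)
    show "h t \<in> h ` Fil 1" using R.t_Fil by simp
    show "inv\<^bsub>S\<^esub> h t \<in> h ` Fil (- 1)" unfolding i using R.inv_t_Fil by simp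
    show "h ` Fil l \<subseteq> h ` Fil m" if "m \<le> l" for l m using R.Fil_mono [OF that] by auto
    show "\<exists>m. y \<in> h ` Fil m" if "y \<in> carrier S" for y using surj [OF that] R.Fil_exh by blast
    show "x \<oplus>\<^bsub>S\<^esub> y \<in> h ` Fil m" if xy: "x \<in> h ` Fil m" "y \<in> h ` Fil m" for x y m
    proof -
      obtain a b where a: "a \<in> Fil m" "x = h a" "b \<in> Fil m" "y = h b" using xy by blast
      hence "x \<oplus>\<^bsub>S\<^esub> y = h (a \<oplus>\<^bsub>R\<^esub> b)" using h(2) [of a b] by auto
      thus ?thesis using R.Fil_add a by blast
    qed
    show "x \<otimes>\<^bsub>S\<^esub> y \<in> h ` Fil (m + l)" if xy: "x \<in> h ` Fil m" "y \<in> h ` Fil l" for x y m l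
    proof -
      obtain a b where a: "a \<in> Fil m" "x = h a" "b \<in> Fil l" "y = h b" using xy by blast
      hence "x \<otimes>\<^bsub>S\<^esub> y = h (a \<otimes>\<^bsub>R\<^esub> b)" using h(3) [of a b] by auto
      thus ?thesis using R.Fil_mult a by blast
    qed
    show "\<ominus>\<^bsub>S\<^esub> x \<in> h ` Fil m" if x: "x \<in> h ` Fil m" for x m
    proof -
      obtain a where a: "a \<in> Fil m" "x = h a" using x by blast
      hence "\<ominus>\<^bsub>S\<^esub> x = h (\<ominus>\<^bsub>R\<^esub> a)" using h(6) [of a] by auto
      thus ?thesis using R.Fil_neg a by blast
    qed
  qed
qed

lemma generate_add_subset:
  assumes "cring L" "S \<subseteq> V" "V \<subseteq> carrier L" "\<zero>\<^bsub>L\<^esub> \<in> V"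
    and "\<And>x y. x \<in> V ==> y \<in> V ==> x \<oplus>\<^bsub>L\<^esub> y \<in> V" "\<And>x. x \<in> V ==> \<ominus>\<^bsub>L\<^esub> x \<in> V"
  shows "generate (add_monoid L) S \<subseteq> V"
proof
  fix x assume "x \<in> generate (add_monoid L) S"
  thus "x \<in> V"
    by (induction rule: generate.induct) (use assms in \<open>auto simp: a_inv_def [symmetric]\<close>)
qed

locale filt_top_ring_elem = filt_top_ring R Fil t + filt_ring_elem R Fil t p
  for R :: "('a, 'b) top_ring_scheme" (structure) and Fil t p
begin

lemma t_pow_unit: "t [^] (n::nat) \<in> Units R"
  using t_unit by (rule Units_pow_closed)

lemma loc_regular: "regular_localisation R (t [^] (n::nat))"
proof unfold_locales
  fix x y assume "x \<in> carrier R" "y \<in> carrier R" "t [^] n \<otimes> x = t [^] n \<otimes> y"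
  thus "x = y" using t_pow_unit [of n] by (simp add: Units_l_cancel)
qed auto

text \<open>As \<open>t\<close> is a unit, localising at \<open>t^n\<close> does not change the
  ring, and a generator \<open>u p^i / t^(n i)\<close> with \<open>u \<in> Fil m\<close> is
  \<open>p^i\<close> times an element of \<open>Fil (m - n i)\<close>. Huber's neighbourhoods
  therefore become the level filtration, which explains the form of \<open>level\<close>.\<close>

lemma top_localisation_filt:
  fixes n :: nat
  defines "j \<equiv> (\<lambda>a. fraction R (t [^] n) a 0)"
  shows "filt_top_ring (top_localisation R p (t [^] n)) (\<lambda>m. j ` Lev R Fil p (int n) m) (j t)"
    and "j \<in> ring_hom R (top_localisation R p (t [^] n))" and "inj_on j (carrier R)"
    and "\<And>y. y \<in> carrier (top_localisation R p (t [^] n)) ==> \<exists>x\<in>carrier R. y = j x"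
proof -
  let ?s = "t [^] n"
  interpret L: regular_localisation R ?s by (rule loc_regular)
  interpret LL: cring "localisation R ?s" by (rule L.localisation_cring)
  let ?T = "top_localisation R p ?s"
  let ?F = "\<lambda>m. j ` Lev R Fil p (int n) m"
  interpret V: filt_ring R "Lev R Fil p (int n)" t by (rule level_filt_ring)
  have jh: "j \<in> ring_hom R (localisation R ?s)" unfolding j_def by (rule L.frac_hom)
  have sj: "?s [^] i = tpow R t (int n * int i)" for i :: nat
  proof -
    have "?s [^] i = t [^] (n * i)" by (simp add: nat_pow_pow)
    thus ?thesis using tpow_nat [of t "n * i"] by simp
  qed
  have frac_j: "fraction R ?s (tpow R t (int n * int i) \<otimes> a) i = j a" if "a \<in> carrier R" for a i
    using L.frac_eq [OF that that, of i 0] by (simp add: j_def sj)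
  have surj: "\<exists>x\<in>carrier R. y = j x" if "y \<in> carrier (localisation R ?s)" for y
  proof -
    obtain a m where a: "y = fraction R ?s a m" "a \<in> carrier R" using \<open>y \<in> _\<close> by auto
    hence "y = j (tpow R t (- (int n * int m)) \<otimes> a)"
      using frac_j [of "tpow R t (- (int n * int m)) \<otimes> a" m] tpow_cancel(1) [OF t_unit a(2)] by simp
    thus ?thesis using a by auto
  qed
  thus "\<And>y. y \<in> carrier ?T ==> \<exists>x\<in>carrier R. y = j x" unfolding top_localisation_def by simp
  show jT: "j \<in> ring_hom R ?T" using jh by (simp add: top_localisation_def ring_hom_with_topology)
  show "inj_on j (carrier R)" unfolding j_def inj_on_def using L.frac_inj by blast
  have FL: "filt_ring (localisation R ?s) ?F (j t)"
    by (rule filt_ring_image [OF level_filt_ring LL.is_cring jh surj])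
  have FT: "filt_ring ?T ?F (j t)"
    by (rule filt_ring_image [OF level_filt_ring _ jT])
      (use surj in \<open>auto simp: top_localisation_def cring_with_topology LL.is_cring\<close>)
  interpret F: filt_ring "localisation R ?s" ?F "j t" by (rule FL)
  define G where "G U = loc_zero_nbhd R p ?s U" for U
  \<comment> \<open>The power of \<open>p\<close> in front is what lets the induction along the
    Horner form close: every coefficient met on the way contributes one generator.\<close>
  have big: "j (p [^] i \<otimes> y) \<in> G U"
    if "level R Fil p (int n) l y" "l = m - int n * int i" "Fil m \<subseteq> U" for l m y U and i :: nat
    using that
  proof (induction arbitrary: i rule: level.induct)
    case (base a l)
    define u where "u = tpow R t (int n * int i) \<otimes> a"
    have "u \<in> Fil m" unfolding u_def by (rule Fil_mult_eq [OF tpow_Fil base(1)]) (use base in simp)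
    moreover have "j (p [^] i \<otimes> a) = fraction R ?s (u \<otimes> p [^] i) i"
      using frac_j [of "p [^] i \<otimes> a" i] base(1) by (simp add: u_def m_ac)
    ultimately show ?case unfolding G_def loc_zero_nbhd_def using base by (intro generate.incl) auto
  next
    case (step a l y)
    define u where "u = tpow R t (int n * int i) \<otimes> a"
    have c: "a \<in> carrier R" "y \<in> carrier R" using step level_carrier by auto
    have "u \<in> Fil m" unfolding u_def by (rule Fil_mult_eq [OF tpow_Fil step(1)]) (use step in simp)
    moreover have "j (p [^] i \<otimes> a) = fraction R ?s (u \<otimes> p [^] i) i"
      using frac_j [of "p [^] i \<otimes> a" i] c by (simp add: u_def m_ac)
    ultimately have 1: "j (p [^] i \<otimes> a) \<in> G U"
      unfolding G_def loc_zero_nbhd_def using step by (intro generate.incl) auto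
    have 2: "j (p [^] Suc i \<otimes> y) \<in> G U" by (rule step.IH) (use step in \<open>auto simp: algebra_simps\<close>)
    have "p [^] i \<otimes> (a \<oplus> p \<otimes> y) = p [^] i \<otimes> a \<oplus> p [^] Suc i \<otimes> y" using c by (simp add: r_distr m_assoc)
    hence "j (p [^] i \<otimes> (a \<oplus> p \<otimes> y)) = j (p [^] i \<otimes> a) \<oplus>\<^bsub>localisation R ?s\<^esub> j (p [^] Suc i \<otimes> y)"
      using ring_hom_add [OF jh, of "p [^] i \<otimes> a" "p [^] Suc i \<otimes> y"] c by simp
    thus ?case using generate.eng [of _ "add_monoid (localisation R ?s)"] 1 2 by (simp add: G_def loc_zero_nbhd_def)
  qed
  have pl: "level R Fil p (int n) l (p [^] i \<otimes> y)" if "y \<in> Fil (l - int n * int i)" for y l and i :: nat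
    using that
  proof (induction i arbitrary: l)
    case (Suc i)
    hence "level R Fil p (int n) (l - int n) (p [^] i \<otimes> y)" by (intro Suc.IH) (simp add: algebra_simps)
    hence "level R Fil p (int n) l (p \<otimes> (p [^] i \<otimes> y))" by (rule level_p)
    thus ?case using Suc by (simp add: m_ac)
  qed (auto intro: level.base)
  have small: "G (Fil m) \<subseteq> ?F m" for m unfolding G_def loc_zero_nbhd_def
  proof (rule generate_add_subset [OF LL.is_cring])
    show "{fraction R ?s (u \<otimes> p [^] i) i |u i. u \<in> Fil m} \<subseteq> ?F m"
    proof clarify
      fix u and i :: nat assume u: "u \<in> Fil m"
      define a where "a = tpow R t (- (int n * int i)) \<otimes> u"
      have "a \<in> Fil (m - int n * int i)" unfolding a_def by (rule Fil_mult_eq [OF tpow_Fil u]) simp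
      hence "p [^] i \<otimes> a \<in> Lev R Fil p (int n) m" using pl by (simp add: Lev_def)
      moreover have "tpow R t (int n * int i) \<otimes> (p [^] i \<otimes> a) = u \<otimes> p [^] i"
        using tpow_cancel(1) [OF t_unit, of u "int n * int i"] u by (simp add: a_def m_lcomm [of _ "p [^] i"] m_comm [of _ "p [^] i"])
      hence "fraction R ?s (u \<otimes> p [^] i) i = j (p [^] i \<otimes> a)"
        using frac_j [of "p [^] i \<otimes> a" i] u by (simp add: a_def)
      ultimately show "fraction R ?s (u \<otimes> p [^] i) i \<in> ?F m" by blast
    qed
  qed (use F.Fil_sub F.Fil_zero F.Fil_add F.Fil_neg in auto)
  have "filt_top ?T ?F" unfolding top_localisation_def
  proof (rule filt_top_zero_basis)
    show "?F l \<subseteq> ?F m" if "m \<le> l" for m l using F.Fil_mono [OF that] .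
    show "\<exists>m. ?F m \<subseteq> U" if U: "U \<in> {loc_zero_nbhd R p ?s U |U. additive_subgroup U R \<and> openin (opens R) U}" for U
    proof -
      obtain W where W: "U = G W" "additive_subgroup W R" "openin (opens R) W" using U by (auto simp: G_def)
      obtain m where m: "Fil m \<subseteq> W" using openin_zeroD [OF W(3)] additive_subgroup.zero_closed [OF W(2)] by blast
      have "j y \<in> U" if "y \<in> Lev R Fil p (int n) m" for y
        using big [of m y m 0 W] that m W(1) level_carrier by (simp add: Lev_def)
      thus ?thesis by blast
    qed
    show "\<exists>U\<in>{loc_zero_nbhd R p ?s U |U. additive_subgroup U R \<and> openin (opens R) U}. U \<subseteq> ?F m" for m
    proof (rule bexI [of _ "G (Fil m)"])
      have "additive_subgroup (Fil m) R"
        by (intro additive_subgroupI add.subgroupI) (use Fil_sub Fil_zero [of m] Fil_add Fil_neg in \<open>auto simp del: Fil_zero\<close>)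
      thus "G (Fil m) \<in> {loc_zero_nbhd R p ?s U |U. additive_subgroup U R \<and> openin (opens R) U}"
        using openin_Fil by (auto simp: G_def)
    qed (rule small)
  qed
  thus "filt_top_ring ?T ?F (j t)" by (intro filt_top_ring.intro filt_top_ring_axioms.intro FT)
qed

end

section \<open>Discretely valued fields and the rings \<open>D\<^sub>n\<close>\<close>

text \<open>Universal property of the localisation; well-definedness is a cross-multiplication in
  \<open>S\<close>, where the image of \<open>s\<close> can be cancelled.\<close>

lemma (in regular_localisation) localisation_lift:
  assumes "cring S" and g: "g \<in> ring_hom R S" and u: "g s \<in> Units S"
  shows "\<exists>h\<in>ring_hom L S. \<forall>a\<in>carrier R. h (fr a 0) = g a"
proof -
  interpret S: cring S by fact
  let ?u = "inv\<^bsub>S\<^esub> g s"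
  note gc = ring_hom_closed [OF g]
  have uc [simp]: "?u \<in> carrier S" "g s \<in> carrier S" using u by auto
  have gp: "g (s [^] (m::nat)) = g s [^]\<^bsub>S\<^esub> m" for m
    by (induction m) (use ring_hom_one [OF g] ring_hom_mult [OF g] in auto)
  have cancel: "(g s [^]\<^bsub>S\<^esub> m) \<otimes>\<^bsub>S\<^esub> (?u [^]\<^bsub>S\<^esub> m) = \<one>\<^bsub>S\<^esub>" for m :: nat
    using u by (simp add: S.nat_pow_distrib [symmetric])
  define h0 where "h0 a m = g a \<otimes>\<^bsub>S\<^esub> ?u [^]\<^bsub>S\<^esub> m" for a and m :: nat
  have h0c: "h0 a m \<in> carrier S" if "a \<in> carrier R" for a m using that gc by (simp add: h0_def)
  have wd: "h0 a m = h0 b l" if "fr a m = fr b l" "a \<in> carrier R" "b \<in> carrier R" for a m b l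
  proof -
    have e: "s [^] m \<otimes> b = s [^] l \<otimes> a" using that fraction_eq_iff by blast
    hence e': "g s [^]\<^bsub>S\<^esub> m \<otimes>\<^bsub>S\<^esub> g b = g s [^]\<^bsub>S\<^esub> l \<otimes>\<^bsub>S\<^esub> g a"
      using ring_hom_mult [OF g, of "s [^] m" b] ring_hom_mult [OF g, of "s [^] l" a] gp that by simp
    define p q p' q' where d: "p = g s [^]\<^bsub>S\<^esub> m" "q = g s [^]\<^bsub>S\<^esub> l" "p' = ?u [^]\<^bsub>S\<^esub> m" "q' = ?u [^]\<^bsub>S\<^esub> l"
    have c: "p \<in> carrier S" "q \<in> carrier S" "p' \<in> carrier S" "q' \<in> carrier S" "g a \<in> carrier S" "g b \<in> carrier S"
      using that gc by (auto simp: d)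
    have pq: "p \<otimes>\<^bsub>S\<^esub> p' = \<one>\<^bsub>S\<^esub>" "q \<otimes>\<^bsub>S\<^esub> q' = \<one>\<^bsub>S\<^esub>" using cancel by (auto simp: d)
    have "g a \<otimes>\<^bsub>S\<^esub> p' = (q \<otimes>\<^bsub>S\<^esub> q') \<otimes>\<^bsub>S\<^esub> (g a \<otimes>\<^bsub>S\<^esub> p')" using pq c by simp
    also have "\<dots> = (q \<otimes>\<^bsub>S\<^esub> g a) \<otimes>\<^bsub>S\<^esub> (p' \<otimes>\<^bsub>S\<^esub> q')" using c by (simp add: S.m_ac)
    also have "\<dots> = (p \<otimes>\<^bsub>S\<^esub> g b) \<otimes>\<^bsub>S\<^esub> (p' \<otimes>\<^bsub>S\<^esub> q')" using e' by (simp add: d)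
    also have "\<dots> = (p \<otimes>\<^bsub>S\<^esub> p') \<otimes>\<^bsub>S\<^esub> (g b \<otimes>\<^bsub>S\<^esub> q')" using c by (simp add: S.m_ac)
    also have "\<dots> = g b \<otimes>\<^bsub>S\<^esub> q'" using pq c by simp
    finally show ?thesis by (simp add: h0_def d)
  qed
  define h where "h x = (SOME y. \<exists>a m. a \<in> carrier R \<and> x = fr a m \<and> y = h0 a m)" for x
  have h: "h (fr a m) = h0 a m" if a: "a \<in> carrier R" for a m
  proof -
    have "\<exists>b l. b \<in> carrier R \<and> fr a m = fr b l \<and> h (fr a m) = h0 b l"
      unfolding h_def by (rule someI [of _ "h0 a m"]) (use a in blast)
    thus ?thesis using wd a by metis
  qed
  have "h \<in> ring_hom L S"
  proof (rule ring_hom_memI)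
    show "h x \<in> carrier S" if "x \<in> carrier L" for x using that h h0c by auto
    show "h \<one>\<^bsub>L\<^esub> = \<one>\<^bsub>S\<^esub>" using h ring_hom_one [OF g] by (simp add: frac_one h0_def)
  next
    fix x y assume "x \<in> carrier L" "y \<in> carrier L"
    then obtain a m b l where x: "x = fr a m" "a \<in> carrier R" "y = fr b l" "b \<in> carrier R" by auto
    have c: "g a \<in> carrier S" "g b \<in> carrier S" "?u [^]\<^bsub>S\<^esub> m \<in> carrier S" "?u [^]\<^bsub>S\<^esub> l \<in> carrier S"
      "g s [^]\<^bsub>S\<^esub> m \<in> carrier S" "g s [^]\<^bsub>S\<^esub> l \<in> carrier S" using x gc by auto
    show "h (x \<otimes>\<^bsub>L\<^esub> y) = h x \<otimes>\<^bsub>S\<^esub> h y"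
      using x h c ring_hom_mult [OF g, of a b] by (simp add: frac_mult h0_def S.nat_pow_mult [symmetric] S.m_ac)
    define p q p' q' where d: "p = g s [^]\<^bsub>S\<^esub> m" "q = g s [^]\<^bsub>S\<^esub> l" "p' = ?u [^]\<^bsub>S\<^esub> m" "q' = ?u [^]\<^bsub>S\<^esub> l"
    have pq: "p \<otimes>\<^bsub>S\<^esub> p' = \<one>\<^bsub>S\<^esub>" "q \<otimes>\<^bsub>S\<^esub> q' = \<one>\<^bsub>S\<^esub>" using cancel by (auto simp: d)
    note cd = c [folded d]
    have "h (x \<oplus>\<^bsub>L\<^esub> y) = (q \<otimes>\<^bsub>S\<^esub> g a \<oplus>\<^bsub>S\<^esub> p \<otimes>\<^bsub>S\<^esub> g b) \<otimes>\<^bsub>S\<^esub> (p' \<otimes>\<^bsub>S\<^esub> q')"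
      using x h gc ring_hom_add [OF g, of "s [^] l \<otimes> a" "s [^] m \<otimes> b"] ring_hom_mult [OF g, of "s [^] l" a]
        ring_hom_mult [OF g, of "s [^] m" b]
      by (simp add: frac_add h0_def S.nat_pow_mult [symmetric] gp d)
    also have "\<dots> = (q \<otimes>\<^bsub>S\<^esub> q') \<otimes>\<^bsub>S\<^esub> (g a \<otimes>\<^bsub>S\<^esub> p') \<oplus>\<^bsub>S\<^esub> (p \<otimes>\<^bsub>S\<^esub> p') \<otimes>\<^bsub>S\<^esub> (g b \<otimes>\<^bsub>S\<^esub> q')"
      using cd by algebra
    also have "\<dots> = g a \<otimes>\<^bsub>S\<^esub> p' \<oplus>\<^bsub>S\<^esub> g b \<otimes>\<^bsub>S\<^esub> q'" unfolding pq using cd by simp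
    also have "\<dots> = h x \<oplus>\<^bsub>S\<^esub> h y" using x h by (simp add: h0_def d)
    finally show "h (x \<oplus>\<^bsub>L\<^esub> y) = h x \<oplus>\<^bsub>S\<^esub> h y" .
  qed
  moreover have "h (fr a 0) = g a" if "a \<in> carrier R" for a using h [OF that] gc [OF that] by (simp add: h0_def)
  ultimately show ?thesis by blast
qed

text \<open>Two instances matter: the inclusion of the integers into \<open>K\<close>, through which
  the coefficients of localised power series are read off, and the residue map.\<close>

definition laurent_map :: "('b, 'd) ring_scheme => ('a => 'b) => (nat => 'a) => int => 'b" where
  "laurent_map S h F i = (if i < 0 then \<zero>\<^bsub>S\<^esub> else h (F (nat i)))"

lemma laurent_map_hom:
  assumes "cring R" "cring S" and h: "h \<in> ring_hom R S"
  shows "laurent_map S h \<in> ring_hom (power_series_ring R) (laurent_series_ring S)"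
proof -
  interpret R: cring R by fact
  interpret S: cring S by fact
  note hc = ring_hom_closed [OF h] and h0 = ring_hom_zero' [OF R.ring_axioms S.ring_axioms h]
  have car: "carrier (power_series_ring R) = {f. \<forall>i. f i \<in> carrier R}" by (simp add: power_series_ring_def)
  show ?thesis
  proof (rule ring_hom_memI)
    fix F assume "F \<in> carrier (power_series_ring R)"
    thus "laurent_map S h F \<in> carrier (laurent_series_ring S)"
      using hc by (auto simp: car S.laurent_carrier laurent_map_def intro: exI [of _ 0])
  next
    show "laurent_map S h \<one>\<^bsub>power_series_ring R\<^esub> = \<one>\<^bsub>laurent_series_ring S\<^esub>"
      using ring_hom_one [OF h] h0 by (auto simp: S.laurent_one power_series_ring_def laurent_map_def series_const_def fun_eq_iff)
  next
    fix F G assume "F \<in> carrier (power_series_ring R)" "G \<in> carrier (power_series_ring R)"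
    hence FG: "F i \<in> carrier R" "G i \<in> carrier R" for i by (auto simp: car)
    show "laurent_map S h (F \<oplus>\<^bsub>power_series_ring R\<^esub> G) = laurent_map S h F \<oplus>\<^bsub>laurent_series_ring S\<^esub> laurent_map S h G"
      using FG ring_hom_add [OF h] by (auto simp: S.laurent_add power_series_ring_def laurent_map_def fun_eq_iff)
    have lc: "laurent_map S h F i \<in> carrier S" "laurent_map S h G i \<in> carrier S" for i
      using FG hc by (auto simp: laurent_map_def)
    have "laurent_map S h (conv R F G) m = conv S (laurent_map S h F) (laurent_map S h G) m" for m
    proof (cases "m < 0")
      case True
      have "{(i, j). i + j = m \<and> laurent_map S h F i \<noteq> \<zero>\<^bsub>S\<^esub> \<and> laurent_map S h G j \<noteq> \<zero>\<^bsub>S\<^esub>} = {}"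
        using True by (auto simp: laurent_map_def split: if_splits)
      thus ?thesis using True unfolding conv_def by (simp only: S.finsum_empty) (simp add: laurent_map_def)
    next
      case False
      define Z where "Z = {(i, j). i + j = nat m}"
      have fZ: "finite Z" unfolding Z_def by (rule finite_subset [of _ "{..nat m} \<times> {..nat m}"]) auto
      let ?e = "\<lambda>(i, j). (int i, int j)"
      have "conv S (laurent_map S h F) (laurent_map S h G) m
          = finsum S (\<lambda>(i, j). laurent_map S h F i \<otimes>\<^bsub>S\<^esub> laurent_map S h G j) (?e ` Z)"
      proof (rule S.conv_superset [OF lc])
        show "finite (?e ` Z)" using fZ by simp
        show "{(i, j). i + j = m \<and> laurent_map S h F i \<noteq> \<zero>\<^bsub>S\<^esub> \<and> laurent_map S h G j \<noteq> \<zero>\<^bsub>S\<^esub>} \<subseteq> ?e ` Z"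
        proof clarify
          fix i j assume "laurent_map S h F i \<noteq> \<zero>\<^bsub>S\<^esub>" "laurent_map S h G j \<noteq> \<zero>\<^bsub>S\<^esub>" and m: "m = i + j"
          hence "0 \<le> i" "0 \<le> j" by (auto simp: laurent_map_def split: if_splits)
          thus "(i, j) \<in> ?e ` Z" using m by (intro image_eqI [of _ _ "(nat i, nat j)"]) (auto simp: Z_def nat_add_distrib)
        qed
        show "?e ` Z \<subseteq> {(i, j). i + j = m}" using False by (auto simp: Z_def)
      qed
      also have "\<dots> = finsum S (\<lambda>x. (\<lambda>(i, j). laurent_map S h F i \<otimes>\<^bsub>S\<^esub> laurent_map S h G j) (?e x)) Z"
        using lc by (intro S.finsum_reindex) (auto simp: inj_on_def)
      also have "\<dots> = finsum S (\<lambda>x. h ((\<lambda>(i, j). F i \<otimes>\<^bsub>R\<^esub> G j) x)) Z"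
        using FG hc ring_hom_mult [OF h] by (intro S.finsum_cong') (auto simp: laurent_map_def)
      also have "\<dots> = h (finsum R (\<lambda>(i, j). F i \<otimes>\<^bsub>R\<^esub> G j) Z)"
        by (rule ring_hom_finsum [OF R.ring_axioms S.ring_axioms h, symmetric]) (use FG in auto)
      also have "finsum R (\<lambda>(i, j). F i \<otimes>\<^bsub>R\<^esub> G j) Z = conv R F G (nat m)"
        by (rule R.conv_superset [symmetric]) (use FG fZ in \<open>auto simp: Z_def\<close>)
      finally have "conv S (laurent_map S h F) (laurent_map S h G) m = h (conv R F G (nat m))" .
      moreover have "laurent_map S h (conv R F G) m = h (conv R F G (nat m))" using False by (simp add: laurent_map_def)
      ultimately show ?thesis by (simp only:)
    qed
    thus "laurent_map S h (F \<otimes>\<^bsub>power_series_ring R\<^esub> G) = laurent_map S h F \<otimes>\<^bsub>laurent_series_ring S\<^esub> laurent_map S h G"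
      by (simp add: power_series_ring_def S.laurent_mult fun_eq_iff)
  qed
qed

section \<open>Valuations and weights\<close>

locale dvf =
  fixes K :: "('k, 'm) ring_scheme" (structure) and v :: "'k => int" and \<pi> :: 'k
  assumes cdvf: "complete_discretely_valued_field K v" and unif: "uniformiser K v \<pi>"
begin

sublocale K: field K using cdvf by (simp add: complete_discretely_valued_field_def)

abbreviation OK where "OK \<equiv> ring_of_integers K v"
abbreviation kk where "kk \<equiv> residue_field K v"

text \<open>The condition that the valuation be at least \<open>b / n\<close>, without division. The
  case \<open>n = 1\<close> gives the ring of integers and the powers of its maximal ideal; general
  \<open>n\<close> gives the weights in which \<open>\<pi>\<close> counts \<open>n\<close> times as
  much as the variable.\<close>

definition V :: "nat => int => 'k set" where
  "V n b = {x \<in> carrier K. x = \<zero> \<or> b \<le> int n * v x}"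

lemma v_mult: "x \<in> carrier K ==> y \<in> carrier K ==> x \<noteq> \<zero> ==> y \<noteq> \<zero> ==> v (x \<otimes> y) = v x + v y"
  using cdvf by (simp add: complete_discretely_valued_field_def)

lemma v_add: "x \<in> carrier K ==> y \<in> carrier K ==> x \<noteq> \<zero> ==> y \<noteq> \<zero> ==> x \<oplus> y \<noteq> \<zero> ==>
    min (v x) (v y) \<le> v (x \<oplus> y)"
  using cdvf by (simp add: complete_discretely_valued_field_def)

lemma v_one: "v \<one> = 0"
  using v_mult [of "\<one>" "\<one>"] by simp

lemma v_neg: "x \<in> carrier K ==> x \<noteq> \<zero> ==> v (\<ominus> x) = v x"
proof -
  assume x: "x \<in> carrier K" "x \<noteq> \<zero>"
  hence n: "\<ominus> x \<noteq> \<zero>" by (metis K.minus_minus K.minus_zero)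
  have "\<ominus> x \<otimes> \<ominus> x = x \<otimes> x" using x(1) by algebra
  hence "v (\<ominus> x) + v (\<ominus> x) = v x + v x" using v_mult x n by (metis K.a_inv_closed)
  thus ?thesis by simp
qed

lemma V_carrier: "x \<in> V n b ==> x \<in> carrier K" by (simp add: V_def)

lemma V_zero [simp]: "\<zero> \<in> V n b" by (simp add: V_def)

lemma V_neg: "x \<in> V n b ==> \<ominus> x \<in> V n b"
  using v_neg by (cases "x = \<zero>") (auto simp: V_def)

lemma V_add: assumes x: "x \<in> V n b" and y: "y \<in> V n b" shows "x \<oplus> y \<in> V n b"
proof (cases "x = \<zero> \<or> y = \<zero> \<or> x \<oplus> y = \<zero>")
  case False
  hence "min (v x) (v y) \<le> v (x \<oplus> y)" using x y by (intro v_add) (auto simp: V_def)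
  hence "int n * min (v x) (v y) \<le> int n * v (x \<oplus> y)" by (rule mult_left_mono) simp
  hence "b \<le> int n * v (x \<oplus> y)" using x y False by (auto simp: V_def min_def split: if_splits)
  thus ?thesis using x y by (simp add: V_def)
qed (use x y in \<open>auto simp: V_def\<close>)

lemma V_mult: assumes x: "x \<in> V n a" and y: "y \<in> V n b" shows "x \<otimes> y \<in> V n (a + b)"
proof (cases "x = \<zero> \<or> y = \<zero>")
  case False
  hence "v (x \<otimes> y) = v x + v y" using x y by (intro v_mult) (auto simp: V_def)
  thus ?thesis using x y False by (auto simp: V_def distrib_left)
qed (use x y in \<open>auto simp: V_def\<close>)

lemma V_mono: "x \<in> V n b ==> a \<le> b ==> x \<in> V n a" by (auto simp: V_def)

lemma V_one: "\<one> \<in> V n 0" by (simp add: V_def v_one)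

lemma V_finsum: "(\<And>i. i \<in> I ==> u i \<in> V n b) ==> finsum K u I \<in> V n b"
proof (induction I rule: infinite_finite_induct)
  case (insert x F)
  hence "finsum K u (insert x F) = u x \<oplus> finsum K u F"
    by (intro K.finsum_insert) (auto simp: V_def)
  thus ?case using insert by (simp add: V_add)
qed (auto simp: K.finsum_infinite)

lemma pi: "\<pi> \<in> carrier K" "\<pi> \<noteq> \<zero>" "v \<pi> = 1"
  using unif by (auto simp: uniformiser_def)

lemma pi_npow: "\<pi> [^] (c::nat) \<in> carrier K" "\<pi> [^] c \<noteq> \<zero>" "v (\<pi> [^] c) = int c"
proof -
  have "\<pi> [^] (c::nat) \<in> carrier K \<and> \<pi> [^] c \<noteq> \<zero> \<and> v (\<pi> [^] c) = int c"
  proof (induction c)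
    case (Suc c)
    hence "v (\<pi> [^] c \<otimes> \<pi>) = int c + 1" using v_mult [of "\<pi> [^] c" \<pi>] pi by simp
    thus ?case using Suc pi K.integral_iff [of "\<pi> [^] c" \<pi>] by simp
  qed (use v_one in auto)
  thus "\<pi> [^] (c::nat) \<in> carrier K" "\<pi> [^] c \<noteq> \<zero>" "v (\<pi> [^] c) = int c" by auto
qed

lemma OK_simps [simp]:
  "monoid.mult OK = monoid.mult K" "one OK = one K" "ring.zero OK = ring.zero K" "ring.add OK = ring.add K"
  by (simp_all add: ring_of_integers_def sub_top_ring_def valued_field_ring_def)

lemma OK_carrier: "carrier OK = V 1 0"
  by (simp add: ring_of_integers_def sub_top_ring_def V_def)

lemma OK_K: "x \<in> carrier OK ==> x \<in> carrier K" by (simp add: OK_carrier V_def)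

lemma OK_V: "x \<in> carrier OK ==> x \<in> V n 0"
proof -
  assume "x \<in> carrier OK"
  hence "x \<in> carrier K" "x = \<zero> \<or> 0 \<le> v x" by (auto simp: OK_carrier V_def)
  moreover from this(2) have "x = \<zero> \<or> 0 \<le> int n * v x"
    by (elim disjE) (rule disjI1, assumption, rule disjI2, rule mult_nonneg_nonneg, rule of_nat_0_le_iff)
  ultimately show ?thesis unfolding V_def by blast
qed

lemma OK_cring: "cring OK"
proof (intro cringI abelian_groupI comm_monoidI)
  fix x assume "x \<in> carrier OK"
  thus "\<exists>y\<in>carrier OK. y \<oplus>\<^bsub>OK\<^esub> x = \<zero>\<^bsub>OK\<^esub>"
    using V_neg by (intro bexI [of _ "\<ominus> x"]) (auto simp: OK_carrier K.l_neg V_carrier)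
next
  fix x y assume "x \<in> carrier OK" "y \<in> carrier OK"
  thus "x \<otimes>\<^bsub>OK\<^esub> y \<in> carrier OK" using V_mult [of x 1 0 y 0] by (simp add: OK_carrier)
qed (auto simp: OK_carrier V_one V_add K.a_assoc K.m_assoc K.l_distr V_carrier intro: K.a_comm K.m_comm)

sublocale O: cring OK by (rule OK_cring)

lemma OK_neg: "x \<in> carrier OK ==> \<ominus>\<^bsub>OK\<^esub> x = \<ominus> x"
  by (rule O.minus_equality) (use V_neg in \<open>auto simp: OK_carrier K.l_neg V_carrier\<close>)

lemma OK_K_hom: "(\<lambda>x. x) \<in> ring_hom OK K"
  by (rule ring_hom_memI) (auto simp: OK_K)

lemma pi_OK: "\<pi> \<in> carrier OK" using pi by (simp add: OK_carrier V_def)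

lemma OK_npow: "x [^]\<^bsub>OK\<^esub> (c::nat) = x [^] c" by (simp add: nat_pow_def)

lemma V_divide:
  assumes "x \<in> V 1 (int c)" shows "\<exists>\<gamma>\<in>carrier OK. x = \<pi> [^] c \<otimes> \<gamma>"
proof (cases "x = \<zero>")
  case True
  thus ?thesis using pi_npow by (intro bexI [of _ "\<zero>"]) (auto simp: OK_carrier)
next
  case False
  let ?p = "\<pi> [^] c"
  have u: "?p \<in> Units K" using pi_npow by (simp add: K.field_Units)
  define y where "y = inv ?p \<otimes> x"
  have x: "x \<in> carrier K" using assms by (rule V_carrier)
  have y: "y \<in> carrier K" "?p \<otimes> y = x"
    using u x pi_npow(1) by (auto simp: y_def K.m_assoc [symmetric])
  have y0: "y \<noteq> \<zero>" using y False pi_npow by auto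
  have "v (?p \<otimes> y) = v ?p + v y" by (rule v_mult [OF pi_npow(1) y(1) pi_npow(2) y0])
  hence "v x = int c + v y" unfolding y(2) pi_npow(3) .
  hence "y \<in> carrier OK" using assms False y by (simp add: V_def OK_carrier)
  thus ?thesis using y by blast
qed

lemma max_ideal_V: "max_ideal K v = V 1 1"
  by (auto simp: max_ideal_def V_def)

lemma max_ideal_ideal: "ideal (max_ideal K v) OK"
proof (rule idealI [OF O.ring_axioms])
  show "subgroup (max_ideal K v) (add_monoid OK)"
    by (rule O.add.subgroupI)
      (use V_neg V_add V_mono [of _ 1 1 0] V_zero [of 1 1] OK_neg in \<open>auto simp: max_ideal_V OK_carrier simp del: V_zero\<close>)
  fix a x assume "a \<in> max_ideal K v" "x \<in> carrier OK"
  thus "x \<otimes>\<^bsub>OK\<^esub> a \<in> max_ideal K v" "a \<otimes>\<^bsub>OK\<^esub> x \<in> max_ideal K v"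
    using V_mult [of x 1 0 a 1] V_mult [of a 1 1 x 0] by (auto simp: max_ideal_V OK_carrier)
qed

lemma kk_cring: "cring kk"
  unfolding residue_field_def by (rule ideal.quotient_is_cring [OF max_ideal_ideal OK_cring])

sublocale k: cring kk by (rule kk_cring)

lemma residue_hom: "residue K v \<in> ring_hom OK kk"
  using ideal.rcos_ring_hom [OF max_ideal_ideal] by (simp add: residue_field_def residue_def [abs_def])

lemma residue_surj: "y \<in> carrier kk ==> \<exists>x\<in>carrier OK. y = residue K v x"
  by (auto simp: residue_field_def residue_def FactRing_def A_RCOSETS_def')

lemma residue_zero_iff: "x \<in> carrier OK ==> residue K v x = \<zero>\<^bsub>kk\<^esub> \<longleftrightarrow> x \<in> V 1 1"
proof -
  assume x: "x \<in> carrier OK"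
  have "residue K v \<zero>\<^bsub>OK\<^esub> = \<zero>\<^bsub>kk\<^esub>" using ring_hom_zero' [OF O.ring_axioms k.ring_axioms residue_hom] .
  moreover have "x \<ominus>\<^bsub>OK\<^esub> \<zero>\<^bsub>OK\<^esub> = x" using x by algebra
  ultimately show ?thesis using ideal.coset_eq_iff [OF max_ideal_ideal x O.zero_closed]
    unfolding residue_def max_ideal_V by simp
qed

end

declare One_nat_def [simp del]

lemma (in cring) monom_mult_nat:
  assumes "\<And>j. g j \<in> carrier R"
  shows "conv R (series_monom R a) g = (\<lambda>i::nat. if a \<le> i then g (i - a) else \<zero>)"
proof
  fix i
  show "conv R (series_monom R a) g i = (if a \<le> i then g (i - a) else \<zero>)"
  proof (cases "a \<le> i")
    case True
    thus ?thesis using conv_single [OF one_closed assms, where a = a and b = "i - a"] assms by (simp add: series_monom_def)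
  next
    case False
    hence "\<nexists>b. i = a + b" by auto
    thus ?thesis using conv_single_0 [of i a \<one> g] False by (simp add: series_monom_def)
  qed
qed

lemma filt_ring_with_topology: "filt_ring R Fil t ==> filt_ring (with_topology R \<tau>) Fil t"
  unfolding filt_ring_def filt_ring_axioms_def by (simp add: cring_with_topology)

lemma (in filt_top_ring) completion_reg:
  assumes "filt_ring_elem_reg R Fil t p M"
  shows "filt_ring_elem_reg (completion R) CFil (completion_map R t) (completion_map R p) M"
proof -
  interpret E: filt_ring_elem_reg R Fil t p M by fact
  interpret C: filt_ring "completion R" CFil "completion_map R t" by (rule completion_filt_ring)
  let ?i = "completion_map R"
  note ic = ring_hom_closed [OF completion_map_hom]
  have pF: "?i p \<in> CFil 0" using completion_map_CFil_iff E.p_Fil by simp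
  show ?thesis
  proof unfold_locales
    fix y m assume y: "y \<in> carrier (completion R)" and py: "?i p \<otimes>\<^bsub>completion R\<^esub> y \<in> CFil m"
    \<comment> \<open>The approximation has to be finer than both \<open>m\<close> and
      \<open>m - M\<close>, as the sign of \<open>M\<close> is not known.\<close>
    define l where "l = max m (m - M)"
    obtain x where x: "x \<in> carrier R" "C.cg l y (?i x)" using completion_dense [OF y] by blast
    have "C.cg (0 + l) (?i p \<otimes>\<^bsub>completion R\<^esub> ?i x) (?i p \<otimes>\<^bsub>completion R\<^esub> y)"
      by (rule C.cg_mult_left [OF C.cg_sym [OF x(2)] pF])
    hence "?i p \<otimes>\<^bsub>completion R\<^esub> ?i x \<in> CFil m" by (rule C.cg_Fil [OF _ py]) (simp add: l_def)
    hence "?i (p \<otimes> x) \<in> CFil m" using ring_hom_mult [OF completion_map_hom, of p x] x by simp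
    hence "x \<in> Fil (m - M)" using E.p_reg x(1) completion_map_CFil_iff by simp
    thus "y \<in> CFil (m - M)" using C.cg_Fil [OF x(2), of "m - M"] completion_map_CFil_iff x(1) by (simp add: l_def)
  qed (fact pF)
qed

context dvf
begin

abbreviation OT where "OT \<equiv> OT_ring K v \<pi>"
abbreviation pc where "pc \<equiv> series_const OK \<pi>"

lemma OT_simps [simp]:
  "monoid.mult OT = conv OK" "one OT = series_const OK \<one>" "ring.zero OT = (\<lambda>_. \<zero>)"
  "ring.add OT = (\<lambda>f g i. f i \<oplus> g i)"
  by (simp_all add: OT_ring_def Let_def power_series_ring_def fun_eq_iff)

lemma OT_carrier: "carrier OT = {f. \<forall>i. f i \<in> carrier OK}"
  by (simp add: OT_ring_def Let_def power_series_ring_def)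

lemma power_cring: "cring (power_series_ring OK)"
  unfolding power_series_ring_def by (rule series_cring.series_ring_cring [OF O.power_series_cring])

lemma OT_cring: "cring OT"
  unfolding OT_ring_def Let_def by (rule cring_with_topology [OF power_cring])

sublocale OT: cring OT by (rule OT_cring)

lemma OT_coeff: "F \<in> carrier OT ==> F i \<in> carrier OK"
  by (simp add: OT_carrier)

lemma OT_monom: "series_monom OK (a::nat) \<in> carrier OT"
  using O.one_closed O.zero_closed by (simp add: OT_carrier series_monom_def)

lemma OT_const: "c \<in> carrier OK ==> series_const OK c \<in> carrier OT"
  using O.zero_closed by (simp add: OT_carrier series_const_def)

lemma OT_pc: "pc \<in> carrier OT" using pi_OK by (rule OT_const)

lemma OT_const_mult: "c \<in> carrier OK ==> F \<in> carrier OT ==> series_const OK c \<otimes>\<^bsub>OT\<^esub> F = (\<lambda>i. c \<otimes> F i)"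
  using O.conv_const [of c F] OT_coeff by simp

lemma OT_monom_mult: "F \<in> carrier OT ==>
    series_monom OK (a::nat) \<otimes>\<^bsub>OT\<^esub> F = (\<lambda>i. if a \<le> i then F (i - a) else \<zero>)"
  using O.monom_mult_nat [of F a] OT_coeff by (simp add: fun_eq_iff)

lemma OT_npow: "x [^]\<^bsub>OT\<^esub> (m::nat) = x [^]\<^bsub>power_series_ring OK\<^esub> m"
  by (simp add: OT_ring_def Let_def)

lemma OT_monom_pow: "series_monom OK (1::nat) [^]\<^bsub>OT\<^esub> (a::nat) = series_monom OK a"
proof (induction a)
  case 0
  show ?case by (simp add: series_monom_def series_const_def fun_eq_iff)
next
  case (Suc a)
  have "series_monom OK (1::nat) [^]\<^bsub>OT\<^esub> Suc a = series_monom OK 1 \<otimes>\<^bsub>OT\<^esub> series_monom OK a"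
    using Suc OT.m_comm [OF OT_monom OT_monom] by simp
  also have "\<dots> = series_monom OK (Suc a)"
    unfolding OT_monom_mult [OF OT_monom] by (auto simp: series_monom_def fun_eq_iff)
  finally show ?case .
qed

lemma OT_const_pow: "pc [^]\<^bsub>OT\<^esub> (c::nat) = series_const OK (\<pi> [^] c)"
proof (induction c)
  case 0
  show ?case by (simp add: series_const_def)
next
  case (Suc c)
  have "\<pi> [^] c \<in> carrier OK" using pi_OK O.nat_pow_closed OK_npow by metis
  hence "series_const OK (\<pi> [^] c) \<otimes>\<^bsub>OT\<^esub> pc = series_const OK (\<pi> [^] Suc c)"
    using OK_K unfolding OT_const_mult [OF \<open>\<pi> [^] c \<in> carrier OK\<close> OT_pc] by (auto simp: series_const_def fun_eq_iff)
  thus ?case using Suc by simp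
qed

end

section \<open>The power series ring with the variable inverted\<close>

locale dvf_level = dvf K v \<pi> for K :: "('k, 'm) ring_scheme" (structure) and v \<pi> +
  fixes n :: nat
  assumes n1: "1 \<le> n"
begin

abbreviation s where "s \<equiv> series_monom OK n"
abbreviation LO where "LO \<equiv> localisation OT s"
abbreviation \<iota> where "\<iota> F \<equiv> fraction OT s F 0"
abbreviation T where "T \<equiv> series_monom OK (1::nat)"
abbreviation \<tau> where "\<tau> \<equiv> \<iota> T"
abbreviation el where "el a F \<equiv> tpow LO \<tau> a \<otimes>\<^bsub>LO\<^esub> \<iota> F"

lemma OT_loc: "regular_localisation OT s"
proof unfold_locales
  show "s \<in> carrier OT" by (rule OT_monom)
  fix x y assume xy: "x \<in> carrier OT" "y \<in> carrier OT" "s \<otimes>\<^bsub>OT\<^esub> x = s \<otimes>\<^bsub>OT\<^esub> y"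
  have "x i = y i" for i
    using fun_cong [OF xy(3), of "i + n"] unfolding OT_monom_mult [OF xy(1)] OT_monom_mult [OF xy(2)] by simp
  thus "x = y" by auto
qed

sublocale L: regular_localisation OT s by (rule OT_loc)
sublocale LO: cring LO by (rule L.localisation_cring)

lemma \<iota>_hom: "\<iota> \<in> ring_hom OT LO" using L.frac_hom .

lemma \<iota>_carrier: "F \<in> carrier OT ==> \<iota> F \<in> carrier LO"
  by (rule ring_hom_closed [OF \<iota>_hom])

lemma \<iota>_mult: "F \<in> carrier OT ==> G \<in> carrier OT ==> \<iota> (F \<otimes>\<^bsub>OT\<^esub> G) = \<iota> F \<otimes>\<^bsub>LO\<^esub> \<iota> G"
  by (rule ring_hom_mult [OF \<iota>_hom])

lemma \<iota>_npow: "F \<in> carrier OT ==> \<iota> (F [^]\<^bsub>OT\<^esub> (m::nat)) = \<iota> F [^]\<^bsub>LO\<^esub> m"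
proof (induction m)
  case 0
  thus ?case using ring_hom_one [OF \<iota>_hom] by simp
next
  case (Suc m)
  thus ?case using \<iota>_mult [of "F [^]\<^bsub>OT\<^esub> m" F] OT.nat_pow_closed [of F m] by simp
qed

text \<open>Inverting \<open>T^n\<close> inverts \<open>T\<close>, because \<open>n \<ge> 1\<close>
  makes \<open>T\<close> a divisor of \<open>T^n\<close>.\<close>

lemma \<tau>_unit: "\<tau> \<in> Units LO"
proof -
  have T: "T \<in> carrier OT" by (rule OT_monom)
  have "\<iota> s \<otimes>\<^bsub>LO\<^esub> fraction OT s \<one>\<^bsub>OT\<^esub> 1 = \<one>\<^bsub>LO\<^esub>"
    using L.frac_s_mult [OF OT.one_closed, of 1] by (simp add: L.frac_one OT_monom del: OT_simps)
  moreover have "\<iota> s = \<tau> \<otimes>\<^bsub>LO\<^esub> \<iota> (series_monom OK (n - 1))"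
  proof -
    have "s = T [^]\<^bsub>OT\<^esub> Suc (n - 1)" using OT_monom_pow [of n] n1 by simp
    also have "\<dots> = T \<otimes>\<^bsub>OT\<^esub> series_monom OK (n - 1)"
      using OT_monom_pow [of "n - 1"] OT.m_comm [OF T OT_monom [of "n - 1"]] by simp
    finally show ?thesis using \<iota>_mult [OF T OT_monom [of "n - 1"]] by simp
  qed
  ultimately have "\<tau> \<otimes>\<^bsub>LO\<^esub> (\<iota> (series_monom OK (n - 1)) \<otimes>\<^bsub>LO\<^esub> fraction OT s \<one>\<^bsub>OT\<^esub> 1) = \<one>\<^bsub>LO\<^esub>"
    using LO.m_assoc [OF \<iota>_carrier [OF T] \<iota>_carrier [OF OT_monom [of "n - 1"]], of "fraction OT s \<one>\<^bsub>OT\<^esub> 1"]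
      OT.one_closed by (auto simp del: OT_simps)
  moreover have c: "\<iota> (series_monom OK (n - 1)) \<otimes>\<^bsub>LO\<^esub> fraction OT s \<one>\<^bsub>OT\<^esub> 1 \<in> carrier LO"
    using OT.one_closed \<iota>_carrier [OF OT_monom [of "n - 1"]] by (intro LO.m_closed) (auto simp del: OT_simps)
  ultimately show ?thesis using LO.m_comm [OF \<iota>_carrier [OF T] c] \<iota>_carrier [OF T] unfolding Units_def
    by (auto simp del: localisation_carrier)
qed

lemma \<iota>_monom: "\<iota> (series_monom OK a) = tpow LO \<tau> (int a)"
  using \<iota>_npow [OF OT_monom [of 1], of a] OT_monom_pow [of a] by (simp add: LO.tpow_nat)

lemma el_carrier: "F \<in> carrier OT ==> el a F \<in> carrier LO"
  using LO.tpow_closed [OF \<tau>_unit] \<iota>_carrier by (intro LO.m_closed)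

lemma el_shift: "F \<in> carrier OT ==> el (a + int b) F = el a (series_monom OK b \<otimes>\<^bsub>OT\<^esub> F)"
  using LO.tpow_add [OF \<tau>_unit, of a "int b"] \<iota>_mult [OF OT_monom, of F b] \<iota>_monom [of b]
    LO.m_assoc [OF LO.tpow_closed [OF \<tau>_unit] LO.tpow_closed [OF \<tau>_unit] \<iota>_carrier] by simp

lemma elE:
  assumes "x \<in> carrier LO" obtains q :: nat and F where "F \<in> carrier OT" "x = el (- int q) F"
proof -
  obtain F m where F: "F \<in> carrier OT" "x = fraction OT s F m" using assms by auto
  have "s [^]\<^bsub>OT\<^esub> m = series_monom OK (n * m)"
    using OT_monom_pow [of n] OT_monom_pow [of "n * m"] OT.nat_pow_pow [OF OT_monom, of 1 n m] by simp
  hence "tpow LO \<tau> (int (n * m)) \<otimes>\<^bsub>LO\<^esub> x = \<iota> F"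
    using L.frac_s_mult [OF F(1), of m] F(2) \<iota>_monom [of "n * m"] by simp
  hence "x = el (- int (n * m)) F" using LO.tpow_cancel(2) [OF \<tau>_unit assms, of "int (n * m)"] by simp
  thus ?thesis using F that by blast
qed

lemma el_add: "F \<in> carrier OT ==> G \<in> carrier OT ==> el a (F \<oplus>\<^bsub>OT\<^esub> G) = el a F \<oplus>\<^bsub>LO\<^esub> el a G"
  using ring_hom_add [OF \<iota>_hom, of F G] LO.r_distr [OF \<iota>_carrier \<iota>_carrier LO.tpow_closed [OF \<tau>_unit]] by simp

lemma el_mult_\<iota>: "F \<in> carrier OT ==> G \<in> carrier OT ==> el a (F \<otimes>\<^bsub>OT\<^esub> G) = \<iota> F \<otimes>\<^bsub>LO\<^esub> el a G"
  using \<iota>_mult [of F G] LO.m_lcomm [OF LO.tpow_closed [OF \<tau>_unit] \<iota>_carrier \<iota>_carrier] by simp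

text \<open>The localised ring consists of Laurent series with integral coefficients. The second
  clause determines the map on shifted power series, and these are all elements by
  \<open>elE\<close>.\<close>

lemma LO_laurent:
  assumes "cring S" and r: "r \<in> ring_hom OK S"
  shows "\<exists>h\<in>ring_hom LO (laurent_series_ring S). (\<forall>F\<in>carrier OT. h (\<iota> F) = laurent_map S r F) \<and>
    (\<forall>a. \<forall>F\<in>carrier OT. h (el a F) = (\<lambda>i. laurent_map S r F (i - a)))"
proof -
  interpret S: cring S by fact
  interpret LS: cring "laurent_series_ring S" by (rule S.laurent_cring)
  have g: "laurent_map S r \<in> ring_hom OT (laurent_series_ring S)"
    using laurent_map_hom [OF OK_cring assms] by (simp add: OT_ring_def Let_def ring_hom_with_topology)
  have r0: "r \<zero> = \<zero>\<^bsub>S\<^esub>" "r \<one> = \<one>\<^bsub>S\<^esub>"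
    using ring_hom_zero' [OF O.ring_axioms S.ring_axioms r] ring_hom_one [OF r] by auto
  have gm: "laurent_map S r (series_monom OK a) = series_monom S (int a)" for a
    using r0 by (auto simp: laurent_map_def series_monom_def fun_eq_iff)
  have "laurent_map S r s \<in> Units (laurent_series_ring S)"
    using gm [of n] S.laurent_tpow_eq [of "int n"] LS.tpow_Units [OF S.laurent_t_unit] by metis
  then obtain h where h: "h \<in> ring_hom LO (laurent_series_ring S)" "\<And>F. F \<in> carrier OT ==> h (\<iota> F) = laurent_map S r F"
    using L.localisation_lift [OF S.laurent_cring g] by blast
  have "h (el a F) = (\<lambda>i. laurent_map S r F (i - a))" if F: "F \<in> carrier OT" for a F
  proof -
    have "h (el a F) = tpow (laurent_series_ring S) (h \<tau>) a \<otimes>\<^bsub>laurent_series_ring S\<^esub> laurent_map S r F"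
      using ring_hom_mult [OF h(1) LO.tpow_closed [OF \<tau>_unit] \<iota>_carrier [OF F]] h(2) [OF F]
        ring_hom_tpow [OF LO.is_cring LS.is_cring h(1) \<tau>_unit] by simp
    also have "h \<tau> = series_monom S 1" using h(2) [OF OT_monom] gm [of 1] by simp
    also have "tpow (laurent_series_ring S) (series_monom S 1) a = series_monom S a" by (rule S.laurent_tpow_eq)
    also have "series_monom S a \<otimes>\<^bsub>laurent_series_ring S\<^esub> laurent_map S r F = (\<lambda>i. laurent_map S r F (i - a))"
      unfolding S.laurent_mult
      by (rule S.monom_mult) (use F OT_coeff ring_hom_closed [OF r] in \<open>auto simp: laurent_map_def\<close>)
    finally show ?thesis .
  qed
  thus ?thesis using h by blast
qed

text \<open>The coefficient function of a localised power series, as an element of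
  \<open>K((T))\<close>. Elements of the localisation are classes of fractions, so such a map is the
  way to their coefficients.\<close>

definition jK where
  "jK = (SOME h. h \<in> ring_hom LO (laurent_series_ring K) \<and>
    (\<forall>a. \<forall>F\<in>carrier OT. h (el a F) = (\<lambda>i. laurent_map K (\<lambda>x. x) F (i - a))))"

lemma jK_hom: "jK \<in> ring_hom LO (laurent_series_ring K)"
  and jK_el0: "F \<in> carrier OT ==> jK (el a F) = (\<lambda>i. laurent_map K (\<lambda>x. x) F (i - a))"
  using someI_ex [of "\<lambda>h. h \<in> ring_hom LO (laurent_series_ring K) \<and>
    (\<forall>a. \<forall>F\<in>carrier OT. h (el a F) = (\<lambda>i. laurent_map K (\<lambda>x. x) F (i - a)))"]
    LO_laurent [OF K.is_cring OK_K_hom] unfolding jK_def [symmetric] by blast+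

lemma jK_el: "F \<in> carrier OT ==> jK (el a F) i = (if i < a then \<zero> else F (nat (i - a)))"
  by (simp add: jK_el0 laurent_map_def)

lemma jK_\<iota>: "F \<in> carrier OT ==> jK (\<iota> F) i = (if i < 0 then \<zero> else F (nat i))"
  using jK_el [of F 0 i] \<iota>_carrier [of F] by simp

lemma jK_add: "x \<in> carrier LO ==> y \<in> carrier LO ==> jK (x \<oplus>\<^bsub>LO\<^esub> y) i = jK x i \<oplus> jK y i"
  using ring_hom_add [OF jK_hom, of x y] by (simp add: K.laurent_add)

lemma jK_OK: "x \<in> carrier LO ==> jK x i \<in> carrier OK"
proof -
  assume "x \<in> carrier LO"
  then obtain q :: nat and F where "F \<in> carrier OT" "x = el (- int q) F" by (rule elE)
  thus ?thesis using jK_el OT_coeff O.zero_closed by simp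
qed

lemma jK_bdd: "x \<in> carrier LO ==> \<exists>q::nat. \<forall>i < - int q. jK x i = \<zero>"
proof -
  assume "x \<in> carrier LO"
  then obtain q :: nat and F where "F \<in> carrier OT" "x = el (- int q) F" by (rule elE)
  thus ?thesis using jK_el by (intro exI [of _ q]) simp
qed

lemma jK_pi_pow: "x \<in> carrier LO ==> jK (\<iota> pc [^]\<^bsub>LO\<^esub> (c::nat) \<otimes>\<^bsub>LO\<^esub> x) i = \<pi> [^] c \<otimes> jK x i"
proof -
  assume "x \<in> carrier LO"
  then obtain q :: nat and F where F: "F \<in> carrier OT" "x = el (- int q) F" by (rule elE)
  have c: "\<pi> [^] c \<in> carrier OK" using pi_OK O.nat_pow_closed OK_npow by metis
  have "\<iota> pc [^]\<^bsub>LO\<^esub> c \<otimes>\<^bsub>LO\<^esub> x = el (- int q) (series_const OK (\<pi> [^] c) \<otimes>\<^bsub>OT\<^esub> F)"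
    using el_mult_\<iota> [OF OT_const [OF c] F(1)] \<iota>_npow [OF OT_pc, of c] F(2) OT_const_pow [of c] by simp
  thus ?thesis
    using F jK_el [of "series_const OK (\<pi> [^] c) \<otimes>\<^bsub>OT\<^esub> F" "- int q" i] OT.m_closed [OF OT_const [OF c] F(1)]
      OT_const_mult [OF c F(1)] jK_el [of F "- int q" i] pi_npow(1) [of c] by simp
qed

text \<open>A Gauss norm in additive form: \<open>T\<close> has weight 1, \<open>\<pi>\<close> has
  weight \<open>n\<close>, and every term must have weight at least \<open>l\<close>. Since
  \<open>T\<close> is no unit in the power series ring, \<open>top_localisation_filt\<close> does
  not apply, and the topology is compared with this filtration directly in
  \<open>LT_filt_top\<close>.\<close>

definition FilL :: "int => ((nat => 'k) \<times> nat) set set" where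
  "FilL l = {x \<in> carrier LO. \<forall>i. jK x i \<in> V n (l - i)}"

lemma FilL_carrier: "x \<in> FilL l ==> x \<in> carrier LO" by (simp add: FilL_def)

lemma el_FilL_iff:
  assumes F: "F \<in> carrier OT"
  shows "el a F \<in> FilL l \<longleftrightarrow> (\<forall>i. F i \<in> V n (l - a - int i))"
proof
  assume "el a F \<in> FilL l"
  hence *: "jK (el a F) (a + int i) \<in> V n (l - (a + int i))" for i by (simp add: FilL_def)
  show "\<forall>i. F i \<in> V n (l - a - int i)"
  proof
    fix i show "F i \<in> V n (l - a - int i)" using * [of i] jK_el [OF F, of a "a + int i"] by (simp add: algebra_simps)
  qed
next
  assume *: "\<forall>i. F i \<in> V n (l - a - int i)"
  have "jK (el a F) i \<in> V n (l - i)" for i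
    using spec [OF *, of "nat (i - a)"] jK_el [OF F, of a i] by (cases "i < a") (simp_all add: algebra_simps)
  thus "el a F \<in> FilL l" using el_carrier [OF F] by (simp add: FilL_def)
qed

lemma el_FilL: "F \<in> carrier OT ==> el a F \<in> FilL a"
  unfolding el_FilL_iff using V_mono [OF OK_V [OF OT_coeff]] by simp

lemma \<iota>_FilL: "F \<in> carrier OT ==> \<iota> F \<in> FilL 0"
  using el_FilL [of F 0] \<iota>_carrier [of F] by simp

lemma tpow_FilL: "tpow LO \<tau> a \<in> FilL a"
  using el_FilL [OF OT.one_closed, of a] ring_hom_one [OF \<iota>_hom] LO.tpow_closed [OF \<tau>_unit] by simp

lemma FilL_filt_ring: "filt_ring LO FilL \<tau>"
proof (intro filt_ring.intro filt_ring_axioms.intro LO.is_cring \<tau>_unit)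
  interpret LK: cring "laurent_series_ring K" by (rule K.laurent_cring)
  show "FilL m \<subseteq> carrier LO" for m using FilL_carrier by blast
  show "\<zero>\<^bsub>LO\<^esub> \<in> FilL m" for m
    using ring_hom_zero' [OF LO.ring_axioms LK.ring_axioms jK_hom] LO.zero_closed unfolding FilL_def by (simp add: K.laurent_zero)
  show "x \<oplus>\<^bsub>LO\<^esub> y \<in> FilL m" if "x \<in> FilL m" "y \<in> FilL m" for x y m
    using that jK_add V_add LO.add.m_closed unfolding FilL_def by simp
  show "\<ominus>\<^bsub>LO\<^esub> x \<in> FilL m" if x: "x \<in> FilL m" for x m
  proof -
    have c: "x \<in> carrier LO" by (rule FilL_carrier [OF x])
    have "jK (\<ominus>\<^bsub>LO\<^esub> x) = (\<lambda>i. \<ominus> jK x i)"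
      using ring_hom_a_inv [OF LO.ring_axioms LK.ring_axioms jK_hom c] K.laurent_neg ring_hom_closed [OF jK_hom c] by simp
    thus ?thesis using x LO.a_inv_closed [OF c] V_neg unfolding FilL_def by simp
  qed
  show "FilL l \<subseteq> FilL m" if "m \<le> l" for m l
  proof
    fix x assume x: "x \<in> FilL l"
    have "jK x i \<in> V n (m - i)" for i
      by (rule V_mono [of _ _ "l - i"]) (use x that in \<open>simp_all add: FilL_def\<close>)
    thus "x \<in> FilL m" using FilL_carrier [OF x] by (simp add: FilL_def)
  qed
  show "x \<otimes>\<^bsub>LO\<^esub> y \<in> FilL (m + l)" if x: "x \<in> FilL m" and y: "y \<in> FilL l" for x y m l
  proof -
    have c: "x \<in> carrier LO" "y \<in> carrier LO" using x y FilL_carrier by auto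
    have "jK (x \<otimes>\<^bsub>LO\<^esub> y) i \<in> V n (m + l - i)" for i
    proof -
      have "conv K (jK x) (jK y) i \<in> V n (m + l - i)" unfolding conv_def
      proof (rule V_finsum, clarify)
        fix a b assume i: "i = a + b"
        have "jK x a \<otimes> jK y b \<in> V n ((m - a) + (l - b))" using x y by (intro V_mult) (auto simp: FilL_def)
        thus "jK x a \<otimes> jK y b \<in> V n (m + l - (a + b))" by (simp add: algebra_simps)
      qed
      thus ?thesis using ring_hom_mult [OF jK_hom c] by (simp add: K.laurent_mult)
    qed
    thus ?thesis using LO.m_closed [OF c] unfolding FilL_def by simp
  qed
  show "\<one>\<^bsub>LO\<^esub> \<in> FilL 0" using tpow_FilL [of 0] by simp
  show "\<exists>m. x \<in> FilL m" if x: "x \<in> carrier LO" for x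
  proof -
    obtain q :: nat and F where "F \<in> carrier OT" "x = el (- int q) F" using x by (rule elE)
    thus ?thesis using el_FilL by blast
  qed
  show "\<tau> \<in> FilL 1" using tpow_FilL [of 1] LO.tpow_1 [OF \<tau>_unit] by simp
  have "tpow LO \<tau> (- 1) = inv\<^bsub>LO\<^esub> \<tau>" using \<tau>_unit LO.Units_inv_closed by (simp add: tpow_def)
  thus "inv\<^bsub>LO\<^esub> \<tau> \<in> FilL (- 1)" using tpow_FilL [of "- 1"] by simp
qed

sublocale FL: filt_ring LO FilL \<tau> by (rule FilL_filt_ring)

lemma V_pi_reg:
  assumes y: "y \<in> carrier K" and py: "\<pi> \<otimes> y \<in> V n b" shows "y \<in> V n (b - int n)"
proof (cases "y = \<zero>")
  case False
  hence "v (\<pi> \<otimes> y) = 1 + v y" "\<pi> \<otimes> y \<noteq> \<zero>"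
    using v_mult [of \<pi> y] pi y K.integral_iff by auto
  hence "b \<le> int n * (1 + v y)" using py by (simp add: V_def)
  thus ?thesis using y by (simp add: V_def distrib_left)
qed simp

text \<open>Multiplication by \<open>\<pi>\<close> raises the weight of every nonzero term by
  exactly \<open>n\<close>.\<close>

lemma FilL_reg: "filt_ring_elem_reg LO FilL \<tau> (\<iota> pc) (int n)"
proof unfold_locales
  show "\<iota> pc \<in> FilL 0" by (rule \<iota>_FilL [OF OT_pc])
  fix x m assume x: "x \<in> carrier LO" and px: "\<iota> pc \<otimes>\<^bsub>LO\<^esub> x \<in> FilL m"
  have "jK (\<iota> pc \<otimes>\<^bsub>LO\<^esub> x) i = \<pi> \<otimes> jK x i" for i
    using jK_pi_pow [OF x, of 1 i] pi(1) \<iota>_carrier [OF OT_pc] LO.nat_pow_one by simp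
  hence *: "\<pi> \<otimes> jK x i \<in> V n (m - i)" for i using px by (simp add: FilL_def)
  have "jK x i \<in> V n (m - int n - i)" for i
    using V_pi_reg [OF OK_K [OF jK_OK [OF x]] *, of i] by (simp add: algebra_simps)
  thus "x \<in> FilL (m - int n)" using x by (simp add: FilL_def)
qed

text \<open>An induction principle. Peeling off the coefficients in degrees below \<open>m\<close>
  one at a time leaves a tail divisible by \<open>T^m\<close>; the power of \<open>\<pi>\<close> in
  each coefficient is made explicit, so that a monomial \<open>\<gamma> \<pi>^c T^a\<close> displays
  its weight \<open>n c + a\<close>.\<close>

lemma LO_decomp:
  assumes x: "x \<in> FilL l" and ml: "l \<le> m"
    and add: "\<And>x y. x \<in> carrier LO ==> y \<in> carrier LO ==> P x ==> P y ==> P (x \<oplus>\<^bsub>LO\<^esub> y)"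
    and tail: "\<And>H. H \<in> carrier OT ==> P (el m H)"
    and mono: "\<And>\<gamma> (c::nat) a. \<gamma> \<in> carrier OK ==> l \<le> int n * int c + a ==>
       P (\<iota> (series_const OK \<gamma>) \<otimes>\<^bsub>LO\<^esub> (\<iota> pc [^]\<^bsub>LO\<^esub> c \<otimes>\<^bsub>LO\<^esub> tpow LO \<tau> a))"
  shows "P x"
proof -
  obtain q :: nat and F0 where F0: "F0 \<in> carrier OT" "x = el (- int q) F0" using FilL_carrier [OF x] by (rule elE)
  \<comment> \<open>The number of coefficients of \<open>F0\<close> that belong to degrees below
    \<open>m\<close>; it is zero if \<open>m \<le> - q\<close>.\<close>
  define N where "N = nat (m + int q)"
  have main: "P (el (- int q) F)"
    if "F \<in> carrier OT" "\<And>i. F i \<in> V n (l + int q - int i)" "\<And>i. i + d < N ==> F i = \<zero>" for d F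
    using that
  proof (induction d arbitrary: F)
    case 0
    \<comment> \<open>If \<open>m < - q\<close>, the truncation in \<open>N\<close> leaves a gap,
      which this extra power of the variable fills.\<close>
    define e where "e = nat (- int q - m)"
    define H where "H i = F (i + N)" for i
    have H: "H \<in> carrier OT" using 0 by (simp add: H_def OT_carrier)
    have "series_monom OK N \<otimes>\<^bsub>OT\<^esub> H = F" unfolding OT_monom_mult [OF H] using 0(3) by (auto simp: H_def fun_eq_iff)
    hence "el (- int q) F = el (- int q + int N) H" using el_shift [OF H, of "- int q" N] by simp
    also have "- int q + int N = m + int e" by (simp add: N_def e_def)
    also have "el (m + int e) H = el m (series_monom OK e \<otimes>\<^bsub>OT\<^esub> H)" by (rule el_shift [OF H])
    finally show ?case using tail OT.m_closed [OF OT_monom H] by simp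
  next
    case (Suc d)
    show ?case
    proof (cases "d < N")
      case False
      thus ?thesis using Suc by (intro Suc.IH) auto
    next
      case True
      define i0 where "i0 = N - Suc d"
      define c0 where "c0 = F i0"
      have c0: "c0 \<in> carrier OK" "c0 \<in> V n (l + int q - int i0)" using Suc.prems OT_coeff by (auto simp: c0_def)
      define F' where "F' i = (if i = i0 then \<zero> else F i)" for i
      have F': "F' \<in> carrier OT" using Suc.prems(1) O.zero_closed by (simp add: F'_def OT_carrier)
      let ?M = "series_const OK c0 \<otimes>\<^bsub>OT\<^esub> series_monom OK i0"
      have M: "?M \<in> carrier OT" using OT.m_closed [OF OT_const [OF c0(1)] OT_monom] .
      have "?M = (\<lambda>i. if i = i0 then c0 else \<zero>)"
        unfolding OT_const_mult [OF c0(1) OT_monom] using OK_K [OF c0(1)] by (auto simp: series_monom_def)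
      hence "F = ?M \<oplus>\<^bsub>OT\<^esub> F'"
        using OK_K [OF OT_coeff [OF Suc.prems(1)]] by (auto simp: F'_def c0_def fun_eq_iff)
      hence eF: "el (- int q) F = el (- int q) ?M \<oplus>\<^bsub>LO\<^esub> el (- int q) F'" using el_add [OF M F'] by simp
      have P': "P (el (- int q) F')"
      proof (rule Suc.IH [OF F'])
        show "F' i \<in> V n (l + int q - int i)" for i using Suc.prems(2) by (simp add: F'_def)
        show "F' i = \<zero>" if "i + d < N" for i
          using Suc.prems(3) [of i] that True by (auto simp: F'_def i0_def)
      qed
      obtain c :: nat and \<gamma> where g: "\<gamma> \<in> carrier OK" "c0 = \<pi> [^] c \<otimes> \<gamma>" "l + int q - int i0 \<le> int n * int c"
      proof (cases "c0 = \<zero>")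
        case True
        \<comment> \<open>A vanishing coefficient has no valuation to choose \<open>c\<close> from,
          so any exponent meeting the weight bound is taken.\<close>
        have "l + int q - int i0 \<le> int n * int (nat (l + int q))"
        proof -
          have "int (nat (l + int q)) \<le> int n * int (nat (l + int q))"
            using n1 mult_right_mono [of 1 "int n" "int (nat (l + int q))"] by linarith
          thus ?thesis by linarith
        qed
        thus ?thesis using that [of "\<zero>" "nat (l + int q)"] True pi_npow(1) O.zero_closed by simp
      next
        case False
        have v0: "0 \<le> v c0" using c0(1) False by (simp add: OK_carrier V_def)
        have "c0 \<in> V 1 (int (nat (v c0)))" using OK_K [OF c0(1)] v0 by (simp add: V_def)
        then obtain \<gamma> where "\<gamma> \<in> carrier OK" "c0 = \<pi> [^] nat (v c0) \<otimes> \<gamma>" using V_divide by blast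
        moreover have "l + int q - int i0 \<le> int n * int (nat (v c0))" using c0(2) False v0 by (simp add: V_def)
        ultimately show ?thesis using that by blast
      qed
      have pcK: "\<pi> [^] c \<in> carrier OK" using pi_OK O.nat_pow_closed OK_npow by metis
      have "series_const OK c0 = series_const OK \<gamma> \<otimes>\<^bsub>OT\<^esub> (pc [^]\<^bsub>OT\<^esub> c)"
        unfolding OT_const_pow OT_const_mult [OF g(1) OT_const [OF pcK]] g(2)
        using OK_K [OF g(1)] pi_npow(1) K.m_comm by (auto simp: series_const_def fun_eq_iff)
      hence i0: "\<iota> (series_const OK c0) = \<iota> (series_const OK \<gamma>) \<otimes>\<^bsub>LO\<^esub> (\<iota> pc [^]\<^bsub>LO\<^esub> c)"
        using \<iota>_mult [OF OT_const [OF g(1)] OT.nat_pow_closed [OF OT_pc, of c]] \<iota>_npow [OF OT_pc, of c] by simp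
      have "el (- int q) ?M = \<iota> (series_const OK c0) \<otimes>\<^bsub>LO\<^esub> el (- int q) (series_monom OK i0)"
        by (rule el_mult_\<iota> [OF OT_const [OF c0(1)] OT_monom])
      also have "el (- int q) (series_monom OK i0) = tpow LO \<tau> (int i0 - int q)"
        using \<iota>_monom [of i0] LO.tpow_add [OF \<tau>_unit, of "- int q" "int i0"] by simp
      finally have "el (- int q) ?M = \<iota> (series_const OK \<gamma>) \<otimes>\<^bsub>LO\<^esub> (\<iota> pc [^]\<^bsub>LO\<^esub> c \<otimes>\<^bsub>LO\<^esub> tpow LO \<tau> (int i0 - int q))"
        unfolding i0 using LO.m_assoc [OF \<iota>_carrier [OF OT_const [OF g(1)]] LO.nat_pow_closed [OF \<iota>_carrier [OF OT_pc]] LO.tpow_closed [OF \<tau>_unit]]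
        by simp
      hence "P (el (- int q) ?M)" using mono [OF g(1), of c "int i0 - int q"] g(3) by simp
      thus ?thesis unfolding eF by (intro add el_carrier M F' P')
    qed
  qed
  have "F0 i \<in> V n (l + int q - int i)" for i using x el_FilL_iff [OF F0(1), of "- int q" l] F0(2) by simp
  thus ?thesis using main [OF F0(1), of N] F0(2) by simp
qed

end

context cring
begin

abbreviation (input) ipow where "ipow I m \<equiv> I [^]\<^bsub>ideals_set R\<^esub> (m::nat)"

lemma ipow_0: "ipow I 0 = carrier R"
  by (simp add: ideals_set_def)

lemma ipow_Suc: "ipow I (Suc m) = ideal_prod R (ipow I m) I"
  by (simp add: ideals_set_def)

lemma ipow_ideal: "ideal I R ==> ideal (ipow I m) R"
proof (induction m)
  case 0
  show ?case unfolding ipow_0 by (rule oneideal)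
next
  case (Suc m)
  thus ?case unfolding ipow_Suc by (intro ideal_prod_is_ideal)
qed

lemma ipow_Suc_subset: "ideal I R ==> ipow I (Suc m) \<subseteq> ipow I m"
  unfolding ipow_Suc using ideal_prod_inter [OF ipow_ideal, of I I m] by blast

lemma ipow_antimono: "ideal I R ==> m \<le> l ==> ipow I l \<subseteq> ipow I m"
  by (rule lift_Suc_antimono_le [of "\<lambda>m. ipow I m"]) (rule ipow_Suc_subset)

lemma ipow_npow: "ideal I R ==> x \<in> I ==> x [^] m \<in> ipow I m"
proof (induction m)
  case 0
  thus ?case unfolding ipow_0 by simp
next
  case (Suc m)
  thus ?case unfolding ipow_Suc by (auto intro: ideal_prod.prod)
qed

text \<open>Negative indices are truncated to the exponent 0 and so stand for the whole
  ring.\<close>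

lemma adic_filt_top: "ideal I R ==> filt_top (with_topology R (adic_topology R I)) (\<lambda>m::int. ipow I (nat m))"
  unfolding adic_topology_def
proof (rule filt_top_zero_basis)
  fix m l :: int assume "ideal I R" "m \<le> l"
  thus "ipow I (nat l) \<subseteq> ipow I (nat m)" by (intro ipow_antimono) auto
next
  fix U assume "U \<in> {ipow I m |m. True}"
  then obtain m where "U = ipow I (nat (int m))" by auto
  thus "\<exists>m::int. ipow I (nat m) \<subseteq> U" by blast
qed blast

end

context dvf_level
begin

text \<open>Two one-sided estimates for the powers of \<open>(\<pi>, T)\<close> suffice to compare
  topologies: they satisfy the weight condition in which \<open>\<pi>\<close> and \<open>T\<close>
  both have weight 1, and they contain the corresponding power of \<open>T\<close>.\<close>

lemma ideal_power_FilL: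
  defines "J \<equiv> \<lambda>m. {F \<in> carrier OT. \<forall>i. F i \<in> V 1 (m - int i)}"
  shows "cring.ipow (power_series_ring OK) (Idl\<^bsub>power_series_ring OK\<^esub> {pc, T}) m \<subseteq> J (int m)"
    and "series_monom OK m \<in> cring.ipow (power_series_ring OK) (Idl\<^bsub>power_series_ring OK\<^esub> {pc, T}) m"
    and "ideal (Idl\<^bsub>power_series_ring OK\<^esub> {pc, T}) (power_series_ring OK)"
proof -
  let ?P = "power_series_ring OK"
  interpret P: cring ?P by (rule power_cring)
  have PO: "carrier ?P = carrier OT" "monoid.mult ?P = monoid.mult OT" "ring.add ?P = ring.add OT"
    by (simp_all add: OT_ring_def Let_def)
  have s: "{pc, T} \<subseteq> carrier ?P" using OT_pc OT_monom PO by auto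
  show I: "ideal (Idl\<^bsub>?P\<^esub> {pc, T}) ?P" by (rule P.genideal_ideal [OF s])
  have mult: "F \<otimes>\<^bsub>OT\<^esub> G \<in> J (a + b)" if F: "F \<in> J a" and G: "G \<in> J b" for F G a b
  proof -
    have c: "F \<in> carrier OT" "G \<in> carrier OT" using F G by (auto simp: J_def)
    have "conv OK F G i \<in> V 1 (a + b - int i)" for i
    proof -
      have "conv OK F G i = conv K F G i"
        using ring_hom_finsum [OF O.ring_axioms K.ring_axioms OK_K_hom,
          of "\<lambda>(j, l). F j \<otimes>\<^bsub>OK\<^esub> G l" "{(j, l). j + l = i \<and> F j \<noteq> \<zero>\<^bsub>OK\<^esub> \<and> G l \<noteq> \<zero>\<^bsub>OK\<^esub>}"]
          O.m_closed [OF OT_coeff [OF c(1)] OT_coeff [OF c(2)]]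
        unfolding conv_def by (simp add: Pi_iff split_def)
      moreover have "conv K F G i \<in> V 1 (a + b - int i)" unfolding conv_def
      proof (rule V_finsum, clarify)
        fix j l assume i: "i = j + l"
        have "F j \<otimes> G l \<in> V 1 ((a - int j) + (b - int l))" using F G by (intro V_mult) (auto simp: J_def)
        thus "F j \<otimes> G l \<in> V 1 (a + b - int (j + l))" by (simp add: algebra_simps)
      qed
      ultimately show ?thesis by simp
    qed
    thus ?thesis using OT.m_closed [OF c] by (simp add: J_def)
  qed
  have J0: "F \<in> J 0" if "F \<in> carrier OT" for F
    using that V_mono [OF OK_V [OF OT_coeff [OF that]]] by (simp add: J_def)
  have add: "F \<oplus>\<^bsub>OT\<^esub> G \<in> J a" if "F \<in> J a" "G \<in> J a" for F G a
    using that V_add OT.add.m_closed [of F G] by (simp add: J_def)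
  have J1: "ideal (J 1) ?P"
  proof (rule idealI [OF P.ring_axioms])
    show "subgroup (J 1) (add_monoid ?P)"
    proof (rule P.add.subgroupI)
      show "J 1 \<subseteq> carrier ?P" by (auto simp: J_def PO)
      have "(\<lambda>_. \<zero>) \<in> J 1" using OT.zero_closed by (simp add: J_def)
      thus "J 1 \<noteq> {}" by blast
    next
      fix F assume F: "F \<in> J 1"
      hence Fc: "F \<in> carrier OT" by (simp add: J_def)
      hence "\<ominus>\<^bsub>?P\<^esub> F = (\<lambda>i. \<ominus> F i)"
        using series_cring.series_ring_neg [OF O.power_series_cring, of F] OK_neg [OF OT_coeff [OF Fc]] Fc
        by (simp add: power_series_ring_def OT_carrier)
      thus "\<ominus>\<^bsub>?P\<^esub> F \<in> J 1"
        using F P.a_inv_closed [of F] V_neg PO(1) Fc by (simp add: J_def)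
    next
      fix F G assume "F \<in> J 1" "G \<in> J 1"
      thus "F \<oplus>\<^bsub>?P\<^esub> G \<in> J 1" using add [of F 1 G] PO(3) by metis
    qed
    fix F G assume F: "F \<in> J 1" and G: "G \<in> carrier ?P"
    show "G \<otimes>\<^bsub>?P\<^esub> F \<in> J 1" using mult [OF J0 F, of G] G PO by simp
    show "F \<otimes>\<^bsub>?P\<^esub> G \<in> J 1" using mult [OF F J0, of G] G PO by simp
  qed
  have "pc \<in> J 1" "T \<in> J 1"
  proof -
    show "pc \<in> J 1" using OT_pc pi V_zero by (auto simp: J_def series_const_def V_def)
    show "T \<in> J 1" using OT_monom V_one by (auto simp: J_def series_monom_def)
  qed
  hence IJ: "Idl\<^bsub>?P\<^esub> {pc, T} \<subseteq> J 1" by (intro P.genideal_minimal J1) auto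
  show "P.ipow (Idl\<^bsub>?P\<^esub> {pc, T}) m \<subseteq> J (int m)"
  proof (induction m)
    case 0
    thus ?case unfolding P.ipow_0 using J0 PO by auto
  next
    case (Suc m)
    show ?case
    proof
      fix x assume "x \<in> P.ipow (Idl\<^bsub>?P\<^esub> {pc, T}) (Suc m)"
      hence "x \<in> ideal_prod ?P (P.ipow (Idl\<^bsub>?P\<^esub> {pc, T}) m) (Idl\<^bsub>?P\<^esub> {pc, T})" unfolding P.ipow_Suc .
      thus "x \<in> J (int (Suc m))"
      proof (induction rule: ideal_prod.induct)
        case (prod i j)
        hence "i \<otimes>\<^bsub>OT\<^esub> j \<in> J (int m + 1)" using Suc IJ by (intro mult) auto
        thus ?case using PO(2) by (simp add: add.commute)
      next
        case (sum s1 s2)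
        thus ?case using add [of s1 "int (Suc m)" s2] PO(3) by metis
      qed
    qed
  qed
  have "T [^]\<^bsub>?P\<^esub> m \<in> P.ipow (Idl\<^bsub>?P\<^esub> {pc, T}) m"
    by (rule P.ipow_npow [OF I]) (use P.genideal_self [OF s] in blast)
  thus "series_monom OK m \<in> P.ipow (Idl\<^bsub>?P\<^esub> {pc, T}) m" using OT_monom_pow [of m] OT_npow by metis
qed

abbreviation LT where "LT \<equiv> top_localisation OT pc s"

text \<open>The fraction \<open>\<pi> / T^n\<close> has weight 0, and raising the weight of
  \<open>\<pi>\<close> from 1 to \<open>n\<close> does not lower the weight of an integral series;
  this puts Huber's generators into \<open>FilL\<close>. Conversely every monomial of large weight
  is rewritten as such a generator.\<close>

lemma LT_filt_top: "filt_top LT FilL"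
proof -
  let ?P = "power_series_ring OK"
  interpret P: cring ?P by (rule power_cring)
  define I where "I = Idl\<^bsub>?P\<^esub> {pc, T}"
  note I = ideal_power_FilL [folded I_def]
  have ft: "filt_top OT (\<lambda>m::int. P.ipow I (nat m))"
    using P.adic_filt_top [OF I(3)] by (simp add: OT_ring_def Let_def I_def)
  note op = ft [unfolded filt_top_def, rule_format]
  interpret FE: filt_ring_elem_reg LO FilL \<tau> "\<iota> pc" "int n" by (rule FilL_reg)
  define G where "G U = loc_zero_nbhd OT pc s U" for U
  have PO: "carrier ?P = carrier OT" "monoid.mult ?P = monoid.mult OT" "ring.add ?P = ring.add OT" "ring.zero ?P = ring.zero OT"
    by (simp_all add: OT_ring_def Let_def)
  have gen: "fraction OT s (u \<otimes>\<^bsub>OT\<^esub> pc [^]\<^bsub>OT\<^esub> i) i = tpow LO \<tau> (- int (n * i)) \<otimes>\<^bsub>LO\<^esub> (\<iota> u \<otimes>\<^bsub>LO\<^esub> \<iota> pc [^]\<^bsub>LO\<^esub> i)"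
    if u: "u \<in> carrier OT" for u and i :: nat
  proof -
    have c: "u \<otimes>\<^bsub>OT\<^esub> pc [^]\<^bsub>OT\<^esub> i \<in> carrier OT" using u OT_pc by (intro OT.m_closed OT.nat_pow_closed)
    have "s [^]\<^bsub>OT\<^esub> i = series_monom OK (n * i)"
      using OT_monom_pow [of n] OT_monom_pow [of "n * i"] OT.nat_pow_pow [OF OT_monom, of 1 n i] by simp
    hence "tpow LO \<tau> (int (n * i)) \<otimes>\<^bsub>LO\<^esub> fraction OT s (u \<otimes>\<^bsub>OT\<^esub> pc [^]\<^bsub>OT\<^esub> i) i = \<iota> (u \<otimes>\<^bsub>OT\<^esub> pc [^]\<^bsub>OT\<^esub> i)"
      using L.frac_s_mult [OF c, of i] \<iota>_monom [of "n * i"] by simp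
    moreover have "fraction OT s (u \<otimes>\<^bsub>OT\<^esub> pc [^]\<^bsub>OT\<^esub> i) i \<in> carrier LO"
      unfolding localisation_carrier using c by blast
    ultimately have "fraction OT s (u \<otimes>\<^bsub>OT\<^esub> pc [^]\<^bsub>OT\<^esub> i) i = tpow LO \<tau> (- int (n * i)) \<otimes>\<^bsub>LO\<^esub> \<iota> (u \<otimes>\<^bsub>OT\<^esub> pc [^]\<^bsub>OT\<^esub> i)"
      using LO.tpow_cancel(2) [OF \<tau>_unit, of _ "int (n * i)"] by metis
    thus ?thesis
      using \<iota>_mult [OF u OT.nat_pow_closed [OF OT_pc, of i]] \<iota>_npow [OF OT_pc, of i] by simp
  qed
  have small: "G (P.ipow I m) \<subseteq> FilL (int m)" for m unfolding G_def loc_zero_nbhd_def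
  proof (rule generate_add_subset [OF LO.is_cring])
    show "{fraction OT s (u \<otimes>\<^bsub>OT\<^esub> pc [^]\<^bsub>OT\<^esub> i) i |u i. u \<in> P.ipow I m} \<subseteq> FilL (int m)"
    proof clarify
      fix u and i :: nat assume "u \<in> P.ipow I m"
      hence u: "u \<in> carrier OT" "\<And>j. u j \<in> V 1 (int m - int j)" using I(1) by auto
      have e: "tpow LO \<tau> (- int (n * i)) \<otimes>\<^bsub>LO\<^esub> (\<iota> u \<otimes>\<^bsub>LO\<^esub> \<iota> pc [^]\<^bsub>LO\<^esub> i)
          = \<iota> pc [^]\<^bsub>LO\<^esub> i \<otimes>\<^bsub>LO\<^esub> el (- int (n * i)) u"
        using \<iota>_carrier [OF u(1)] LO.nat_pow_closed [OF \<iota>_carrier [OF OT_pc], of i] LO.tpow_closed [OF \<tau>_unit, of "- int (n * i)"]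
        by (metis LO.m_comm LO.m_lcomm)
      have "jK (\<iota> pc [^]\<^bsub>LO\<^esub> i \<otimes>\<^bsub>LO\<^esub> el (- int (n * i)) u) j \<in> V n (int m - j)" for j
      proof -
        let ?w = "jK (el (- int (n * i)) u) j"
        have w: "?w = (if j < - int (n * i) then \<zero> else u (nat (j + int (n * i))))" using jK_el [OF u(1)] by simp
        have "\<pi> [^] i \<otimes> ?w \<in> V n (int m - j)"
        proof (cases "?w = \<zero>")
          case True
          thus ?thesis using pi_npow(1) by simp
        next
          case False
          define h where "h = nat (j + int (n * i))"
          have h: "?w = u h" "int h = j + int (n * i)" using False w by (auto simp: h_def split: if_splits)
          have wK: "u h \<in> carrier K" "0 \<le> v (u h)" "int m - int h \<le> v (u h)"
            using u(2) [of h] False h(1) OT_coeff [OF u(1), of h] by (auto simp: V_def OK_carrier)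
          have "v (\<pi> [^] i \<otimes> u h) = int i + v (u h)"
            using v_mult [OF pi_npow(1) wK(1) pi_npow(2), of i] False h pi_npow(3) by simp
          moreover have "int m - j \<le> int n * (int i + v (u h))"
          proof -
            have "v (u h) \<le> int n * v (u h)" using n1 wK(2) mult_right_mono [of 1 "int n" "v (u h)"] by linarith
            thus ?thesis using wK(3) h(2) by (simp add: distrib_left)
          qed
          ultimately show ?thesis using wK(1) pi_npow(1) h(1) by (simp add: V_def)
        qed
        thus ?thesis using jK_pi_pow [OF el_carrier [OF u(1)], of i "- int (n * i)" j] by simp
      qed
      thus "fraction OT s (u \<otimes>\<^bsub>OT\<^esub> pc [^]\<^bsub>OT\<^esub> i) i \<in> FilL (int m)"
        unfolding gen [OF u(1)] e FilL_def
        using LO.m_closed [OF LO.nat_pow_closed [OF \<iota>_carrier [OF OT_pc], of i] el_carrier [OF u(1)]] by blast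
    qed
  qed (use FL.Fil_sub FL.Fil_zero FL.Fil_add FL.Fil_neg in auto)
  have big: "FilL (int m) \<subseteq> G U" if U: "P.ipow I m \<subseteq> U" for m U
  proof
    fix x assume x: "x \<in> FilL (int m)"
    have inI: "series_monom OK b \<otimes>\<^bsub>OT\<^esub> H \<in> P.ipow I m" if "H \<in> carrier OT" "m \<le> b" for b H
    proof -
      have "series_monom OK b \<in> P.ipow I m" using I(2) [of b] P.ipow_antimono [OF I(3) that(2)] by blast
      thus ?thesis using ideal.I_r_closed [OF P.ipow_ideal [OF I(3)], of _ m H] that(1) PO by metis
    qed
    show "x \<in> G U"
    proof (rule LO_decomp [OF x order_refl])
      show "y \<oplus>\<^bsub>LO\<^esub> z \<in> G U" if "y \<in> G U" "z \<in> G U" for y z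
        using generate.eng [OF that [unfolded G_def loc_zero_nbhd_def]]
        unfolding G_def loc_zero_nbhd_def by (simp only: monoid.simps)
    next
      fix H assume H: "H \<in> carrier OT"
      have "el (int m) H = \<iota> (series_monom OK m \<otimes>\<^bsub>OT\<^esub> H)" using \<iota>_mult [OF OT_monom H, of m] \<iota>_monom [of m] by simp
      also have "\<dots> = fraction OT s ((series_monom OK m \<otimes>\<^bsub>OT\<^esub> H) \<otimes>\<^bsub>OT\<^esub> pc [^]\<^bsub>OT\<^esub> (0::nat)) 0"
        using OT.m_closed [OF OT_monom H] OT.r_one by (simp del: OT_simps)
      also have "\<dots> \<in> G U" unfolding G_def loc_zero_nbhd_def
        using inI [OF H order_refl] U by (intro generate.incl) blast
      finally show "el (int m) H \<in> G U" .
    next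
      fix \<gamma> and c :: nat and a :: int
      assume g: "\<gamma> \<in> carrier OK" and a: "int m \<le> int n * int c + a"
      \<comment> \<open>\<open>\<gamma> \<pi>^c T^a = (\<gamma> T^b) (\<pi> / T^n)^c\<close>, and
        \<open>b \<ge> m\<close> puts \<open>\<gamma> T^b\<close> into the \<open>m\<close>-th power
        of the ideal.\<close>
      define b where "b = nat (int n * int c + a)"
      let ?u = "series_monom OK b \<otimes>\<^bsub>OT\<^esub> series_const OK \<gamma>"
      have u: "?u \<in> carrier OT" using OT.m_closed [OF OT_monom OT_const [OF g]] .
      have b: "int b = int n * int c + a" "m \<le> b" using a by (auto simp: b_def)
      have "\<iota> ?u = tpow LO \<tau> (int b) \<otimes>\<^bsub>LO\<^esub> \<iota> (series_const OK \<gamma>)" using \<iota>_mult [OF OT_monom OT_const [OF g], of b] \<iota>_monom [of b] by simp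
      hence "tpow LO \<tau> (- int (n * c)) \<otimes>\<^bsub>LO\<^esub> \<iota> ?u = tpow LO \<tau> a \<otimes>\<^bsub>LO\<^esub> \<iota> (series_const OK \<gamma>)"
        using LO.m_assoc [OF LO.tpow_closed [OF \<tau>_unit] LO.tpow_closed [OF \<tau>_unit] \<iota>_carrier [OF OT_const [OF g]], of "- int (n * c)" "int b"]
          LO.tpow_add [OF \<tau>_unit, of "- int (n * c)" "int b"] b(1) by simp
      moreover have "tpow LO \<tau> (- int (n * c)) \<otimes>\<^bsub>LO\<^esub> (\<iota> ?u \<otimes>\<^bsub>LO\<^esub> \<iota> pc [^]\<^bsub>LO\<^esub> c)
        = (tpow LO \<tau> (- int (n * c)) \<otimes>\<^bsub>LO\<^esub> \<iota> ?u) \<otimes>\<^bsub>LO\<^esub> \<iota> pc [^]\<^bsub>LO\<^esub> c"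
        using LO.m_assoc [OF LO.tpow_closed [OF \<tau>_unit] \<iota>_carrier [OF u] LO.nat_pow_closed [OF \<iota>_carrier [OF OT_pc]]] by simp
      moreover have "(tpow LO \<tau> a \<otimes>\<^bsub>LO\<^esub> \<iota> (series_const OK \<gamma>)) \<otimes>\<^bsub>LO\<^esub> \<iota> pc [^]\<^bsub>LO\<^esub> c
        = \<iota> (series_const OK \<gamma>) \<otimes>\<^bsub>LO\<^esub> (\<iota> pc [^]\<^bsub>LO\<^esub> c \<otimes>\<^bsub>LO\<^esub> tpow LO \<tau> a)"
        using LO.tpow_closed [OF \<tau>_unit, of a] \<iota>_carrier [OF OT_const [OF g]] LO.nat_pow_closed [OF \<iota>_carrier [OF OT_pc], of c]
        by algebra
      ultimately have "\<iota> (series_const OK \<gamma>) \<otimes>\<^bsub>LO\<^esub> (\<iota> pc [^]\<^bsub>LO\<^esub> c \<otimes>\<^bsub>LO\<^esub> tpow LO \<tau> a)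
        = fraction OT s (?u \<otimes>\<^bsub>OT\<^esub> pc [^]\<^bsub>OT\<^esub> c) c" unfolding gen [OF u] by simp
      also have "\<dots> \<in> G U" unfolding G_def loc_zero_nbhd_def
        using inI [OF OT_const [OF g] b(2)] U by (intro generate.incl) blast
      finally show "\<iota> (series_const OK \<gamma>) \<otimes>\<^bsub>LO\<^esub> (\<iota> pc [^]\<^bsub>LO\<^esub> c \<otimes>\<^bsub>LO\<^esub> tpow LO \<tau> a) \<in> G U" .
    qed
  qed
  show ?thesis unfolding top_localisation_def
  proof (rule filt_top_zero_basis)
    show "FilL l \<subseteq> FilL m" if "m \<le> l" for m l using FL.Fil_mono [OF that] .
  next
    fix U assume "U \<in> {loc_zero_nbhd OT pc s U |U. additive_subgroup U OT \<and> openin (opens OT) U}"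
    then obtain W where W: "U = G W" "additive_subgroup W OT" "openin (opens OT) W" by (auto simp: G_def)
    have "\<zero>\<^bsub>OT\<^esub> \<in> W" by (rule additive_subgroup.zero_closed [OF W(2)])
    then obtain m :: int where m: "\<forall>u\<in>P.ipow I (nat m). \<zero>\<^bsub>OT\<^esub> \<oplus>\<^bsub>OT\<^esub> u \<in> W" using W(3) unfolding op by blast
    have "P.ipow I (nat m) \<subseteq> W"
    proof
      fix u assume u: "u \<in> P.ipow I (nat m)"
      hence "u \<in> carrier OT" using I(1) by auto
      thus "u \<in> W" using m u OT.l_zero by metis
    qed
    thus "\<exists>m. FilL m \<subseteq> U" using big W(1) by blast
  next
    fix m
    let ?U = "P.ipow I (nat m)"
    have id: "ideal ?U ?P" by (rule P.ipow_ideal [OF I(3)])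
    have 1: "additive_subgroup ?U OT"
      using ideal.axioms(1) [OF id] PO unfolding additive_subgroup_def subgroup_def by (simp add: m_inv_def)
    have 2: "openin (opens OT) ?U" unfolding op
    proof (intro conjI ballI)
      show "?U \<subseteq> carrier OT" using I(1) by auto
      fix x assume "x \<in> ?U"
      thus "\<exists>l::int. \<forall>u\<in>P.ipow I (nat l). x \<oplus>\<^bsub>OT\<^esub> u \<in> ?U"
        using additive_subgroup.a_closed [OF 1] by blast
    qed
    have "G ?U \<subseteq> FilL m" by (rule subset_trans [OF small FL.Fil_mono]) simp
    thus "\<exists>U\<in>{loc_zero_nbhd OT pc s U |U. additive_subgroup U OT \<and> openin (opens OT) U}. U \<subseteq> FilL m"
    proof (rule bexI)
      show "G ?U \<in> {loc_zero_nbhd OT pc s U |U. additive_subgroup U OT \<and> openin (opens OT) U}"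
        unfolding G_def using 1 2 by blast
    qed
  qed
qed

lemma LT_ring: "filt_top_ring LT FilL \<tau>"
  by (intro filt_top_ring.intro filt_top_ring_axioms.intro LT_filt_top)
    (simp add: top_localisation_def filt_ring_with_topology FilL_filt_ring)

end

section \<open>The completed ring, its separatedness and its reduction\<close>

context dvf_level
begin

abbreviation D where "D \<equiv> D_ring K v \<pi> n"
abbreviation FD where "FD \<equiv> filt_top_ring.CFil LT FilL"
abbreviation dm where "dm \<equiv> completion_map LT"

lemma D_completion: "D = completion LT"
  by (simp add: D_ring_def rational_localisation_def)

lemma D_map_dm: "D_map K v \<pi> n F = dm (\<iota> F)"
  by (simp add: D_map_def rational_localisation_map_def)

lemma LT_LO: "carrier LT = carrier LO" "monoid.mult LT = monoid.mult LO" "ring.add LT = ring.add LO"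
    "one LT = one LO" "ring.zero LT = ring.zero LO" "a_minus LT = a_minus LO" "Units LT = Units LO" "m_inv LT = m_inv LO"
  unfolding top_localisation_def by (simp_all del: localisation_carrier)

lemma LT_npow: "x [^]\<^bsub>LT\<^esub> (a::nat) = x [^]\<^bsub>LO\<^esub> a"
  unfolding top_localisation_def by simp

sublocale LT: filt_top_ring LT FilL \<tau> by (rule LT_ring)

lemma D_complete: "complete_filt_ring D FD (dm \<tau>)"
  unfolding D_completion by (rule LT.completion_complete)

sublocale D: complete_filt_ring D FD "dm \<tau>" by (rule D_complete)

lemma D_filt_top: "filt_top D FD"
  unfolding D_completion by (rule LT.completion_filt_top)

lemma LT_reg: "filt_ring_elem_reg LT FilL \<tau> (\<iota> pc) (int n)"
proof -
  interpret E: filt_ring_elem_reg LO FilL \<tau> "\<iota> pc" "int n" by (rule FilL_reg)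
  show ?thesis by unfold_locales (use E.p_Fil E.p_reg in \<open>auto simp: LT_LO simp del: localisation_carrier\<close>)
qed

lemma D_reg: "filt_ring_elem_reg D FD (dm \<tau>) (dm (\<iota> pc)) (int n)"
  unfolding D_completion by (rule LT.completion_reg [OF LT_reg])

sublocale DE: filt_ring_elem_reg D FD "dm \<tau>" "dm (\<iota> pc)" "int n" by (rule D_reg)

lemma dm_hom: "dm \<in> ring_hom LO D"
  using LT.completion_map_hom unfolding D_completion top_localisation_def ring_hom_with_topology .

lemma dm_FD: "x \<in> carrier LO ==> dm x \<in> FD m \<longleftrightarrow> x \<in> FilL m"
  using LT.completion_map_CFil_iff [of x m] by (simp add: LT_LO del: localisation_carrier)

lemma D_dense: "y \<in> carrier D ==> \<exists>x\<in>carrier LO. D.cg m y (dm x)"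
  using LT.completion_dense [of y m] unfolding D_completion LT_LO(1) .

lemma dm_carrier: "x \<in> carrier LO ==> dm x \<in> carrier D"
  by (rule ring_hom_closed [OF dm_hom])

lemma dm_cg: "x \<in> carrier LO ==> y \<in> carrier LO ==> D.cg m (dm x) (dm y) \<longleftrightarrow> FL.cg m x y"
  using dm_FD [OF LO.minus_closed, of x y m] ring_hom_minus [OF LO.ring_axioms D.ring_axioms dm_hom, of x y] dm_carrier
  by (simp add: D.cg_def FL.cg_def del: localisation_carrier)

lemma dm_tpow: "dm (tpow LO \<tau> a) = tpow D (dm \<tau>) a"
  by (rule ring_hom_tpow [OF LO.is_cring D.is_cring dm_hom \<tau>_unit])

text \<open>An approximation \<open>x\<close> of \<open>d\<close> modulo \<open>FD m\<close> has no
  coefficients below some degree \<open>- q\<close>. As \<open>d\<close> is a multiple of a high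
  power of \<open>\<pi>\<close>, every other coefficient of \<open>x\<close> has large weight too,
  so that \<open>x\<close> and hence \<open>d\<close> lie in \<open>FD m\<close>.\<close>

lemma D_pi_separated:
  assumes d: "d \<in> carrier D" and div: "\<And>j::nat. \<exists>w\<in>carrier D. d = dm (\<iota> pc) [^]\<^bsub>D\<^esub> j \<otimes>\<^bsub>D\<^esub> w"
  shows "d = \<zero>\<^bsub>D\<^esub>"
proof (rule D.sep_nat [OF d])
  fix m :: nat
  obtain x where x: "x \<in> carrier LO" "D.cg (int m) d (dm x)" using D_dense [OF d] by blast
  obtain q where q: "\<And>i. i < - int q ==> jK x i = \<zero>" using jK_bdd [OF x(1)] by blast
  \<comment> \<open>With this exponent the weight of \<open>\<pi>^j\<close> is at least
    \<open>m - i\<close> for every degree \<open>i \<ge> - q\<close>.\<close>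
  define j where "j = m + q"
  have pF: "dm (\<iota> pc) \<in> FD 0" by (rule DE.p_Fil)
  have pjF: "dm (\<iota> pc) [^]\<^bsub>D\<^esub> j \<in> FD 0" by (rule D.Fil_npow [OF pF])
  obtain w where w: "w \<in> carrier D" "d = dm (\<iota> pc) [^]\<^bsub>D\<^esub> j \<otimes>\<^bsub>D\<^esub> w" using div by blast
  obtain w' where w': "w' \<in> carrier LO" "D.cg (int m) w (dm w')" using D_dense [OF w(1)] by blast
  let ?p = "\<iota> pc [^]\<^bsub>LO\<^esub> j"
  have pc: "?p \<in> carrier LO" using \<iota>_carrier [OF OT_pc] by (rule LO.nat_pow_closed)
  have dp: "dm ?p = dm (\<iota> pc) [^]\<^bsub>D\<^esub> j"
    using ring_hom_tpow [OF LO.is_cring D.is_cring dm_hom, of "\<iota> pc"]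
  proof -
    show ?thesis
    proof (induction j)
      case 0
      thus ?case using ring_hom_one [OF dm_hom] by simp
    next
      case (Suc j)
      thus ?case
        using ring_hom_mult [OF dm_hom LO.nat_pow_closed [OF \<iota>_carrier [OF OT_pc], of j] \<iota>_carrier [OF OT_pc]] by simp
    qed
  qed
  have "D.cg (int m) (dm x) (dm (?p \<otimes>\<^bsub>LO\<^esub> w'))"
  proof -
    have "D.cg (int m) (dm x) d" by (rule D.cg_sym [OF x(2)])
    also have "D.cg (int m) d (dm (\<iota> pc) [^]\<^bsub>D\<^esub> j \<otimes>\<^bsub>D\<^esub> dm w')"
      using D.cg_mult_left [OF w'(2) pjF] w(2) by simp
    finally show ?thesis using ring_hom_mult [OF dm_hom pc w'(1)] dp by simp
  qed
  hence cg: "FL.cg (int m) x (?p \<otimes>\<^bsub>LO\<^esub> w')" using dm_cg x(1) w'(1) LO.m_closed [OF pc w'(1)] by blast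
  have "x \<in> FilL (int m)" unfolding FilL_def
  proof (intro CollectI conjI allI x)
    fix i
    show "jK x i \<in> V n (int m - i)"
    proof (cases "i < - int q")
      case True
      thus ?thesis using q by simp
    next
      case False
      define z where "z = x \<ominus>\<^bsub>LO\<^esub> ?p \<otimes>\<^bsub>LO\<^esub> w'"
      have z: "z \<in> FilL (int m)" using cg by (simp add: z_def FL.cg_def)
      have pw: "?p \<otimes>\<^bsub>LO\<^esub> w' \<in> carrier LO" by (rule LO.m_closed [OF pc w'(1)])
      have "x = z \<oplus>\<^bsub>LO\<^esub> ?p \<otimes>\<^bsub>LO\<^esub> w'" unfolding z_def using x(1) pw pc w'(1) by algebra
      hence "jK x i = jK z i \<oplus> \<pi> [^] j \<otimes> jK w' i"
        using jK_add [OF FilL_carrier [OF z] pw, of i] jK_pi_pow [OF w'(1), of j i] by simp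
      moreover have "jK z i \<in> V n (int m - i)" using z by (simp add: FilL_def)
      moreover have "\<pi> [^] j \<otimes> jK w' i \<in> V n (int m - i)"
      proof -
        have "int j \<le> int n * int j" using n1 mult_right_mono [of 1 "int n" "int j"] by linarith
        hence "\<pi> [^] j \<in> V n (int j)" using pi_npow [of j] by (simp add: V_def)
        hence "\<pi> [^] j \<otimes> jK w' i \<in> V n (int j + 0)" by (rule V_mult [OF _ OK_V [OF jK_OK [OF w'(1)]]])
        thus ?thesis by (rule V_mono) (use False in \<open>simp add: j_def\<close>)
      qed
      ultimately show ?thesis using V_add by simp
    qed
  qed
  hence "dm x \<in> FD (int m)" using dm_FD x(1) by blast
  thus "d \<in> FD (int m)" by (rule D.cg_Fil [OF x(2)]) simp
qed

abbreviation kL where "kL \<equiv> laurent_series_ring kk"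

text \<open>In degrees below \<open>m\<close> an element of \<open>FilL m\<close> has coefficients
  of positive valuation, which the residue map kills. Coefficientwise reduction therefore respects
  the filtrations and extends to the completion.\<close>

lemma D_reduction:
  "\<exists>\<rho>\<in>ring_hom D kL. (\<forall>m y. y \<in> FD m --> \<rho> y \<in> laurent_Fil kk m) \<and>
    (\<forall>x\<in>carrier LO. \<forall>i. \<rho> (dm x) i = residue K v (jK x i))"
proof -
  obtain h where h: "h \<in> ring_hom LO kL"
    "\<And>a F. F \<in> carrier OT ==> h (el a F) = (\<lambda>i. laurent_map kk (residue K v) F (i - a))"
    using LO_laurent [OF kk_cring residue_hom] by blast
  have r0: "residue K v \<zero> = \<zero>\<^bsub>kk\<^esub>" using ring_hom_zero' [OF O.ring_axioms k.ring_axioms residue_hom] by simp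
  have hj: "h x i = residue K v (jK x i)" if x: "x \<in> carrier LO" for x i
  proof -
    obtain q :: nat and F where "F \<in> carrier OT" "x = el (- int q) F" using x by (rule elE)
    thus ?thesis using h(2) [of F "- int q"] jK_el [of F "- int q" i] r0 by (simp add: laurent_map_def)
  qed
  have hF: "h x \<in> laurent_Fil kk m" if x: "x \<in> FilL m" for x m
  proof -
    have xc: "x \<in> carrier LO" by (rule FilL_carrier [OF x])
    have "h x i = \<zero>\<^bsub>kk\<^esub>" if i: "i < m" for i
    proof -
      have y: "jK x i \<in> carrier OK" "jK x i \<in> V n (m - i)" using jK_OK [OF xc] x by (auto simp: FilL_def)
      have "jK x i \<in> V 1 1"
      proof (cases "jK x i = \<zero>")
        case False
        hence "1 \<le> int n * v (jK x i)" using y(2) i by (simp add: V_def)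
        moreover have "0 \<le> v (jK x i)" using y(1) False by (simp add: OK_carrier V_def)
        ultimately have "v (jK x i) \<noteq> 0" "0 \<le> v (jK x i)" by auto
        thus ?thesis using OK_K [OF y(1)] by (simp add: V_def)
      qed simp
      thus ?thesis using hj [OF xc] residue_zero_iff [OF y(1)] by simp
    qed
    thus ?thesis using ring_hom_closed [OF h(1) xc] by (simp add: laurent_Fil_def k.laurent_carrier)
  qed
  have "\<exists>g\<in>ring_hom D kL. (\<forall>m y. y \<in> FD m --> g y \<in> laurent_Fil kk m) \<and> (\<forall>x\<in>carrier LO. g (dm x) = h x)"
    by (rule hom_extension [OF FilL_filt_ring D.filt_ring_axioms k.laurent_complete dm_hom dm_FD D_dense h(1) hF])
  then obtain g where g: "g \<in> ring_hom D kL" "\<forall>m y. y \<in> FD m --> g y \<in> laurent_Fil kk m" "\<forall>x\<in>carrier LO. g (dm x) = h x"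
    by blast
  have "\<forall>x\<in>carrier LO. \<forall>i. g (dm x) i = residue K v (jK x i)" using g(3) hj by simp
  thus ?thesis using g by blast
qed

definition \<rho> where
  "\<rho> = (SOME \<rho>. \<rho> \<in> ring_hom D kL \<and> (\<forall>m y. y \<in> FD m --> \<rho> y \<in> laurent_Fil kk m) \<and>
    (\<forall>x\<in>carrier LO. \<forall>i. \<rho> (dm x) i = residue K v (jK x i)))"

lemma \<rho>_hom: "\<rho> \<in> ring_hom D kL"
  and \<rho>_Fil: "y \<in> FD m ==> \<rho> y \<in> laurent_Fil kk m"
  and \<rho>_dm: "x \<in> carrier LO ==> \<rho> (dm x) i = residue K v (jK x i)"
proof -
  have "\<exists>\<rho>. \<rho> \<in> ring_hom D kL \<and> (\<forall>m y. y \<in> FD m --> \<rho> y \<in> laurent_Fil kk m) \<and>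
    (\<forall>x\<in>carrier LO. \<forall>i. \<rho> (dm x) i = residue K v (jK x i))" using D_reduction by blast
  from someI_ex [OF this] show "\<rho> \<in> ring_hom D kL" "y \<in> FD m ==> \<rho> y \<in> laurent_Fil kk m"
    "x \<in> carrier LO ==> \<rho> (dm x) i = residue K v (jK x i)" unfolding \<rho>_def by blast+
qed

lemma \<rho>_is_reduction: "is_D_reduction K v \<pi> n \<rho>"
proof -
  interpret KL: complete_filt_ring kL "laurent_Fil kk" "series_monom kk 1" by (rule k.laurent_complete)
  have "continuous_map (opens D) (opens kL) \<rho>"
  proof (rule filt_top_continuous [OF D_filt_top k.laurent_filt_top])
    show "\<exists>l. \<forall>u\<in>FD l. \<rho> u \<in> laurent_Fil kk m" for m using \<rho>_Fil by blast
  qed (use ring_hom_closed [OF \<rho>_hom] ring_hom_add [OF \<rho>_hom] in auto)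
  moreover have "\<rho> (dm (\<iota> F)) = (\<lambda>i. if i < 0 then \<zero>\<^bsub>kk\<^esub> else residue K v (F (nat i)))" if F: "F \<in> carrier OT" for F
  proof
    fix i
    have r0: "residue K v \<zero> = \<zero>\<^bsub>kk\<^esub>" using ring_hom_zero' [OF O.ring_axioms k.ring_axioms residue_hom] by simp
    show "\<rho> (dm (\<iota> F)) i = (if i < 0 then \<zero>\<^bsub>kk\<^esub> else residue K v (F (nat i)))"
      using \<rho>_dm [OF \<iota>_carrier [OF F], of i] jK_\<iota> [OF F, of i] r0 by simp
  qed
  ultimately show ?thesis using \<rho>_hom by (simp add: is_D_reduction_def cont_ring_hom_def D_map_dm)
qed

text \<open>An approximation of \<open>d\<close> modulo \<open>FD m\<close> has coefficients
  divisible by \<open>\<pi>\<close> below degree \<open>m\<close>, and its remaining part lies in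
  \<open>FD m\<close>. So \<open>d\<close> is a limit of multiples of \<open>\<pi>\<close>, and
  these form a closed set.\<close>

lemma \<rho>_kernel:
  assumes d: "d \<in> carrier D" and r: "\<rho> d = \<zero>\<^bsub>kL\<^esub>"
  shows "\<exists>w\<in>carrier D. d = dm (\<iota> pc) \<otimes>\<^bsub>D\<^esub> w"
proof (rule DE.p_multiple_closed [OF D_complete d])
  fix m :: nat
  interpret KL: complete_filt_ring kL "laurent_Fil kk" "series_monom kk 1" by (rule k.laurent_complete)
  obtain x where x: "x \<in> carrier LO" "D.cg (int m) d (dm x)" using D_dense [OF d] by blast
  have "\<rho> (d \<ominus>\<^bsub>D\<^esub> dm x) \<in> laurent_Fil kk (int m)" using x(2) \<rho>_Fil by (simp add: D.cg_def)
  hence "KL.cg (int m) (\<rho> d) (\<rho> (dm x))"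
    using ring_hom_minus [OF D.ring_axioms KL.ring_axioms \<rho>_hom d dm_carrier [OF x(1)]] ring_hom_closed [OF \<rho>_hom] d dm_carrier [OF x(1)]
    by (simp add: KL.cg_def)
  hence "\<rho> (dm x) \<in> laurent_Fil kk (int m)" using KL.cg_sym [of "int m" "\<rho> d"] KL.cg_zero_iff r by simp
  hence res: "residue K v (jK x i) = \<zero>\<^bsub>kk\<^esub>" if "i < int m" for i
    using that \<rho>_dm [OF x(1), of i] by (simp add: laurent_Fil_def)
  obtain q :: nat and F where F: "F \<in> carrier OT" "x = el (- int q) F" using x(1) by (rule elE)
  define N where "N = m + q"
  have "\<exists>\<gamma>\<in>carrier OK. i < N --> F i = \<pi> \<otimes> \<gamma>" for i
  proof (cases "i < N")
    case True
    have "jK x (int i - int q) = F i" using jK_el [OF F(1), of "- int q" "int i - int q"] F(2) by simp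
    moreover have "int i - int q < int m" using True by (simp add: N_def)
    ultimately have "F i \<in> V 1 1" using res residue_zero_iff [OF OT_coeff [OF F(1)], of i] by metis
    hence "\<exists>\<gamma>\<in>carrier OK. F i = \<pi> [^] (1::nat) \<otimes> \<gamma>" by (intro V_divide) simp
    thus ?thesis using pi(1) by auto
  qed (use O.zero_closed in auto)
  then obtain G where G: "\<And>i. G i \<in> carrier OK" "\<And>i. i < N ==> F i = \<pi> \<otimes> G i" by metis
  define G' where "G' i = (if i < N then G i else \<zero>)" for i
  define H where "H i = F (i + N)" for i
  have G': "G' \<in> carrier OT" using G(1) O.zero_closed by (simp add: G'_def OT_carrier)
  have H: "H \<in> carrier OT" using F(1) by (simp add: H_def OT_carrier)
  have "F = pc \<otimes>\<^bsub>OT\<^esub> G' \<oplus>\<^bsub>OT\<^esub> series_monom OK N \<otimes>\<^bsub>OT\<^esub> H"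
    unfolding OT_const_mult [OF pi_OK G'] OT_monom_mult [OF H]
  proof -
    have "F i = \<pi> \<otimes> G' i \<oplus> (if N \<le> i then H (i - N) else \<zero>)" for i
      using G(2) [of i] OK_K [OF G(1) [of i]] pi(1) OK_K [OF OT_coeff [OF F(1), of i]] by (simp add: G'_def H_def)
    thus "F = (\<lambda>i. \<pi> \<otimes> G' i) \<oplus>\<^bsub>OT\<^esub> (\<lambda>i. if N \<le> i then H (i - N) else \<zero>)" by (simp add: fun_eq_iff)
  qed
  hence "x = el (- int q) (pc \<otimes>\<^bsub>OT\<^esub> G') \<oplus>\<^bsub>LO\<^esub> el (- int q) (series_monom OK N \<otimes>\<^bsub>OT\<^esub> H)"
    using F(2) el_add [OF OT.m_closed [OF OT_pc G'] OT.m_closed [OF OT_monom H]] by metis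
  moreover have "el (- int q) (series_monom OK N \<otimes>\<^bsub>OT\<^esub> H) = el (int m) H"
    using el_shift [OF H, of "- int q" N] by (simp add: N_def)
  moreover have "el (- int q) (pc \<otimes>\<^bsub>OT\<^esub> G') = \<iota> pc \<otimes>\<^bsub>LO\<^esub> el (- int q) G'" by (rule el_mult_\<iota> [OF OT_pc G'])
  ultimately have xe: "x = \<iota> pc \<otimes>\<^bsub>LO\<^esub> el (- int q) G' \<oplus>\<^bsub>LO\<^esub> el (int m) H" by simp
  let ?g = "el (- int q) G'"
  have gc: "?g \<in> carrier LO" "\<iota> pc \<in> carrier LO" using el_carrier [OF G'] \<iota>_carrier [OF OT_pc] by auto
  have "FL.cg (int m) x (\<iota> pc \<otimes>\<^bsub>LO\<^esub> ?g)"
  proof (rule FL.cgI [OF x(1) LO.m_closed [OF gc(2,1)]])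
    have "x \<ominus>\<^bsub>LO\<^esub> \<iota> pc \<otimes>\<^bsub>LO\<^esub> ?g = el (int m) H" unfolding xe using gc el_carrier [OF H, of "int m"] by algebra
    thus "x \<ominus>\<^bsub>LO\<^esub> \<iota> pc \<otimes>\<^bsub>LO\<^esub> ?g \<in> FilL (int m)" using el_FilL [OF H] by simp
  qed
  hence "D.cg (int m) (dm x) (dm (\<iota> pc \<otimes>\<^bsub>LO\<^esub> ?g))" using dm_cg [OF x(1) LO.m_closed [OF gc(2,1)]] by blast
  hence "D.cg (int m) d (dm (\<iota> pc) \<otimes>\<^bsub>D\<^esub> dm ?g)"
    using D.cg_trans [OF x(2)] ring_hom_mult [OF dm_hom gc(2,1)] by simp
  thus "\<exists>y\<in>carrier D. D.cg (int m) d (dm (\<iota> pc) \<otimes>\<^bsub>D\<^esub> y)" using dm_carrier [OF gc(1)] by blast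
qed

abbreviation dmon where "dmon \<gamma> a \<equiv> dm (\<iota> (series_const OK \<gamma>)) \<otimes>\<^bsub>D\<^esub> tpow D (dm \<tau>) a"

text \<open>Topological generation by the monomials \<open>\<gamma> T^a\<close>: an additive
  property has to be tested only on these and on small elements. The factor \<open>\<pi>^c\<close>
  of \<open>LO_decomp\<close> is absorbed into \<open>\<gamma>\<close>.\<close>

lemma D_span:
  assumes d: "d \<in> carrier D"
    and add: "\<And>x y. x \<in> carrier D ==> y \<in> carrier D ==> P x ==> P y ==> P (x \<oplus>\<^bsub>D\<^esub> y)"
    and small: "\<And>x. x \<in> FD m ==> P x"
    and mono: "\<And>\<gamma> a. \<gamma> \<in> carrier OK ==> P (dmon \<gamma> a)"
  shows "P d"
proof -
  obtain x where x: "x \<in> carrier LO" "D.cg m d (dm x)" using D_dense [OF d] by blast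
  obtain l0 where "x \<in> FilL l0" using FL.Fil_exh [OF x(1)] by blast
  hence xl: "x \<in> FilL (min l0 m)" by (rule FL.Fil_monoD) simp
  have "P (dm x)"
  proof (rule LO_decomp [OF xl, of m])
    fix y z assume "y \<in> carrier LO" "z \<in> carrier LO" "P (dm y)" "P (dm z)"
    thus "P (dm (y \<oplus>\<^bsub>LO\<^esub> z))" using add dm_carrier ring_hom_add [OF dm_hom, of y z] by (simp del: localisation_carrier)
  next
    fix H assume "H \<in> carrier OT"
    thus "P (dm (el m H))" using small dm_FD [OF el_carrier] el_FilL by blast
  next
    fix \<gamma> and c :: nat and a assume g: "\<gamma> \<in> carrier OK"
    have pcK: "\<pi> [^] c \<in> carrier OK" using pi_OK O.nat_pow_closed OK_npow by metis
    have g': "\<gamma> \<otimes> \<pi> [^] c \<in> carrier OK" using O.m_closed [OF g pcK] by simp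
    have "series_const OK \<gamma> \<otimes>\<^bsub>OT\<^esub> (pc [^]\<^bsub>OT\<^esub> c) = series_const OK (\<gamma> \<otimes> \<pi> [^] c)"
      unfolding OT_const_pow OT_const_mult [OF g OT_const [OF pcK]]
      using OK_K [OF g] by (auto simp: series_const_def fun_eq_iff)
    hence e: "\<iota> (series_const OK \<gamma>) \<otimes>\<^bsub>LO\<^esub> \<iota> pc [^]\<^bsub>LO\<^esub> c = \<iota> (series_const OK (\<gamma> \<otimes> \<pi> [^] c))"
      using \<iota>_mult [OF OT_const [OF g] OT.nat_pow_closed [OF OT_pc, of c]] \<iota>_npow [OF OT_pc, of c] by simp
    have "\<iota> (series_const OK \<gamma>) \<otimes>\<^bsub>LO\<^esub> (\<iota> pc [^]\<^bsub>LO\<^esub> c \<otimes>\<^bsub>LO\<^esub> tpow LO \<tau> a)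
      = \<iota> (series_const OK (\<gamma> \<otimes> \<pi> [^] c)) \<otimes>\<^bsub>LO\<^esub> tpow LO \<tau> a"
      unfolding e [symmetric]
      using LO.m_assoc [OF \<iota>_carrier [OF OT_const [OF g]] LO.nat_pow_closed [OF \<iota>_carrier [OF OT_pc]] LO.tpow_closed [OF \<tau>_unit]] by simp
    hence "dm (\<iota> (series_const OK \<gamma>) \<otimes>\<^bsub>LO\<^esub> (\<iota> pc [^]\<^bsub>LO\<^esub> c \<otimes>\<^bsub>LO\<^esub> tpow LO \<tau> a)) = dmon (\<gamma> \<otimes> \<pi> [^] c) a"
      using ring_hom_mult [OF dm_hom \<iota>_carrier [OF OT_const [OF g']] LO.tpow_closed [OF \<tau>_unit]] dm_tpow [of a] by simp
    thus "P (dm (\<iota> (series_const OK \<gamma>) \<otimes>\<^bsub>LO\<^esub> (\<iota> pc [^]\<^bsub>LO\<^esub> c \<otimes>\<^bsub>LO\<^esub> tpow LO \<tau> a)))" using mono [OF g'] by simp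
  qed simp
  moreover have "P (d \<ominus>\<^bsub>D\<^esub> dm x)" using small x(2) by (simp add: D.cg_def)
  moreover have "d = dm x \<oplus>\<^bsub>D\<^esub> (d \<ominus>\<^bsub>D\<^esub> dm x)" using d dm_carrier [OF x(1)] by algebra
  ultimately show ?thesis using add dm_carrier [OF x(1)] d by (metis D.minus_closed)
qed

end

section \<open>Pseudoaffinoid algebras\<close>

lemma (in cring) ideal_of_closed:
  assumes "J \<subseteq> carrier R" "\<zero> \<in> J" "\<And>a b. a \<in> J ==> b \<in> J ==> a \<oplus> b \<in> J"
    and m: "\<And>x a. x \<in> carrier R ==> a \<in> J ==> x \<otimes> a \<in> J"
  shows "ideal J R"
proof (rule idealI [OF ring_axioms])
  show "subgroup J (add_monoid R)"
  proof (rule add.subgroupI)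
    fix a assume a: "a \<in> J"
    hence "a \<in> carrier R" using assms by blast
    hence "\<ominus> a = (\<ominus> \<one>) \<otimes> a" by algebra
    thus "\<ominus> a \<in> J" using m [of "\<ominus> \<one>" a] a by simp
  qed (use assms in auto)
  fix a x assume "a \<in> J" "x \<in> carrier R"
  thus "x \<otimes> a \<in> J" by (intro m)
  thus "a \<otimes> x \<in> J" using m_comm [of a x] \<open>a \<in> J\<close> \<open>x \<in> carrier R\<close> assms(1) by auto
qed

lemma (in filt_top_ring) complete_filt_ringI:
  assumes c: "complete_top_ring R"
  shows "complete_filt_ring R Fil t"
proof (intro complete_filt_ring.intro complete_filt_ring_axioms.intro filt_ring_axioms)
  fix x assume x: "x \<in> carrier R" "\<And>m. x \<in> Fil m"
  show "x = \<zero>"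
  proof (rule ccontr)
    assume "x \<noteq> \<zero>"
    moreover have "Hausdorff_space (opens R)" using c by (simp add: complete_top_ring_def)
    ultimately obtain U W where U: "openin (opens R) U" "\<zero> \<in> U" "x \<in> W" "disjnt U W"
      using x(1) zero_closed unfolding Hausdorff_space_def topspace_carrier by metis
    obtain m where "Fil m \<subseteq> U" using openin_zeroD [OF U(1,2)] by blast
    thus False using x(2) [of m] U by (auto simp: disjnt_def)
  qed
next
  fix s :: "nat => 'a"
  assume s: "\<And>m. s m \<in> carrier R" "\<And>m. cg (int m) (s (Suc m)) (s m)"
  have far: "cg (int N) (s (N + k)) (s N)" for N k
  proof (induction k)
    case 0
    thus ?case using s(1) by simp
  next
    case (Suc k)
    have "cg (int N) (s (Suc (N + k))) (s (N + k))" by (rule cg_mono [OF s(2) [of "N + k"]]) simp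
    thus ?case using Suc cg_trans by auto
  qed
  have ycg: "cg m (s i) (s N)" if "m \<le> int N" "i \<ge> N" for m i N
    using cg_mono [OF far [of N "i - N"] that(1)] that(2) by simp
  have "cauchy_seq R s" unfolding cauchy_seq_iff
  proof (intro conjI allI)
    fix m
    have "cg m (s i) (s j)" if "i \<ge> nat m" "j \<ge> nat m" for i j
      using cg_trans [OF ycg [of m "nat m" i] cg_sym [OF ycg [of m "nat m" j]]] that by simp
    thus "\<exists>N. \<forall>i\<ge>N. \<forall>j\<ge>N. cg m (s i) (s j)" by blast
  qed (fact s(1))
  then obtain y where "limitin (opens R) s y sequentially" using c by (auto simp: complete_top_ring_def)
  hence y: "y \<in> carrier R" "\<And>m. \<exists>N. \<forall>i\<ge>N. cg m (s i) y" using limitin_iff [of s y] s(1) by auto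
  have "cg (int m) y (s m)" for m
  proof -
    obtain N where "\<forall>i\<ge>N. cg (int m) (s i) y" using y(2) by blast
    hence "cg (int m) (s (max N m)) y" by simp
    moreover have "cg (int m) (s (max N m)) (s m)" by (rule ycg) auto
    ultimately show ?thesis by (meson cg_sym cg_trans)
  qed
  thus "\<exists>y\<in>carrier R. \<forall>m. cg (int m) y (s m)" using y(1) by blast
qed

context dvf
begin

text \<open>Flatness is applied to multiplication by \<open>\<pi>\<close> on a copy \<open>N\<close>
  of the integers: \<open>\<pi> \<otimes> a = 1 \<otimes> \<pi> a = 0\<close> forces
  \<open>1 \<otimes> a = 0\<close>, and the action map from the tensor product to \<open>A\<close>
  turns this into \<open>a = 0\<close>.\<close>

lemma flat_torsion_free:
  fixes A :: "('a, 'b) ring_scheme"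
  assumes A: "cring A" and \<eta>: "\<eta> \<in> ring_hom OK A" and fl: "flat_via OK A \<eta>"
    and a: "a \<in> carrier A" and pa: "\<eta> \<pi> \<otimes>\<^bsub>A\<^esub> a = \<zero>\<^bsub>A\<^esub>"
  shows "a = \<zero>\<^bsub>A\<^esub>"
proof -
  interpret A: cring A by fact
  \<comment> \<open>\<open>flat_module\<close> quantifies over modules whose elements are sets of
    sequences; an integer is coded as the singleton of a constant sequence.\<close>
  define e :: "'k => (nat => 'k) set" where "e x = {\<lambda>_. x}" for x
  define unw where "unw X1 = the_elem X1 (0::nat)" for X1 :: "(nat => 'k) set"
  have ue [simp]: "unw (e x) = x" for x by (simp add: unw_def e_def)
  define N :: "('k, (nat => 'k) set) module" where
    "N = \<lparr>carrier = e ` carrier OK, monoid.mult = undefined, one = undefined, ring.zero = e \<zero>\<^bsub>K\<^esub>,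
      ring.add = (\<lambda>X1 Y1. e (unw X1 \<oplus>\<^bsub>K\<^esub> unw Y1)), smult = (\<lambda>r X1. e (r \<otimes>\<^bsub>K\<^esub> unw X1))\<rparr>"
  let ?M = "module_via A \<eta>"
  have Nc: "carrier N = e ` carrier OK" and Nz: "\<zero>\<^bsub>N\<^esub> = e \<zero>\<^bsub>K\<^esub>" and Na: "X1 \<oplus>\<^bsub>N\<^esub> Y1 = e (unw X1 \<oplus>\<^bsub>K\<^esub> unw Y1)"
    and Ns: "r \<odot>\<^bsub>N\<^esub> X1 = e (r \<otimes>\<^bsub>K\<^esub> unw X1)" for X1 Y1 r by (simp_all add: N_def)
  have Mc: "carrier ?M = carrier A" and Mz: "\<zero>\<^bsub>?M\<^esub> = \<zero>\<^bsub>A\<^esub>" and Ma: "x \<oplus>\<^bsub>?M\<^esub> y = x \<oplus>\<^bsub>A\<^esub> y"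
    and Ms: "r \<odot>\<^bsub>?M\<^esub> x = \<eta> r \<otimes>\<^bsub>A\<^esub> x" for x y r by (simp_all add: module_via_def)
  have abN: "abelian_group N"
  proof (rule abelian_groupI)
    fix X1 assume "X1 \<in> carrier N"
    then obtain x where x: "x \<in> carrier OK" "X1 = e x" by (auto simp: Nc)
    thus "\<exists>Y1\<in>carrier N. Y1 \<oplus>\<^bsub>N\<^esub> X1 = \<zero>\<^bsub>N\<^esub>"
      using O.l_neg [OF x(1)] O.a_inv_closed [OF x(1)] by (intro bexI [of _ "e (\<ominus>\<^bsub>OK\<^esub> x)"]) (simp_all add: Na Nz Nc)
  qed (use O.add.m_closed O.zero_closed OK_K in \<open>auto simp: Nc Nz Na K.a_ac\<close>)
  have modN: "Module.module OK N"
  proof (rule moduleI [OF OK_cring abN])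
  qed (use O.m_closed O.one_closed OK_K in \<open>auto simp: Nc Ns Na K.l_distr K.r_distr K.m_assoc\<close>)
  define f where "f X1 = e (\<pi> \<otimes>\<^bsub>K\<^esub> unw X1)" for X1
  have fl: "f \<in> linear_maps OK N N"
    unfolding linear_maps_def hom_def f_def
    using O.m_closed [OF pi_OK] O.add.m_closed OK_K pi(1) by (auto simp: Nc Na Ns K.r_distr K.m_lcomm)
  have finj: "inj_on f (carrier N)"
  proof (rule inj_onI)
    fix X1 Y1 assume "X1 \<in> carrier N" "Y1 \<in> carrier N" and fe: "f X1 = f Y1"
    then obtain x y where x: "x \<in> carrier OK" "X1 = e x" "y \<in> carrier OK" "Y1 = e y" by (auto simp: Nc)
    have "\<pi> \<otimes>\<^bsub>K\<^esub> x = \<pi> \<otimes>\<^bsub>K\<^esub> y" using arg_cong [OF fe, of unw] x by (simp add: f_def)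
    thus "X1 = Y1" using K.m_lcancel [OF pi(2,1)] OK_K x by simp
  qed
  have e1: "e \<one>\<^bsub>K\<^esub> \<in> carrier N" "e \<zero>\<^bsub>K\<^esub> \<in> carrier N" using O.one_closed O.zero_closed by (auto simp: Nc)
  have "tensor_eq OK N ?M [(\<pi> \<odot>\<^bsub>N\<^esub> e \<one>\<^bsub>K\<^esub>, a)] [(e \<one>\<^bsub>K\<^esub>, \<pi> \<odot>\<^bsub>?M\<^esub> a)]"
    by (rule tensor_eq.balanced [OF pi_OK e1(1)]) (use a Mc in simp)
  \<comment> \<open>The rules annihilate a zero only on the left; balancing the scalar zero moves it
    there and shows that \<open>1 \<otimes> 0\<close> vanishes.\<close>
  moreover have "tensor_eq OK N ?M [(\<zero>\<^bsub>K\<^esub> \<odot>\<^bsub>N\<^esub> e \<one>\<^bsub>K\<^esub>, \<zero>\<^bsub>A\<^esub>)] [(e \<one>\<^bsub>K\<^esub>, \<zero>\<^bsub>K\<^esub> \<odot>\<^bsub>?M\<^esub> \<zero>\<^bsub>A\<^esub>)]"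
    by (rule tensor_eq.balanced [OF _ e1(1)]) (use O.zero_closed Mc in auto)
  moreover have "tensor_eq OK N ?M [(\<zero>\<^bsub>N\<^esub>, \<zero>\<^bsub>A\<^esub>)] []" by (rule tensor_eq.zero) (simp add: Mc)
  moreover have "\<pi> \<odot>\<^bsub>?M\<^esub> a = \<zero>\<^bsub>A\<^esub>" "\<zero>\<^bsub>K\<^esub> \<odot>\<^bsub>?M\<^esub> \<zero>\<^bsub>A\<^esub> = \<zero>\<^bsub>A\<^esub>" "\<zero>\<^bsub>K\<^esub> \<odot>\<^bsub>N\<^esub> e \<one>\<^bsub>K\<^esub> = \<zero>\<^bsub>N\<^esub>"
    using pa ring_hom_closed [OF \<eta> O.zero_closed] by (simp_all add: Ms Ns Nz)
  moreover have "\<pi> \<odot>\<^bsub>N\<^esub> e \<one>\<^bsub>K\<^esub> = f (e \<one>\<^bsub>K\<^esub>)" by (simp add: Ns f_def)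
  ultimately have "tensor_eq OK N ?M [(f (e \<one>\<^bsub>K\<^esub>), a)] []"
    by (metis tensor_eq.trans tensor_eq.sym)
  hence "tensor_eq OK N ?M (map (apfst f) [(e \<one>\<^bsub>K\<^esub>, a)]) (map (apfst f) [])" by simp
  moreover have "set [(e \<one>\<^bsub>K\<^esub>, a)] \<subseteq> carrier N \<times> carrier ?M" using e1 a by (simp add: Mc)
  ultimately have te: "tensor_eq OK N ?M [(e \<one>\<^bsub>K\<^esub>, a)] []"
    using assms(3) modN fl finj unfolding flat_via_def flat_module_def by (metis empty_set empty_subsetI)
  \<comment> \<open>The action map, evaluated on formal sums of tensors.\<close>
  define ev where "ev xs = foldr (\<lambda>(X1, m) s. (\<eta> (unw X1) \<otimes>\<^bsub>A\<^esub> m) \<oplus>\<^bsub>A\<^esub> s) xs \<zero>\<^bsub>A\<^esub>" for xs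
  have ev_simps [simp]: "ev [] = \<zero>\<^bsub>A\<^esub>" "ev ((X1, m) # xs) = (\<eta> (unw X1) \<otimes>\<^bsub>A\<^esub> m) \<oplus>\<^bsub>A\<^esub> ev xs" for X1 m xs
    by (simp_all add: ev_def)
  let ?C = "carrier N \<times> carrier ?M"
  have unc: "unw X1 \<in> carrier OK" if "X1 \<in> carrier N" for X1 using that by (auto simp: Nc)
  have evc: "ev xs \<in> carrier A" if "set xs \<subseteq> ?C" for xs
    using that by (induction xs) (auto simp: Mc intro!: A.add.m_closed A.m_closed ring_hom_closed [OF \<eta>] unc)
  have ev_app: "ev (xs @ ys) = ev xs \<oplus>\<^bsub>A\<^esub> ev ys" if "set xs \<subseteq> ?C" "set ys \<subseteq> ?C" for xs ys
    using that
  proof (induction xs)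
    case (Cons p xs)
    obtain X1 m where p: "p = (X1, m)" by force
    have "\<eta> (unw X1) \<otimes>\<^bsub>A\<^esub> m \<in> carrier A" using Cons.prems p Mc ring_hom_closed [OF \<eta> unc [of X1]] by auto
    thus ?case using Cons p evc by (simp add: A.a_assoc)
  qed (use evc in simp)
  \<comment> \<open>Membership in the carriers belongs to the invariant, because
    \<open>refl\<close>, \<open>sym\<close> and \<open>trans\<close> impose no condition on the
    lists.\<close>
  have inv: "(set xs \<subseteq> ?C \<longleftrightarrow> set ys \<subseteq> ?C) \<and> (set xs \<subseteq> ?C --> ev xs = ev ys)"
    if "tensor_eq OK N ?M xs ys" for xs ys
    using that
  proof (induction rule: tensor_eq.induct)
    case (cong xs ys us vs)
    thus ?case using ev_app [of us "xs @ vs"] ev_app [of us "ys @ vs"] ev_app [of xs vs] ev_app [of ys vs] by auto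
  next
    case (comm p q)
    obtain X1 m Y1 l where p: "p = (X1, m)" "q = (Y1, l)" by force
    have "\<eta> (unw X1) \<otimes>\<^bsub>A\<^esub> m \<in> carrier A" "\<eta> (unw Y1) \<otimes>\<^bsub>A\<^esub> l \<in> carrier A"
      using comm p Mc ring_hom_closed [OF \<eta> unc [of X1]] ring_hom_closed [OF \<eta> unc [of Y1]] by auto
    thus ?case using comm p by (simp add: A.a_ac)
  next
    case (zero m)
    thus ?case using e1 ring_hom_zero' [OF O.ring_axioms A.ring_axioms \<eta>] by (simp add: Nz Mc)
  next
    case (add_left x y m)
    have u: "unw x \<in> carrier OK" "unw y \<in> carrier OK" using unc add_left by auto
    have c: "\<eta> (unw x) \<in> carrier A" "\<eta> (unw y) \<in> carrier A" "m \<in> carrier A"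
      using add_left ring_hom_closed [OF \<eta>] u Mc by auto
    have "\<eta> (unw x \<oplus>\<^bsub>K\<^esub> unw y) = \<eta> (unw x) \<oplus>\<^bsub>A\<^esub> \<eta> (unw y)" using ring_hom_add [OF \<eta> u] by simp
    thus ?case using add_left c O.add.m_closed [OF u] by (simp add: Na Nc A.l_distr A.a_assoc)
  next
    case (add_right x m m')
    have c: "\<eta> (unw x) \<in> carrier A" "m \<in> carrier A" "m' \<in> carrier A"
      using add_right ring_hom_closed [OF \<eta> unc] Mc by auto
    thus ?case using add_right by (simp add: Ma Mc A.r_distr A.a_assoc)
  next
    case (balanced r x m)
    have c: "\<eta> r \<in> carrier A" "\<eta> (unw x) \<in> carrier A" "m \<in> carrier A" "unw x \<in> carrier OK"
      using balanced ring_hom_closed [OF \<eta>] unc Mc by auto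
    have "\<eta> (r \<otimes>\<^bsub>K\<^esub> unw x) = \<eta> r \<otimes>\<^bsub>A\<^esub> \<eta> (unw x)" using ring_hom_mult [OF \<eta> balanced(1) c(4)] by simp
    thus ?case using balanced c O.m_closed [OF balanced(1) c(4)] by (simp add: Ns Ms Mc Nc A.m_ac)
  qed auto
  have "ev [(e \<one>\<^bsub>K\<^esub>, a)] = ev []" using inv [OF te] e1 a by (simp add: Mc)
  thus ?thesis using a ring_hom_one [OF \<eta>] by simp
qed

end

text \<open>Polynomials in \<open>w\<close> of degree below \<open>d\<close> with coefficients in
  \<open>B\<close>, as an inductive predicate to avoid sums over index sets. For
  \<open>d = 0\<close> only zero remains.\<close>

inductive wspan for R :: "('a, 'b) ring_scheme" (structure) and B :: "'a set" and w :: 'a and d :: nat where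
  zero: "wspan R B w d \<zero>"
| step: "b \<in> B ==> i < d ==> wspan R B w d y ==> wspan R B w d (b \<otimes> w [^] i \<oplus> y)"

context cring
begin

lemma wspan_carrier: "wspan R B w d y ==> B \<subseteq> carrier R ==> w \<in> carrier R ==> y \<in> carrier R"
  by (induction rule: wspan.induct) auto

lemma wspan_add:
  assumes "wspan R B w d x" "wspan R B w d y" "B \<subseteq> carrier R" "w \<in> carrier R"
  shows "wspan R B w d (x \<oplus> y)"
  using assms
proof (induction rule: wspan.induct)
  case zero
  thus ?case using wspan_carrier by simp
next
  case (step b i x)
  have "b \<in> carrier R" "x \<in> carrier R" "y \<in> carrier R" "w [^] i \<in> carrier R"
    using step wspan_carrier by auto
  hence "b \<otimes> w [^] i \<oplus> x \<oplus> y = b \<otimes> w [^] i \<oplus> (x \<oplus> y)" by (simp add: a_assoc)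
  thus ?case using step by (auto intro: wspan.step)
qed

lemma wspan_mult:
  assumes "wspan R B w d x" "b \<in> B" "B \<subseteq> carrier R" "w \<in> carrier R"
    and m: "\<And>a b. a \<in> B ==> b \<in> B ==> a \<otimes> b \<in> B"
  shows "wspan R B w d (b \<otimes> x)"
  using assms(1)
proof (induction rule: wspan.induct)
  case zero
  show ?case using assms(2,3) wspan.zero [of R B w d] by auto
next
  case (step c i x)
  have "b \<in> carrier R" "c \<in> carrier R" "x \<in> carrier R" "w [^] i \<in> carrier R"
    using step assms wspan_carrier by auto
  hence "b \<otimes> (c \<otimes> w [^] i \<oplus> x) = (b \<otimes> c) \<otimes> w [^] i \<oplus> b \<otimes> x" by (simp add: r_distr m_assoc)
  thus ?case using step m [OF assms(2) step(1)] by (auto intro: wspan.step)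
qed

lemma wspan_mono: "wspan R B w d x ==> d \<le> d' ==> B \<subseteq> B' ==> wspan R B' w d' x"
  by (induction rule: wspan.induct) (auto intro: wspan.intros)

text \<open>The usual integrality argument: multiplication by \<open>w\<close> preserves the span,
  since an overflowing power \<open>w^d\<close> is rewritten by the given relation.\<close>

lemma wspan_power:
  assumes "B \<subseteq> carrier R" "w \<in> carrier R" "\<one> \<in> B" and m: "\<And>a b. a \<in> B ==> b \<in> B ==> a \<otimes> b \<in> B"
    and d: "0 < d" and wd: "wspan R B w d (w [^] d)"
  shows "wspan R B w d (w [^] (j::nat))"
proof -
  have w: "wspan R B w d (w \<otimes> y)" if "wspan R B w d y" for y
    using that
  proof (induction rule: wspan.induct)
    case zero
    show ?case using assms(2) wspan.zero [of R B w d] by simp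
  next
    case (step b i y)
    have c: "b \<in> carrier R" "y \<in> carrier R" "w \<in> carrier R" using step assms wspan_carrier by auto
    hence e: "w \<otimes> (b \<otimes> w [^] i \<oplus> y) = b \<otimes> w [^] Suc i \<oplus> w \<otimes> y"
      by (simp add: r_distr m_ac)
    have "wspan R B w d (b \<otimes> w [^] Suc i)"
    proof (cases "Suc i < d")
      case True
      have "wspan R B w d (b \<otimes> w [^] Suc i \<oplus> \<zero>)" by (rule wspan.step [OF step(1) True wspan.zero])
      thus ?thesis using c by simp
    next
      case False
      hence "Suc i = d" using step(2) by simp
      thus ?thesis using wspan_mult [OF wd step(1) assms(1,2) m] by simp
    qed
    thus ?case unfolding e using step.IH by (rule wspan_add [OF _ _ assms(1,2)])
  qed
  show ?thesis
  proof (induction j)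
    case 0
    have "wspan R B w d (\<one> \<otimes> w [^] (0::nat) \<oplus> \<zero>)" by (rule wspan.step [OF assms(3) d wspan.zero])
    thus ?case by simp
  next
    case (Suc j)
    thus ?case using w [OF Suc] assms(2) by (simp add: m_comm)
  qed
qed

end

section \<open>The filtration of a pseudoaffinoid algebra by powers of T\<close>

locale psa = dvf K v \<pi> for K :: "('k, 'm) ring_scheme" and v \<pi> +
  fixes A :: "('a, 'b) top_ring_scheme" (structure) and \<eta> :: "'k => 'a" and T :: 'a
  assumes psa: "pseudoaffinoid OK A \<eta>" and flat: "flat_via OK A \<eta>"
    and pi_nonunit: "\<eta> \<pi> \<notin> Units A" and T_unit: "T \<in> Units A" and T_nil: "top_nilpotent A T"
begin

abbreviation p where "p \<equiv> \<eta> \<pi>"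

lemma A_top: "topological_ring A" and A_compl: "complete_top_ring A" and \<eta>_hom: "\<eta> \<in> ring_hom OK A"
  using psa by (auto simp: pseudoaffinoid_def tate_ring_def cont_ring_hom_def)

sublocale A: cring A using A_top by (simp add: topological_ring_def)

lemma T_carrier [simp]: "T \<in> carrier A" using T_unit by (rule A.Units_closed)

lemma A_topspace: "topspace (opens A) = carrier A"
  using A_top by (simp add: topological_ring_def)

lemma openin_translate:
  assumes U: "openin (opens A) U" and x: "x \<in> carrier A"
  shows "openin (opens A) {y \<in> carrier A. x \<oplus> y \<in> U}"
proof -
  have "continuous_map (opens A) (prod_topology (opens A) (opens A)) (\<lambda>y. (x, y))"
    using x A_topspace by (intro continuous_map_pairedI) auto
  hence "continuous_map (opens A) (opens A) ((\<lambda>(x, y). x \<oplus> y) \<circ> (\<lambda>y. (x, y)))"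
    using A_top unfolding topological_ring_def by (intro continuous_map_compose [of _ "prod_topology (opens A) (opens A)"]) auto
  from openin_continuous_map_preimage [OF this U] show ?thesis by (simp add: A_topspace)
qed

lemma openin_scale:
  assumes U: "openin (opens A) U" and x: "x \<in> carrier A"
  shows "openin (opens A) {y \<in> carrier A. x \<otimes> y \<in> U}"
proof -
  have "continuous_map (opens A) (prod_topology (opens A) (opens A)) (\<lambda>y. (x, y))"
    using x A_topspace by (intro continuous_map_pairedI) auto
  hence "continuous_map (opens A) (opens A) ((\<lambda>(x, y). x \<otimes> y) \<circ> (\<lambda>y. (x, y)))"
    using A_top unfolding topological_ring_def by (intro continuous_map_compose [of _ "prod_topology (opens A) (opens A)"]) auto
  from openin_continuous_map_preimage [OF this U] show ?thesis by (simp add: A_topspace)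
qed

lemma T_power_in:
  assumes "openin (opens A) U" "\<zero> \<in> U"
  shows "\<exists>i0. \<forall>i\<ge>i0. T [^] (i::nat) \<in> U"
  using T_nil assms unfolding top_nilpotent_def limitin_def eventually_sequentially by blast

definition A0 where
  "A0 = (SOME A0. ring_of_definition A A0 \<and> formally_of_finite_type OK (sub_top_ring A A0) \<eta>)"

lemma A0: "ring_of_definition A A0" "formally_of_finite_type OK (sub_top_ring A A0) \<eta>"
proof -
  have "\<exists>A0. ring_of_definition A A0 \<and> formally_of_finite_type OK (sub_top_ring A A0) \<eta>"
    using psa by (auto simp: pseudoaffinoid_def)
  from someI_ex [OF this] show "ring_of_definition A A0" "formally_of_finite_type OK (sub_top_ring A A0) \<eta>"
    unfolding A0_def by blast+
qed

abbreviation B0 where "B0 \<equiv> sub_top_ring A A0"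

lemma B0_simps [simp]: "carrier B0 = A0" "monoid.mult B0 = monoid.mult A" "one B0 = one A"
    "ring.zero B0 = ring.zero A" "ring.add B0 = ring.add A" "opens B0 = subtopology (opens A) A0"
  by (simp_all add: sub_top_ring_def)

lemma B0_cring: "cring B0" and B0_noeth: "noetherian_ring B0" and \<eta>_A0: "x \<in> carrier OK ==> \<eta> x \<in> A0"
  using A0(2) ring_hom_closed [of \<eta> OK B0 x] by (auto simp: formally_of_finite_type_def topological_ring_def cont_ring_hom_def)

sublocale B0: cring B0 by (rule B0_cring)

lemma A0_sub: "A0 \<subseteq> carrier A" and A0_open: "openin (opens A) A0"
  using A0(1) subringE(1) by (auto simp: ring_of_definition_def)

lemma A0_carrier: "x \<in> A0 ==> x \<in> carrier A" using A0_sub by blast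

lemma A0_ops: "\<zero> \<in> A0" "\<one> \<in> A0" "x \<in> A0 ==> y \<in> A0 ==> x \<oplus> y \<in> A0"
    "x \<in> A0 ==> y \<in> A0 ==> x \<otimes> y \<in> A0" "x \<in> A0 ==> \<ominus> x \<in> A0"
  using A0(1) subringE [of A0 A] by (auto simp: ring_of_definition_def)

definition k0 where "k0 = (SOME k0::nat. \<forall>i\<ge>k0. T [^] (i::nat) \<in> A0)"

lemma k0: "i \<ge> k0 ==> T [^] (i::nat) \<in> A0"
  using someI_ex [OF T_power_in [OF A0_open A0_ops(1)]] unfolding k0_def by blast

text \<open>\<open>A\<^sub>1 = A\<^sub>0[T]\<close> replaces \<open>A\<^sub>0\<close> because \<open>T\<close> itself need not lie in \<open>A\<^sub>0\<close>.\<close>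

inductive_set A1 :: "'a set" where
  zero: "\<zero> \<in> A1"
| step: "a \<in> A0 ==> x \<in> A1 ==> a \<otimes> T [^] (i::nat) \<oplus> x \<in> A1"

lemma A1_carrier: "x \<in> A1 ==> x \<in> carrier A"
  by (induction rule: A1.induct) (auto simp: A0_carrier)

lemma A1_add: "x \<in> A1 ==> y \<in> A1 ==> x \<oplus> y \<in> A1"
proof (induction rule: A1.induct)
  case (step a x i)
  hence "a \<otimes> T [^] i \<oplus> x \<oplus> y = a \<otimes> T [^] i \<oplus> (x \<oplus> y)"
    using A0_carrier A1_carrier by (intro A.a_assoc) auto
  thus ?case using step by (auto intro: A1.step)
qed (simp add: A1_carrier)

lemma A1_term: "a \<in> A0 ==> a \<otimes> T [^] (i::nat) \<in> A1"
  using A1.step [OF _ A1.zero, of a i] A0_carrier by simp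

lemma A1_mult_term: "x \<in> A1 ==> b \<in> A0 ==> (b \<otimes> T [^] (j::nat)) \<otimes> x \<in> A1"
proof (induction rule: A1.induct)
  case (step a x i)
  have c: "a \<in> carrier A" "b \<in> carrier A" "x \<in> carrier A" "T [^] i \<in> carrier A" "T [^] j \<in> carrier A"
    using step A0_carrier A1_carrier by auto
  hence "(b \<otimes> T [^] j) \<otimes> (a \<otimes> T [^] i \<oplus> x)
    = (b \<otimes> a) \<otimes> (T [^] j \<otimes> T [^] i) \<oplus> (b \<otimes> T [^] j) \<otimes> x" by algebra
  thus ?case using step A1.step [OF A0_ops(4) [OF step.prems step(1)], of _ "j + i"] by (simp add: A.nat_pow_mult)
qed (use A1.zero A0_carrier in simp)

lemma A1_mult: "x \<in> A1 ==> y \<in> A1 ==> x \<otimes> y \<in> A1"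
proof (induction rule: A1.induct)
  case (step a x i)
  hence "(a \<otimes> T [^] i \<oplus> x) \<otimes> y = (a \<otimes> T [^] i) \<otimes> y \<oplus> x \<otimes> y"
    using A0_carrier A1_carrier by (intro A.l_distr) auto
  thus ?case using step A1_add A1_mult_term by simp
qed (use A1.zero A1_carrier in simp)

lemma A0_A1: "a \<in> A0 ==> a \<in> A1"
  using A1_term [of a 0] A0_carrier by simp

lemma A1_T: "T [^] (i::nat) \<in> A1"
  using A1_term [OF A0_ops(2), of i] by simp

lemma A1_neg: "x \<in> A1 ==> \<ominus> x \<in> A1"
proof -
  assume x: "x \<in> A1"
  have xc: "x \<in> carrier A" using x by (rule A1_carrier)
  have "\<ominus> x = (\<ominus> \<one>) \<otimes> x" using xc by algebra
  thus ?thesis using A1_mult [OF A0_A1 [OF A0_ops(5) [OF A0_ops(2)]] x] by simp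
qed

text \<open>Only powers of \<open>T\<close> below \<open>k0\<close> can fail to lie in
  \<open>A0\<close>, and one factor \<open>T^j\<close> with \<open>j \<ge> k0\<close> repairs all of
  them. So \<open>A1\<close> is bounded, and it defines the same topology as
  \<open>A0\<close>.\<close>

lemma A1_bounded: "x \<in> A1 ==> j \<ge> k0 ==> T [^] (j::nat) \<otimes> x \<in> A0"
proof (induction rule: A1.induct)
  case (step a x i)
  have c: "a \<in> carrier A" "x \<in> carrier A" "T [^] i \<in> carrier A" "T [^] j \<in> carrier A"
    using step A0_carrier A1_carrier by auto
  hence "T [^] j \<otimes> (a \<otimes> T [^] i \<oplus> x)
    = a \<otimes> (T [^] j \<otimes> T [^] i) \<oplus> T [^] j \<otimes> x" by algebra
  moreover have "T [^] j \<otimes> T [^] i \<in> A0" using k0 [of "j + i"] step by (simp add: A.nat_pow_mult)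
  ultimately show ?case using step A0_ops by simp
qed (use A0_ops in simp)

text \<open>This is \<open>T^m A1\<close>, written as a condition so that membership needs no
  witness.\<close>

definition Fil :: "int => 'a set" where
  "Fil m = {x \<in> carrier A. tpow A T (- m) \<otimes> x \<in> A1}"

lemma tT: "tpow A T m \<in> carrier A" using T_unit by simp

lemma Fil_0: "Fil 0 = A1"
  using A1_carrier by (auto simp: Fil_def)

lemma Fil_filt_ring: "filt_ring A Fil T"
proof (intro filt_ring.intro filt_ring_axioms.intro A.is_cring T_unit)
  show "Fil m \<subseteq> carrier A" for m by (auto simp: Fil_def)
  show "\<zero> \<in> Fil m" for m using tT A1.zero by (simp add: Fil_def)
  show "x \<oplus> y \<in> Fil m" if "x \<in> Fil m" "y \<in> Fil m" for x y m
    using that tT A1_add by (auto simp: Fil_def A.r_distr)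
  show "\<ominus> x \<in> Fil m" if "x \<in> Fil m" for x m
    using that tT A1_neg by (auto simp: Fil_def A.r_minus)
  show "Fil l \<subseteq> Fil m" if ml: "m \<le> l" for m l
  proof
    fix x assume x: "x \<in> Fil l"
    have "- m = int (nat (l - m)) + (- l)" using ml by simp
    hence "tpow A T (- m) = T [^] nat (l - m) \<otimes> tpow A T (- l)"
      using A.tpow_add [OF T_unit, of "int (nat (l - m))" "- l"] A.tpow_nat [of T "nat (l - m)"] by simp
    hence "tpow A T (- m) \<otimes> x = T [^] nat (l - m) \<otimes> (tpow A T (- l) \<otimes> x)"
      using x tT by (simp add: Fil_def A.m_assoc)
    thus "x \<in> Fil m" using x A1_mult [OF A1_T] by (simp add: Fil_def)
  qed
  show "x \<otimes> y \<in> Fil (m + l)" if x: "x \<in> Fil m" and y: "y \<in> Fil l" for x y m l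
  proof -
    have c: "x \<in> carrier A" "y \<in> carrier A" using x y by (auto simp: Fil_def)
    have "tpow A T (- (m + l)) = tpow A T (- m) \<otimes> tpow A T (- l)" using A.tpow_add [OF T_unit, of "- m" "- l"] by simp
    hence "tpow A T (- (m + l)) \<otimes> (x \<otimes> y) = (tpow A T (- m) \<otimes> x) \<otimes> (tpow A T (- l) \<otimes> y)"
      using c tT by (simp add: A.m_ac)
    thus ?thesis using x y c A1_mult by (simp add: Fil_def)
  qed
  show "\<one> \<in> Fil 0" using A1_T [of 0] by (simp add: Fil_0)
  have inv: "inv T \<in> carrier A" using T_unit by simp
  have "tpow A T (- 1) = inv T" using inv by (simp add: tpow_def)
  thus "T \<in> Fil 1" using A1_T [of 0] T_unit by (simp add: Fil_def)
  show "inv T \<in> Fil (- 1)" using A1_T [of 0] T_unit inv by (simp add: Fil_def)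
  show "\<exists>m. x \<in> Fil m" if x: "x \<in> carrier A" for x
  proof -
    \<comment> \<open>Multiplication by \<open>x\<close> is continuous and the powers of
      \<open>T\<close> tend to zero, so some \<open>x T^i\<close> lies in \<open>A0\<close>.\<close>
    have U: "openin (opens A) {y \<in> carrier A. x \<otimes> y \<in> A0}" by (rule openin_scale [OF A0_open x])
    have "\<zero> \<in> {y \<in> carrier A. x \<otimes> y \<in> A0}" using x A0_ops by simp
    then obtain i where "x \<otimes> T [^] (i::nat) \<in> A0" using T_power_in [OF U] by blast
    hence "tpow A T (- (- int i)) \<otimes> x \<in> A1"
      using A.tpow_nat [of T i] A0_A1 A.m_comm [OF x, of "T [^] i"] by simp
    thus ?thesis using x unfolding Fil_def by blast
  qed
qed

sublocale F: filt_ring A Fil T by (rule Fil_filt_ring)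

text \<open>The topology of \<open>A0\<close> is adic for an unspecified ideal \<open>I\<close>.
  Some \<open>T^i\<close> lies in \<open>I^m\<close>, and \<open>T^k0\<close> carries
  \<open>A1\<close> into \<open>A0\<close>, so \<open>T^(i + k0) A1\<close> lies in
  \<open>I^m\<close>. Conversely \<open>A1\<close> is open as a union of cosets of
  \<open>A0\<close>.\<close>

lemma Fil_filt_top: "filt_top A Fil"
  unfolding filt_top_def
proof (intro allI iffI)
  fix W assume W: "openin (opens A) W"
  obtain I where I: "ideal I B0" "opens B0 = adic_topology B0 I"
    using A0(2) by (auto simp: formally_of_finite_type_def)
  note op = B0.adic_filt_top [OF I(1), unfolded filt_top_def with_topology_simps, rule_format, folded I(2)]
  have id: "ideal (B0.ipow I m) B0" for m by (rule B0.ipow_ideal [OF I(1)])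
  have sub: "B0.ipow I m \<subseteq> A0" for m using ideal.axioms(1) [OF id] additive_subgroup.a_subset by fastforce
  show "W \<subseteq> carrier A \<and> (\<forall>x\<in>W. \<exists>m. \<forall>u\<in>Fil m. x \<oplus> u \<in> W)"
  proof (intro conjI ballI)
    show "W \<subseteq> carrier A" using openin_subset [OF W] A_topspace by simp
    fix x assume x: "x \<in> W"
    hence xc: "x \<in> carrier A" using openin_subset [OF W] A_topspace by auto
    define U where "U = {y \<in> carrier A. x \<oplus> y \<in> W}"
    have U: "openin (opens A) U" "\<zero> \<in> U" using openin_translate [OF W xc] x xc by (auto simp: U_def)
    have "openin (opens B0) (U \<inter> A0)" unfolding B0_simps using U(1) by (auto simp: openin_subtopology)
    moreover have "\<zero>\<^bsub>B0\<^esub> \<in> U \<inter> A0" using U(2) A0_ops by simp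
    ultimately obtain m :: int where m: "\<forall>u\<in>B0.ipow I (nat m). \<zero>\<^bsub>B0\<^esub> \<oplus>\<^bsub>B0\<^esub> u \<in> U \<inter> A0" unfolding op by blast
    have mU: "u \<in> U" if u: "u \<in> B0.ipow I (nat m)" for u
    proof -
      have "u \<in> A0" using sub u by blast
      thus ?thesis using bspec [OF m u] A0_carrier by simp
    qed
    have "openin (opens B0) (B0.ipow I (nat m))" unfolding op
    proof (intro conjI ballI)
      show "B0.ipow I (nat m) \<subseteq> carrier B0" using sub by simp
      fix y assume "y \<in> B0.ipow I (nat m)"
      thus "\<exists>l::int. \<forall>u\<in>B0.ipow I (nat l). y \<oplus>\<^bsub>B0\<^esub> u \<in> B0.ipow I (nat m)"
        using additive_subgroup.a_closed [OF ideal.axioms(1) [OF id [of "nat m"]]] by blast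
    qed
    hence "openin (opens A) (B0.ipow I (nat m))"
      using openin_open_subtopology [OF A0_open] by simp
    moreover have "\<zero> \<in> B0.ipow I (nat m)" using additive_subgroup.zero_closed [OF ideal.axioms(1) [OF id [of "nat m"]]] by simp
    ultimately obtain i where i: "T [^] (i::nat) \<in> B0.ipow I (nat m)" using T_power_in by blast
    define N where "N = i + k0"
    have "\<forall>u\<in>Fil (int N). x \<oplus> u \<in> W"
    proof
      fix u assume u: "u \<in> Fil (int N)"
      define z where "z = tpow A T (- int N) \<otimes> u"
      have uc: "u \<in> carrier A" and z: "z \<in> A1" using u unfolding z_def Fil_def by blast+
      have "u = tpow A T (int N) \<otimes> z"
        unfolding z_def by (rule A.tpow_cancel(1) [OF T_unit uc, symmetric])
      also have "\<dots> = T [^] N \<otimes> z" by (simp only: A.tpow_nat)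
      also have "\<dots> = (T [^] i \<otimes> T [^] k0) \<otimes> z"
        unfolding N_def A.nat_pow_mult [OF T_carrier] ..
      also have "\<dots> = T [^] i \<otimes> (T [^] k0 \<otimes> z)"
        using A1_carrier [OF z] by (intro A.m_assoc) auto
      finally have "u \<in> B0.ipow I (nat m)"
        using ideal.I_r_closed [OF id i, of "T [^] k0 \<otimes> z"] A1_bounded [OF z order_refl]
        unfolding B0_simps by simp
      hence "u \<in> U" by (rule mU)
      thus "x \<oplus> u \<in> W" unfolding U_def by blast
    qed
    thus "\<exists>m. \<forall>u\<in>Fil m. x \<oplus> u \<in> W" by blast
  qed
next
  fix W assume W: "W \<subseteq> carrier A \<and> (\<forall>x\<in>W. \<exists>m. \<forall>u\<in>Fil m. x \<oplus> u \<in> W)"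
  have A1_open: "openin (opens A) A1"
    unfolding openin_subopen [of "opens A" A1]
  proof
    fix x assume x: "x \<in> A1"
    have xc: "\<ominus> x \<in> carrier A" using A1_carrier [OF x] by simp
    have "{y \<in> carrier A. \<ominus> x \<oplus> y \<in> A0} \<subseteq> A1"
    proof clarify
      fix y assume y: "y \<in> carrier A" "\<ominus> x \<oplus> y \<in> A0"
      have "y = x \<oplus> (\<ominus> x \<oplus> y)" using y(1) A1_carrier [OF x] by algebra
      thus "y \<in> A1" using A1_add [OF x A0_A1 [OF y(2)]] by simp
    qed
    moreover have "x \<in> {y \<in> carrier A. \<ominus> x \<oplus> y \<in> A0}" using A1_carrier [OF x] A0_ops(1) by (simp add: A.l_neg)
    ultimately show "\<exists>U. openin (opens A) U \<and> x \<in> U \<and> U \<subseteq> A1" using openin_translate [OF A0_open xc] by blast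
  qed
  have Fil_open: "openin (opens A) (Fil m)" for m
    unfolding Fil_def by (rule openin_scale [OF A1_open tT])
  show "openin (opens A) W"
  proof (subst openin_subopen, rule ballI)
    fix x assume x: "x \<in> W"
    hence xc: "x \<in> carrier A" using W by blast
    obtain m where m: "\<forall>u\<in>Fil m. x \<oplus> u \<in> W" using W x by blast
    have "{y \<in> carrier A. \<ominus> x \<oplus> y \<in> Fil m} \<subseteq> W"
    proof clarify
      fix y assume y: "y \<in> carrier A" "\<ominus> x \<oplus> y \<in> Fil m"
      have "y = x \<oplus> (\<ominus> x \<oplus> y)" using y(1) xc by algebra
      thus "y \<in> W" using bspec [OF m y(2)] by simp
    qed
    moreover have "x \<in> {y \<in> carrier A. \<ominus> x \<oplus> y \<in> Fil m}" using xc by (simp add: A.l_neg)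
    ultimately show "\<exists>U. openin (opens A) U \<and> x \<in> U \<and> U \<subseteq> W"
      using openin_translate [OF Fil_open A.a_inv_closed [OF xc], of m] by blast
  qed
qed

sublocale F: filt_top_ring A Fil T by unfold_locales (rule Fil_filt_top)

lemma A_complete: "complete_filt_ring A Fil T"
  by (rule F.complete_filt_ringI [OF A_compl])

sublocale F: complete_filt_ring A Fil T by (rule A_complete)

lemma \<eta>_Fil: "x \<in> carrier OK ==> \<eta> x \<in> Fil 0"
  using \<eta>_A0 A0_A1 Fil_0 by auto

lemma p_tf: "x \<in> carrier A ==> y \<in> carrier A ==> p \<otimes> x = p \<otimes> y ==> x = y"
proof -
  assume xy: "x \<in> carrier A" "y \<in> carrier A" "p \<otimes> x = p \<otimes> y"
  have pc: "p \<in> carrier A" using \<eta>_A0 [OF pi_OK] by (rule A0_carrier)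
  have "p \<otimes> (x \<ominus> y) = p \<otimes> x \<ominus> p \<otimes> y" using xy(1,2) pc by algebra
  also have "\<dots> = \<zero>" unfolding xy(3) using xy(2) pc by algebra
  finally have "x \<ominus> y = \<zero>" using xy flat_torsion_free [OF A.is_cring \<eta>_hom flat] by simp
  thus ?thesis using xy by (simp add: A.r_right_minus_eq)
qed

sublocale E: filt_ring_elem A Fil T p
  by unfold_locales (rule \<eta>_Fil [OF pi_OK])

sublocale E: filt_top_ring_elem A Fil T p ..

lemma A0_Fil: "a \<in> A0 ==> a \<in> Fil 0" using A0_A1 Fil_0 by simp

text \<open>A bound of Artin-Rees type. The elements of \<open>A0\<close> divisible by
  \<open>p\<close> in \<open>A\<close> form a finitely generated ideal; the quotients of its
  generators lie in one \<open>Fil c\<close>, hence so do all quotients, which are unique by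
  torsion-freeness. Scaling by powers of \<open>T\<close> carries the bound to all degrees.\<close>

lemma p_reg_ex: "\<exists>M\<ge>0. \<forall>x m. x \<in> carrier A --> p \<otimes> x \<in> Fil m --> x \<in> Fil (m - M)"
proof -
  define J where "J = {a \<in> A0. \<exists>x\<in>carrier A. a = p \<otimes> x}"
  have J: "ideal J B0"
  proof (rule B0.ideal_of_closed)
    show "\<zero>\<^bsub>B0\<^esub> \<in> J" using A0_ops by (auto simp: J_def intro: bexI [of _ "\<zero>"])
    fix a b assume "a \<in> J" "b \<in> J"
    then obtain x y where "a \<in> A0" "b \<in> A0" "x \<in> carrier A" "y \<in> carrier A" "a = p \<otimes> x" "b = p \<otimes> y" by (auto simp: J_def)
    thus "a \<oplus>\<^bsub>B0\<^esub> b \<in> J" using A0_ops(3) [of a b] by (auto simp: J_def A.r_distr intro!: bexI [of _ "x \<oplus> y"])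
  next
    fix c a assume c: "c \<in> carrier B0" and "a \<in> J"
    then obtain x where x: "a \<in> A0" "x \<in> carrier A" "a = p \<otimes> x" by (auto simp: J_def)
    have cc: "c \<in> carrier A" using c A0_carrier by simp
    have "c \<otimes> a = p \<otimes> (c \<otimes> x)" unfolding x(3) using x(2) cc by (simp add: A.m_lcomm)
    moreover have "c \<otimes> a \<in> A0" using c x(1) A0_ops(4) by simp
    ultimately show "c \<otimes>\<^bsub>B0\<^esub> a \<in> J" using x(2) cc unfolding J_def by auto
  qed (auto simp: J_def)
  obtain S where S: "S \<subseteq> A0" "finite S" "J = Idl\<^bsub>B0\<^esub> S"
    using noetherian_ring.finetely_gen [OF B0_noeth J] by auto
  have SJ: "S \<subseteq> J" using B0.genideal_self [of S] S by simp
  have "\<exists>c\<le>0. \<forall>a\<in>S. \<exists>x\<in>Fil c. a = p \<otimes> x"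
    using S(2) SJ
  proof (induction rule: finite_induct)
    case (insert a F)
    then obtain c where c: "c \<le> 0" "\<forall>a\<in>F. \<exists>x\<in>Fil c. a = p \<otimes> x" by auto
    obtain x where x: "x \<in> carrier A" "a = p \<otimes> x" using insert by (auto simp: J_def)
    obtain d where d: "d \<le> c" "x \<in> Fil d" using F.Fil_exh_le [OF x(1)] by blast
    show ?case
    proof (intro exI [of _ d] conjI ballI)
      fix b assume "b \<in> insert a F"
      thus "\<exists>x\<in>Fil d. b = p \<otimes> x"
        using c(2) x(2) d F.Fil_mono [OF d(1)] by blast
    qed (use c d in simp)
  qed (intro exI [of _ 0], simp)
  then obtain c where c: "c \<le> 0" "\<And>a. a \<in> S ==> \<exists>x\<in>Fil c. a = p \<otimes> x" by blast
  \<comment> \<open>Divisibility with a quotient in \<open>Fil c\<close> again defines an ideal of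
    \<open>A0\<close>; containing the generators of \<open>J\<close>, it contains
    \<open>J\<close>.\<close>
  define J' where "J' = {a \<in> A0. \<exists>x\<in>Fil c. a = p \<otimes> x}"
  have "ideal J' B0"
  proof (rule B0.ideal_of_closed)
    show "\<zero>\<^bsub>B0\<^esub> \<in> J'" using A0_ops by (auto simp: J'_def intro: bexI [of _ "\<zero>"])
    fix a b assume "a \<in> J'" "b \<in> J'"
    then obtain x y where x: "a \<in> A0" "b \<in> A0" "x \<in> Fil c" "y \<in> Fil c" "a = p \<otimes> x" "b = p \<otimes> y" by (auto simp: J'_def)
    have "a \<oplus> b = p \<otimes> (x \<oplus> y)" using x F.Fil_carrier by (simp add: A.r_distr)
    thus "a \<oplus>\<^bsub>B0\<^esub> b \<in> J'" using A0_ops(3) [OF x(1,2)] F.Fil_add [OF x(3,4)] unfolding J'_def by auto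
  next
    fix b a assume b: "b \<in> carrier B0" and "a \<in> J'"
    then obtain x where x: "a \<in> A0" "x \<in> Fil c" "a = p \<otimes> x" by (auto simp: J'_def)
    have bc: "b \<in> carrier A" "b \<in> A0" using b A0_carrier by auto
    have "b \<otimes> a = p \<otimes> (b \<otimes> x)" unfolding x(3) using F.Fil_carrier [OF x(2)] bc by (simp add: A.m_lcomm)
    moreover have "b \<otimes> a \<in> A0" using bc x(1) A0_ops(4) by simp
    ultimately show "b \<otimes>\<^bsub>B0\<^esub> a \<in> J'" using F.Fil_mult0 [OF A0_Fil [OF bc(2)] x(2)] unfolding J'_def by auto
  qed (auto simp: J'_def)
  moreover have "S \<subseteq> J'" using c(2) S(1) by (auto simp: J'_def)
  ultimately have JJ: "J \<subseteq> J'" unfolding S(3) by (rule B0.genideal_minimal)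
  have 0: "x \<in> Fil c" if x: "x \<in> carrier A" "p \<otimes> x \<in> A0" for x
  proof -
    have "p \<otimes> x \<in> J'" using JJ x by (auto simp: J_def)
    then obtain y where "y \<in> Fil c" "p \<otimes> x = p \<otimes> y" by (auto simp: J'_def)
    thus ?thesis using p_tf x(1) F.Fil_carrier by metis
  qed
  \<comment> \<open>The constant is made up of \<open>k0\<close>, paid for passing from
    \<open>A1\<close> to \<open>A0\<close>, and of \<open>- c\<close>, paid for the quotients of the
    generators.\<close>
  show ?thesis
  proof (intro exI [of _ "int k0 - c"] conjI allI impI)
    show "0 \<le> int k0 - c" using c(1) by simp
    fix x m assume x: "x \<in> carrier A" "p \<otimes> x \<in> Fil m"
    have "tpow A T (- m) \<otimes> (p \<otimes> x) \<in> A1" using x(2) unfolding Fil_def by blast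
    hence "T [^] k0 \<otimes> (tpow A T (- m) \<otimes> (p \<otimes> x)) \<in> A0" by (rule A1_bounded) simp
    moreover have "T [^] k0 \<otimes> (tpow A T (- m) \<otimes> (p \<otimes> x)) = p \<otimes> (tpow A T (int k0 - m) \<otimes> x)"
    proof -
      define P where "P = tpow A T (- m)"
      have c: "P \<in> carrier A" "T [^] k0 \<in> carrier A" using tT by (auto simp: P_def)
      have "tpow A T (int k0 - m) = T [^] k0 \<otimes> P"
        using A.tpow_add [OF T_unit, of "int k0" "- m"] unfolding P_def A.tpow_nat by simp
      thus ?thesis unfolding P_def [symmetric] using c x(1) E.p_carrier by (simp add: A.m_ac)
    qed
    ultimately have "tpow A T (int k0 - m) \<otimes> x \<in> Fil c" using x(1) tT by (intro 0) auto
    thus "x \<in> Fil (m - (int k0 - c))" using F.tpow_Fil_iff [OF x(1), of "int k0 - m" c] by (simp add: algebra_simps)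
  qed
qed

definition M1 where "M1 = (SOME M. M \<ge> 0 \<and> (\<forall>x m. x \<in> carrier A --> p \<otimes> x \<in> Fil m --> x \<in> Fil (m - M)))"

lemma M1: "0 \<le> M1" "x \<in> carrier A ==> p \<otimes> x \<in> Fil m ==> x \<in> Fil (m - M1)"
  using someI_ex [OF p_reg_ex] unfolding M1_def by blast+

sublocale E: filt_ring_elem_reg A Fil T p M1
  by unfold_locales (rule M1(2))

text \<open>When the powers of \<open>w\<close> are bounded modulo \<open>p\<close>, the elements of
  \<open>A0\<close> of the form \<open>t y + p z\<close>, with \<open>y\<close> a polynomial in
  \<open>w\<close> of degree below \<open>j\<close>, form an ascending chain of ideals
  \<open>J j\<close>. Where the chain becomes stationary, \<open>w^d\<close> is expressed by lower
  powers modulo multiples of \<open>p\<close>.\<close>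

lemma power_integral:
  assumes w: "w \<in> carrier A" and bd: "\<And>j::nat. \<exists>z\<in>carrier A. w [^] j \<ominus> p \<otimes> z \<in> Fil (- int M)"
  shows "\<exists>d z y. z \<in> carrier A \<and> wspan A (Fil 0) w d y \<and> w [^] d = y \<oplus> p \<otimes> z"
proof -
  \<comment> \<open>\<open>T^M\<close> moves the bounded representatives into \<open>A1\<close>, and
    \<open>T^k0\<close> moves \<open>A1\<close> into \<open>A0\<close>; so \<open>t\<close> clears
    all denominators simultaneously.\<close>
  define N where "N = M + k0"
  define t where "t = T [^] N"
  have tc: "t \<in> carrier A" "t \<in> Units A" using A.Units_pow_closed [OF T_unit] by (auto simp: t_def)
  note ws = A.wspan_carrier [OF _ A0_sub w]
  define J where "J j = {a \<in> A0. \<exists>y z. wspan A A0 w j y \<and> z \<in> carrier A \<and> a = t \<otimes> y \<oplus> p \<otimes> z}" for j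
  have J: "ideal (J j) B0" for j
  proof (rule B0.ideal_of_closed)
    have "\<zero> = t \<otimes> \<zero> \<oplus> p \<otimes> \<zero>" using tc by simp
    thus "\<zero>\<^bsub>B0\<^esub> \<in> J j" using A0_ops(1) wspan.zero [of A A0 w j] A.zero_closed unfolding J_def B0_simps by blast
    fix a b assume "a \<in> J j" "b \<in> J j"
    then obtain y z y' z' where y: "a \<in> A0" "b \<in> A0" "wspan A A0 w j y" "wspan A A0 w j y'" "z \<in> carrier A" "z' \<in> carrier A"
      "a = t \<otimes> y \<oplus> p \<otimes> z" "b = t \<otimes> y' \<oplus> p \<otimes> z'" unfolding J_def by blast
    have "a \<oplus> b = t \<otimes> (y \<oplus> y') \<oplus> p \<otimes> (z \<oplus> z')"
      unfolding y(7,8) using ws [OF y(3)] ws [OF y(4)] y(5,6) tc E.p_carrier by algebra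
    thus "a \<oplus>\<^bsub>B0\<^esub> b \<in> J j" using A0_ops(3) [OF y(1,2)] A.wspan_add [OF y(3,4) A0_sub w] A.add.m_closed [OF y(5,6)]
      unfolding J_def B0_simps by blast
  next
    fix c a assume c0: "c \<in> carrier B0" and "a \<in> J j"
    then obtain y z where y: "a \<in> A0" "wspan A A0 w j y" "z \<in> carrier A" "a = t \<otimes> y \<oplus> p \<otimes> z" unfolding J_def by blast
    have c: "c \<in> A0" "c \<in> carrier A" using c0 A0_carrier by auto
    have "c \<otimes> a = t \<otimes> (c \<otimes> y) \<oplus> p \<otimes> (c \<otimes> z)"
      unfolding y(4) using ws [OF y(2)] y(3) c(2) tc E.p_carrier by algebra
    thus "c \<otimes>\<^bsub>B0\<^esub> a \<in> J j"
      using A0_ops(4) [OF c(1) y(1)] A.wspan_mult [OF y(2) c(1) A0_sub w A0_ops(4)] A.m_closed [OF c(2) y(3)]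
      unfolding J_def B0_simps by blast
  qed (auto simp: J_def)
  have mono: "J i \<subseteq> J j" if "i \<le> j" for i j
    using A.wspan_mono [OF _ that order_refl, of A0 w] unfolding J_def by blast
  have "\<Union> (range J) \<in> range J"
  proof (rule noetherian_ring.ideal_chain_is_trivial [OF B0_noeth])
    show "subset.chain {I. ideal I B0} (range J)"
      unfolding pred_on.chain_def
    proof (intro conjI ballI)
      fix I I' assume "I \<in> range J" "I' \<in> range J"
      then obtain i j where "I = J i" "I' = J j" by blast
      thus "(\<subset>)\<^sup>=\<^sup>= I I' \<or> (\<subset>)\<^sup>=\<^sup>= I' I" using mono [of i j] mono [of j i] by (cases "i \<le> j") auto
    qed (use J in auto)
  qed simp
  then obtain d where d: "\<Union> (range J) = J d" by blast
  obtain z where z: "z \<in> carrier A" "w [^] d \<ominus> p \<otimes> z \<in> Fil (- int M)" using bd by blast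
  let ?u = "w [^] d \<ominus> p \<otimes> z"
  have uc: "?u \<in> carrier A" using z(2) by (rule F.Fil_carrier)
  have tu: "t \<otimes> ?u \<in> A0"
  proof -
    have "tpow A T (- (- int M)) \<otimes> ?u \<in> A1" using z(2) unfolding Fil_def by blast
    hence "T [^] M \<otimes> ?u \<in> A1" unfolding minus_minus A.tpow_nat .
    hence "T [^] k0 \<otimes> (T [^] M \<otimes> ?u) \<in> A0" by (rule A1_bounded) simp
    moreover have "t = T [^] k0 \<otimes> T [^] M" by (simp add: t_def N_def A.nat_pow_mult add.commute)
    ultimately show ?thesis using uc by (simp add: A.m_assoc)
  qed
  have "t \<otimes> ?u \<in> J (Suc d)"
  proof -
    have "wspan A A0 w (Suc d) (\<one> \<otimes> w [^] d \<oplus> \<zero>)"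
      by (rule wspan.step [OF A0_ops(2) _ wspan.zero]) simp
    hence s: "wspan A A0 w (Suc d) (w [^] d)" using w by simp
    have wd: "w [^] d \<in> carrier A" using w by simp
    have "t \<otimes> ?u = t \<otimes> w [^] d \<oplus> p \<otimes> (\<ominus> (t \<otimes> z))"
      using wd z(1) tc(1) E.p_carrier by algebra
    moreover have "\<ominus> (t \<otimes> z) \<in> carrier A" using z(1) tc(1) by simp
    ultimately show ?thesis using tu s unfolding J_def by blast
  qed
  hence "t \<otimes> ?u \<in> J d" using d by blast
  then obtain y z' where y: "wspan A A0 w d y" "z' \<in> carrier A" "t \<otimes> ?u = t \<otimes> y \<oplus> p \<otimes> z'"
    unfolding J_def by blast
  let ?i = "inv t"
  have ic: "?i \<in> carrier A" "?i \<otimes> t = \<one>" using tc by auto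
  have yc: "y \<in> carrier A" by (rule ws [OF y(1)])
  have "?u = (?i \<otimes> t) \<otimes> ?u" using ic uc by simp
  also have "\<dots> = ?i \<otimes> (t \<otimes> y \<oplus> p \<otimes> z')" using ic(1) tc(1) uc y(3) by (simp add: A.m_assoc)
  also have "\<dots> = (?i \<otimes> t) \<otimes> y \<oplus> p \<otimes> (?i \<otimes> z')"
    using ic(1) tc(1) yc y(2) E.p_carrier by algebra
  also have "\<dots> = y \<oplus> p \<otimes> (?i \<otimes> z')" using ic yc by simp
  finally have u: "?u = y \<oplus> p \<otimes> (?i \<otimes> z')" .
  have wd: "w [^] d \<in> carrier A" using w by simp
  have "w [^] d = ?u \<oplus> p \<otimes> z" using wd z(1) E.p_carrier by algebra
  also have "\<dots> = y \<oplus> p \<otimes> (?i \<otimes> z' \<oplus> z)"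
    unfolding u using yc y(2) ic(1) z(1) E.p_carrier by algebra
  finally have "w [^] d = y \<oplus> p \<otimes> (?i \<otimes> z' \<oplus> z)" .
  moreover have "wspan A (Fil 0) w d y" using A.wspan_mono [OF y(1) order_refl, of "Fil 0"] A0_Fil by blast
  ultimately show ?thesis using ic(1) y(2) z(1)
    by (intro exI [of _ d] exI [of _ "?i \<otimes> z' \<oplus> z"] exI [of _ y] conjI) simp_all
qed

text \<open>In the relation \<open>w^d = y + p z\<close> the size of \<open>z\<close> is unknown.
  For \<open>n \<ge> - c0\<close> the term \<open>p z\<close> has level 0, so \<open>w\<close> is
  integral over \<open>Lev A Fil p n 0\<close> and its powers stay in the span of the first
  \<open>d\<close> of them. The bound \<open>c\<close> does not depend on \<open>n\<close>.\<close>

lemma power_bounded: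
  assumes w: "w \<in> carrier A" and bd: "\<And>j::nat. \<exists>z\<in>carrier A. w [^] j \<ominus> p \<otimes> z \<in> Fil (- int M)"
  shows "\<exists>n0\<ge>0. \<exists>c\<le>0. \<forall>n\<ge>n0. \<forall>j::nat. level A Fil p n c (w [^] j)"
proof -
  obtain d z y where z: "z \<in> carrier A" "wspan A (Fil 0) w d y" "w [^] d = y \<oplus> p \<otimes> z"
    using power_integral [OF w bd] by blast
  \<comment> \<open>A relation of degree 0 would read \<open>1 = p z\<close>, contrary to the
    assumption that \<open>\<pi>\<close> is not invertible in \<open>A\<close>.\<close>
  have d: "0 < d"
  proof (rule ccontr)
    assume "\<not> 0 < d"
    hence d0: "d = 0" by simp
    have "y = \<zero>" using z(2) unfolding d0 by cases auto
    hence "p \<otimes> z = \<one>" using z d0 by simp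
    thus False using pi_nonunit z(1) E.p_carrier A.m_comm [of p z] by (auto simp: Units_def)
  qed
  obtain c0 where c0: "c0 \<le> 0" "z \<in> Fil c0" using F.Fil_exh_le [OF z(1)] by blast
  have "\<exists>c\<le>0. \<forall>i<e. w [^] i \<in> Fil c" for e :: nat
  proof (induction e)
    case (Suc e)
    then obtain c where c: "c \<le> 0" "\<forall>i<e. w [^] i \<in> Fil c" by blast
    obtain b where b: "b \<le> c" "w [^] e \<in> Fil b" using F.Fil_exh_le [of "w [^] e" c] w by auto
    thus ?case using c by (intro exI [of _ b]) (auto simp: less_Suc_eq intro: F.Fil_monoD)
  qed auto
  then obtain c where c: "c \<le> 0" "\<And>i. i < d ==> w [^] i \<in> Fil c" by blast
  have "level A Fil p n c (w [^] j)" if n: "n \<ge> - c0" for n and j :: nat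
  proof -
    interpret V: filt_ring A "Lev A Fil p n" T by (rule E.level_filt_ring)
    let ?B = "Lev A Fil p n 0"
    have pz: "p \<otimes> z \<in> ?B"
    proof -
      have "z \<in> Fil (0 - n)" by (rule F.Fil_monoD [OF c0(2)]) (use n in simp)
      hence "level A Fil p n 0 (p \<otimes> z)" by (intro E.level_p) (rule level.base)
      thus ?thesis by (simp add: Lev_def)
    qed
    have y: "wspan A ?B w d y" by (rule A.wspan_mono [OF z(2) order_refl E.Fil_Lev])
    have "wspan A ?B w d (p \<otimes> z \<otimes> w [^] (0::nat) \<oplus> y)" by (rule wspan.step [OF pz d y])
    moreover have "p \<otimes> z \<otimes> w [^] (0::nat) \<oplus> y = w [^] d"
      using z(1,3) A.wspan_carrier [OF z(2) F.Fil_sub w] by (simp add: A.a_comm)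
    ultimately have wd: "wspan A ?B w d (w [^] d)" by simp
    have "wspan A ?B w d (w [^] j)"
      by (rule A.wspan_power [OF V.Fil_sub w V.Fil_one V.Fil_mult0 d wd])
    hence "w [^] j \<in> Lev A Fil p n c"
    proof (induction "w [^] j" rule: wspan.induct)
      case zero
      thus ?case using V.Fil_zero by simp
    next
      case (step b i y)
      have "y \<in> Lev A Fil p n c" using step(3)
      proof (induction rule: wspan.induct)
        case (step b i y)
        have "w [^] i \<in> Lev A Fil p n c" using c(2) [OF step(2)] E.Fil_Lev by blast
        thus ?case using V.Fil_add V.Fil_mult0 [OF step(1)] step by simp
      qed (rule V.Fil_zero)
      moreover have "w [^] i \<in> Lev A Fil p n c" using c(2) [OF step(2)] E.Fil_Lev by blast
      ultimately have "b \<otimes> w [^] i \<oplus> y \<in> Lev A Fil p n c" using V.Fil_add V.Fil_mult0 [OF step(1)] by simp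
      thus ?case using step by simp
    qed
    thus ?thesis by (simp add: Lev_def)
  qed
  thus ?thesis using c0(1) c(1) by (intro exI [of _ "- c0"]) auto
qed

end

section \<open>Tate algebras and lifts of generators\<close>

definition TFil :: "nat => ('a, 'b) top_ring_scheme => (int => 'a set) => int => ((nat \<Rightarrow>\<^sub>0 nat) => 'a) set" where
  "TFil r R Fil m = {f \<in> carrier (tate_algebra r R). \<forall>\<nu>. f \<nu> \<in> Fil m}"

definition tmon :: "('a, 'b) ring_scheme => 'i => 'a => 'i => 'a" where
  "tmon R \<nu> d = (\<lambda>\<mu>. if \<mu> = \<nu> then d else \<zero>\<^bsub>R\<^esub>)"

lemma tate_simps [simp]:
  "f \<otimes>\<^bsub>tate_algebra r R\<^esub> g = conv R f g"
  "f \<oplus>\<^bsub>tate_algebra r R\<^esub> g = (\<lambda>\<nu>. f \<nu> \<oplus>\<^bsub>R\<^esub> g \<nu>)"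
  "\<one>\<^bsub>tate_algebra r R\<^esub> = series_const R \<one>\<^bsub>R\<^esub>"
  "\<zero>\<^bsub>tate_algebra r R\<^esub> = (\<lambda>_. \<zero>\<^bsub>R\<^esub>)"
  by (simp_all add: tate_algebra_def Let_def)

context filt_top_ring
begin

lemma tate_carrier:
  "f \<in> carrier (tate_algebra r R) \<longleftrightarrow> (\<forall>\<nu>. f \<nu> \<in> carrier R) \<and>
     (\<forall>\<nu>. \<not> Poly_Mapping.keys \<nu> \<subseteq> {..<r} --> f \<nu> = \<zero>) \<and> (\<forall>m. finite {\<nu>. f \<nu> \<notin> Fil m})"
proof -
  have "(\<forall>U. openin (opens R) U \<and> \<zero> \<in> U --> finite {\<nu>. f \<nu> \<notin> U}) \<longleftrightarrow> (\<forall>m. finite {\<nu>. f \<nu> \<notin> Fil m})"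
  proof
    assume *: "\<forall>m. finite {\<nu>. f \<nu> \<notin> Fil m}"
    show "\<forall>U. openin (opens R) U \<and> \<zero> \<in> U --> finite {\<nu>. f \<nu> \<notin> U}"
    proof (intro allI impI)
      fix U assume "openin (opens R) U \<and> \<zero> \<in> U"
      then obtain m where "Fil m \<subseteq> U" using openin_zeroD by blast
      thus "finite {\<nu>. f \<nu> \<notin> U}" using * by (intro finite_subset [OF _ spec [OF *, of m]]) blast
    qed
  qed (use openin_Fil in auto)
  thus ?thesis by (simp add: tate_algebra_def Let_def)
qed

lemma tate_coeff: "f \<in> carrier (tate_algebra r R) ==> f \<nu> \<in> carrier R"
  by (simp add: tate_carrier)

lemma tate_add_closed:
  assumes "f \<in> carrier (tate_algebra r R)" "g \<in> carrier (tate_algebra r R)"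
  shows "(\<lambda>\<nu>. f \<nu> \<oplus> g \<nu>) \<in> carrier (tate_algebra r R)"
proof -
  have "finite {\<nu>. f \<nu> \<oplus> g \<nu> \<notin> Fil m}" for m
    by (rule finite_subset [of _ "{\<nu>. f \<nu> \<notin> Fil m} \<union> {\<nu>. g \<nu> \<notin> Fil m}"])
      (use assms Fil_add in \<open>auto simp: tate_carrier\<close>)
  thus ?thesis using assms by (simp add: tate_carrier)
qed

lemma tate_minus_closed:
  assumes "f \<in> carrier (tate_algebra r R)" "g \<in> carrier (tate_algebra r R)"
  shows "(\<lambda>\<nu>. f \<nu> \<ominus> g \<nu>) \<in> carrier (tate_algebra r R)"
proof -
  have "finite {\<nu>. f \<nu> \<ominus> g \<nu> \<notin> Fil m}" for m
    by (rule finite_subset [of _ "{\<nu>. f \<nu> \<notin> Fil m} \<union> {\<nu>. g \<nu> \<notin> Fil m}"])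
      (use assms Fil_minus in \<open>auto simp: tate_carrier\<close>)
  thus ?thesis using assms by (simp add: tate_carrier r_right_minus_eq)
qed

lemma tate_scale_closed:
  assumes d: "d \<in> carrier R" and f: "f \<in> carrier (tate_algebra r R)"
  shows "(\<lambda>\<nu>. d \<otimes> f \<nu>) \<in> carrier (tate_algebra r R)"
proof -
  obtain c where c: "d \<in> Fil c" using Fil_exh [OF d] by blast
  have "finite {\<nu>. d \<otimes> f \<nu> \<notin> Fil m}" for m
    by (rule finite_subset [of _ "{\<nu>. f \<nu> \<notin> Fil (m - c)}"])
      (use f Fil_mult_eq [OF c, of _ "m - c" m] in \<open>auto simp: tate_carrier\<close>)
  thus ?thesis using f d by (simp add: tate_carrier)
qed

lemma tmon_closed:
  assumes "d \<in> carrier R" "Poly_Mapping.keys \<nu> \<subseteq> {..<r}"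
  shows "tmon R \<nu> d \<in> carrier (tate_algebra r R)"
proof -
  have "finite {\<mu>. tmon R \<nu> d \<mu> \<notin> Fil m}" for m
    by (rule finite_subset [of _ "{\<nu>}"]) (auto simp: tmon_def)
  thus ?thesis using assms by (auto simp: tate_carrier tmon_def)
qed

lemma tmon_TFil: "d \<in> Fil m ==> Poly_Mapping.keys \<nu> \<subseteq> {..<r} ==> tmon R \<nu> d \<in> TFil r R Fil m"
  unfolding TFil_def using tmon_closed [of d \<nu> r] by (auto simp: tmon_def)

lemma tmon_add: "x \<in> carrier R ==> y \<in> carrier R ==> tmon R \<nu> (x \<oplus> y) = (\<lambda>\<mu>. tmon R \<nu> x \<mu> \<oplus> tmon R \<nu> y \<mu>)"
  by (auto simp: tmon_def fun_eq_iff)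

lemma tate_const_mult:
  assumes "d \<in> carrier R" "f \<in> carrier (tate_algebra r R)"
  shows "series_const R d \<otimes>\<^bsub>tate_algebra r R\<^esub> f = (\<lambda>\<nu>. d \<otimes> f \<nu>)"
  using conv_const [of d f] assms tate_coeff by simp

lemma tmon_mult:
  assumes "c \<in> carrier R" "d \<in> carrier R"
  shows "tmon R \<nu> c \<otimes>\<^bsub>tate_algebra r R\<^esub> tmon R \<mu> d = tmon R (\<nu> + \<mu>) (c \<otimes> d)"
proof
  fix m
  have g: "tmon R \<mu> d j \<in> carrier R" for j using assms by (simp add: tmon_def)
  show "(tmon R \<nu> c \<otimes>\<^bsub>tate_algebra r R\<^esub> tmon R \<mu> d) m = tmon R (\<nu> + \<mu>) (c \<otimes> d) m"
  proof (cases "\<exists>b. m = \<nu> + b")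
    case True
    then obtain b where b: "m = \<nu> + b" by blast
    show ?thesis using conv_single [of c "tmon R \<mu> d" \<nu> b] assms g unfolding b by (simp add: tmon_def)
  next
    case False
    thus ?thesis using conv_single_0 [of m \<nu> c "tmon R \<mu> d"] unfolding tmon_def by auto
  qed
qed

lemma tate_filt_top: "filt_top (tate_algebra r R) (TFil r R Fil)"
proof -
  define B where "B = {{f \<in> carrier (tate_algebra r R). \<forall>\<nu>. f \<nu> \<in> U} |U. openin (opens R) U \<and> \<zero> \<in> U}"
  define P where "P = series_ring R
        {f :: (nat \<Rightarrow>\<^sub>0 nat) => 'a. (\<forall>\<nu>. f \<nu> \<in> carrier R) \<and>
            (\<forall>\<nu>. \<not> Poly_Mapping.keys \<nu> \<subseteq> {..<r} --> f \<nu> = \<zero>) \<and>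
            (\<forall>U. openin (opens R) U \<and> \<zero> \<in> U --> finite {\<nu>. f \<nu> \<notin> U})}"
  have P0: "tate_algebra r R = with_topology P (zero_basis_topology P
        {{f \<in> carrier P. \<forall>\<nu>. f \<nu> \<in> U} | U. openin (opens R) U \<and> \<zero> \<in> U})"
    by (simp only: tate_algebra_def Let_def P_def)
  have "carrier (tate_algebra r R) = carrier P" unfolding P0 by simp
  hence P: "tate_algebra r R = with_topology P (zero_basis_topology P B)" unfolding B_def using P0 by simp
  have "filt_top (with_topology P (zero_basis_topology P B)) (TFil r R Fil)"
  proof (rule filt_top_zero_basis)
    show "TFil r R Fil l \<subseteq> TFil r R Fil m" if "m \<le> l" for m l
    proof
      fix f assume "f \<in> TFil r R Fil l"
      thus "f \<in> TFil r R Fil m" using subsetD [OF Fil_mono [OF that]] by (simp add: TFil_def)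
    qed
    show "\<exists>m. TFil r R Fil m \<subseteq> U" if U: "U \<in> B" for U
    proof -
      obtain W where W: "openin (opens R) W" "\<zero> \<in> W" "U = {f \<in> carrier (tate_algebra r R). \<forall>\<nu>. f \<nu> \<in> W}"
        using U unfolding B_def mem_Collect_eq by (elim exE conjE)
      obtain m where "Fil m \<subseteq> W" using openin_zeroD W by blast
      hence "TFil r R Fil m \<subseteq> U" unfolding W(3) TFil_def by auto
      thus ?thesis ..
    qed
    show "\<exists>U\<in>B. U \<subseteq> TFil r R Fil m" for m
    proof
      show "{f \<in> carrier (tate_algebra r R). \<forall>\<nu>. f \<nu> \<in> Fil m} \<in> B"
        using openin_Fil [of m] Fil_zero [of m] unfolding B_def by auto
    qed (simp add: TFil_def)
  qed
  thus ?thesis unfolding P [symmetric] .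
qed

text \<open>Only finitely many coefficients lie outside \<open>Fil m\<close>; splitting off their
  terms leaves a small series. Additive properties are thus reduced to small series and to single
  terms of \<open>f\<close>.\<close>

lemma tate_induct:
  assumes f: "f \<in> carrier (tate_algebra r R)"
    and small: "\<And>g. g \<in> TFil r R Fil m ==> P g"
    and single: "\<And>\<nu>. Poly_Mapping.keys \<nu> \<subseteq> {..<r} ==> P (tmon R \<nu> (f \<nu>))"
    and add: "\<And>g h. g \<in> carrier (tate_algebra r R) ==> h \<in> carrier (tate_algebra r R) ==> P g ==> P h ==>
      P (\<lambda>\<nu>. g \<nu> \<oplus> h \<nu>)"
  shows "P f"
proof -
  have main: "P (\<lambda>\<nu>. if \<nu> \<in> S then f \<nu> else \<zero>) \<and> (\<lambda>\<nu>. if \<nu> \<in> S then f \<nu> else \<zero>) \<in> carrier (tate_algebra r R)"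
    if "finite S" "S \<subseteq> {\<nu>. f \<nu> \<notin> Fil m}" for S
    using that
  proof (induction rule: finite_induct)
    case empty
    have "(\<lambda>_. \<zero>) \<in> carrier (tate_algebra r R)" by (simp add: tate_carrier)
    thus ?case using small by (simp add: TFil_def)
  next
    case (insert \<nu> S)
    have k: "Poly_Mapping.keys \<nu> \<subseteq> {..<r}" using insert.prems f Fil_zero [of m] by (auto simp: tate_carrier)
    have e: "(\<lambda>\<mu>. if \<mu> \<in> insert \<nu> S then f \<mu> else \<zero>) = (\<lambda>\<mu>. tmon R \<nu> (f \<nu>) \<mu> \<oplus> (if \<mu> \<in> S then f \<mu> else \<zero>))"
      using insert.hyps tate_coeff [OF f] by (auto simp: tmon_def fun_eq_iff)
    have t: "tmon R \<nu> (f \<nu>) \<in> carrier (tate_algebra r R)" by (rule tmon_closed [OF tate_coeff [OF f] k])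
    show ?case unfolding e using add [OF t _ single [OF k]] tate_add_closed [OF t] insert by simp
  qed
  define S where "S = {\<nu>. f \<nu> \<notin> Fil m}"
  define g where "g = (\<lambda>\<nu>. if \<nu> \<in> S then f \<nu> else \<zero>)"
  have S: "finite S" using f by (simp add: S_def tate_carrier)
  have g: "P g" "g \<in> carrier (tate_algebra r R)" using main [OF S] by (auto simp: S_def g_def)
  define h where "h = (\<lambda>\<nu>. f \<nu> \<ominus> g \<nu>)"
  have hc: "h \<in> carrier (tate_algebra r R)" unfolding h_def by (rule tate_minus_closed [OF f g(2)])
  have "h \<nu> \<in> Fil m" for \<nu>
    using tate_coeff [OF f, of \<nu>] by (simp add: h_def g_def S_def a_minus_def r_neg)
  hence "P h" using small hc by (simp add: TFil_def)
  moreover have "f = (\<lambda>\<nu>. g \<nu> \<oplus> h \<nu>)"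
  proof
    fix \<nu> show "f \<nu> = g \<nu> \<oplus> h \<nu>" unfolding h_def using tate_coeff [OF f, of \<nu>] tate_coeff [OF g(2), of \<nu>] by algebra
  qed
  ultimately show ?thesis using add [OF g(2) hc g(1)] by simp
qed

end

text \<open>Baire's theorem for the union of the subgroups \<open>t^(-M) N\<close>, in elementary
  form. If none of them met every class of \<open>Fil 0\<close> modulo \<open>Fil 1\<close>, a
  Cauchy sequence could be built that leaves the \<open>M\<close>-th subgroup at step
  \<open>M\<close>, and its limit would lie in none of them.\<close>

lemma (in complete_filt_ring) baire:
  assumes N: "N \<subseteq> carrier R" "\<And>x y. x \<in> N ==> y \<in> N ==> x \<ominus> y \<in> N"
    and tN: "\<And>x. x \<in> N ==> t \<otimes> x \<in> N" and ex: "\<And>a. a \<in> carrier R ==> \<exists>M::nat. t [^] M \<otimes> a \<in> N"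
  shows "\<exists>M::nat. \<forall>a\<in>Fil 0. \<exists>y\<in>carrier R. t [^] M \<otimes> y \<in> N \<and> cg 1 a y"
proof (rule ccontr)
  assume "\<not> (\<exists>M::nat. \<forall>a\<in>Fil 0. \<exists>y\<in>carrier R. t [^] M \<otimes> y \<in> N \<and> cg 1 a y)"
  hence no: "\<exists>b\<in>Fil 0. \<forall>y\<in>carrier R. t [^] M \<otimes> y \<in> N --> \<not> cg 1 b y" for M :: nat by blast
  have step: "\<exists>a'. a' \<in> carrier R \<and> cg (int M) a' a \<and> (\<forall>y\<in>carrier R. t [^] M \<otimes> y \<in> N --> \<not> cg (int M + 1) a' y)"
    if a: "a \<in> carrier R" for a and M :: nat
  proof (cases "\<forall>y\<in>carrier R. t [^] M \<otimes> y \<in> N --> \<not> cg (int M + 1) a y")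
    case True
    thus ?thesis using a cg_refl by blast
  next
    case False
    then obtain y0 where y0: "y0 \<in> carrier R" "t [^] M \<otimes> y0 \<in> N" "cg (int M + 1) a y0" by blast
    \<comment> \<open>Density is denied at \<open>2 M\<close>: after subtracting \<open>y0\<close>
      and dividing by \<open>t^M\<close>, an element of \<open>t^(-M) N\<close> becomes one of
      \<open>t^(-2 M) N\<close>.\<close>
    obtain b where b: "b \<in> Fil 0" "\<And>y. y \<in> carrier R ==> t [^] (M + M) \<otimes> y \<in> N ==> \<not> cg 1 b y" using no by blast
    let ?s = "t [^] M"
    have s: "?s \<in> carrier R" "?s \<in> Fil (int M)" using tpow_Fil [of "int M"] tpow_nat [of t M] by auto
    have bc: "b \<in> carrier R" using b(1) by blast
    define a' where "a' = a \<oplus> ?s \<otimes> b"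
    have a': "a' \<in> carrier R" using a s bc by (simp add: a'_def)
    have "a' \<ominus> a = ?s \<otimes> b" unfolding a'_def using a s(1) bc by algebra
    hence "cg (int M) a' a" using a a' Fil_mult [OF s(2) b(1)] by (simp add: cg_def)
    moreover have "\<not> cg (int M + 1) a' y" if y: "y \<in> carrier R" "?s \<otimes> y \<in> N" for y
    proof
      assume "cg (int M + 1) a' y"
      hence "cg (int M + 1) (a' \<ominus> a) (y \<ominus> y0)" by (rule cg_minus [OF _ y0(3)])
      hence "cg (- int M + (int M + 1)) (tpow R t (- int M) \<otimes> (?s \<otimes> b)) (tpow R t (- int M) \<otimes> (y \<ominus> y0))"
        unfolding \<open>a' \<ominus> a = ?s \<otimes> b\<close> by (rule cg_mult_left [OF _ tpow_Fil])
      moreover have "tpow R t (- int M) \<otimes> (?s \<otimes> b) = b"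
        using tpow_cancel(2) [OF t_unit bc, of "int M"] by (simp add: tpow_nat)
      ultimately have "cg 1 b (tpow R t (- int M) \<otimes> (y \<ominus> y0))" by simp
      moreover have "t [^] (M + M) \<otimes> (tpow R t (- int M) \<otimes> (y \<ominus> y0)) = ?s \<otimes> y \<ominus> ?s \<otimes> y0"
      proof -
        have "?s \<otimes> (tpow R t (- int M) \<otimes> (y \<ominus> y0)) = y \<ominus> y0"
          using tpow_cancel(1) [OF t_unit, of "y \<ominus> y0" "int M"] y(1) y0(1) by (simp add: tpow_nat)
        hence "t [^] (M + M) \<otimes> (tpow R t (- int M) \<otimes> (y \<ominus> y0)) = ?s \<otimes> (y \<ominus> y0)"
          using s(1) y(1) y0(1) by (simp add: nat_pow_mult [symmetric] m_assoc)
        also have "\<dots> = ?s \<otimes> y \<ominus> ?s \<otimes> y0" using s(1) y(1) y0(1) by algebra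
        finally show ?thesis .
      qed
      ultimately show False using b(2) [of "tpow R t (- int M) \<otimes> (y \<ominus> y0)"] N(2) [OF y(2) y0(2)] y(1) y0(1) by simp
    qed
    ultimately show ?thesis using a' by blast
  qed
  obtain f where f: "\<And>a M. a \<in> carrier R ==> f M a \<in> carrier R \<and> cg (int M) (f M a) a \<and>
      (\<forall>y\<in>carrier R. t [^] M \<otimes> y \<in> N --> \<not> cg (int M + 1) (f M a) y)"
  proof (rule that [of "\<lambda>M a. SOME a'. a' \<in> carrier R \<and> cg (int M) a' a \<and>
      (\<forall>y\<in>carrier R. t [^] M \<otimes> y \<in> N --> \<not> cg (int M + 1) a' y)"])
  qed (rule someI_ex, rule step)
  define s where "s = rec_nat \<zero> f"
  have s_Suc: "s (Suc m) = f m (s m)" for m by (simp add: s_def)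
  have sc: "s m \<in> carrier R" for m
  proof (induction m)
    case 0
    show ?case by (simp add: s_def)
  next
    case (Suc m)
    thus ?case unfolding s_Suc using f by blast
  qed
  have "cg (int m) (s (Suc m)) (s m)" for m unfolding s_Suc using f [OF sc] by blast
  then obtain y where y: "y \<in> carrier R" "\<And>m. cg (int m) y (s m)" using fast_complete [of s] sc by blast
  \<comment> \<open>The limit lies in the \<open>M\<close>-th subgroup, yet agrees with
    \<open>s (Suc M)\<close> to the precision \<open>M + 1\<close> at which that member avoids the
    subgroup.\<close>
  obtain M :: nat where M: "t [^] M \<otimes> y \<in> N" using ex [OF y(1)] by blast
  have "\<not> cg (int M + 1) (s (Suc M)) y" unfolding s_Suc using f [OF sc, of M M] M y(1) by blast
  moreover have "cg (int M + 1) (s (Suc M)) y" using cg_sym [OF y(2) [of "Suc M"]] by (simp add: add.commute)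
  ultimately show False by blast
qed

lemma mod_class_eq_iff:
  assumes "cring R" and p: "p \<in> carrier R" and ab: "a \<in> carrier R" "b \<in> carrier R"
  shows "mod_class R p a = mod_class R p b \<longleftrightarrow> (\<exists>z\<in>carrier R. a = b \<oplus>\<^bsub>R\<^esub> p \<otimes>\<^bsub>R\<^esub> z)"
proof -
  interpret cring R by fact
  have "mod_class R p a = mod_class R p b \<longleftrightarrow> a \<ominus>\<^bsub>R\<^esub> b \<in> PIdl\<^bsub>R\<^esub> p"
    unfolding mod_class_def by (rule ideal.coset_eq_iff [OF cgenideal_ideal [OF p] ab])
  also have "\<dots> \<longleftrightarrow> (\<exists>z\<in>carrier R. a \<ominus>\<^bsub>R\<^esub> b = z \<otimes>\<^bsub>R\<^esub> p)" by (auto simp: cgenideal_def)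
  also have "\<dots> \<longleftrightarrow> (\<exists>z\<in>carrier R. a = b \<oplus>\<^bsub>R\<^esub> p \<otimes>\<^bsub>R\<^esub> z)"
  proof (rule bex_cong [OF HOL.refl])
    fix z assume z: "z \<in> carrier R"
    show "a \<ominus>\<^bsub>R\<^esub> b = z \<otimes>\<^bsub>R\<^esub> p \<longleftrightarrow> a = b \<oplus>\<^bsub>R\<^esub> p \<otimes>\<^bsub>R\<^esub> z"
    proof
      assume "a \<ominus>\<^bsub>R\<^esub> b = z \<otimes>\<^bsub>R\<^esub> p"
      hence "b \<oplus>\<^bsub>R\<^esub> p \<otimes>\<^bsub>R\<^esub> z = b \<oplus>\<^bsub>R\<^esub> (a \<ominus>\<^bsub>R\<^esub> b)" using z p by (simp add: m_comm)
      also have "\<dots> = a" using ab by algebra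
      finally show "a = b \<oplus>\<^bsub>R\<^esub> p \<otimes>\<^bsub>R\<^esub> z" by simp
    next
      assume "a = b \<oplus>\<^bsub>R\<^esub> p \<otimes>\<^bsub>R\<^esub> z"
      thus "a \<ominus>\<^bsub>R\<^esub> b = z \<otimes>\<^bsub>R\<^esub> p" using z ab p by algebra
    qed
  qed
  finally show ?thesis .
qed

section \<open>The given map on monomials and its boundedness\<close>

locale lifting = psa K v \<pi> A \<eta> T
  for K :: "('k, 'm) ring_scheme" and v \<pi> and A :: "('a, 'b) top_ring_scheme" (structure) and \<eta> T +
  fixes r :: nat and \<sigma> :: "(int => 'k set) => 'a set" and \<phi> :: "((nat \<Rightarrow>\<^sub>0 nat) => int => 'k set) => 'a set"
  assumes \<sigma>: "is_laurent_structure_map K v \<pi> A \<eta> T \<sigma>"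
    and \<phi>: "finite_injection (laurent_series_ring (residue_field K v))
           (tate_algebra r (laurent_series_ring (residue_field K v)))
           (series_const (laurent_series_ring (residue_field K v)))
           (mod_ring A (\<eta> \<pi>)) \<sigma> \<phi>"
begin

abbreviation kL where "kL \<equiv> laurent_series_ring kk"
abbreviation TK where "TK \<equiv> tate_algebra r kL"
abbreviation Am where "Am \<equiv> mod_ring A p"
abbreviation cl where "cl \<equiv> mod_class A p"
abbreviation FK where "FK \<equiv> laurent_Fil kk"

sublocale KL: complete_filt_ring kL FK "series_monom kk 1" by (rule k.laurent_complete)
sublocale KL: filt_top_ring kL FK "series_monom kk 1" by unfold_locales (rule k.laurent_filt_top)

lemma PIdl_ideal: "ideal (PIdl p) A"
  by (rule A.cgenideal_ideal) simp

lemma Am_cring: "cring Am"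
  unfolding mod_ring_def quot_top_ring_def
  by (rule cring_with_topology [OF ideal.quotient_is_cring [OF PIdl_ideal A.is_cring]])

sublocale Am: cring Am by (rule Am_cring)

lemma cl_hom: "cl \<in> ring_hom A Am"
  using ideal.rcos_ring_hom [OF PIdl_ideal]
  by (simp add: mod_ring_def quot_top_ring_def ring_hom_with_topology mod_class_def [abs_def])

lemma cl_closed [simp]: "a \<in> carrier A ==> cl a \<in> carrier Am" by (rule ring_hom_closed [OF cl_hom])

lemma cl_surj: "c \<in> carrier Am ==> \<exists>a\<in>carrier A. c = cl a"
  by (auto simp: mod_ring_def quot_top_ring_def mod_class_def FactRing_def A_RCOSETS_def')

lemma cl_eq_iff:
  assumes "a \<in> carrier A" "b \<in> carrier A"
  shows "cl a = cl b \<longleftrightarrow> (\<exists>z\<in>carrier A. a = b \<oplus> p \<otimes> z)"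
  by (rule mod_class_eq_iff [OF A.is_cring E.p_carrier assms])

lemma openin_Am:
  "openin (opens Am) W \<longleftrightarrow> W \<subseteq> carrier Am \<and> openin (opens A) {x \<in> carrier A. cl x \<in> W}"
proof -
  define P where "P W \<longleftrightarrow> W \<subseteq> carrier Am \<and> openin (opens A) {x \<in> carrier A. cl x \<in> W}" for W
  have "istopology P" unfolding istopology_def
  proof (intro conjI allI impI)
    fix S U assume "P S" "P U"
    moreover have "{x \<in> carrier A. cl x \<in> S \<inter> U} = {x \<in> carrier A. cl x \<in> S} \<inter> {x \<in> carrier A. cl x \<in> U}" by blast
    ultimately show "P (S \<inter> U)" unfolding P_def by auto
  next
    fix \<K> assume K: "\<forall>S\<in>\<K>. P S"
    have "{x \<in> carrier A. cl x \<in> \<Union> \<K>} = \<Union> ((\<lambda>S. {x \<in> carrier A. cl x \<in> S}) ` \<K>)" by blast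
    thus "P (\<Union> \<K>)" using K unfolding P_def by auto
  qed
  moreover have "opens Am = topology P"
    unfolding mod_ring_def quot_top_ring_def P_def mod_class_def by simp
  ultimately show ?thesis by (simp add: topology_inverse' P_def)
qed

lemma \<sigma>_hom: "\<sigma> \<in> ring_hom kL Am"
  and \<sigma>_const: "x \<in> carrier OK ==> \<sigma> (series_const kk (residue K v x)) = cl (\<eta> x)"
  and \<sigma>_T: "\<sigma> (series_monom kk 1) = cl T"
  using \<sigma> by (auto simp: is_laurent_structure_map_def cont_ring_hom_def)

lemma \<phi>_hom: "\<phi> \<in> ring_hom TK Am"
  and \<phi>_cont: "continuous_map (opens TK) (opens Am) \<phi>"
  and \<phi>_const: "c \<in> carrier kL ==> \<phi> (series_const kL c) = \<sigma> c"
  and \<phi>_inj: "inj_on \<phi> (carrier TK)"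
  and \<phi>_fin: "module_finite TK Am \<phi>"
  using \<phi> by (auto simp: finite_injection_def cont_algebra_hom_def cont_ring_hom_def)

lemma \<phi>_closed: "f \<in> carrier TK ==> \<phi> f \<in> carrier Am" by (rule ring_hom_closed [OF \<phi>_hom])

lemma \<phi>_add: "f \<in> carrier TK ==> g \<in> carrier TK ==> \<phi> (\<lambda>\<nu>. f \<nu> \<oplus>\<^bsub>kL\<^esub> g \<nu>) = \<phi> f \<oplus>\<^bsub>Am\<^esub> \<phi> g"
  using ring_hom_add [OF \<phi>_hom, of f g] by simp

lemma \<phi>_scale: "c \<in> carrier kL ==> f \<in> carrier TK ==> \<phi> (\<lambda>\<nu>. c \<otimes>\<^bsub>kL\<^esub> f \<nu>) = \<sigma> c \<otimes>\<^bsub>Am\<^esub> \<phi> f"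
proof -
  assume c: "c \<in> carrier kL" and f: "f \<in> carrier TK"
  have s: "series_const kL c = tmon kL 0 c" by (simp add: series_const_def tmon_def fun_eq_iff)
  have "series_const kL c \<in> carrier TK" unfolding s by (rule KL.tmon_closed [OF c]) simp
  thus ?thesis
    using ring_hom_mult [OF \<phi>_hom _ f, of "series_const kL c"] KL.tate_const_mult [OF c f] \<phi>_const [OF c] by simp
qed

lemma kmon_\<sigma>: "\<sigma> (series_monom kk a) = cl (tpow A T a)"
  using ring_hom_tpow [OF KL.is_cring Am.is_cring \<sigma>_hom k.laurent_t_unit, of a] k.laurent_tpow_eq [of a] \<sigma>_T
    ring_hom_tpow [OF A.is_cring Am.is_cring cl_hom T_unit, of a] by simp

text \<open>The reduction of the monomial \<open>\<gamma> T^a\<close>, that is, of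
  \<open>dmon \<gamma> a\<close> (see \<open>\<rho>_dmon\<close>).\<close>

definition kmon :: "'k => int => int => 'k set" where
  "kmon \<gamma> a = (\<lambda>j. if j = a then residue K v \<gamma> else \<zero>\<^bsub>kk\<^esub>)"

lemma kmon_Fil: "\<gamma> \<in> carrier OK ==> kmon \<gamma> a \<in> FK a"
  using ring_hom_closed [OF residue_hom] by (simp add: kmon_def laurent_Fil_def)

lemma kmon_eq: assumes g: "\<gamma> \<in> carrier OK"
  shows "kmon \<gamma> a = series_const kk (residue K v \<gamma>) \<otimes>\<^bsub>kL\<^esub> series_monom kk a"
proof -
  have rg: "residue K v \<gamma> \<in> carrier kk" by (rule ring_hom_closed [OF residue_hom g])
  have "series_monom kk a j \<in> carrier kk" for j by (simp add: series_monom_def)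
  thus ?thesis unfolding k.laurent_mult using k.conv_const [OF rg, of "series_monom kk a"] rg
    by (auto simp: kmon_def series_monom_def fun_eq_iff)
qed

lemma \<sigma>_kmon: "\<gamma> \<in> carrier OK ==> \<sigma> (kmon \<gamma> a) = cl (\<eta> \<gamma> \<otimes> tpow A T a)"
proof -
  assume g: "\<gamma> \<in> carrier OK"
  have rg: "residue K v \<gamma> \<in> carrier kk" by (rule ring_hom_closed [OF residue_hom g])
  have c: "series_const kk (residue K v \<gamma>) \<in> carrier kL" "series_monom kk a \<in> carrier kL"
    using rg by (auto simp: k.laurent_carrier series_const_def series_monom_def intro: exI [of _ 0] exI [of _ a])
  have "\<sigma> (kmon \<gamma> a) = cl (\<eta> \<gamma>) \<otimes>\<^bsub>Am\<^esub> cl (tpow A T a)"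
    using ring_hom_mult [OF \<sigma>_hom c] \<sigma>_const [OF g] kmon_\<sigma> kmon_eq [OF g] by simp
  thus ?thesis using ring_hom_mult [OF cl_hom A0_carrier [OF \<eta>_A0 [OF g]] tT] by simp
qed

text \<open>The restriction to \<open>l < r\<close> sits inside the choice, so that
  \<open>xs l\<close> belongs to \<open>A\<close> for every \<open>l\<close>.\<close>

definition xs :: "nat => 'a" where
  "xs l = (SOME a. a \<in> carrier A \<and> (l < r --> cl a = \<phi> (tmon kL (Poly_Mapping.single l 1) \<one>\<^bsub>kL\<^esub>)))"

lemma xs: "xs l \<in> carrier A" "l < r ==> cl (xs l) = \<phi> (tmon kL (Poly_Mapping.single l 1) \<one>\<^bsub>kL\<^esub>)"
proof -
  have "\<exists>a. a \<in> carrier A \<and> (l < r --> cl a = \<phi> (tmon kL (Poly_Mapping.single l 1) \<one>\<^bsub>kL\<^esub>))"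
  proof (cases "l < r")
    case True
    have "tmon kL (Poly_Mapping.single l 1) \<one>\<^bsub>kL\<^esub> \<in> carrier TK"
      by (rule KL.tmon_closed) (use True in auto)
    from cl_surj [OF \<phi>_closed [OF this]] show ?thesis by metis
  qed auto
  from someI_ex [OF this] show "xs l \<in> carrier A" "l < r ==> cl (xs l) = \<phi> (tmon kL (Poly_Mapping.single l 1) \<one>\<^bsub>kL\<^esub>)"
    unfolding xs_def by blast+
qed

definition xp :: "(nat \<Rightarrow>\<^sub>0 nat) => 'a" where
  "xp \<nu> = finprod A (\<lambda>l. xs l [^] Poly_Mapping.lookup \<nu> l) {..<r}"

lemma xp_closed [simp]: "xp \<nu> \<in> carrier A"
  unfolding xp_def by (rule A.finprod_closed) (use xs in auto)

lemma xp_0: "xp 0 = \<one>"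
  unfolding xp_def by (simp add: A.finprod_one_eqI)

lemma xp_add: "xp (\<nu> + \<mu>) = xp \<nu> \<otimes> xp \<mu>"
proof -
  have "xp \<nu> \<otimes> xp \<mu> = finprod A (\<lambda>l. xs l [^] Poly_Mapping.lookup \<nu> l \<otimes> xs l [^] Poly_Mapping.lookup \<mu> l) {..<r}"
    unfolding xp_def by (rule A.finprod_multf [symmetric]) (use xs in auto)
  also have "\<dots> = xp (\<nu> + \<mu>)"
    unfolding xp_def by (rule A.finprod_cong') (use xs in \<open>auto simp: A.nat_pow_mult lookup_add\<close>)
  finally show ?thesis by simp
qed

lemma xp_single: "l < r ==> xp (Poly_Mapping.single l j) = xs l [^] j"
proof -
  assume l: "l < r"
  have "xp (Poly_Mapping.single l j) = finprod A (\<lambda>i. if l = i then (\<lambda>i. xs i [^] j) i else \<one>) {..<r}"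
    unfolding xp_def by (rule A.finprod_cong') (use xs in \<open>auto simp: lookup_single when_def\<close>)
  also have "\<dots> = xs l [^] j" by (rule A.finprod_singleton) (use l xs in auto)
  finally show ?thesis .
qed

text \<open>Induction on the total degree, splitting off one variable at a time and using the choice
  of \<open>xs\<close> for it.\<close>

lemma \<phi>_monom: "Poly_Mapping.keys \<nu> \<subseteq> {..<r} ==> \<phi> (tmon kL \<nu> \<one>\<^bsub>kL\<^esub>) = cl (xp \<nu>)"
proof (induction "\<Sum>l<r. Poly_Mapping.lookup \<nu> l" arbitrary: \<nu> rule: less_induct)
  case less
  show ?case
  proof (cases "\<nu> = 0")
    case True
    have "tmon kL (0 :: nat \<Rightarrow>\<^sub>0 nat) \<one>\<^bsub>kL\<^esub> = \<one>\<^bsub>TK\<^esub>" by (simp add: tmon_def series_const_def fun_eq_iff)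
    thus ?thesis using True xp_0 ring_hom_one [OF \<phi>_hom] ring_hom_one [OF cl_hom] by metis
  next
    case False
    then obtain l where l: "l \<in> Poly_Mapping.keys \<nu>" by fastforce
    hence lr: "l < r" using less.prems by auto
    have l0: "0 < Poly_Mapping.lookup \<nu> l" using l by (simp add: in_keys_iff)
    define \<mu> where "\<mu> = \<nu> - Poly_Mapping.single l 1"
    have lk: "Poly_Mapping.lookup \<mu> i = Poly_Mapping.lookup \<nu> i - (if i = l then 1 else 0)" for i
      by (simp add: \<mu>_def lookup_minus lookup_single when_def)
    have e: "\<nu> = Poly_Mapping.single l 1 + \<mu>"
      by (rule poly_mapping_eqI) (use l0 in \<open>auto simp: lookup_add lk lookup_single when_def\<close>)
    have k: "Poly_Mapping.keys \<mu> \<subseteq> {..<r}"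
      using less.prems by (auto simp: in_keys_iff lk subset_iff split: if_splits)
    have "(\<Sum>i<r. Poly_Mapping.lookup \<mu> i) < (\<Sum>i<r. Poly_Mapping.lookup \<nu> i)"
      by (rule sum_strict_mono_ex1) (use lr l0 lk in auto)
    hence IH: "\<phi> (tmon kL \<mu> \<one>\<^bsub>kL\<^esub>) = cl (xp \<mu>)" by (rule less.hyps [OF _ k])
    have t: "tmon kL (Poly_Mapping.single l 1) \<one>\<^bsub>kL\<^esub> \<in> carrier TK" "tmon kL \<mu> \<one>\<^bsub>kL\<^esub> \<in> carrier TK"
      by (rule KL.tmon_closed; use lr k in simp)+
    have "\<phi> (tmon kL \<nu> \<one>\<^bsub>kL\<^esub>) = \<phi> (tmon kL (Poly_Mapping.single l 1) \<one>\<^bsub>kL\<^esub>) \<otimes>\<^bsub>Am\<^esub> \<phi> (tmon kL \<mu> \<one>\<^bsub>kL\<^esub>)"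
      using ring_hom_mult [OF \<phi>_hom t] KL.tmon_mult [OF KL.one_closed KL.one_closed, where \<nu> = "Poly_Mapping.single l 1" and \<mu> = \<mu>] e by simp
    also have "\<dots> = cl (xs l \<otimes> xp \<mu>)" using IH xs(2) [OF lr] ring_hom_mult [OF cl_hom xs(1) xp_closed] by simp
    also have "xs l \<otimes> xp \<mu> = xp \<nu>" using e xp_add [of "Poly_Mapping.single l 1" \<mu>] xp_single [OF lr, of 1] xs(1) by simp
    finally show ?thesis .
  qed
qed

lemma \<phi>_tmon:
  assumes "c \<in> carrier kL" "Poly_Mapping.keys \<nu> \<subseteq> {..<r}"
  shows "\<phi> (tmon kL \<nu> c) = \<sigma> c \<otimes>\<^bsub>Am\<^esub> cl (xp \<nu>)"
proof -
  have "tmon kL \<nu> c = (\<lambda>\<mu>. c \<otimes>\<^bsub>kL\<^esub> tmon kL \<nu> \<one>\<^bsub>kL\<^esub> \<mu>)"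
    using assms(1) by (auto simp: tmon_def fun_eq_iff simp del: One_nat_def)
  thus ?thesis
    using \<phi>_scale [OF assms(1) KL.tmon_closed [OF KL.one_closed assms(2)]] \<phi>_monom [OF assms(2)] by simp
qed

lemma \<phi>_kmon:
  assumes g: "\<gamma> \<in> carrier OK" and k: "Poly_Mapping.keys \<nu> \<subseteq> {..<r}"
  shows "\<phi> (tmon kL \<nu> (kmon \<gamma> a)) = cl (\<eta> \<gamma> \<otimes> tpow A T a \<otimes> xp \<nu>)"
  using \<phi>_tmon [OF KL.Fil_carrier [OF kmon_Fil [OF g]] k] \<sigma>_kmon [OF g]
    ring_hom_mult [OF cl_hom A.m_closed [OF A0_carrier [OF \<eta>_A0 [OF g]] tT] xp_closed] by simp

abbreviation FT where "FT \<equiv> TFil r kL FK"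

lemma FT_carrier: "f \<in> FT m ==> f \<in> carrier TK" by (simp add: TFil_def)

lemma FT_shift: "f \<in> FT m ==> (\<lambda>\<nu>. series_monom kk a \<otimes>\<^bsub>kL\<^esub> f \<nu>) \<in> FT (m + a)"
  using KL.tate_scale_closed [OF KL.tpow_carrier, of f r a] KL.Fil_mult [OF KL.tpow_Fil [of a], of _ m]
  unfolding TFil_def k.laurent_tpow_eq by (simp add: add.commute)

text \<open>Continuity provides one \<open>m0\<close> for which \<open>FT m0\<close> is mapped into
  the classes of \<open>Fil 0\<close>. As \<open>\<phi>\<close> turns the variable of
  \<open>k((T))\<close> into the class of \<open>T\<close>, the same loss occurs in every
  degree.\<close>

lemma \<phi>_bounded: "\<exists>M. \<forall>m. \<forall>f\<in>FT m. \<exists>a\<in>Fil (m - int M). \<phi> f = cl a"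
proof -
  \<comment> \<open>Open in the quotient, because its preimage \<open>Fil 0 + p A\<close> is stable
    under adding \<open>Fil 0\<close>.\<close>
  define W where "W = cl ` Fil 0"
  have "{x \<in> carrier A. cl x \<in> W} = {x \<in> carrier A. \<exists>z\<in>carrier A. \<exists>a\<in>Fil 0. x = a \<oplus> p \<otimes> z}"
    using cl_eq_iff F.Fil_carrier unfolding W_def by (auto simp: image_iff) metis+
  moreover have "openin (opens A) {x \<in> carrier A. \<exists>z\<in>carrier A. \<exists>a\<in>Fil 0. x = a \<oplus> p \<otimes> z}"
    unfolding F.openin_iff
  proof (intro conjI ballI)
    fix x assume "x \<in> {x \<in> carrier A. \<exists>z\<in>carrier A. \<exists>a\<in>Fil 0. x = a \<oplus> p \<otimes> z}"
    then obtain z a where z: "z \<in> carrier A" "a \<in> Fil 0" "x = a \<oplus> p \<otimes> z" by blast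
    have "x \<oplus> u \<in> {x \<in> carrier A. \<exists>z\<in>carrier A. \<exists>a\<in>Fil 0. x = a \<oplus> p \<otimes> z}" if u: "u \<in> Fil 0" for u
    proof -
      have c: "a \<in> carrier A" "u \<in> carrier A" "p \<in> carrier A" using z(2) u F.Fil_carrier by auto
      have "x \<oplus> u = (a \<oplus> u) \<oplus> p \<otimes> z" unfolding z(3) using c z(1) by algebra
      moreover have "x \<oplus> u \<in> carrier A" unfolding z(3) using c z(1) by simp
      ultimately show ?thesis using F.Fil_add [OF z(2) u] z(1) by blast
    qed
    thus "\<exists>m. \<forall>u\<in>Fil m. x \<oplus> u \<in> {x \<in> carrier A. \<exists>z\<in>carrier A. \<exists>a\<in>Fil 0. x = a \<oplus> p \<otimes> z}" by blast
  qed blast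
  ultimately have W: "openin (opens Am) W" unfolding openin_Am W_def using F.Fil_carrier by auto
  have tsp: "topspace (opens TK) = carrier TK"
  proof (rule filt_top_topspace [OF KL.tate_filt_top])
    fix x m u assume "x \<in> carrier TK" "u \<in> FT m"
    thus "x \<oplus>\<^bsub>TK\<^esub> u \<in> carrier TK" using KL.tate_add_closed [OF _ FT_carrier] by simp
  qed
  have "openin (opens TK) {f \<in> carrier TK. \<phi> f \<in> W}"
    using openin_continuous_map_preimage [OF \<phi>_cont W] by (simp add: tsp)
  hence op: "\<forall>x\<in>{f \<in> carrier TK. \<phi> f \<in> W}. \<exists>m. \<forall>u\<in>FT m. x \<oplus>\<^bsub>TK\<^esub> u \<in> {f \<in> carrier TK. \<phi> f \<in> W}"
    unfolding KL.tate_filt_top [of r, unfolded filt_top_def, rule_format] by blast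
  have z: "(\<lambda>_. \<zero>\<^bsub>kL\<^esub>) \<in> carrier TK" by (simp add: KL.tate_carrier)
  have "\<phi> (\<lambda>_. \<zero>\<^bsub>kL\<^esub>) \<oplus>\<^bsub>Am\<^esub> \<phi> (\<lambda>_. \<zero>\<^bsub>kL\<^esub>) = \<phi> (\<lambda>_. \<zero>\<^bsub>kL\<^esub>)" using \<phi>_add [OF z z] by simp
  hence "\<phi> (\<lambda>_. \<zero>\<^bsub>kL\<^esub>) = \<zero>\<^bsub>Am\<^esub>" using \<phi>_closed [OF z] by (metis Am.add.r_cancel_one')
  also have "\<zero>\<^bsub>Am\<^esub> = cl \<zero>" using ring_hom_zero' [OF A.ring_axioms Am.ring_axioms cl_hom] by simp
  finally have "(\<lambda>_. \<zero>\<^bsub>kL\<^esub>) \<in> {f \<in> carrier TK. \<phi> f \<in> W}" using z F.Fil_zero [of 0] unfolding W_def by blast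
  then obtain m0 where m0: "\<forall>u\<in>FT m0. (\<lambda>_. \<zero>\<^bsub>kL\<^esub>) \<oplus>\<^bsub>TK\<^esub> u \<in> {f \<in> carrier TK. \<phi> f \<in> W}" using op by blast
  have u0: "\<exists>a\<in>Fil 0. \<phi> u = cl a" if u: "u \<in> FT m0" for u
  proof -
    have "(\<lambda>_. \<zero>\<^bsub>kL\<^esub>) \<oplus>\<^bsub>TK\<^esub> u = u" using KL.tate_coeff [OF FT_carrier [OF u]] by (simp add: fun_eq_iff)
    hence "\<phi> u \<in> W" using bspec [OF m0 u] by simp
    thus ?thesis unfolding W_def by blast
  qed
  have "\<exists>a\<in>Fil (m - m0). \<phi> f = cl a" if f: "f \<in> FT m" for f m
  proof -
    let ?g = "\<lambda>\<nu>. series_monom kk (m0 - m) \<otimes>\<^bsub>kL\<^esub> f \<nu>"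
    have "?g \<in> FT m0" using FT_shift [OF f, of "m0 - m"] by simp
    then obtain a where a: "a \<in> Fil 0" "\<phi> ?g = cl a" using u0 by blast
    have mc: "series_monom kk b \<in> carrier kL" for b using KL.tpow_carrier [of b] unfolding k.laurent_tpow_eq .
    have e: "cl a = cl (tpow A T (m0 - m)) \<otimes>\<^bsub>Am\<^esub> \<phi> f" using \<phi>_scale [OF mc FT_carrier [OF f]] a(2) kmon_\<sigma> by simp
    have "cl (tpow A T (m - m0) \<otimes> a) = cl (tpow A T (m - m0)) \<otimes>\<^bsub>Am\<^esub> (cl (tpow A T (m0 - m)) \<otimes>\<^bsub>Am\<^esub> \<phi> f)"
      using ring_hom_mult [OF cl_hom tT F.Fil_carrier [OF a(1)]] e by simp
    also have "\<dots> = cl (tpow A T (m - m0) \<otimes> tpow A T (m0 - m)) \<otimes>\<^bsub>Am\<^esub> \<phi> f"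
      using ring_hom_mult [OF cl_hom tT tT] Am.m_assoc [OF cl_closed [OF tT] cl_closed [OF tT] \<phi>_closed [OF FT_carrier [OF f]]] by simp
    also have "\<dots> = \<phi> f"
      using A.tpow_add [OF T_unit, of "m - m0" "m0 - m"] ring_hom_one [OF cl_hom] \<phi>_closed [OF FT_carrier [OF f]] by simp
    finally show ?thesis using F.Fil_mult [OF F.tpow_Fil [of "m - m0"] a(1)] by (intro bexI [of _ "tpow A T (m - m0) \<otimes> a"]) auto
  qed
  moreover have "Fil (m - m0) \<subseteq> Fil (m - int (nat m0))" for m by (rule F.Fil_mono) simp
  ultimately show ?thesis by blast
qed

definition M2 where "M2 = (SOME M. \<forall>m. \<forall>f\<in>FT m. \<exists>a\<in>Fil (m - int M). \<phi> f = cl a)"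

lemma M2: "f \<in> FT m ==> \<exists>a\<in>Fil (m - int M2). \<phi> f = cl a"
  using someI_ex [OF \<phi>_bounded] unfolding M2_def by blast

text \<open>Monomials have coefficient 1, so all powers of a variable are bounded by the same
  \<open>M2\<close> modulo \<open>p\<close>, and \<open>power_bounded\<close> turns this into a
  level. The bounds of the \<open>r\<close> variables add up because levels are
  multiplicative.\<close>

lemma xp_bounded: "\<exists>n0\<ge>0. \<exists>c\<le>0. \<forall>n\<ge>n0. \<forall>\<nu>. level A Fil p n c (xp \<nu>)"
proof -
  have one: "\<exists>n0\<ge>0. \<exists>c\<le>0. \<forall>n\<ge>n0. \<forall>j::nat. level A Fil p n c (xs l [^] j)" if l: "l < r" for l
  proof (rule power_bounded [OF xs(1)])
    fix j :: nat
    have k: "Poly_Mapping.keys (Poly_Mapping.single l j) \<subseteq> {..<r}" using l by auto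
    have "tmon kL (Poly_Mapping.single l j) \<one>\<^bsub>kL\<^esub> \<in> FT 0" by (rule KL.tmon_TFil [OF KL.Fil_one k])
    then obtain a where a: "a \<in> Fil (0 - int M2)" "\<phi> (tmon kL (Poly_Mapping.single l j) \<one>\<^bsub>kL\<^esub>) = cl a" using M2 by blast
    have w: "xs l [^] j \<in> carrier A" using xs(1) by simp
    have "cl (xs l [^] j) = cl a" using a(2) \<phi>_monom [OF k] xp_single [OF l] by simp
    then obtain z where z: "z \<in> carrier A" "xs l [^] j = a \<oplus> p \<otimes> z"
      using cl_eq_iff [OF w F.Fil_carrier [OF a(1)]] by blast
    have "xs l [^] j \<ominus> p \<otimes> z = a" unfolding z(2) using z(1) F.Fil_carrier [OF a(1)] E.p_carrier by algebra
    thus "\<exists>z\<in>carrier A. xs l [^] j \<ominus> p \<otimes> z \<in> Fil (- int M2)" using z(1) a(1) by auto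
  qed
  have "\<exists>n0\<ge>0. \<exists>c\<le>0. \<forall>n\<ge>n0. \<forall>\<nu>::nat \<Rightarrow>\<^sub>0 nat. level A Fil p n c (finprod A (\<lambda>l. xs l [^] Poly_Mapping.lookup \<nu> l) {..<q})"
    if "q \<le> r" for q
    using that
  proof (induction q)
    case 0
    have "level A Fil p n 0 \<one>" for n by (rule level.base) (rule F.Fil_one)
    thus ?case by (intro exI [of _ 0]) auto
  next
    case (Suc q)
    from Suc.IH [OF Suc_leD [OF Suc.prems]] obtain n0 c where n0: "n0 \<ge> 0" "c \<le> 0"
      and n0': "\<forall>n\<ge>n0. \<forall>\<nu>::nat \<Rightarrow>\<^sub>0 nat. level A Fil p n c (finprod A (\<lambda>l. xs l [^] Poly_Mapping.lookup \<nu> l) {..<q})"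
      by (elim exE conjE) (rule that)
    have "q < r" using Suc.prems by simp
    from one [OF this] obtain n1 d where n1: "n1 \<ge> 0" "d \<le> 0"
      and n1': "\<forall>n\<ge>n1. \<forall>j. level A Fil p n d (xs q [^] (j::nat))"
      by (elim exE conjE) (rule that)
    have "level A Fil p n (d + c) (finprod A (\<lambda>l. xs l [^] Poly_Mapping.lookup \<nu> l) {..<Suc q})"
      if n: "n \<ge> max n0 n1" for n and \<nu> :: "nat \<Rightarrow>\<^sub>0 nat"
    proof -
      have "finprod A (\<lambda>l. xs l [^] Poly_Mapping.lookup \<nu> l) {..<Suc q}
        = xs q [^] Poly_Mapping.lookup \<nu> q \<otimes> finprod A (\<lambda>l. xs l [^] Poly_Mapping.lookup \<nu> l) {..<q}"
        unfolding lessThan_Suc by (rule A.finprod_insert) (use xs(1) in auto)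
      thus ?thesis using E.level_mult [OF n1' [rule_format] n0' [rule_format]] n by simp
    qed
    thus ?case using n0 n1 by (intro exI [of _ "max n0 n1"] conjI exI [of _ "d + c"]) auto
  qed
  from this [OF order_refl] show ?thesis unfolding xp_def .
qed

end

section \<open>Module generators with bounded denominators\<close>

context lifting
begin

definition EE :: "'a set set" where
  "EE = (SOME E. finite E \<and> E \<subseteq> carrier Am \<and>
    (\<forall>y\<in>carrier Am. \<exists>c. c \<in> E \<rightarrow> carrier TK \<and> y = (\<Oplus>\<^bsub>Am\<^esub>e\<in>E. \<phi> (c e) \<otimes>\<^bsub>Am\<^esub> e)))"

lemma EE_fin [simp]: "finite EE" and EE_sub: "EE \<subseteq> carrier Am"
  and EE_gen: "y \<in> carrier Am ==> \<exists>c. c \<in> EE \<rightarrow> carrier TK \<and> y = (\<Oplus>\<^bsub>Am\<^esub>e\<in>EE. \<phi> (c e) \<otimes>\<^bsub>Am\<^esub> e)"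
proof -
  have "\<exists>E. finite E \<and> E \<subseteq> carrier Am \<and>
    (\<forall>y\<in>carrier Am. \<exists>c. c \<in> E \<rightarrow> carrier TK \<and> y = (\<Oplus>\<^bsub>Am\<^esub>e\<in>E. \<phi> (c e) \<otimes>\<^bsub>Am\<^esub> e))"
    using \<phi>_fin unfolding module_finite_def .
  from someI_ex [OF this]
  show "finite EE" "EE \<subseteq> carrier Am"
    "y \<in> carrier Am ==> \<exists>c. c \<in> EE \<rightarrow> carrier TK \<and> y = (\<Oplus>\<^bsub>Am\<^esub>e\<in>EE. \<phi> (c e) \<otimes>\<^bsub>Am\<^esub> e)"
    unfolding EE_def [symmetric] by simp_all
qed

lemma EE_c [simp]: "e \<in> EE ==> e \<in> carrier Am" using EE_sub by auto

lemma \<phi>_c: "c \<in> EE \<rightarrow> FT m ==> e \<in> EE ==> \<phi> (c e) \<in> carrier Am"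
  by (rule \<phi>_closed [OF FT_carrier [OF funcset_mem]])

definition rp :: "'a set => 'a" where
  "rp e = (SOME a. a \<in> carrier A \<and> (e \<in> carrier Am --> cl a = e))"

lemma rp [simp]: "rp e \<in> carrier A" and cl_rp: "e \<in> carrier Am ==> cl (rp e) = e"
proof -
  have "\<exists>a. a \<in> carrier A \<and> (e \<in> carrier Am --> cl a = e)"
    using cl_surj [of e] by (cases "e \<in> carrier Am") auto
  from someI_ex [OF this] show "rp e \<in> carrier A" "e \<in> carrier Am ==> cl (rp e) = e"
    unfolding rp_def by blast+
qed

definition comb :: "('a set => 'a) => 'a" where "comb q = finsum A (\<lambda>e. q e \<otimes> rp e) EE"

lemma comb_closed [simp]: "q \<in> EE \<rightarrow> carrier A ==> comb q \<in> carrier A"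
  unfolding comb_def by (rule A.finsum_closed) auto

lemma comb_add:
  assumes "q \<in> EE \<rightarrow> carrier A" "q' \<in> EE \<rightarrow> carrier A"
  shows "comb (\<lambda>e. q e \<oplus> q' e) = comb q \<oplus> comb q'"
proof -
  have "comb (\<lambda>e. q e \<oplus> q' e) = finsum A (\<lambda>e. q e \<otimes> rp e \<oplus> q' e \<otimes> rp e) EE"
    unfolding comb_def by (rule A.finsum_cong') (use assms in \<open>auto simp: A.l_distr Pi_iff\<close>)
  thus ?thesis unfolding comb_def using assms by (subst (asm) A.finsum_addf) auto
qed

lemma cl_comb:
  assumes "q \<in> EE \<rightarrow> carrier A"
  shows "cl (comb q) = (\<Oplus>\<^bsub>Am\<^esub>e\<in>EE. cl (q e) \<otimes>\<^bsub>Am\<^esub> e)"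
proof -
  have "cl (comb q) = (\<Oplus>\<^bsub>Am\<^esub>e\<in>EE. cl (q e \<otimes> rp e))"
    unfolding comb_def by (rule ring_hom_finsum [OF A.ring_axioms Am.ring_axioms cl_hom]) (use assms in auto)
  also have "\<dots> = (\<Oplus>\<^bsub>Am\<^esub>e\<in>EE. cl (q e) \<otimes>\<^bsub>Am\<^esub> e)"
  proof (rule Am.finsum_cong' [OF HOL.refl])
    show "cl (q e \<otimes> rp e) = cl (q e) \<otimes>\<^bsub>Am\<^esub> e" if "e \<in> EE" for e
      using ring_hom_mult [OF cl_hom funcset_mem [OF assms that] rp, of e] cl_rp [OF EE_c [OF that]] by simp
  qed (use assms in \<open>auto simp: Pi_iff\<close>)
  finally show ?thesis .
qed

lemma TK_bdd: "f \<in> carrier TK ==> \<exists>m\<le>0. f \<in> FT m"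
proof (rule KL.tate_induct [of f r 0])
  fix g assume "g \<in> FT 0" thus "\<exists>m\<le>0. g \<in> FT m" by auto
next
  fix \<nu> :: "nat \<Rightarrow>\<^sub>0 nat" assume f: "f \<in> carrier TK" and k: "Poly_Mapping.keys \<nu> \<subseteq> {..<r}"
  obtain c where "c \<le> 0" "f \<nu> \<in> FK c" using KL.Fil_exh_le [OF KL.tate_coeff [OF f]] by blast
  thus "\<exists>m\<le>0. tmon kL \<nu> (f \<nu>) \<in> FT m" using KL.tmon_TFil [OF _ k] by blast
next
  fix g h assume gh: "g \<in> carrier TK" "h \<in> carrier TK" "\<exists>m\<le>0. g \<in> FT m" "\<exists>m\<le>0. h \<in> FT m"
  then obtain m l where ml: "m \<le> 0" "g \<in> FT m" "h \<in> FT l" by blast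
  have "(\<lambda>\<nu>. g \<nu> \<oplus>\<^bsub>kL\<^esub> h \<nu>) \<in> FT (min m l)"
    using ml KL.tate_add_closed [OF gh(1,2)] unfolding TFil_def
    by (auto intro!: KL.Fil_add intro: KL.Fil_monoD)
  thus "\<exists>m\<le>0. (\<lambda>\<nu>. g \<nu> \<oplus>\<^bsub>kL\<^esub> h \<nu>) \<in> FT m" using ml(1) by (intro exI [of _ "min m l"]) auto
qed

lemma FT_mono: "f \<in> FT l ==> m \<le> l ==> f \<in> FT m"
  unfolding TFil_def using KL.Fil_monoD by blast

text \<open>The classes are combinations of the generators with coefficients in the unit ball of the
  Tate algebra. The set is a subgroup, and every element of \<open>A\<close> enters it after
  multiplication by a power of \<open>T\<close>, as \<open>baire\<close> demands; it also contains
  all multiples of \<open>p\<close>.\<close>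

definition NN :: "'a set" where
  "NN = {a \<in> carrier A. \<exists>c\<in>EE \<rightarrow> FT 0. cl a = (\<Oplus>\<^bsub>Am\<^esub>e\<in>EE. \<phi> (c e) \<otimes>\<^bsub>Am\<^esub> e)}"

lemma NN_minus: assumes "x \<in> NN" "y \<in> NN" shows "x \<ominus> y \<in> NN"
proof -
  obtain c d where c: "c \<in> EE \<rightarrow> FT 0" "cl x = (\<Oplus>\<^bsub>Am\<^esub>e\<in>EE. \<phi> (c e) \<otimes>\<^bsub>Am\<^esub> e)"
    and d: "d \<in> EE \<rightarrow> FT 0" "cl y = (\<Oplus>\<^bsub>Am\<^esub>e\<in>EE. \<phi> (d e) \<otimes>\<^bsub>Am\<^esub> e)" and xy: "x \<in> carrier A" "y \<in> carrier A"
    using assms unfolding NN_def by blast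
  define h where "h = (\<lambda>e \<nu>. c e \<nu> \<ominus>\<^bsub>kL\<^esub> d e \<nu>)"
  have h: "h e \<in> FT 0" if "e \<in> EE" for e
    using c(1) d(1) that KL.tate_minus_closed [of "c e" r "d e"] KL.Fil_minus unfolding TFil_def h_def by (auto simp: Pi_iff)
  have "cl (x \<ominus> y) \<oplus>\<^bsub>Am\<^esub> cl y = cl x"
    using ring_hom_add [OF cl_hom, of "x \<ominus> y" y] xy by (simp add: A.minus_eq A.a_assoc A.l_neg)
  have s: "\<phi> (c e) = \<phi> (h e) \<oplus>\<^bsub>Am\<^esub> \<phi> (d e)" if e: "e \<in> EE" for e
  proof -
    have ce: "c e \<in> carrier TK" "d e \<in> carrier TK" using c(1) d(1) e FT_carrier by auto
    have "c e = (\<lambda>\<nu>. h e \<nu> \<oplus>\<^bsub>kL\<^esub> d e \<nu>)"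
    proof
      fix \<nu> show "c e \<nu> = h e \<nu> \<oplus>\<^bsub>kL\<^esub> d e \<nu>"
        unfolding h_def using KL.tate_coeff [OF ce(1), of \<nu>] KL.tate_coeff [OF ce(2), of \<nu>] by algebra
    qed
    thus ?thesis using \<phi>_add [OF FT_carrier [OF h [OF e]] ce(2)] by simp
  qed
  have cc: "\<phi> (h e) \<in> carrier Am" "\<phi> (d e) \<in> carrier Am" "e \<in> carrier Am" if "e \<in> EE" for e
    using \<phi>_closed [OF FT_carrier [OF h [OF that]]] \<phi>_c [OF d(1) that] EE_c [OF that] by simp_all
  have "cl x = (\<Oplus>\<^bsub>Am\<^esub>e\<in>EE. \<phi> (h e) \<otimes>\<^bsub>Am\<^esub> e \<oplus>\<^bsub>Am\<^esub> \<phi> (d e) \<otimes>\<^bsub>Am\<^esub> e)"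
    unfolding c(2) by (rule Am.finsum_cong') (use cc s in \<open>auto simp: Am.l_distr\<close>)
  also have "\<dots> = (\<Oplus>\<^bsub>Am\<^esub>e\<in>EE. \<phi> (h e) \<otimes>\<^bsub>Am\<^esub> e) \<oplus>\<^bsub>Am\<^esub> cl y"
    unfolding d(2) by (rule Am.finsum_addf) (use cc in auto)
  finally have "cl (x \<ominus> y) \<oplus>\<^bsub>Am\<^esub> cl y = (\<Oplus>\<^bsub>Am\<^esub>e\<in>EE. \<phi> (h e) \<otimes>\<^bsub>Am\<^esub> e) \<oplus>\<^bsub>Am\<^esub> cl y"
    using \<open>cl (x \<ominus> y) \<oplus>\<^bsub>Am\<^esub> cl y = cl x\<close> by simp
  hence "cl (x \<ominus> y) = (\<Oplus>\<^bsub>Am\<^esub>e\<in>EE. \<phi> (h e) \<otimes>\<^bsub>Am\<^esub> e)"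
    using xy cc by (subst (asm) Am.add.right_cancel) (auto intro!: Am.finsum_closed)
  thus ?thesis unfolding NN_def using h xy by auto
qed

lemma NN_shift:
  assumes a: "a \<in> carrier A" and c: "c \<in> EE \<rightarrow> FT m" "cl a = (\<Oplus>\<^bsub>Am\<^esub>e\<in>EE. \<phi> (c e) \<otimes>\<^bsub>Am\<^esub> e)"
    and j: "0 \<le> m + j"
  shows "tpow A T j \<otimes> a \<in> NN"
proof -
  define h where "h = (\<lambda>e \<nu>. series_monom kk j \<otimes>\<^bsub>kL\<^esub> c e \<nu>)"
  have mc: "series_monom kk j \<in> carrier kL" using KL.tpow_carrier [of j] unfolding k.laurent_tpow_eq .
  have h: "h e \<in> FT 0" if "e \<in> EE" for e unfolding h_def using FT_shift [of "c e" m j] c(1) that FT_mono [OF _ j] by auto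
  have cc: "\<phi> (c e) \<in> carrier Am" "e \<in> carrier Am" if "e \<in> EE" for e
    using \<phi>_c [OF c(1) that] EE_c [OF that] by simp_all
  have s: "\<phi> (h e) = cl (tpow A T j) \<otimes>\<^bsub>Am\<^esub> \<phi> (c e)" if "e \<in> EE" for e
    unfolding h_def using \<phi>_scale [OF mc FT_carrier, of "c e" m] c(1) that kmon_\<sigma> by auto
  have "cl (tpow A T j \<otimes> a) = cl (tpow A T j) \<otimes>\<^bsub>Am\<^esub> (\<Oplus>\<^bsub>Am\<^esub>e\<in>EE. \<phi> (c e) \<otimes>\<^bsub>Am\<^esub> e)"
    using ring_hom_mult [OF cl_hom tT a] c(2) by simp
  also have "\<dots> = (\<Oplus>\<^bsub>Am\<^esub>e\<in>EE. cl (tpow A T j) \<otimes>\<^bsub>Am\<^esub> (\<phi> (c e) \<otimes>\<^bsub>Am\<^esub> e))"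
    by (rule Am.finsum_rdistr) (use cc in auto)
  also have "\<dots> = (\<Oplus>\<^bsub>Am\<^esub>e\<in>EE. \<phi> (h e) \<otimes>\<^bsub>Am\<^esub> e)"
    by (rule Am.finsum_cong') (use cc s h \<phi>_closed [OF FT_carrier] in \<open>auto simp: Am.m_assoc\<close>)
  finally show ?thesis using h a unfolding NN_def by auto
qed

lemma NN_exh: assumes a: "a \<in> carrier A" shows "\<exists>M::nat. T [^] M \<otimes> a \<in> NN"
proof -
  obtain c where c: "c \<in> EE \<rightarrow> carrier TK" "cl a = (\<Oplus>\<^bsub>Am\<^esub>e\<in>EE. \<phi> (c e) \<otimes>\<^bsub>Am\<^esub> e)"
    using EE_gen [OF cl_closed [OF a]] by blast
  have "\<exists>m\<le>0. \<forall>e\<in>E'. c e \<in> FT m" if "finite E'" "E' \<subseteq> EE" for E'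
    using that
  proof (induction rule: finite_induct)
    case (insert e F)
    obtain m where m: "m \<le> 0" "\<forall>e\<in>F. c e \<in> FT m" using insert by blast
    obtain l where l: "l \<le> 0" "c e \<in> FT l" using TK_bdd [of "c e"] c(1) insert.prems by auto
    show ?case using m l FT_mono by (intro exI [of _ "min m l"]) auto
  qed auto
  from this [OF EE_fin order_refl] obtain m where "m \<le> 0" "\<forall>e\<in>EE. c e \<in> FT m" by (elim exE conjE) (rule that)
  hence m: "m \<le> 0" "c \<in> EE \<rightarrow> FT m" by auto
  have "T [^] nat (- m) \<otimes> a = tpow A T (- m) \<otimes> a" using m(1) A.tpow_nat [of T "nat (- m)"] by simp
  thus ?thesis using NN_shift [OF a m(2) c(2), of "- m"] by (intro exI [of _ "nat (- m)"]) simp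
qed

lemma NN_baire: "\<exists>M::nat. \<forall>a\<in>Fil 0. \<exists>y\<in>carrier A. T [^] M \<otimes> y \<in> NN \<and> F.cg 1 a y"
proof (rule F.baire)
  fix x assume "x \<in> NN"
  then obtain c where "x \<in> carrier A" "c \<in> EE \<rightarrow> FT 0" "cl x = (\<Oplus>\<^bsub>Am\<^esub>e\<in>EE. \<phi> (c e) \<otimes>\<^bsub>Am\<^esub> e)" unfolding NN_def by blast
  from NN_shift [OF this, of 1] show "T \<otimes> x \<in> NN" using T_unit by simp
qed (use NN_minus NN_exh in \<open>auto simp: NN_def\<close>)

text \<open>Finite sums of \<open>\<gamma> T^i x^\<nu>\<close> with \<open>i \<ge> 0\<close>. Being
  polynomial expressions in the lifted variables, they have explicit preimages in the unit ball,
  exact and not merely modulo \<open>p\<close> (\<open>QQ_lift\<close>), and the set does not depend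
  on \<open>n\<close>.\<close>

inductive_set QQ :: "'a set" where
  zero: "\<zero> \<in> QQ"
| add: "\<gamma> \<in> carrier OK ==> Poly_Mapping.keys \<nu> \<subseteq> {..<r} ==> q \<in> QQ ==>
    (\<eta> \<gamma> \<otimes> tpow A T (int i) \<otimes> xp \<nu>) \<oplus> q \<in> QQ"

lemma QQ_mono_closed: "\<gamma> \<in> carrier OK ==> \<eta> \<gamma> \<otimes> tpow A T i \<otimes> xp \<nu> \<in> carrier A"
  using A0_carrier [OF \<eta>_A0] tT by simp

lemma QQ_carrier [simp]: "q \<in> QQ ==> q \<in> carrier A"
  by (induction rule: QQ.induct) (use QQ_mono_closed in auto)

lemma QQ_add: "q \<in> QQ ==> q' \<in> QQ ==> q \<oplus> q' \<in> QQ"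
  by (induction rule: QQ.induct) (use QQ_mono_closed QQ.add in \<open>auto simp: A.a_assoc\<close>)

lemma QQ_single: "\<gamma> \<in> carrier OK ==> Poly_Mapping.keys \<nu> \<subseteq> {..<r} ==> \<eta> \<gamma> \<otimes> tpow A T (int i) \<otimes> xp \<nu> \<in> QQ"
  using QQ.add [OF _ _ QQ.zero, of \<gamma> \<nu> i] QQ_mono_closed by simp

text \<open>Each step lifts the lowest remaining coefficient from the residue field to the integers
  and leaves a series of order one higher.\<close>

lemma QQ_peel:
  assumes x: "x \<in> FK 0" and k: "Poly_Mapping.keys \<nu> \<subseteq> {..<r}"
  shows "\<exists>q\<in>QQ. \<exists>x'\<in>FK (int N). \<phi> (tmon kL \<nu> x) = cl q \<oplus>\<^bsub>Am\<^esub> \<phi> (tmon kL \<nu> x')"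
proof (induction N)
  case 0
  have "cl \<zero> = \<zero>\<^bsub>Am\<^esub>" by (rule ring_hom_zero' [OF A.ring_axioms Am.ring_axioms cl_hom])
  thus ?case using x \<phi>_closed [OF KL.tmon_closed [OF KL.Fil_carrier [OF x] k]] QQ.zero
    by (intro bexI [of _ "\<zero>"] bexI [of _ x]) auto
next
  case (Suc N)
  then obtain q x' where q: "q \<in> QQ" "x' \<in> FK (int N)" "\<phi> (tmon kL \<nu> x) = cl q \<oplus>\<^bsub>Am\<^esub> \<phi> (tmon kL \<nu> x')" by blast
  have xc: "x' j \<in> carrier kk" for j using KL.Fil_carrier [OF q(2)] by (simp add: k.laurent_carrier)
  obtain \<gamma> where g: "\<gamma> \<in> carrier OK" "residue K v \<gamma> = x' (int N)" using residue_surj [OF xc] by blast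
  define y where "y = (\<lambda>j. if j = int N then \<zero>\<^bsub>kk\<^esub> else x' j)"
  have y: "y \<in> FK (int (Suc N))" using q(2) by (auto simp: y_def laurent_Fil_def)
  have e: "x' = kmon \<gamma> (int N) \<oplus>\<^bsub>kL\<^esub> y"
    unfolding k.laurent_add using xc g by (auto simp: y_def kmon_def fun_eq_iff)
  have kc: "kmon \<gamma> (int N) \<in> carrier kL" using kmon_Fil [OF g(1)] by blast
  have "\<phi> (tmon kL \<nu> x') = cl (\<eta> \<gamma> \<otimes> tpow A T (int N) \<otimes> xp \<nu>) \<oplus>\<^bsub>Am\<^esub> \<phi> (tmon kL \<nu> y)"
    unfolding e KL.tmon_add [OF kc KL.Fil_carrier [OF y]]
      \<phi>_add [OF KL.tmon_closed [OF kc k] KL.tmon_closed [OF KL.Fil_carrier [OF y] k]] \<phi>_kmon [OF g(1) k] by simp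
  hence "\<phi> (tmon kL \<nu> x) = cl (q \<oplus> \<eta> \<gamma> \<otimes> tpow A T (int N) \<otimes> xp \<nu>) \<oplus>\<^bsub>Am\<^esub> \<phi> (tmon kL \<nu> y)"
    unfolding q(3) using ring_hom_add [OF cl_hom QQ_carrier [OF q(1)] QQ_mono_closed [OF g(1)]]
      QQ_carrier [OF q(1)] QQ_mono_closed [OF g(1)] \<phi>_closed [OF KL.tmon_closed [OF KL.Fil_carrier [OF y] k]]
    by (simp add: Am.a_assoc)
  thus ?case using QQ_add [OF q(1) QQ_single [OF g(1) k]] y by blast
qed

text \<open>The series in the lifted variables need not converge in \<open>A\<close>. Finitely many
  of its terms are therefore lifted exactly, and the rest is small enough for its class to come from
  \<open>Fil s\<close>.\<close>

lemma QQ_approx: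
  assumes c: "c \<in> FT 0"
  shows "\<exists>q\<in>QQ. \<exists>a\<in>Fil s. \<phi> c = cl (q \<oplus> a)"
proof (rule KL.tate_induct [OF FT_carrier [OF c], where m = "s + int M2"])
  \<comment> \<open>\<open>M2\<close> is added in advance to pay for the loss of
    \<open>\<phi>\<close>.\<close>
  fix g assume "g \<in> FT (s + int M2)"
  then obtain a where a: "a \<in> Fil s" "\<phi> g = cl a" using M2 by fastforce
  hence "\<phi> g = cl (\<zero> \<oplus> a)" using F.Fil_carrier [OF a(1)] by simp
  thus "\<exists>q\<in>QQ. \<exists>a\<in>Fil s. \<phi> g = cl (q \<oplus> a)" using QQ.zero a(1) by blast
next
  fix \<nu> :: "nat \<Rightarrow>\<^sub>0 nat" assume k: "Poly_Mapping.keys \<nu> \<subseteq> {..<r}"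
  have x: "c \<nu> \<in> FK 0" using c by (simp add: TFil_def)
  obtain q x' where q: "q \<in> QQ" "x' \<in> FK (int (nat (s + int M2)))" "\<phi> (tmon kL \<nu> (c \<nu>)) = cl q \<oplus>\<^bsub>Am\<^esub> \<phi> (tmon kL \<nu> x')"
    using QQ_peel [OF x k] by blast
  have "tmon kL \<nu> x' \<in> FT (s + int M2)" using FT_mono [OF KL.tmon_TFil [OF q(2) k]] by simp
  then obtain a where a: "a \<in> Fil s" "\<phi> (tmon kL \<nu> x') = cl a" using M2 by fastforce
  hence "\<phi> (tmon kL \<nu> (c \<nu>)) = cl (q \<oplus> a)"
    unfolding q(3) using ring_hom_add [OF cl_hom QQ_carrier [OF q(1)] F.Fil_carrier [OF a(1)]] by simp
  thus "\<exists>q\<in>QQ. \<exists>a\<in>Fil s. \<phi> (tmon kL \<nu> (c \<nu>)) = cl (q \<oplus> a)" using q(1) a(1) by blast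
next
  fix g h assume gh: "g \<in> carrier TK" "h \<in> carrier TK"
    and "\<exists>q\<in>QQ. \<exists>a\<in>Fil s. \<phi> g = cl (q \<oplus> a)" "\<exists>q\<in>QQ. \<exists>a\<in>Fil s. \<phi> h = cl (q \<oplus> a)"
  then obtain q a q' a' where q: "q \<in> QQ" "a \<in> Fil s" "\<phi> g = cl (q \<oplus> a)" "q' \<in> QQ" "a' \<in> Fil s" "\<phi> h = cl (q' \<oplus> a')"
    by blast
  have cc: "q \<in> carrier A" "a \<in> carrier A" "q' \<in> carrier A" "a' \<in> carrier A" using q F.Fil_carrier by auto
  have "(q \<oplus> a) \<oplus> (q' \<oplus> a') = (q \<oplus> q') \<oplus> (a \<oplus> a')" using cc by algebra
  hence "\<phi> (\<lambda>\<nu>. g \<nu> \<oplus>\<^bsub>kL\<^esub> h \<nu>) = cl ((q \<oplus> q') \<oplus> (a \<oplus> a'))"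
    using \<phi>_add [OF gh] q(3,6) ring_hom_add [OF cl_hom, of "q \<oplus> a" "q' \<oplus> a'"] cc by simp
  thus "\<exists>q\<in>QQ. \<exists>a\<in>Fil s. \<phi> (\<lambda>\<nu>. g \<nu> \<oplus>\<^bsub>kL\<^esub> h \<nu>) = cl (q \<oplus> a)"
    using QQ_add [OF q(1,4)] F.Fil_add [OF q(2,5)] by blast
qed

lemma rp_bounded: "\<exists>c\<le>0. \<forall>e\<in>EE. rp e \<in> Fil c"
proof -
  have "\<exists>c\<le>0. \<forall>e\<in>E'. rp e \<in> Fil c" if "finite E'" for E'
    using that
  proof (induction rule: finite_induct)
    case (insert e F)
    then obtain m where m: "m \<le> 0" "\<forall>e\<in>F. rp e \<in> Fil m" by blast
    obtain l where l: "l \<le> 0" "rp e \<in> Fil l" using F.Fil_exh_le [OF rp] by blast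
    show ?case using m l F.Fil_monoD by (intro exI [of _ "min m l"]) auto
  qed auto
  thus ?thesis by simp
qed

text \<open>\<open>NN_baire\<close> supplies one denominator \<open>T^M\<close> for all of
  \<open>Fil 0\<close>; the coefficients are then approximated by \<open>QQ\<close> finely enough
  for the error to survive division by \<open>T^M\<close>.\<close>

lemma K1: "\<exists>M\<ge>0. \<forall>a\<in>Fil 0. \<exists>q\<in>EE \<rightarrow> QQ. \<exists>z\<in>carrier A. F.cg 1 a (tpow A T (- M) \<otimes> comb q \<oplus> p \<otimes> z)"
proof -
  obtain M :: nat where M: "\<And>a. a \<in> Fil 0 ==> \<exists>y\<in>carrier A. T [^] M \<otimes> y \<in> NN \<and> F.cg 1 a y"
    using NN_baire by blast
  obtain c0 where c0: "c0 \<le> 0" "\<And>e. e \<in> EE ==> rp e \<in> Fil c0" using rp_bounded by blast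
  have "\<exists>q\<in>EE \<rightarrow> QQ. \<exists>z\<in>carrier A. F.cg 1 a (tpow A T (- int M) \<otimes> comb q \<oplus> p \<otimes> z)" if a: "a \<in> Fil 0" for a
  proof -
    obtain y where y: "y \<in> carrier A" "T [^] M \<otimes> y \<in> NN" "F.cg 1 a y" using M [OF a] by blast
    let ?w = "T [^] M \<otimes> y"
    obtain c where c: "c \<in> EE \<rightarrow> FT 0" "cl ?w = (\<Oplus>\<^bsub>Am\<^esub>e\<in>EE. \<phi> (c e) \<otimes>\<^bsub>Am\<^esub> e)" and w: "?w \<in> carrier A"
      using y(2) unfolding NN_def by blast
    \<comment> \<open>An error in \<open>Fil s\<close>, multiplied by a generator in
      \<open>Fil c0\<close> and divided by \<open>T^M\<close>, still lies in
      \<open>Fil 1\<close>.\<close>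
    define s where "s = int M + 1 - c0"
    have "\<exists>q b. q \<in> QQ \<and> b \<in> Fil s \<and> \<phi> (c e) = cl (q \<oplus> b)" if "e \<in> EE" for e
      using QQ_approx [of "c e" s] c(1) that by blast
    then obtain q b where qb: "\<And>e. e \<in> EE ==> q e \<in> QQ \<and> b e \<in> Fil s \<and> \<phi> (c e) = cl (q e \<oplus> b e)" by metis
    have qc: "q \<in> EE \<rightarrow> carrier A" "b \<in> EE \<rightarrow> carrier A" using qb F.Fil_carrier by auto
    have "cl (comb (\<lambda>e. q e \<oplus> b e)) = (\<Oplus>\<^bsub>Am\<^esub>e\<in>EE. cl (q e \<oplus> b e) \<otimes>\<^bsub>Am\<^esub> e)"
      by (rule cl_comb) (use qc in auto)
    also have "\<dots> = cl ?w" unfolding c(2)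
      by (rule Am.finsum_cong') (use qb \<phi>_c [OF c(1)] in auto)
    finally have "cl ?w = cl (comb q \<oplus> comb b)" using comb_add [OF qc] by simp
    then obtain z where z: "z \<in> carrier A" "?w = comb q \<oplus> comb b \<oplus> p \<otimes> z"
      using cl_eq_iff [OF w, of "comb q \<oplus> comb b"] qc by auto
    let ?u = "tpow A T (- int M)"
    have "y = ?u \<otimes> ?w" using A.tpow_cancel(2) [OF T_unit y(1), of "int M"] by (simp add: A.tpow_nat)
    also have "\<dots> = (?u \<otimes> comb q \<oplus> p \<otimes> (?u \<otimes> z)) \<oplus> ?u \<otimes> comb b"
      unfolding z(2) using tT [of "- int M"] comb_closed [OF qc(1)] comb_closed [OF qc(2)] z(1) E.p_carrier by algebra
    finally have y2: "y = (?u \<otimes> comb q \<oplus> p \<otimes> (?u \<otimes> z)) \<oplus> ?u \<otimes> comb b" .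
    have "comb b \<in> Fil (s + c0)" unfolding comb_def
      by (rule F.Fil_finsum) (use qb c0(2) F.Fil_mult in auto)
    hence B: "?u \<otimes> comb b \<in> Fil 1" by (rule F.Fil_mult_eq [OF F.tpow_Fil]) (simp add: s_def)
    let ?g = "?u \<otimes> comb q \<oplus> p \<otimes> (?u \<otimes> z)"
    have gc: "?g \<in> carrier A" using qc z(1) by simp
    have "y \<ominus> ?g = ?u \<otimes> comb b" unfolding y2 using gc F.Fil_carrier [OF B] by algebra
    hence "F.cg 1 y ?g" using B gc y(1) by (simp add: F.cg_def)
    hence "F.cg 1 a ?g" by (rule F.cg_trans [OF y(3)])
    moreover have "q \<in> EE \<rightarrow> QQ" using qb by auto
    moreover have "?u \<otimes> z \<in> carrier A" using z(1) by simp
    ultimately show ?thesis by blast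
  qed
  thus ?thesis by (intro exI [of _ "int M"]) auto
qed

text \<open>The \<open>z\<close> of \<open>K1\<close> is uncontrolled, but \<open>p z\<close> is the
  difference of elements bounded at the fixed level \<open>n0\<close>. Dividing there bounds
  \<open>z\<close> by a constant, after which multiplication by \<open>p\<close> at a large level
  \<open>n\<close> gains enough to reach level 1.\<close>

lemma K2: "\<exists>M\<ge>0. \<exists>n1. \<forall>n\<ge>n1. \<forall>a\<in>Fil 0. \<exists>q\<in>EE \<rightarrow> QQ. level A Fil p n 1 (a \<ominus> tpow A T (- M) \<otimes> comb q)"
proof -
  obtain M where M: "M \<ge> 0" "\<And>a. a \<in> Fil 0 ==> \<exists>q\<in>EE \<rightarrow> QQ. \<exists>z\<in>carrier A. F.cg 1 a (tpow A T (- M) \<otimes> comb q \<oplus> p \<otimes> z)"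
    using K1 by blast
  obtain c0 where c0: "c0 \<le> 0" "\<And>e. e \<in> EE ==> rp e \<in> Fil c0" using rp_bounded by blast
  obtain n0 c where n0: "n0 \<ge> 0" "c \<le> 0" and xpl: "\<And>\<nu>. level A Fil p n0 c (xp \<nu>)" using xp_bounded by blast
  have Ql: "level A Fil p n0 c q" if "q \<in> QQ" for q
    using that
  proof induction
    case zero
    show ?case by (rule level.base) simp
  next
    case (add \<gamma> \<nu> q i)
    have "\<eta> \<gamma> \<otimes> tpow A T (int i) \<in> Fil 0"
      using F.Fil_mult [OF \<eta>_Fil [OF add(1)] F.tpow_Fil [of "int i"]] F.Fil_monoD by auto
    from E.level_base_mult [OF xpl this] show ?case by (intro E.level_add add.IH) simp
  qed
  have cl: "level A Fil p n0 (c + c0) (comb q)" if q: "q \<in> EE \<rightarrow> QQ" for q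
  proof -
    interpret LF: filt_ring A "Lev A Fil p n0" T by (rule E.level_filt_ring)
    have "comb q \<in> Lev A Fil p n0 (c + c0)" unfolding comb_def
    proof (rule LF.Fil_finsum)
      show "q e \<otimes> rp e \<in> Lev A Fil p n0 (c + c0)" if "e \<in> EE" for e
        unfolding Lev_def mem_Collect_eq
        by (rule E.level_mult [OF Ql [OF funcset_mem [OF q that]] level.base [of "rp e" Fil, OF c0(2) [OF that]]])
    qed
    thus ?thesis by (simp add: Lev_def)
  qed
  \<comment> \<open>A common bound for \<open>a - b\<close> and for \<open>T^(-M) comb q\<close>,
    independent of \<open>a\<close> and of the later \<open>n\<close>.\<close>
  define m where "m = min 0 (- M + (c + c0))"
  interpret LR: filt_ring_elem_reg A "Lev A Fil p n0" T p "max M1 n0" by (rule E.level_reg)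
  \<comment> \<open>For \<open>n \<ge> n1\<close> the bound \<open>m - max M1 n0\<close> on
    \<open>z\<close> is at least \<open>1 - n\<close>, which is what \<open>p z\<close> needs to
    have level 1.\<close>
  define n1 where "n1 = max n0 (1 - (m - max M1 n0))"
  have "\<exists>q\<in>EE \<rightarrow> QQ. level A Fil p n 1 (a \<ominus> tpow A T (- M) \<otimes> comb q)" if n: "n \<ge> n1" and a: "a \<in> Fil 0" for n a
  proof -
    obtain q z where q: "q \<in> EE \<rightarrow> QQ" "z \<in> carrier A" "F.cg 1 a (tpow A T (- M) \<otimes> comb q \<oplus> p \<otimes> z)"
      using M(2) [OF a] by blast
    have qc: "q \<in> EE \<rightarrow> carrier A" using QQ_carrier [OF funcset_mem [OF q(1)]] by simp
    let ?g = "tpow A T (- M) \<otimes> comb q"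
    define b where "b = a \<ominus> (?g \<oplus> p \<otimes> z)"
    have b: "b \<in> Fil 1" using q(3) by (simp add: F.cg_def b_def)
    have gc: "?g \<in> carrier A" using qc by simp
    have ac: "a \<in> carrier A" using a by blast
    have pz: "p \<otimes> z = (a \<ominus> b) \<oplus> (\<ominus> ?g)" unfolding b_def using gc ac q(2) E.p_carrier by algebra
    have "level A Fil p n0 m (a \<ominus> b)"
      by (rule level.base) (use a F.Fil_monoD [OF b, of 0] F.Fil_minus F.Fil_monoD in \<open>auto simp: m_def\<close>)
    moreover have "level A Fil p n0 m (\<ominus> ?g)"
      by (rule E.level_mono [OF E.level_neg [OF E.level_base_mult [OF cl [OF q(1)] F.tpow_Fil]]]) (simp add: m_def)
    ultimately have "level A Fil p n0 m (p \<otimes> z)" unfolding pz by (rule E.level_add)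
    hence "level A Fil p n0 (m - max M1 n0) z" using LR.p_reg [OF q(2), of m] by (simp add: Lev_def)
    hence "level A Fil p n (m - max M1 n0) z" by (rule E.level_mono_n) (use n in \<open>simp add: n1_def\<close>)
    hence "level A Fil p n (1 - n) z" by (rule E.level_mono) (use n in \<open>simp add: n1_def\<close>)
    hence "level A Fil p n 1 (b \<oplus> p \<otimes> z)" using b by (intro level.step)
    moreover have "b \<oplus> p \<otimes> z = a \<ominus> ?g" unfolding b_def using gc ac q(2) E.p_carrier by algebra
    ultimately show ?thesis using q(1) by auto
  qed
  thus ?thesis using M(1) by blast
qed

end

section \<open>The lifted homomorphism\<close>

text \<open>Fixes one sufficiently large \<open>n\<close>. The hypotheses record what large means:
  \<open>c0\<close> bounds all monomials in the lifted variables, and \<open>M\<close> is the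
  exponent of the denominator in the approximation by generators.\<close>

locale lift_level = lifting K v \<pi> A \<eta> T r \<sigma> \<phi>
  for K :: "('k, 'm) ring_scheme" and v \<pi> and A :: "('a, 'b) top_ring_scheme" (structure) and \<eta> T r \<sigma> \<phi> +
  fixes n :: nat and c0 M :: int
  assumes n1: "1 \<le> n"
    and c0: "c0 \<le> 0" and xp_level: "level A Fil p (int n) c0 (xp \<nu>)"
    and M: "0 \<le> M" and comb_approx: "a \<in> Fil 0 ==>
      \<exists>q\<in>EE \<rightarrow> QQ. level A Fil p (int n) 1 (a \<ominus> tpow A T (- M) \<otimes> comb q)"
begin

sublocale L: dvf_level K v \<pi> n by unfold_locales (rule n1)

abbreviation TL where "TL \<equiv> top_localisation A p (T [^] n)"
abbreviation jT where "jT \<equiv> \<lambda>a. fraction A (T [^] n) a 0"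
abbreviation FTL where "FTL \<equiv> \<lambda>m. jT ` Lev A Fil p (int n) m"
abbreviation B where "B \<equiv> loc_ring A p T n"
abbreviation lam where "lam \<equiv> loc_map A p T n"
abbreviation FB where "FB \<equiv> filt_top_ring.CFil TL FTL"

lemma jT_hom: "jT \<in> ring_hom A TL" and jT_inj: "inj_on jT (carrier A)"
  and jT_surj: "y \<in> carrier TL ==> \<exists>x\<in>carrier A. y = jT x"
  using E.top_localisation_filt(2,3,4) [where n = n] by simp_all

sublocale TL: filt_top_ring TL FTL "jT T" by (rule E.top_localisation_filt(1))

lemma lam_comp: "lam a = completion_map TL (jT a)"
  by (simp add: loc_map_def rational_localisation_map_def)

lemma B_completion: "B = completion TL"
  by (simp add: loc_ring_def rational_localisation_def)

lemma B_complete: "complete_filt_ring B FB (lam T)"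
  unfolding lam_comp B_completion by (rule TL.completion_complete)

sublocale B: complete_filt_ring B FB "lam T" by (rule B_complete)

lemma B_filt_top: "filt_top B FB"
  unfolding B_completion by (rule TL.completion_filt_top)

lemma lam_hom: "lam \<in> ring_hom A B"
proof (rule ring_hom_memI)
  note h = TL.completion_map_hom [folded B_completion]
  note jc = ring_hom_closed [OF jT_hom]
  show "lam x \<in> carrier B" if "x \<in> carrier A" for x unfolding lam_comp by (rule ring_hom_closed [OF h jc [OF that]])
  show "lam (x \<otimes> y) = lam x \<otimes>\<^bsub>B\<^esub> lam y" "lam (x \<oplus> y) = lam x \<oplus>\<^bsub>B\<^esub> lam y"
    if xy: "x \<in> carrier A" "y \<in> carrier A" for x y
    unfolding lam_comp ring_hom_mult [OF jT_hom xy] ring_hom_add [OF jT_hom xy]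
    by (rule ring_hom_mult [OF h jc [OF xy(1)] jc [OF xy(2)]], rule ring_hom_add [OF h jc [OF xy(1)] jc [OF xy(2)]])
  show "lam \<one> = \<one>\<^bsub>B\<^esub>" unfolding lam_comp ring_hom_one [OF jT_hom] by (rule ring_hom_one [OF h])
qed

lemma lam_closed [simp]: "a \<in> carrier A ==> lam a \<in> carrier B" by (rule ring_hom_closed [OF lam_hom])
lemma lam_mult: "x \<in> carrier A ==> y \<in> carrier A ==> lam (x \<otimes> y) = lam x \<otimes>\<^bsub>B\<^esub> lam y"
  by (rule ring_hom_mult [OF lam_hom])
lemma lam_add: "x \<in> carrier A ==> y \<in> carrier A ==> lam (x \<oplus> y) = lam x \<oplus>\<^bsub>B\<^esub> lam y"
  by (rule ring_hom_add [OF lam_hom])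
lemma lam_minus: "x \<in> carrier A ==> y \<in> carrier A ==> lam (x \<ominus> y) = lam x \<ominus>\<^bsub>B\<^esub> lam y"
  by (rule ring_hom_minus [OF A.ring_axioms B.ring_axioms lam_hom])
lemma lam_one: "lam \<one> = \<one>\<^bsub>B\<^esub>" by (rule ring_hom_one [OF lam_hom])
lemma lam_zero: "lam \<zero> = \<zero>\<^bsub>B\<^esub>" by (rule ring_hom_zero' [OF A.ring_axioms B.ring_axioms lam_hom])
lemma lam_tpow: "lam (tpow A T a) = tpow B (lam T) a"
  by (rule ring_hom_tpow [OF A.is_cring B.is_cring lam_hom T_unit])

text \<open>Localising at a unit is bijective and completing reflects filtrations, so estimates in
  \<open>B\<close> on elements of \<open>A\<close> are exactly levels, whether or not
  \<open>lam\<close> is injective.\<close>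

lemma lam_FB: assumes a: "a \<in> carrier A" shows "lam a \<in> FB m \<longleftrightarrow> level A Fil p (int n) m a"
proof -
  have "lam a \<in> FB m \<longleftrightarrow> jT a \<in> FTL m"
    unfolding lam_comp by (rule TL.completion_map_CFil_iff [OF ring_hom_closed [OF jT_hom a]])
  also have "\<dots> \<longleftrightarrow> a \<in> Lev A Fil p (int n) m"
  proof (rule inj_on_image_mem_iff [OF jT_inj a])
    show "Lev A Fil p (int n) m \<subseteq> carrier A" using E.level_carrier unfolding Lev_def by blast
  qed
  finally show ?thesis by (simp add: Lev_def)
qed

lemma lam_Fil: "a \<in> Fil m ==> lam a \<in> FB m"
  using lam_FB [of a m] F.Fil_carrier [of a m] level.base [of a Fil m] by simp

lemma lam_dense: "y \<in> carrier B ==> \<exists>a\<in>carrier A. B.cg m y (lam a)"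
proof -
  assume "y \<in> carrier B"
  then obtain x where x: "x \<in> carrier TL" "B.cg m y (completion_map TL x)"
    using TL.completion_dense [of y m] unfolding B_completion by blast
  obtain a where a: "a \<in> carrier A" "x = jT a" using jT_surj [OF x(1)] by blast
  have "B.cg m y (lam a)" using x(2) unfolding a(2) lam_comp .
  thus ?thesis using a(1) by blast
qed

lemma TL_reg: "filt_ring_elem_reg TL FTL (jT T) (jT p) (max M1 (int n))"
proof
  interpret R: filt_ring_elem_reg A "Lev A Fil p (int n)" T p "max M1 (int n)" by (rule E.level_reg)
  show "jT p \<in> FTL 0" using R.p_Fil by blast
  fix x m assume x: "x \<in> carrier TL" "jT p \<otimes>\<^bsub>TL\<^esub> x \<in> FTL m"
  obtain a where a: "a \<in> carrier A" "x = jT a" using jT_surj [OF x(1)] by blast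
  have "jT (p \<otimes> a) \<in> FTL m" using x(2) ring_hom_mult [OF jT_hom E.p_carrier a(1)] a(2) by simp
  moreover have "Lev A Fil p (int n) m \<subseteq> carrier A" using E.level_carrier unfolding Lev_def by blast
  ultimately have "p \<otimes> a \<in> Lev A Fil p (int n) m"
    using inj_on_image_mem_iff [OF jT_inj, of "p \<otimes> a"] a(1) by simp
  hence "a \<in> Lev A Fil p (int n) (m - max M1 (int n))" by (rule R.p_reg [OF a(1)])
  thus "x \<in> FTL (m - max M1 (int n))" unfolding a(2) by (rule imageI)
qed

lemma B_reg: "filt_ring_elem_reg B FB (lam T) (lam p) (max M1 (int n))"
  unfolding lam_comp B_completion by (rule TL.completion_reg [OF TL_reg])

sublocale BE: filt_ring_elem_reg B FB "lam T" "lam p" "max M1 (int n)" by (rule B_reg)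

text \<open>Zero lies in every \<open>FB m\<close> and division loses a bounded amount, so
  \<open>b\<close> lies in every \<open>FB m\<close>.\<close>

lemma B_p_torsion:
  assumes "b \<in> carrier B" "lam p \<otimes>\<^bsub>B\<^esub> b = \<zero>\<^bsub>B\<^esub>" shows "b = \<zero>\<^bsub>B\<^esub>"
proof (rule B.sep [OF assms(1)])
  fix m
  show "b \<in> FB m" using BE.p_reg [OF assms(1), of "m + max M1 (int n)"] assms(2) by simp
qed

text \<open>A restatement of \<open>\<pi> / T^n\<close> lying in the unit ball \<open>FB 0\<close>
  of the localisation.\<close>

lemma p_FB: "lam p \<in> FB (int n)"
proof -
  have "level A Fil p (int n) 0 \<one>" by (rule level.base) (rule F.Fil_one)
  hence "level A Fil p (int n) (int n) (p \<otimes> \<one>)" by (intro E.level_p) simp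
  thus ?thesis using lam_FB [of p] by simp
qed

lemma p_pow_FB: "lam p [^]\<^bsub>B\<^esub> (j::nat) \<in> FB (int n * int j)"
proof (induction j)
  case 0
  show ?case using B.Fil_one by simp
next
  case (Suc j)
  from B.Fil_mult [OF Suc p_FB] show ?case by (simp add: algebra_simps)
qed

text \<open>Modulo multiples of \<open>p\<close> the level filtration is no coarser than
  \<open>Fil\<close>; all terms of the Horner form but the leading one disappear.\<close>

lemma level_cl: "level A Fil p n' m x ==> \<exists>y\<in>carrier A. F.cg m x (p \<otimes> y)"
proof (induction rule: level.induct)
  case (base a m)
  thus ?case using F.cg_zero_iff [of m a] F.Fil_carrier [OF base] by (intro bexI [of _ "\<zero>"]) auto
next
  case (step a m y)
  have c: "a \<in> carrier A" "y \<in> carrier A" using step E.level_carrier F.Fil_carrier by auto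
  hence "(a \<oplus> p \<otimes> y) \<ominus> p \<otimes> y = a" using E.p_carrier by algebra
  thus ?case using c step by (intro bexI [of _ y]) (auto simp: F.cg_def)
qed

text \<open>Injectivity of \<open>A/pA\<close> into the reduction of \<open>B\<close>. Approximating
  \<open>b\<close> by an element of \<open>A\<close> leaves an error of high level, which
  \<open>level_cl\<close> turns into a multiple of \<open>p\<close> up to \<open>Fil m\<close>;
  multiples of \<open>p\<close> form a closed set in \<open>A\<close>.\<close>

lemma lam_p_dvd:
  assumes a: "a \<in> carrier A" and b: "b \<in> carrier B" "lam a = lam p \<otimes>\<^bsub>B\<^esub> b"
  shows "\<exists>z\<in>carrier A. a = p \<otimes> z"
proof (rule E.p_multiple_closed [OF A_complete a])
  fix m :: nat
  obtain y where y: "y \<in> carrier A" "B.cg (int m) b (lam y)" using lam_dense [OF b(1)] by blast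
  have "B.cg (int m) (lam a) (lam (p \<otimes> y))"
    using B.cg_mult_left [OF y(2) BE.p_Fil] b(2) lam_mult [OF E.p_carrier y(1)] by simp
  hence "level A Fil p (int n) (int m) (a \<ominus> p \<otimes> y)"
    using a y(1) lam_FB [of "a \<ominus> p \<otimes> y" "int m"] lam_minus [of a "p \<otimes> y"] by (simp add: B.cg_def)
  then obtain w where w: "w \<in> carrier A" "F.cg (int m) (a \<ominus> p \<otimes> y) (p \<otimes> w)" using level_cl by blast
  have "(a \<ominus> p \<otimes> y) \<ominus> p \<otimes> w = a \<ominus> p \<otimes> (y \<oplus> w)" using a y(1) w(1) E.p_carrier by algebra
  hence "F.cg (int m) a (p \<otimes> (y \<oplus> w))" using w a y(1) by (simp add: F.cg_def)
  thus "\<exists>y\<in>carrier A. F.cg (int m) a (p \<otimes> y)" using w(1) y(1) A.a_closed by blast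
qed

text \<open>The terms of the power series \<open>G\<close> evaluated at the element \<open>T\<close>
  of \<open>A\<close>.\<close>

definition evf :: "(nat => 'k) => nat => 'a" where "evf G i = \<eta> (G i) \<otimes> tpow A T (int i)"

lemma evf_Fil: "G \<in> carrier OT ==> evf G i \<in> Fil (int i)"
  unfolding evf_def by (rule F.Fil_mult0 [OF \<eta>_Fil [OF OT_coeff] F.tpow_Fil])

lemma evf_null: assumes G: "G \<in> carrier OT" shows "F.nullfam (evf G)"
  unfolding F.nullfam_def
proof (intro conjI allI)
  show "evf G i \<in> carrier A" for i using F.Fil_carrier [OF evf_Fil [OF G]] .
  fix m
  have "{i. evf G i \<notin> Fil m} \<subseteq> {..nat m}"
  proof
    fix i assume "i \<in> {i. evf G i \<notin> Fil m}"
    thus "i \<in> {..nat m}" using F.Fil_monoD [OF evf_Fil [OF G, of i], of m] by (cases "m \<le> int i") auto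
  qed
  thus "finite {i. evf G i \<notin> Fil m}" by (rule finite_subset) simp
qed

abbreviation ev where "ev G \<equiv> F.fsum (evf G)"

lemma ev_single: assumes g: "\<gamma> \<in> carrier OK" shows "ev (\<lambda>j. if j = i then \<gamma> else \<zero>\<^bsub>OK\<^esub>) = \<eta> \<gamma> \<otimes> tpow A T (int i)"
proof -
  have z: "\<eta> \<zero>\<^bsub>OK\<^esub> = \<zero>" using ring_hom_zero' [OF O.ring_axioms A.ring_axioms \<eta>_hom] by simp
  have "evf (\<lambda>j. if j = i then \<gamma> else \<zero>\<^bsub>OK\<^esub>) = (\<lambda>j. if j = i then \<eta> \<gamma> \<otimes> tpow A T (int i) else \<zero>)"
    using z tT by (auto simp: evf_def fun_eq_iff)
  thus ?thesis using F.fsum_single [of "\<eta> \<gamma> \<otimes> tpow A T (int i)" i] A0_carrier [OF \<eta>_A0 [OF g]] tT by simp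
qed

lemma ev_hom: "ev \<in> ring_hom OT A"
proof (rule ring_hom_memI)
  show "ev G \<in> carrier A" if "G \<in> carrier OT" for G by (rule F.fsum_closed [OF evf_null [OF that]])
  show "ev \<one>\<^bsub>OT\<^esub> = \<one>"
  proof -
    have "\<one>\<^bsub>OT\<^esub> = (\<lambda>j. if j = 0 then \<one>\<^bsub>OK\<^esub> else \<zero>\<^bsub>OK\<^esub>)" by (simp add: series_const_def fun_eq_iff)
    thus ?thesis using ev_single [OF O.one_closed, of 0] ring_hom_one [OF \<eta>_hom] by simp
  qed
  fix G H assume GH: "G \<in> carrier OT" "H \<in> carrier OT"
  note gc = OT_coeff [OF GH(1)] OT_coeff [OF GH(2)]
  note ec = A0_carrier [OF \<eta>_A0 [OF gc(1)]] A0_carrier [OF \<eta>_A0 [OF gc(2)]]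
  have "evf (G \<oplus>\<^bsub>OT\<^esub> H) = (\<lambda>i. evf G i \<oplus> evf H i)"
    using ring_hom_add [OF \<eta>_hom gc] A.l_distr [OF ec tT] by (simp add: evf_def fun_eq_iff)
  thus "ev (G \<oplus>\<^bsub>OT\<^esub> H) = ev G \<oplus> ev H" using F.fsum_add [OF evf_null [OF GH(1)] evf_null [OF GH(2)]] by simp
  have fin: "finite {(i, j). i + j = (q::nat) \<and> True}" for q
    by (rule finite_subset [of _ "{..q} \<times> {..q}"]) auto
  have "evf (conv OK G H) q = finsum A (\<lambda>(i, j). evf G i \<otimes> evf H j) {(i, j). i + j = q \<and> True}" for q
  proof -
    let ?Z = "{(i, j). i + j = q \<and> True}"
    have "conv OK G H q = finsum OK (\<lambda>(i, j). G i \<otimes>\<^bsub>OK\<^esub> H j) ?Z"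
      by (rule O.conv_superset) (use gc fin in auto)
    also have "\<eta> \<dots> = finsum A (\<lambda>ij. \<eta> (case ij of (i, j) => G i \<otimes>\<^bsub>OK\<^esub> H j)) ?Z"
      by (rule ring_hom_finsum [OF O.ring_axioms A.ring_axioms \<eta>_hom]) (use gc O.m_closed in \<open>auto simp del: OK_simps\<close>)
    finally have e: "\<eta> (conv OK G H q) = finsum A (\<lambda>ij. \<eta> (case ij of (i, j) => G i \<otimes>\<^bsub>OK\<^esub> H j)) ?Z" .
    have "evf (conv OK G H) q = finsum A (\<lambda>ij. \<eta> (case ij of (i, j) => G i \<otimes>\<^bsub>OK\<^esub> H j) \<otimes> tpow A T (int q)) ?Z"
      unfolding evf_def e by (rule A.finsum_ldistr [OF fin tT])
        (use gc O.m_closed A0_carrier [OF \<eta>_A0] in \<open>auto simp del: OK_simps\<close>)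
    also have "\<dots> = finsum A (\<lambda>(i, j). evf G i \<otimes> evf H j) ?Z"
    proof (rule A.finsum_cong' [OF HOL.refl])
      show "(\<lambda>(i, j). evf G i \<otimes> evf H j) \<in> ?Z \<rightarrow> carrier A"
        using F.Fil_carrier [OF evf_Fil [OF GH(1)]] F.Fil_carrier [OF evf_Fil [OF GH(2)]] by auto
      fix ij assume "ij \<in> ?Z"
      then obtain i j where ij: "ij = (i, j)" "i + j = q" by blast
      have t: "tpow A T (int q) = tpow A T (int i) \<otimes> tpow A T (int j)"
        using A.tpow_add [OF T_unit, of "int i" "int j"] unfolding ij(2) [symmetric] by simp
      have "(\<eta> (G i) \<otimes> \<eta> (H j)) \<otimes> (tpow A T (int i) \<otimes> tpow A T (int j)) = evf G i \<otimes> evf H j"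
        unfolding evf_def using ec(1) [of i] ec(2) [of j] tT [of "int i"] tT [of "int j"] by algebra
      thus "\<eta> (case ij of (i, j) => G i \<otimes>\<^bsub>OK\<^esub> H j) \<otimes> tpow A T (int q) = (case ij of (i, j) => evf G i \<otimes> evf H j)"
        unfolding ij(1) prod.case t ring_hom_mult [OF \<eta>_hom gc(1) gc(2)] .
    qed
    finally show ?thesis .
  qed
  hence "F.nullfam (evf (conv OK G H)) \<and> ev (conv OK G H) = ev G \<otimes> ev H"
    by (intro F.fsum_mult [where P = "\<lambda>_ _. True", OF evf_null [OF GH(1)] evf_null [OF GH(2)] fin]) auto
  thus "ev (G \<otimes>\<^bsub>OT\<^esub> H) = ev G \<otimes> ev H" by simp
qed

lemma ev_Fil: "G \<in> carrier OT ==> ev G \<in> Fil 0"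
  by (rule F.fsum_Fil [OF evf_null]) (auto intro: F.Fil_monoD [OF evf_Fil])

text \<open>Evaluation of power series at \<open>T\<close> passes to the localisation, since
  \<open>T^n\<close> becomes a unit, and to the completion. The required filtration estimate is
  checked on the pieces of \<open>LO_decomp\<close>: the weight \<open>n c + a\<close> of a monomial
  is matched by \<open>lam p\<close> lying in \<open>FB n\<close>.\<close>

lemma PD_ex: "\<exists>h\<in>ring_hom L.D B. (\<forall>m y. y \<in> L.FD m --> h y \<in> FB m) \<and>
    (\<forall>\<gamma>\<in>carrier OK. h (L.dm (L.\<iota> (series_const OK \<gamma>))) = lam (\<eta> \<gamma>)) \<and> h (L.dm L.\<tau>) = lam T"
proof -
  let ?g = "\<lambda>G. lam (ev G)"
  have g: "?g \<in> ring_hom OT B"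
    using ring_hom_trans [OF ev_hom lam_hom] by (simp add: comp_def)
  have gm: "ev (series_monom OK i) = tpow A T (int i)" for i
    using ev_single [OF O.one_closed, of i] ring_hom_one [OF \<eta>_hom] tT unfolding series_monom_def by simp
  have gcst: "ev (series_const OK \<gamma>) = \<eta> \<gamma>" if "\<gamma> \<in> carrier OK" for \<gamma>
    using ev_single [OF that, of 0] A0_carrier [OF \<eta>_A0 [OF that]] unfolding series_const_def by simp
  have "?g L.s \<in> Units B"
    unfolding gm by (rule ring_hom_Units [OF A.is_cring B.is_cring lam_hom A.tpow_Units [OF T_unit]])
  then obtain h where h: "h \<in> ring_hom L.LO B" "\<And>G. G \<in> carrier OT ==> h (L.\<iota> G) = lam (ev G)"
    using L.L.localisation_lift [OF B.is_cring g] by blast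
  have h\<tau>: "h L.\<tau> = lam T" using h(2) [OF OT_monom, of 1] gm [of 1] T_unit by simp
  have ht: "h (tpow L.LO L.\<tau> a) = lam (tpow A T a)" for a
    using ring_hom_tpow [OF L.LO.is_cring B.is_cring h(1) L.\<tau>_unit, of a] h\<tau> lam_tpow by simp
  note tc = L.LO.tpow_closed [OF L.\<tau>_unit]
  have hF: "h x \<in> FB l" if x: "x \<in> L.FilL l" for x l
  proof (rule L.LO_decomp [OF x order_refl])
    fix x y assume "x \<in> carrier L.LO" "y \<in> carrier L.LO" "h x \<in> FB l" "h y \<in> FB l"
    thus "h (x \<oplus>\<^bsub>L.LO\<^esub> y) \<in> FB l" using ring_hom_add [OF h(1), of x y] B.Fil_add by (simp del: localisation_carrier)
  next
    fix H assume H: "H \<in> carrier OT"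
    have "h (L.el l H) = lam (tpow A T l) \<otimes>\<^bsub>B\<^esub> lam (ev H)"
      using ring_hom_mult [OF h(1) tc L.\<iota>_carrier [OF H]] ht h(2) [OF H] by simp
    thus "h (L.el l H) \<in> FB l"
      using B.Fil_mult [OF lam_Fil [OF F.tpow_Fil] lam_Fil [OF ev_Fil [OF H]]] by simp
  next
    fix \<gamma> and c :: nat and a assume g: "\<gamma> \<in> carrier OK" and l: "l \<le> int n * int c + a"
    have hp: "h (L.\<iota> pc [^]\<^bsub>L.LO\<^esub> c) = lam p [^]\<^bsub>B\<^esub> c"
    proof (induction c)
      case 0
      show ?case using ring_hom_one [OF h(1)] by simp
    next
      case (Suc c)
      have "h (L.\<iota> pc) = lam p" using h(2) [OF OT_pc] gcst [OF pi_OK] by simp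
      thus ?case
        using Suc ring_hom_mult [OF h(1) L.LO.nat_pow_closed [OF L.\<iota>_carrier [OF OT_pc]] L.\<iota>_carrier [OF OT_pc], of c] by simp
    qed
    have pcc: "L.\<iota> pc [^]\<^bsub>L.LO\<^esub> c \<in> carrier L.LO" by (rule L.LO.nat_pow_closed [OF L.\<iota>_carrier [OF OT_pc]])
    have "h (L.\<iota> (series_const OK \<gamma>) \<otimes>\<^bsub>L.LO\<^esub> (L.\<iota> pc [^]\<^bsub>L.LO\<^esub> c \<otimes>\<^bsub>L.LO\<^esub> tpow L.LO L.\<tau> a))
      = lam (\<eta> \<gamma>) \<otimes>\<^bsub>B\<^esub> (lam p [^]\<^bsub>B\<^esub> c \<otimes>\<^bsub>B\<^esub> lam (tpow A T a))"
      using ring_hom_mult [OF h(1) L.\<iota>_carrier [OF OT_const [OF g]] L.LO.m_closed [OF pcc tc]] ring_hom_mult [OF h(1) pcc tc]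
        hp ht h(2) [OF OT_const [OF g]] gcst [OF g] by simp
    moreover have "lam p [^]\<^bsub>B\<^esub> c \<otimes>\<^bsub>B\<^esub> lam (tpow A T a) \<in> FB l"
      by (rule B.Fil_monoD [OF B.Fil_mult [OF p_pow_FB lam_Fil [OF F.tpow_Fil]] l])
    ultimately show "h (L.\<iota> (series_const OK \<gamma>) \<otimes>\<^bsub>L.LO\<^esub> (L.\<iota> pc [^]\<^bsub>L.LO\<^esub> c \<otimes>\<^bsub>L.LO\<^esub> tpow L.LO L.\<tau> a)) \<in> FB l"
      using B.Fil_mult0 [OF lam_Fil [OF \<eta>_Fil [OF g]]] by simp
  qed
  obtain q where q: "q \<in> ring_hom L.D B" "\<forall>m y. y \<in> L.FD m --> q y \<in> FB m" "\<forall>x\<in>carrier L.LO. q (L.dm x) = h x"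
    using hom_extension [OF L.FL.filt_ring_axioms L.D.filt_ring_axioms B_complete L.dm_hom L.dm_FD L.D_dense h(1) hF] by blast
  have "q (L.dm (L.\<iota> (series_const OK \<gamma>))) = lam (\<eta> \<gamma>)" if "\<gamma> \<in> carrier OK" for \<gamma>
    using bspec [OF q(3) L.\<iota>_carrier [OF OT_const [OF that]]] h(2) [OF OT_const [OF that]] gcst [OF that] by simp
  moreover have "q (L.dm L.\<tau>) = lam T" using bspec [OF q(3) L.\<iota>_carrier [OF OT_monom]] h\<tau> by simp
  ultimately show ?thesis using q(1,2) by blast
qed

definition PD where "PD = (SOME h. h \<in> ring_hom L.D B \<and> (\<forall>m y. y \<in> L.FD m --> h y \<in> FB m) \<and>
    (\<forall>\<gamma>\<in>carrier OK. h (L.dm (L.\<iota> (series_const OK \<gamma>))) = lam (\<eta> \<gamma>)) \<and> h (L.dm L.\<tau>) = lam T)"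

lemma PD_hom: "PD \<in> ring_hom L.D B" and PD_FB: "y \<in> L.FD m ==> PD y \<in> FB m"
  and PD_const: "\<gamma> \<in> carrier OK ==> PD (L.dm (L.\<iota> (series_const OK \<gamma>))) = lam (\<eta> \<gamma>)"
  and PD_\<tau>: "PD (L.dm L.\<tau>) = lam T"
proof -
  have "\<exists>h. h \<in> ring_hom L.D B \<and> (\<forall>m y. y \<in> L.FD m --> h y \<in> FB m) \<and>
    (\<forall>\<gamma>\<in>carrier OK. h (L.dm (L.\<iota> (series_const OK \<gamma>))) = lam (\<eta> \<gamma>)) \<and> h (L.dm L.\<tau>) = lam T"
    using PD_ex unfolding Bex_def .
  from someI_ex [OF this, folded PD_def] show "PD \<in> ring_hom L.D B" "y \<in> L.FD m ==> PD y \<in> FB m"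
    "\<gamma> \<in> carrier OK ==> PD (L.dm (L.\<iota> (series_const OK \<gamma>))) = lam (\<eta> \<gamma>)" "PD (L.dm L.\<tau>) = lam T"
    by simp_all
qed

lemma PD_closed: "d \<in> carrier L.D ==> PD d \<in> carrier B" by (rule ring_hom_closed [OF PD_hom])

lemma PD_tpow: "PD (tpow L.D (L.dm L.\<tau>) a) = lam (tpow A T a)"
  using ring_hom_tpow [OF L.D.is_cring B.is_cring PD_hom L.D.t_unit, of a] PD_\<tau> lam_tpow by simp

lemma PD_dmon: "\<gamma> \<in> carrier OK ==> PD (L.dmon \<gamma> a) = lam (\<eta> \<gamma> \<otimes> tpow A T a)"
  using ring_hom_mult [OF PD_hom L.dm_carrier [OF L.\<iota>_carrier [OF OT_const]] L.D.tpow_carrier]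
    PD_const PD_tpow lam_mult [OF A0_carrier [OF \<eta>_A0] tT] by simp

end

text \<open>Both summands are bounded by \<open>q\<close> in every coordinate and vanish off its
  keys; the second is determined by the first.\<close>

lemma finite_multi_index_sum: "finite {(i, j). i + j = (q :: nat \<Rightarrow>\<^sub>0 nat)}"
proof -
  let ?A = "Poly_Mapping.keys q" let ?b = "\<Sum>x\<in>Poly_Mapping.keys q. Poly_Mapping.lookup q x"
  let ?S = "{i. \<exists>j. i + j = q}"
  have "Poly_Mapping.lookup ` ?S \<subseteq> {f. \<forall>x. (x \<in> ?A --> f x \<in> {..?b}) \<and> (x \<notin> ?A --> f x = 0)}"
  proof
    fix f assume "f \<in> Poly_Mapping.lookup ` ?S"
    then obtain i j where ij: "f = Poly_Mapping.lookup i" "i + j = q" by blast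
    have le: "f x \<le> Poly_Mapping.lookup q x" for x unfolding ij(1) ij(2) [symmetric] by (simp add: lookup_add)
    have "f x \<le> ?b" if "x \<in> ?A" for x
      using le [of x] member_le_sum [OF that, of "Poly_Mapping.lookup q"] by simp
    moreover have "f x = 0" if "x \<notin> ?A" for x using le [of x] that by (simp add: in_keys_iff)
    ultimately show "f \<in> {f. \<forall>x. (x \<in> ?A --> f x \<in> {..?b}) \<and> (x \<notin> ?A --> f x = 0)}" by simp
  qed
  hence "finite (Poly_Mapping.lookup ` ?S)" by (rule finite_subset) (rule finite_set_of_finite_funs; simp)
  hence S: "finite ?S" by (rule finite_imageD) (auto simp: inj_on_def intro: poly_mapping_eqI)
  have "{(i, j). i + j = q} \<subseteq> (\<lambda>i. (i, q - i)) ` ?S" by force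
  thus ?thesis by (rule finite_subset) (use S in simp)
qed

context lift_level
begin

sublocale LD: filt_top_ring L.D L.FD "L.dm L.\<tau>" by unfold_locales (rule L.D_filt_top)

abbreviation TX where "TX \<equiv> tate_algebra r L.D"
abbreviation FX where "FX \<equiv> TFil r L.D L.FD"
abbreviation pD where "pD \<equiv> L.dm (L.\<iota> pc)"

lemma FX_carrier: "f \<in> FX m ==> f \<in> carrier TX" by (simp add: TFil_def)

lemma FX_add: "f \<in> FX m ==> g \<in> FX m ==> (\<lambda>\<nu>. f \<nu> \<oplus>\<^bsub>L.D\<^esub> g \<nu>) \<in> FX m"
  unfolding TFil_def using LD.tate_add_closed [of f r g] L.D.Fil_add by blast

lemma FX_scale: "d \<in> L.FD a ==> f \<in> FX m ==> (\<lambda>\<nu>. d \<otimes>\<^bsub>L.D\<^esub> f \<nu>) \<in> FX (a + m)"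
  unfolding TFil_def using LD.tate_scale_closed [OF L.D.Fil_carrier, of d a f r] L.D.Fil_mult by blast

lemma PD_zero: "PD \<zero>\<^bsub>L.D\<^esub> = \<zero>\<^bsub>B\<^esub>" by (rule ring_hom_zero' [OF L.D.ring_axioms B.ring_axioms PD_hom])

definition pf :: "((nat \<Rightarrow>\<^sub>0 nat) => (nat => ((nat => 'k) \<times> nat) set) set) => (nat \<Rightarrow>\<^sub>0 nat) => (nat => ('a \<times> nat) set) set"
  where "pf f \<nu> = PD (f \<nu>) \<otimes>\<^bsub>B\<^esub> lam (xp \<nu>)"

lemma xp_FB: "lam (xp \<nu>) \<in> FB c0" using lam_FB [OF xp_closed] xp_level by simp

lemma pf_FB: "f \<nu> \<in> L.FD m ==> pf f \<nu> \<in> FB (m + c0)"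
  unfolding pf_def by (rule B.Fil_mult [OF PD_FB xp_FB])

lemma pf_closed: "f \<in> carrier TX ==> pf f \<nu> \<in> carrier B"
  unfolding pf_def by (rule B.m_closed [OF PD_closed [OF LD.tate_coeff] lam_closed [OF xp_closed]])

text \<open>The purpose of the uniform bound \<open>c0\<close> on the monomials: the terms tend to
  zero as soon as the coefficients do.\<close>

lemma pf_null: assumes f: "f \<in> carrier TX" shows "B.nullfam (pf f)"
  unfolding B.nullfam_def
proof (intro conjI allI)
  show "pf f \<nu> \<in> carrier B" for \<nu> by (rule pf_closed [OF f])
  fix m
  have "{\<nu>. pf f \<nu> \<notin> FB m} \<subseteq> {\<nu>. f \<nu> \<notin> L.FD (m - c0)}" using pf_FB [of f _ "m - c0"] by auto
  moreover have "finite {\<nu>. f \<nu> \<notin> L.FD (m - c0)}" using f by (simp add: LD.tate_carrier)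
  ultimately show "finite {\<nu>. pf f \<nu> \<notin> FB m}" by (rule finite_subset)
qed

definition Ph where "Ph f = B.fsum (pf f)"

lemma Ph_closed: "f \<in> carrier TX ==> Ph f \<in> carrier B"
  unfolding Ph_def by (rule B.fsum_closed [OF pf_null])

lemma Ph_add:
  assumes fg: "f \<in> carrier TX" "g \<in> carrier TX"
  shows "Ph (\<lambda>\<nu>. f \<nu> \<oplus>\<^bsub>L.D\<^esub> g \<nu>) = Ph f \<oplus>\<^bsub>B\<^esub> Ph g"
proof -
  have "pf (\<lambda>\<nu>. f \<nu> \<oplus>\<^bsub>L.D\<^esub> g \<nu>) = (\<lambda>\<nu>. pf f \<nu> \<oplus>\<^bsub>B\<^esub> pf g \<nu>)"
    unfolding pf_def
    using ring_hom_add [OF PD_hom LD.tate_coeff [OF fg(1)] LD.tate_coeff [OF fg(2)]]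
      B.l_distr [OF PD_closed [OF LD.tate_coeff [OF fg(1)]] PD_closed [OF LD.tate_coeff [OF fg(2)]] lam_closed [OF xp_closed]]
    by simp
  thus ?thesis unfolding Ph_def using B.fsum_add [OF pf_null [OF fg(1)] pf_null [OF fg(2)]] by simp
qed

lemma Ph_FB: "f \<in> FX m ==> Ph f \<in> FB (m + c0)"
  unfolding Ph_def by (rule B.fsum_Fil [OF pf_null [OF FX_carrier]]) (auto simp: TFil_def intro: pf_FB)

lemma Ph_tmon: assumes d: "d \<in> carrier L.D" shows "Ph (tmon L.D \<nu> d) = PD d \<otimes>\<^bsub>B\<^esub> lam (xp \<nu>)"
proof -
  have "pf (tmon L.D \<nu> d) = (\<lambda>\<mu>. if \<mu> = \<nu> then PD d \<otimes>\<^bsub>B\<^esub> lam (xp \<nu>) else \<zero>\<^bsub>B\<^esub>)"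
    unfolding pf_def tmon_def fun_eq_iff using PD_zero by simp
  thus ?thesis unfolding Ph_def using B.fsum_single [OF B.m_closed [OF PD_closed [OF d] lam_closed [OF xp_closed]]] by simp
qed

lemma const_tmon: "series_const L.D d = tmon L.D (0 :: nat \<Rightarrow>\<^sub>0 nat) d"
  by (simp add: series_const_def tmon_def fun_eq_iff)

lemma Ph_const: "d \<in> carrier L.D ==> Ph (series_const L.D d) = PD d"
  unfolding const_tmon using Ph_tmon [of d 0] PD_closed [of d] xp_0 lam_one by simp

text \<open>An instance of the Cauchy product \<open>fsum_mult\<close>, as multi-indices have
  finitely many decompositions.\<close>

lemma Ph_mult:
  assumes f: "f \<in> carrier TX" and g: "g \<in> carrier TX"
  shows "Ph (conv L.D f g) = Ph f \<otimes>\<^bsub>B\<^esub> Ph g"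
proof -
  note gc = LD.tate_coeff [OF f] LD.tate_coeff [OF g]
  note pc = PD_closed [OF gc(1)] PD_closed [OF gc(2)]
  have fin: "finite {(i, j). i + j = (q :: nat \<Rightarrow>\<^sub>0 nat) \<and> True}" for q using finite_multi_index_sum [of q] by simp
  have "pf (conv L.D f g) q = finsum B (\<lambda>(i, j). pf f i \<otimes>\<^bsub>B\<^esub> pf g j) {(i, j). i + j = q \<and> True}" for q
  proof -
    let ?Z = "{(i, j). i + j = q \<and> True}"
    let ?u = "\<lambda>(i, j). f i \<otimes>\<^bsub>L.D\<^esub> g j"
    have uc: "?u ij \<in> carrier L.D" for ij using gc by (simp add: case_prod_beta)
    have "conv L.D f g q = finsum L.D ?u ?Z"
      by (rule L.D.conv_superset) (use gc fin in auto)
    also have "PD \<dots> = finsum B (\<lambda>ij. PD (?u ij)) ?Z"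
      by (rule ring_hom_finsum [OF L.D.ring_axioms B.ring_axioms PD_hom]) (use uc in blast)
    finally have e: "PD (conv L.D f g q) = finsum B (\<lambda>ij. PD (?u ij)) ?Z" .
    have "pf (conv L.D f g) q = finsum B (\<lambda>ij. PD (?u ij) \<otimes>\<^bsub>B\<^esub> lam (xp q)) ?Z"
      unfolding pf_def e by (rule B.finsum_ldistr [OF fin lam_closed [OF xp_closed]]) (use PD_closed [OF uc] in blast)
    also have "\<dots> = finsum B (\<lambda>(i, j). pf f i \<otimes>\<^bsub>B\<^esub> pf g j) ?Z"
    proof (rule B.finsum_cong' [OF HOL.refl])
      show "(\<lambda>(i, j). pf f i \<otimes>\<^bsub>B\<^esub> pf g j) \<in> ?Z \<rightarrow> carrier B"
        using pf_closed [OF f] pf_closed [OF g] by auto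
      fix ij assume "ij \<in> ?Z"
      then obtain i j where ij: "ij = (i, j)" "i + j = q" by blast
      have x: "lam (xp q) = lam (xp i) \<otimes>\<^bsub>B\<^esub> lam (xp j)"
        unfolding ij(2) [symmetric] xp_add by (rule lam_mult [OF xp_closed xp_closed])
      have "(PD (f i) \<otimes>\<^bsub>B\<^esub> PD (g j)) \<otimes>\<^bsub>B\<^esub> (lam (xp i) \<otimes>\<^bsub>B\<^esub> lam (xp j)) = pf f i \<otimes>\<^bsub>B\<^esub> pf g j"
        unfolding pf_def using pc(1) [of i] pc(2) [of j] lam_closed [OF xp_closed, of i] lam_closed [OF xp_closed, of j] by algebra
      thus "PD (?u ij) \<otimes>\<^bsub>B\<^esub> lam (xp q) = (case ij of (i, j) => pf f i \<otimes>\<^bsub>B\<^esub> pf g j)"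
        unfolding ij(1) prod.case x ring_hom_mult [OF PD_hom gc(1) gc(2)] .
    qed
    finally show ?thesis .
  qed
  hence "B.nullfam (pf (conv L.D f g)) \<and> B.fsum (pf (conv L.D f g)) = B.fsum (pf f) \<otimes>\<^bsub>B\<^esub> B.fsum (pf g)"
    by (intro B.fsum_mult [where P = "\<lambda>_ _. True", OF pf_null [OF f] pf_null [OF g] fin]) auto
  thus ?thesis unfolding Ph_def by simp
qed

lemma Ph_scale: "d \<in> carrier L.D ==> f \<in> carrier TX ==> Ph (\<lambda>\<nu>. d \<otimes>\<^bsub>L.D\<^esub> f \<nu>) = PD d \<otimes>\<^bsub>B\<^esub> Ph f"
  using Ph_mult [of "series_const L.D d" f] LD.tmon_closed [of d 0 r] LD.tate_const_mult [of d f r] Ph_const [of d]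
  unfolding const_tmon by simp

lemma Ph_cont_hom: "Ph \<in> cont_ring_hom TX B"
  unfolding cont_ring_hom_def
proof (intro CollectI conjI ring_hom_memI)
  show "Ph \<one>\<^bsub>TX\<^esub> = \<one>\<^bsub>B\<^esub>" using Ph_const [OF L.D.one_closed] ring_hom_one [OF PD_hom] by simp
  show "continuous_map (opens TX) (opens B) Ph"
  proof (rule filt_top_continuous [OF LD.tate_filt_top B_filt_top])
    show "\<exists>l. \<forall>u\<in>FX l. Ph u \<in> FB m" for m
      by (intro exI [of _ "m - c0"] ballI) (use Ph_FB [of _ "m - c0"] in simp)
    show "u \<in> carrier TX \<and> x \<oplus>\<^bsub>TX\<^esub> u \<in> carrier TX" if "x \<in> carrier TX" "u \<in> FX m" for x m u
      using LD.tate_add_closed [OF that(1) FX_carrier [OF that(2)]] FX_carrier [OF that(2)] by simp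
  qed (use Ph_closed Ph_add in auto)
qed (use Ph_closed Ph_add Ph_mult in auto)

lemma Ph_algebra: "Ph \<in> cont_algebra_hom OK (DX_ring K v \<pi> n r) (DX_structure K v \<pi> n) B (\<lambda>x. lam (\<eta> x))"
proof -
  have "Ph (DX_structure K v \<pi> n x) = lam (\<eta> x)" if x: "x \<in> carrier OK" for x
    unfolding DX_structure_def L.D_map_dm Ph_const [OF L.dm_carrier [OF L.\<iota>_carrier [OF OT_const [OF x]]]]
    by (rule PD_const [OF x])
  thus ?thesis unfolding cont_algebra_hom_def DX_ring_def using Ph_cont_hom by simp
qed

lemma \<rho>_dmon: assumes g: "\<gamma> \<in> carrier OK" shows "L.\<rho> (L.dmon \<gamma> a) = kmon \<gamma> a"
proof -
  have red: "L.\<rho> (L.dm (L.\<iota> G)) = (\<lambda>i. if i < 0 then \<zero>\<^bsub>kk\<^esub> else residue K v (G (nat i)))" if "G \<in> carrier OT" for G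
    using L.\<rho>_is_reduction that unfolding is_D_reduction_def L.D_map_dm by blast
  have r0: "residue K v \<zero>\<^bsub>OK\<^esub> = \<zero>\<^bsub>kk\<^esub>" by (rule ring_hom_zero' [OF O.ring_axioms k.ring_axioms residue_hom])
  have r1: "residue K v \<one>\<^bsub>OK\<^esub> = \<one>\<^bsub>kk\<^esub>" by (rule ring_hom_one [OF residue_hom])
  have c: "L.\<rho> (L.dm (L.\<iota> (series_const OK \<gamma>))) = series_const kk (residue K v \<gamma>)"
    unfolding red [OF OT_const [OF g]] using r0 by (simp add: series_const_def fun_eq_iff del: OK_simps)
  have t: "L.\<rho> (L.dm L.\<tau>) = series_monom kk 1"
  proof
    fix i :: int
    have m: "series_monom OK (1::nat) j = (if j = 1 then \<one>\<^bsub>OK\<^esub> else \<zero>\<^bsub>OK\<^esub>)" for j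
      by (simp add: series_monom_def)
    have m': "series_monom kk 1 i = (if i = 1 then \<one>\<^bsub>kk\<^esub> else \<zero>\<^bsub>kk\<^esub>)" by (simp add: series_monom_def)
    show "L.\<rho> (L.dm L.\<tau>) i = series_monom kk 1 i"
      unfolding red [OF OT_monom] m m' using r0 r1 by (cases "i < 0"; cases "i = 1") (auto simp del: OK_simps)
  qed
  have "L.\<rho> (tpow L.D (L.dm L.\<tau>) a) = series_monom kk a"
    using ring_hom_tpow [OF L.D.is_cring KL.is_cring L.\<rho>_hom L.D.t_unit, of a] k.laurent_tpow_eq [of a] unfolding t by simp
  thus ?thesis
    unfolding kmon_eq [OF g] using ring_hom_mult [OF L.\<rho>_hom L.dm_carrier [OF L.\<iota>_carrier [OF OT_const [OF g]]] L.D.tpow_carrier] c by simp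
qed

abbreviation rho where "rho f \<equiv> \<lambda>\<nu>. L.\<rho> (f \<nu>)"

lemma \<rho>_zero: "L.\<rho> \<zero>\<^bsub>L.D\<^esub> = \<zero>\<^bsub>kL\<^esub>" by (rule ring_hom_zero' [OF L.D.ring_axioms KL.ring_axioms L.\<rho>_hom])

lemma rho_closed: assumes f: "f \<in> carrier TX" shows "rho f \<in> carrier TK"
proof -
  have "finite {\<nu>. rho f \<nu> \<notin> FK m}" for m
  proof (rule finite_subset)
    show "{\<nu>. rho f \<nu> \<notin> FK m} \<subseteq> {\<nu>. f \<nu> \<notin> L.FD m}" using L.\<rho>_Fil by blast
    show "finite {\<nu>. f \<nu> \<notin> L.FD m}" using f by (simp add: LD.tate_carrier)
  qed
  moreover have "f \<nu> = \<zero>\<^bsub>L.D\<^esub>" if "\<not> Poly_Mapping.keys \<nu> \<subseteq> {..<r}" for \<nu> using f that by (simp add: LD.tate_carrier)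
  ultimately show ?thesis unfolding KL.tate_carrier
    using ring_hom_closed [OF L.\<rho>_hom LD.tate_coeff [OF f]] \<rho>_zero by simp
qed

lemma rho_FT: "f \<in> FX m ==> rho f \<in> FT m"
  unfolding TFil_def using rho_closed L.\<rho>_Fil by blast

lemma \<phi>_rho_add:
  assumes "f \<in> carrier TX" "g \<in> carrier TX"
  shows "\<phi> (rho (\<lambda>\<nu>. f \<nu> \<oplus>\<^bsub>L.D\<^esub> g \<nu>)) = \<phi> (rho f) \<oplus>\<^bsub>Am\<^esub> \<phi> (rho g)"
  using \<phi>_add [OF rho_closed rho_closed, OF assms]
    ring_hom_add [OF L.\<rho>_hom LD.tate_coeff [OF assms(1)] LD.tate_coeff [OF assms(2)]] by simp

lemma rho_tmon: "rho (tmon L.D \<nu> d) = tmon kL \<nu> (L.\<rho> d)"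
  using \<rho>_zero by (simp add: tmon_def fun_eq_iff)

text \<open>One element \<open>a\<close> represents both the reduction of \<open>f\<close> under
  \<open>\<phi>\<close> and, up to \<open>FB m\<close>, its image under \<open>Ph\<close>. This
  approximate form of the lifting property is additive and holds for small series as well as for
  monomials, so it extends by density; \<open>Ph_lifts\<close> lets \<open>m\<close> grow.\<close>

definition liftP :: "int => ((nat \<Rightarrow>\<^sub>0 nat) => (nat => ((nat => 'k) \<times> nat) set) set) => bool" where
  "liftP m f \<longleftrightarrow> (\<exists>a\<in>carrier A. \<phi> (rho f) = cl a \<and> B.cg m (Ph f) (lam a))"

lemma liftP_add:
  assumes "f \<in> carrier TX" "g \<in> carrier TX" "liftP m f" "liftP m g"
  shows "liftP m (\<lambda>\<nu>. f \<nu> \<oplus>\<^bsub>L.D\<^esub> g \<nu>)"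
proof -
  obtain a b where a: "a \<in> carrier A" "\<phi> (rho f) = cl a" "B.cg m (Ph f) (lam a)"
    and b: "b \<in> carrier A" "\<phi> (rho g) = cl b" "B.cg m (Ph g) (lam b)" using assms(3,4) unfolding liftP_def by blast
  have "\<phi> (rho (\<lambda>\<nu>. f \<nu> \<oplus>\<^bsub>L.D\<^esub> g \<nu>)) = cl (a \<oplus> b)"
    unfolding \<phi>_rho_add [OF assms(1,2)] a(2) b(2) by (rule ring_hom_add [OF cl_hom a(1) b(1), symmetric])
  moreover have "B.cg m (Ph (\<lambda>\<nu>. f \<nu> \<oplus>\<^bsub>L.D\<^esub> g \<nu>)) (lam (a \<oplus> b))"
    unfolding Ph_add [OF assms(1,2)] lam_add [OF a(1) b(1)] by (rule B.cg_add [OF a(3) b(3)])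
  ultimately show ?thesis unfolding liftP_def using a(1) b(1) A.a_closed by blast
qed

text \<open>The bound pays for both maps: \<open>\<phi>\<close> loses \<open>M2\<close> and
  \<open>Ph\<close> loses \<open>- c0\<close>.\<close>

lemma liftP_small: assumes g: "g \<in> FX (max m 0 + int M2 - c0)" shows "liftP m g"
proof -
  obtain a where a: "a \<in> Fil (max m 0 + int M2 - c0 - int M2)" "\<phi> (rho g) = cl a" using M2 [OF rho_FT [OF g]] by blast
  have "lam a \<in> FB m" using lam_Fil [OF a(1)] c0 by (rule_tac B.Fil_monoD) auto
  moreover have "Ph g \<in> FB m" using Ph_FB [OF g] by (rule_tac B.Fil_monoD) auto
  ultimately have "B.cg m (Ph g) (lam a)" unfolding B.cg_def using B.Fil_minus B.Fil_carrier by blast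
  thus ?thesis unfolding liftP_def using a F.Fil_carrier by blast
qed

lemma liftP_tmon:
  assumes d: "d \<in> carrier L.D" and k: "Poly_Mapping.keys \<nu> \<subseteq> {..<r}"
  shows "liftP m (tmon L.D \<nu> d)"
proof (rule L.D_span [OF d])
  fix x y assume xy: "x \<in> carrier L.D" "y \<in> carrier L.D" "liftP m (tmon L.D \<nu> x)" "liftP m (tmon L.D \<nu> y)"
  show "liftP m (tmon L.D \<nu> (x \<oplus>\<^bsub>L.D\<^esub> y))"
    unfolding LD.tmon_add [OF xy(1,2)] by (rule liftP_add [OF LD.tmon_closed [OF xy(1) k] LD.tmon_closed [OF xy(2) k] xy(3,4)])
next
  fix x assume "x \<in> L.FD (max m 0 + int M2 - c0)"
  thus "liftP m (tmon L.D \<nu> x)" by (rule liftP_small [OF LD.tmon_TFil [OF _ k]])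
next
  fix \<gamma> a assume g: "\<gamma> \<in> carrier OK"
  have e: "\<eta> \<gamma> \<otimes> tpow A T a \<in> carrier A" by (rule A.m_closed [OF A0_carrier [OF \<eta>_A0 [OF g]] tT])
  have "\<phi> (rho (tmon L.D \<nu> (L.dmon \<gamma> a))) = cl (\<eta> \<gamma> \<otimes> tpow A T a \<otimes> xp \<nu>)"
    unfolding rho_tmon \<rho>_dmon [OF g] by (rule \<phi>_kmon [OF g k])
  moreover have "Ph (tmon L.D \<nu> (L.dmon \<gamma> a)) = lam (\<eta> \<gamma> \<otimes> tpow A T a \<otimes> xp \<nu>)"
    unfolding Ph_tmon [OF L.D.m_closed [OF L.dm_carrier [OF L.\<iota>_carrier [OF OT_const [OF g]]] L.D.tpow_carrier]]
      PD_dmon [OF g] by (rule lam_mult [OF e xp_closed, symmetric])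
  ultimately show "liftP m (tmon L.D \<nu> (L.dmon \<gamma> a))"
    unfolding liftP_def using B.cg_refl [OF lam_closed [OF A.m_closed [OF e xp_closed]]] A.m_closed [OF e xp_closed] by metis
qed

lemma liftP: assumes f: "f \<in> carrier TX" shows "liftP m f"
proof (rule LD.tate_induct [OF f])
  show "liftP m g" if "g \<in> FX (max m 0 + int M2 - c0)" for g by (rule liftP_small [OF that])
qed (use liftP_tmon [OF LD.tate_coeff [OF f]] liftP_add in auto)

text \<open>By \<open>liftP\<close> the difference of \<open>Ph f\<close> and \<open>lam a\<close>
  is congruent to a multiple of \<open>lam p\<close> modulo every \<open>FB m\<close>, and such
  multiples form a closed set in \<open>B\<close>.\<close>

lemma Ph_lifts:
  assumes f: "f \<in> carrier TX" and a: "a \<in> carrier A" "\<phi> (rho f) = cl a"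
  shows "\<exists>z\<in>carrier B. Ph f = lam a \<oplus>\<^bsub>B\<^esub> lam p \<otimes>\<^bsub>B\<^esub> z"
proof -
  note pB = lam_closed [OF E.p_carrier]
  have "\<exists>z\<in>carrier B. Ph f \<ominus>\<^bsub>B\<^esub> lam a = lam p \<otimes>\<^bsub>B\<^esub> z"
  proof (rule BE.p_multiple_closed [OF B_complete])
    show "Ph f \<ominus>\<^bsub>B\<^esub> lam a \<in> carrier B" using Ph_closed [OF f] a(1) by simp
    fix m :: nat
    obtain b where b: "b \<in> carrier A" "cl b = cl a" "B.cg (int m) (Ph f) (lam b)"
      using liftP [OF f, of "int m"] a(2) unfolding liftP_def by auto
    obtain z where z: "z \<in> carrier A" "b = a \<oplus> p \<otimes> z" using b(2) cl_eq_iff [OF b(1) a(1)] by blast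
    have "lam b \<ominus>\<^bsub>B\<^esub> lam a = lam p \<otimes>\<^bsub>B\<^esub> lam z"
      unfolding z(2) lam_add [OF a(1) A.m_closed [OF E.p_carrier z(1)]] lam_mult [OF E.p_carrier z(1)]
      using lam_closed [OF a(1)] lam_closed [OF z(1)] pB by algebra
    hence "B.cg (int m) (Ph f \<ominus>\<^bsub>B\<^esub> lam a) (lam p \<otimes>\<^bsub>B\<^esub> lam z)"
      using B.cg_minus [OF b(3) B.cg_refl [OF lam_closed [OF a(1)]]] by simp
    thus "\<exists>y\<in>carrier B. B.cg (int m) (Ph f \<ominus>\<^bsub>B\<^esub> lam a) (lam p \<otimes>\<^bsub>B\<^esub> y)" using lam_closed [OF z(1)] by blast
  qed
  then obtain z where z: "z \<in> carrier B" "Ph f \<ominus>\<^bsub>B\<^esub> lam a = lam p \<otimes>\<^bsub>B\<^esub> z" by blast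
  have "Ph f = lam a \<oplus>\<^bsub>B\<^esub> (Ph f \<ominus>\<^bsub>B\<^esub> lam a)" using Ph_closed [OF f] lam_closed [OF a(1)] by algebra
  thus ?thesis unfolding z(2) using z(1) by blast
qed

lemma Ph_lifts': "lifts K v \<pi> r A \<eta> T n \<phi> Ph"
  unfolding lifts_def DX_ring_def
proof (intro exI [of _ L.\<rho>] conjI ballI impI)
  show "is_D_reduction K v \<pi> n L.\<rho>" by (rule L.\<rho>_is_reduction)
  fix f a assume "f \<in> carrier TX" "a \<in> carrier A" "\<phi> (rho f) = cl a"
  thus "mod_class B (lam p) (Ph f) = mod_class B (lam p) (lam a)"
    using Ph_lifts [of f a] mod_class_eq_iff [OF B.is_cring lam_closed [OF E.p_carrier] Ph_closed [of f] lam_closed [of a]] by simp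
qed

end

text \<open>The tails are summed coefficientwise. That the result again has coefficients tending to
  zero follows by splitting off finitely many terms until the remaining tail lies in
  \<open>Fil m\<close> altogether.\<close>

lemma (in filt_top_ring) tate_tail_sums:
  assumes compl: "complete_filt_ring R Fil t" and c: "\<And>j::nat. c j \<in> TFil r R Fil (int j + k)"
  shows "\<exists>f. \<forall>j. f j \<in> TFil r R Fil (int j + k) \<and> f j = (\<lambda>\<nu>. c j \<nu> \<oplus> f (Suc j) \<nu>)"
proof -
  interpret T: complete_filt_ring R Fil t by (rule compl)
  have cF: "c j \<nu> \<in> Fil (int j + k)" and cT: "c j \<in> carrier (tate_algebra r R)" for j \<nu> using c by (auto simp: TFil_def)
  have "\<exists>g. \<forall>j. g j \<in> Fil (int j + k) \<and> g j = c j \<nu> \<oplus> g (Suc j)" for \<nu> by (rule T.tail_sums) (rule cF)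
  then obtain g where g: "\<And>\<nu> j. g \<nu> j \<in> Fil (int j + k) \<and> g \<nu> j = c j \<nu> \<oplus> g \<nu> (Suc j)" by metis
  define f where "f j \<nu> = (if Poly_Mapping.keys \<nu> \<subseteq> {..<r} then g \<nu> j else \<zero>)" for j \<nu>
  have fF: "f j \<nu> \<in> Fil (int j + k)" for j \<nu>
    unfolding f_def using conjunct1 [OF g] by auto
  have fe: "f j \<nu> = c j \<nu> \<oplus> f (Suc j) \<nu>" for j \<nu>
  proof (cases "Poly_Mapping.keys \<nu> \<subseteq> {..<r}")
    case True
    thus ?thesis using g [of \<nu> j] by (simp add: f_def)
  next
    case False
    hence "c j \<nu> = \<zero>" using cT [of j] by (simp add: tate_carrier)
    thus ?thesis using False by (simp add: f_def)
  qed
  \<comment> \<open>\<open>d\<close> counts the terms to split off before the tail is uniformly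
    small.\<close>
  have fin: "finite {\<nu>. f j \<nu> \<notin> Fil m}" if "m - k \<le> int j + int d" for m j d
    using that
  proof (induction d arbitrary: j)
    case 0
    hence "f j \<nu> \<in> Fil m" for \<nu> using Fil_monoD [OF fF, of m j] by simp
    thus ?case by simp
  next
    case (Suc d)
    have "{\<nu>. f j \<nu> \<notin> Fil m} \<subseteq> {\<nu>. c j \<nu> \<notin> Fil m} \<union> {\<nu>. f (Suc j) \<nu> \<notin> Fil m}"
      using fe [of j] Fil_add [of "c j _" m "f (Suc j) _"] by auto
    moreover have "finite {\<nu>. c j \<nu> \<notin> Fil m}" using cT by (simp add: tate_carrier)
    moreover have "finite {\<nu>. f (Suc j) \<nu> \<notin> Fil m}" using Suc.prems by (intro Suc.IH) simp
    ultimately show ?case by (meson finite_UnI finite_subset)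
  qed
  have "f j \<in> carrier (tate_algebra r R)" for j
    unfolding tate_carrier
  proof (intro conjI allI impI)
    show "f j \<nu> \<in> carrier R" for \<nu> using fF by blast
    show "f j \<nu> = \<zero>" if "\<not> Poly_Mapping.keys \<nu> \<subseteq> {..<r}" for \<nu> using that by (simp add: f_def)
    show "finite {\<nu>. f j \<nu> \<notin> Fil m}" for m by (rule fin [of m j "nat (m - k)"]) simp
  qed
  hence "f j \<in> TFil r R Fil (int j + k)" for j using fF by (simp add: TFil_def)
  moreover have "f j = (\<lambda>\<nu>. c j \<nu> \<oplus> f (Suc j) \<nu>)" for j by (rule ext) (rule fe)
  ultimately show ?thesis by blast
qed

section \<open>Injectivity of the lifted map\<close>

context lift_level
begin

lemma TX_zero: "(\<lambda>_. \<zero>\<^bsub>L.D\<^esub>) \<in> carrier TX" by (simp add: LD.tate_carrier)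

lemma PD_p: "PD pD = lam p" by (rule PD_const [OF pi_OK])

lemma pD_carrier: "pD \<in> carrier L.D" by (rule L.dm_carrier [OF L.\<iota>_carrier [OF OT_pc]])

text \<open>The reduction of \<open>f\<close> has a representative \<open>a\<close> in
  \<open>A\<close> that becomes divisible by \<open>p\<close> in \<open>B\<close>; by
  \<open>lam_p_dvd\<close> it is so in \<open>A\<close>, and injectivity of \<open>\<phi>\<close>
  applies. Absence of \<open>p\<close>-torsion in \<open>B\<close> keeps the quotient in the
  kernel.\<close>

lemma kernel_step:
  assumes f: "f \<in> carrier TX" and z: "Ph f = \<zero>\<^bsub>B\<^esub>"
  shows "\<exists>g\<in>carrier TX. f = (\<lambda>\<nu>. pD \<otimes>\<^bsub>L.D\<^esub> g \<nu>) \<and> Ph g = \<zero>\<^bsub>B\<^esub>"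
proof -
  note pB = lam_closed [OF E.p_carrier]
  obtain a where a: "a \<in> carrier A" "\<phi> (rho f) = cl a" using cl_surj [OF \<phi>_closed [OF rho_closed [OF f]]] by blast
  obtain b where b: "b \<in> carrier B" "Ph f = lam a \<oplus>\<^bsub>B\<^esub> lam p \<otimes>\<^bsub>B\<^esub> b" using Ph_lifts [OF f a] by blast
  have "lam a = (lam a \<oplus>\<^bsub>B\<^esub> lam p \<otimes>\<^bsub>B\<^esub> b) \<oplus>\<^bsub>B\<^esub> lam p \<otimes>\<^bsub>B\<^esub> (\<ominus>\<^bsub>B\<^esub> b)"
    using lam_closed [OF a(1)] pB b(1) by algebra
  also have "\<dots> = lam p \<otimes>\<^bsub>B\<^esub> (\<ominus>\<^bsub>B\<^esub> b)" unfolding b(2) [symmetric] z using pB b(1) by simp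
  finally obtain y where y: "y \<in> carrier A" "a = p \<otimes> y" using lam_p_dvd [OF a(1) B.a_inv_closed [OF b(1)]] by blast
  have t0: "(\<lambda>_. \<zero>\<^bsub>kL\<^esub>) \<in> carrier TK" by (simp add: KL.tate_carrier)
  have "cl a = cl \<zero>" using cl_eq_iff [OF a(1) A.zero_closed] y by auto
  also have "\<dots> = \<zero>\<^bsub>Am\<^esub>" by (rule ring_hom_zero' [OF A.ring_axioms Am.ring_axioms cl_hom])
  also have "\<dots> = \<phi> (\<lambda>_. \<zero>\<^bsub>kL\<^esub>)"
    using \<phi>_add [OF t0 t0] \<phi>_closed [OF t0] by (simp add: Am.add.l_cancel_one')
  finally have "\<phi> (rho f) = \<phi> (\<lambda>_. \<zero>\<^bsub>kL\<^esub>)" using a(2) by simp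
  hence r0: "rho f = (\<lambda>_. \<zero>\<^bsub>kL\<^esub>)" by (rule inj_onD [OF \<phi>_inj _ rho_closed [OF f] t0])
  have "\<exists>w. w \<in> carrier L.D \<and> f \<nu> = pD \<otimes>\<^bsub>L.D\<^esub> w" for \<nu>
    using L.\<rho>_kernel [OF LD.tate_coeff [OF f] fun_cong [OF r0, of \<nu>]] by blast
  then obtain w where w: "\<And>\<nu>. w \<nu> \<in> carrier L.D \<and> f \<nu> = pD \<otimes>\<^bsub>L.D\<^esub> w \<nu>" by metis
  \<comment> \<open>Division by \<open>\<pi>\<close> costs \<open>n\<close> in every coefficient
    alike, so the quotients again tend to zero and form an element of the Tate algebra.\<close>
  have wF: "w \<nu> \<in> L.FD m" if "f \<nu> \<in> L.FD (m + int n)" for \<nu> m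
    using L.DE.p_reg [of "w \<nu>" "m + int n"] w [of \<nu>] that by simp
  have g: "w \<in> carrier TX" unfolding LD.tate_carrier
  proof (intro conjI allI impI)
    show "w \<nu> \<in> carrier L.D" for \<nu> using w by simp
    show "w \<nu> = \<zero>\<^bsub>L.D\<^esub>" if "\<not> Poly_Mapping.keys \<nu> \<subseteq> {..<r}" for \<nu>
    proof (rule L.D.sep)
      have "f \<nu> = \<zero>\<^bsub>L.D\<^esub>" using f that by (simp add: LD.tate_carrier)
      thus "w \<nu> \<in> L.FD m" for m by (intro wF) simp
    qed (use w in simp)
    fix m
    have "{\<nu>. w \<nu> \<notin> L.FD m} \<subseteq> {\<nu>. f \<nu> \<notin> L.FD (m + int n)}" using wF by blast
    moreover have "finite {\<nu>. f \<nu> \<notin> L.FD (m + int n)}" using f by (simp add: LD.tate_carrier)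
    ultimately show "finite {\<nu>. w \<nu> \<notin> L.FD m}" by (rule finite_subset)
  qed
  have e: "f = (\<lambda>\<nu>. pD \<otimes>\<^bsub>L.D\<^esub> w \<nu>)" using w by (simp add: fun_eq_iff)
  have "lam p \<otimes>\<^bsub>B\<^esub> Ph w = \<zero>\<^bsub>B\<^esub>" using Ph_scale [OF pD_carrier g] z e PD_p by simp
  hence "Ph w = \<zero>\<^bsub>B\<^esub>" by (rule B_p_torsion [OF Ph_closed [OF g]])
  thus ?thesis using e g by blast
qed

lemma kernel_zero: assumes f: "f \<in> carrier TX" and z: "Ph f = \<zero>\<^bsub>B\<^esub>" shows "f \<nu> = \<zero>\<^bsub>L.D\<^esub>"
proof (rule L.D_pi_separated [OF LD.tate_coeff [OF f]])
  have "\<exists>g\<in>carrier TX. f = (\<lambda>\<nu>. pD [^]\<^bsub>L.D\<^esub> j \<otimes>\<^bsub>L.D\<^esub> g \<nu>) \<and> Ph g = \<zero>\<^bsub>B\<^esub>" for j :: nat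
  proof (induction j)
    case 0
    have "f = (\<lambda>\<nu>. pD [^]\<^bsub>L.D\<^esub> (0::nat) \<otimes>\<^bsub>L.D\<^esub> f \<nu>)" using LD.tate_coeff [OF f] by (simp add: fun_eq_iff)
    thus ?case using f z by blast
  next
    case (Suc j)
    then obtain g where g: "g \<in> carrier TX" "f = (\<lambda>\<nu>. pD [^]\<^bsub>L.D\<^esub> j \<otimes>\<^bsub>L.D\<^esub> g \<nu>)" "Ph g = \<zero>\<^bsub>B\<^esub>" by blast
    obtain h where h: "h \<in> carrier TX" "g = (\<lambda>\<nu>. pD \<otimes>\<^bsub>L.D\<^esub> h \<nu>)" "Ph h = \<zero>\<^bsub>B\<^esub>" using kernel_step [OF g(1,3)] by blast
    have "f = (\<lambda>\<nu>. pD [^]\<^bsub>L.D\<^esub> Suc j \<otimes>\<^bsub>L.D\<^esub> h \<nu>)"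
      unfolding g(2) h(2) using LD.tate_coeff [OF h(1)] pD_carrier by (simp add: fun_eq_iff L.D.m_assoc)
    thus ?case using h by blast
  qed
  thus "\<exists>w\<in>carrier L.D. f \<nu> = pD [^]\<^bsub>L.D\<^esub> j \<otimes>\<^bsub>L.D\<^esub> w" for j :: nat
    using LD.tate_coeff by metis
qed

lemma Ph_inj: "inj_on Ph (carrier TX)"
proof (rule inj_onI)
  fix f g assume fg: "f \<in> carrier TX" "g \<in> carrier TX" "Ph f = Ph g"
  define h where "h = (\<lambda>\<nu>. f \<nu> \<ominus>\<^bsub>L.D\<^esub> g \<nu>)"
  have h: "h \<in> carrier TX" unfolding h_def by (rule LD.tate_minus_closed [OF fg(1,2)])
  note c = LD.tate_coeff [OF fg(1)] LD.tate_coeff [OF fg(2)]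
  have "f = (\<lambda>\<nu>. h \<nu> \<oplus>\<^bsub>L.D\<^esub> g \<nu>)"
  proof
    fix \<nu> show "f \<nu> = h \<nu> \<oplus>\<^bsub>L.D\<^esub> g \<nu>" unfolding h_def using c(1) [of \<nu>] c(2) [of \<nu>] by algebra
  qed
  hence "Ph h \<oplus>\<^bsub>B\<^esub> Ph g = Ph g" using Ph_add [OF h fg(2)] fg(3) by simp
  hence "Ph h = \<zero>\<^bsub>B\<^esub>" using Ph_closed [OF h] Ph_closed [OF fg(2)] by (simp add: B.add.r_cancel_one)
  hence "h \<nu> = \<zero>\<^bsub>L.D\<^esub>" for \<nu> by (rule kernel_zero [OF h])
  thus "f = g" using c unfolding h_def by (simp add: fun_eq_iff L.D.r_right_minus_eq)
qed

section \<open>Finiteness of the lifted map\<close>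

definition cmb where "cmb c = finsum B (\<lambda>e. Ph (c e) \<otimes>\<^bsub>B\<^esub> lam (rp e)) EE"

lemma Ph_c: "c \<in> EE \<rightarrow> FX m ==> e \<in> EE ==> Ph (c e) \<in> carrier B"
  by (rule Ph_closed [OF FX_carrier [OF funcset_mem]])

lemma cmb_closed: "c \<in> EE \<rightarrow> FX m ==> cmb c \<in> carrier B"
  unfolding cmb_def by (rule B.finsum_closed) (use Ph_c lam_closed [OF rp] in blast)

lemma cmb_add:
  assumes "c \<in> EE \<rightarrow> FX m" "d \<in> EE \<rightarrow> FX l"
  shows "cmb (\<lambda>e \<nu>. c e \<nu> \<oplus>\<^bsub>L.D\<^esub> d e \<nu>) = cmb c \<oplus>\<^bsub>B\<^esub> cmb d"
proof -
  have "cmb (\<lambda>e \<nu>. c e \<nu> \<oplus>\<^bsub>L.D\<^esub> d e \<nu>) = finsum B (\<lambda>e. Ph (c e) \<otimes>\<^bsub>B\<^esub> lam (rp e) \<oplus>\<^bsub>B\<^esub> Ph (d e) \<otimes>\<^bsub>B\<^esub> lam (rp e)) EE"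
    unfolding cmb_def
  proof (rule B.finsum_cong' [OF HOL.refl])
    fix e assume e: "e \<in> EE"
    note cd = FX_carrier [OF funcset_mem [OF assms(1) e]] FX_carrier [OF funcset_mem [OF assms(2) e]]
    show "Ph (\<lambda>\<nu>. c e \<nu> \<oplus>\<^bsub>L.D\<^esub> d e \<nu>) \<otimes>\<^bsub>B\<^esub> lam (rp e) = Ph (c e) \<otimes>\<^bsub>B\<^esub> lam (rp e) \<oplus>\<^bsub>B\<^esub> Ph (d e) \<otimes>\<^bsub>B\<^esub> lam (rp e)"
      unfolding Ph_add [OF cd] by (rule B.l_distr [OF Ph_closed [OF cd(1)] Ph_closed [OF cd(2)] lam_closed [OF rp]])
  qed (use Ph_c [OF assms(1)] Ph_c [OF assms(2)] lam_closed [OF rp] in auto)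
  also have "\<dots> = cmb c \<oplus>\<^bsub>B\<^esub> cmb d"
    unfolding cmb_def by (rule B.finsum_addf) (use Ph_c [OF assms(1)] Ph_c [OF assms(2)] lam_closed [OF rp] in auto)
  finally show ?thesis .
qed

lemma cmb_scale:
  assumes "c \<in> EE \<rightarrow> FX m" "d \<in> carrier L.D"
  shows "cmb (\<lambda>e \<nu>. d \<otimes>\<^bsub>L.D\<^esub> c e \<nu>) = PD d \<otimes>\<^bsub>B\<^esub> cmb c"
proof -
  have "cmb (\<lambda>e \<nu>. d \<otimes>\<^bsub>L.D\<^esub> c e \<nu>) = finsum B (\<lambda>e. PD d \<otimes>\<^bsub>B\<^esub> (Ph (c e) \<otimes>\<^bsub>B\<^esub> lam (rp e))) EE"
    unfolding cmb_def
  proof (rule B.finsum_cong' [OF HOL.refl])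
    fix e assume e: "e \<in> EE"
    note ce = FX_carrier [OF funcset_mem [OF assms(1) e]]
    show "Ph (\<lambda>\<nu>. d \<otimes>\<^bsub>L.D\<^esub> c e \<nu>) \<otimes>\<^bsub>B\<^esub> lam (rp e) = PD d \<otimes>\<^bsub>B\<^esub> (Ph (c e) \<otimes>\<^bsub>B\<^esub> lam (rp e))"
      unfolding Ph_scale [OF assms(2) ce] by (rule B.m_assoc [OF PD_closed [OF assms(2)] Ph_closed [OF ce] lam_closed [OF rp]])
  qed (use Ph_c [OF assms(1)] PD_closed [OF assms(2)] lam_closed [OF rp] in auto)
  also have "\<dots> = PD d \<otimes>\<^bsub>B\<^esub> cmb c"
    unfolding cmb_def by (rule B.finsum_rdistr [symmetric]) (use Ph_c [OF assms(1)] PD_closed [OF assms(2)] lam_closed [OF rp] in auto)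
  finally show ?thesis .
qed

text \<open>\<open>Ph\<close> takes a monomial \<open>\<gamma> T^i X^\<nu>\<close> exactly to the
  corresponding summand, and \<open>i \<ge> 0\<close> keeps the preimage in the unit ball.\<close>

lemma QQ_lift: "q \<in> QQ ==> \<exists>f\<in>FX 0. Ph f = lam q"
proof (induction rule: QQ.induct)
  case zero
  have "(\<lambda>_. \<zero>\<^bsub>L.D\<^esub>) \<in> FX 0" using TX_zero by (simp add: TFil_def)
  moreover have "pf (\<lambda>_. \<zero>\<^bsub>L.D\<^esub>) = (\<lambda>_. \<zero>\<^bsub>B\<^esub>)" using PD_zero by (simp add: pf_def fun_eq_iff)
  hence "Ph (\<lambda>_. \<zero>\<^bsub>L.D\<^esub>) = \<zero>\<^bsub>B\<^esub>" using B.fsum_single [OF B.zero_closed, of undefined] by (simp add: Ph_def)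
  ultimately show ?case using lam_zero by auto
next
  case (add \<gamma> \<nu> q i)
  then obtain f where f: "f \<in> FX 0" "Ph f = lam q" by blast
  let ?d = "L.dmon \<gamma> (int i)"
  have "L.\<iota> (series_const OK \<gamma>) \<in> L.FilL 0" by (rule L.\<iota>_FilL [OF OT_const [OF add(1)]])
  hence "L.dm (L.\<iota> (series_const OK \<gamma>)) \<in> L.FD 0" by (rule iffD2 [OF L.dm_FD [OF L.\<iota>_carrier [OF OT_const [OF add(1)]]]])
  from L.D.Fil_mult0 [OF this L.D.tpow_Fil [of "int i"]] have d: "?d \<in> L.FD 0" by (rule L.D.Fil_monoD) simp
  have t: "tmon L.D \<nu> ?d \<in> FX 0" by (rule LD.tmon_TFil [OF d add(2)])
  have e: "\<eta> \<gamma> \<otimes> tpow A T (int i) \<in> carrier A" by (rule A.m_closed [OF A0_carrier [OF \<eta>_A0 [OF add(1)]] tT])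
  have "Ph (\<lambda>\<mu>. tmon L.D \<nu> ?d \<mu> \<oplus>\<^bsub>L.D\<^esub> f \<mu>) = lam (\<eta> \<gamma> \<otimes> tpow A T (int i) \<otimes> xp \<nu> \<oplus> q)"
    unfolding Ph_add [OF FX_carrier [OF t] FX_carrier [OF f(1)]] Ph_tmon [OF L.D.Fil_carrier [OF d]] PD_dmon [OF add(1)] f(2)
      lam_add [OF A.m_closed [OF e xp_closed] QQ_carrier [OF add(3)]] lam_mult [OF e xp_closed] ..
  thus ?case using FX_add [OF t f(1)] by blast
qed

lemma pD_FD: "pD \<in> L.FD (int n)"
proof -
  have "L.el 0 pc \<in> L.FilL (int n)"
    unfolding L.el_FilL_iff [OF OT_pc] using pi by (simp add: series_const_def V_def)
  hence "L.\<iota> pc \<in> L.FilL (int n)" using L.\<iota>_carrier [OF OT_pc] L.LO.l_one by simp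
  thus ?thesis by (rule iffD2 [OF L.dm_FD [OF L.\<iota>_carrier [OF OT_pc]]])
qed

text \<open>The approximation in degree 0, scaled by \<open>T^m\<close>. The denominator
  \<open>T^M\<close> appears as the loss \<open>M\<close> in the coefficients, while the error gains
  one degree.\<close>

lemma base_comb:
  assumes a: "a \<in> Fil m"
  shows "\<exists>c\<in>EE \<rightarrow> FX (m - M). B.cg (m + 1) (lam a) (cmb c)"
proof -
  obtain a0 where a0: "a0 \<in> Fil 0" "a = tpow A T m \<otimes> a0" using F.Fil_tpowE [OF a] by blast
  obtain q where q: "q \<in> EE \<rightarrow> QQ" "level A Fil p (int n) 1 (a0 \<ominus> tpow A T (- M) \<otimes> comb q)"
    using comb_approx [OF a0(1)] by blast
  have qc: "q \<in> EE \<rightarrow> carrier A" using QQ_carrier [OF funcset_mem [OF q(1)]] by simp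
  have "\<forall>e\<in>EE. \<exists>f. f \<in> FX 0 \<and> Ph f = lam (q e)" using QQ_lift [OF funcset_mem [OF q(1)]] by blast
  then obtain f where f: "\<forall>e\<in>EE. f e \<in> FX 0 \<and> Ph (f e) = lam (q e)" by (rule bchoice [THEN exE])
  have fX: "f \<in> EE \<rightarrow> FX 0" using f by auto
  let ?d = "tpow L.D (L.dm L.\<tau>) (m - M)"
  let ?c = "\<lambda>e \<nu>. ?d \<otimes>\<^bsub>L.D\<^esub> f e \<nu>"
  have c: "?c \<in> EE \<rightarrow> FX (m - M)"
  proof
    show "?c e \<in> FX (m - M)" if "e \<in> EE" for e
      using FX_scale [OF L.D.tpow_Fil [of "m - M"] funcset_mem [OF fX that]] by simp
  qed
  have "cmb f = finsum B (\<lambda>e. lam (q e \<otimes> rp e)) EE"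
    unfolding cmb_def
  proof (rule B.finsum_cong' [OF HOL.refl])
    show "Ph (f e) \<otimes>\<^bsub>B\<^esub> lam (rp e) = lam (q e \<otimes> rp e)" if "e \<in> EE" for e
      using f that lam_mult [OF funcset_mem [OF qc that] rp] by simp
    show "(\<lambda>e. lam (q e \<otimes> rp e)) \<in> EE \<rightarrow> carrier B"
      using lam_closed [OF A.m_closed [OF funcset_mem [OF qc] rp]] by blast
  qed
  also have "\<dots> = lam (comb q)"
    unfolding comb_def by (rule ring_hom_finsum [OF A.ring_axioms B.ring_axioms lam_hom, symmetric])
      (use A.m_closed [OF funcset_mem [OF qc] rp] in blast)
  finally have cf: "cmb f = lam (comb q)" .
  have g: "tpow A T (- M) \<otimes> comb q \<in> carrier A" by (rule A.m_closed [OF tT comb_closed [OF qc]])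
  have a0c: "a0 \<in> carrier A" by (rule F.Fil_carrier [OF a0(1)])
  have "B.cg 1 (lam a0) (lam (tpow A T (- M) \<otimes> comb q))"
    using q(2) lam_FB [OF A.minus_closed [OF a0c g]] lam_minus [OF a0c g] lam_closed [OF a0c] lam_closed [OF g] by (simp add: B.cg_def)
  from B.cg_mult_left [OF this lam_Fil [OF F.tpow_Fil [of m]]]
  have "B.cg (m + 1) (lam a) (lam (tpow A T m) \<otimes>\<^bsub>B\<^esub> lam (tpow A T (- M) \<otimes> comb q))"
    unfolding a0(2) lam_mult [OF tT a0c] .
  moreover have "cmb ?c = lam (tpow A T m) \<otimes>\<^bsub>B\<^esub> lam (tpow A T (- M) \<otimes> comb q)"
  proof -
    have "tpow A T (m - M) \<otimes> comb q = tpow A T m \<otimes> (tpow A T (- M) \<otimes> comb q)"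
      using A.tpow_add [OF T_unit, of m "- M"] A.m_assoc [OF tT tT comb_closed [OF qc], of m "- M"] by simp
    thus ?thesis unfolding cmb_scale [OF fX L.D.tpow_carrier] PD_tpow cf
      using lam_mult [OF tT comb_closed [OF qc], of "m - M"] lam_mult [OF tT g, of m] by simp
  qed
  ultimately have "B.cg (m + 1) (lam a) (cmb ?c)" by simp
  thus ?thesis using c by blast
qed

text \<open>Along the Horner form the correction for \<open>y\<close> is multiplied by
  \<open>pD\<close>, which lies in \<open>L.FD n\<close> just as \<open>lam p\<close> lies in
  \<open>FB n\<close>. Coefficients and errors both gain \<open>n\<close>, so neither the loss
  \<open>M\<close> nor the gain of one degree depends on the length of the form.\<close>

lemma level_comb:
  assumes "level A Fil p (int n) m a"
  shows "\<exists>c\<in>EE \<rightarrow> FX (m - M). B.cg (m + 1) (lam a) (cmb c)"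
  using assms
proof (induction rule: level.induct)
  case (base a m)
  thus ?case by (rule base_comb)
next
  case (step a m y)
  obtain c where c: "c \<in> EE \<rightarrow> FX (m - M)" "B.cg (m + 1) (lam a) (cmb c)" using base_comb [OF step(1)] by blast
  obtain d where d: "d \<in> EE \<rightarrow> FX (m - int n - M)" "B.cg (m - int n + 1) (lam y) (cmb d)" using step.IH by blast
  let ?d = "\<lambda>e \<nu>. pD \<otimes>\<^bsub>L.D\<^esub> d e \<nu>"
  have d': "?d \<in> EE \<rightarrow> FX (m - M)"
  proof
    show "?d e \<in> FX (m - M)" if "e \<in> EE" for e using FX_scale [OF pD_FD funcset_mem [OF d(1) that]] by simp
  qed
  have y: "y \<in> carrier A" by (rule E.level_carrier [OF step(2)])
  have "B.cg (int n + (m - int n + 1)) (lam p \<otimes>\<^bsub>B\<^esub> lam y) (lam p \<otimes>\<^bsub>B\<^esub> cmb d)" by (rule B.cg_mult_left [OF d(2) p_FB])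
  hence "B.cg (m + 1) (lam (p \<otimes> y)) (cmb ?d)"
    unfolding cmb_scale [OF d(1) pD_carrier] PD_p lam_mult [OF E.p_carrier y] by simp
  from B.cg_add [OF c(2) this]
  have "B.cg (m + 1) (lam (a \<oplus> p \<otimes> y)) (cmb (\<lambda>e \<nu>. c e \<nu> \<oplus>\<^bsub>L.D\<^esub> ?d e \<nu>))"
    unfolding cmb_add [OF c(1) d'] lam_add [OF F.Fil_carrier [OF step(1)] A.m_closed [OF E.p_carrier y]] .
  moreover have "(\<lambda>e \<nu>. c e \<nu> \<oplus>\<^bsub>L.D\<^esub> ?d e \<nu>) \<in> EE \<rightarrow> FX (m - M)"
    using FX_add [OF funcset_mem [OF c(1)] funcset_mem [OF d']] by blast
  ultimately show ?case by blast
qed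

text \<open>One round of successive approximation. The loss \<open>M\<close> stays fixed while the
  degree of the error rises, so the coefficients found in later rounds tend to zero.\<close>

lemma FB_comb: assumes b: "b \<in> FB m" shows "\<exists>c. c \<in> EE \<rightarrow> FX (m - M) \<and> b \<ominus>\<^bsub>B\<^esub> cmb c \<in> FB (m + 1)"
proof -
  obtain a where a: "a \<in> carrier A" "B.cg (m + 1) b (lam a)" using lam_dense [OF B.Fil_carrier [OF b]] by blast
  have "B.cg m (lam a) b" by (rule B.cg_mono [OF B.cg_sym [OF a(2)]]) simp
  hence "lam a \<in> FB m" by (rule B.cg_Fil [OF _ b]) simp
  hence "level A Fil p (int n) m a" using lam_FB [OF a(1)] by simp
  then obtain c where c: "c \<in> EE \<rightarrow> FX (m - M)" "B.cg (m + 1) (lam a) (cmb c)" using level_comb by blast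
  have "B.cg (m + 1) b (cmb c)" by (rule B.cg_trans [OF a(2) c(2)])
  thus ?thesis using c(1) unfolding B.cg_def by blast
qed

text \<open>Lets small coefficient tails be recognised as giving small combinations in
  \<open>cmb_surj\<close>; the constant adds up the bound \<open>c0\<close> on monomials and a bound
  on the generators.\<close>

lemma cmb_FB: "\<exists>l. \<forall>m. \<forall>c\<in>EE \<rightarrow> FX m. cmb c \<in> FB (m + l)"
proof -
  obtain c1 where c1: "\<And>e. e \<in> EE ==> rp e \<in> Fil c1" using rp_bounded by blast
  have "cmb c \<in> FB (m + (c0 + c1))" if c: "c \<in> EE \<rightarrow> FX m" for c m
    unfolding cmb_def
  proof (rule B.Fil_finsum)
    show "Ph (c e) \<otimes>\<^bsub>B\<^esub> lam (rp e) \<in> FB (m + (c0 + c1))" if e: "e \<in> EE" for e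
      by (rule B.Fil_mult_eq [OF Ph_FB [OF funcset_mem [OF c e]] lam_Fil [OF c1 [OF e]]]) simp
  qed
  thus ?thesis by blast
qed

lemma cmb_surj: assumes b: "b \<in> carrier B" shows "\<exists>f\<in>EE \<rightarrow> carrier TX. b = cmb f"
proof -
  obtain l where l: "\<And>m c. c \<in> EE \<rightarrow> FX m ==> cmb c \<in> FB (m + l)" using cmb_FB by blast
  obtain m0 where m0: "b \<in> FB m0" using B.Fil_exh [OF b] by blast
  define C where "C m x = (SOME c. c \<in> EE \<rightarrow> FX (m - M) \<and> x \<ominus>\<^bsub>B\<^esub> cmb c \<in> FB (m + 1))" for m x
  have C: "C m x \<in> EE \<rightarrow> FX (m - M) \<and> x \<ominus>\<^bsub>B\<^esub> cmb (C m x) \<in> FB (m + 1)" if "x \<in> FB m" for m x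
    unfolding C_def by (rule someI_ex [OF FB_comb [OF that]])
  define bs where "bs = rec_nat b (\<lambda>j x. x \<ominus>\<^bsub>B\<^esub> cmb (C (int j + m0) x))"
  have bs_Suc: "bs (Suc j) = bs j \<ominus>\<^bsub>B\<^esub> cmb (C (int j + m0) (bs j))" for j by (simp add: bs_def)
  have bsF: "bs j \<in> FB (int j + m0)" for j
  proof (induction j)
    case 0
    show ?case using m0 by (simp add: bs_def)
  next
    case (Suc j)
    thus ?case unfolding bs_Suc using C [OF Suc] by (simp add: algebra_simps)
  qed
  define c where "c j = C (int j + m0) (bs j)" for j
  have c: "c j \<in> EE \<rightarrow> FX (int j + (m0 - M))" for j using C [OF bsF [of j]] by (simp add: c_def algebra_simps)
  have "\<forall>e\<in>EE. \<exists>f. \<forall>j. f j \<in> FX (int j + (m0 - M)) \<and> f j = (\<lambda>\<nu>. c j e \<nu> \<oplus>\<^bsub>L.D\<^esub> f (Suc j) \<nu>)"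
  proof
    fix e assume "e \<in> EE"
    thus "\<exists>f. \<forall>j. f j \<in> FX (int j + (m0 - M)) \<and> f j = (\<lambda>\<nu>. c j e \<nu> \<oplus>\<^bsub>L.D\<^esub> f (Suc j) \<nu>)"
      by (intro LD.tate_tail_sums [OF L.D_complete] funcset_mem [OF c])
  qed
  then obtain f where f: "\<forall>e\<in>EE. \<forall>j. f e j \<in> FX (int j + (m0 - M)) \<and> f e j = (\<lambda>\<nu>. c j e \<nu> \<oplus>\<^bsub>L.D\<^esub> f e (Suc j) \<nu>)"
    by (rule bchoice [THEN exE])
  have fX: "(\<lambda>e. f e j) \<in> EE \<rightarrow> FX (int j + (m0 - M))" for j
    by (rule funcsetI) (rule conjunct1 [OF spec [OF bspec [OF f]]])
  have fs: "cmb (\<lambda>e. f e j) = cmb (c j) \<oplus>\<^bsub>B\<^esub> cmb (\<lambda>e. f e (Suc j))" for j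
  proof -
    have "cmb (\<lambda>e. f e j) = cmb (\<lambda>e \<nu>. c j e \<nu> \<oplus>\<^bsub>L.D\<^esub> f e (Suc j) \<nu>)"
      unfolding cmb_def
    proof (rule B.finsum_cong' [OF HOL.refl])
      fix e assume e: "e \<in> EE"
      have e': "f e j = (\<lambda>\<nu>. c j e \<nu> \<oplus>\<^bsub>L.D\<^esub> f e (Suc j) \<nu>)" by (rule conjunct2 [OF spec [OF bspec [OF f e]]])
      show "Ph (f e j) \<otimes>\<^bsub>B\<^esub> lam (rp e) = Ph (\<lambda>\<nu>. c j e \<nu> \<oplus>\<^bsub>L.D\<^esub> f e (Suc j) \<nu>) \<otimes>\<^bsub>B\<^esub> lam (rp e)"
        by (rule arg_cong [OF e', of "\<lambda>g. Ph g \<otimes>\<^bsub>B\<^esub> lam (rp e)"])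
    next
      show "(\<lambda>e. Ph (\<lambda>\<nu>. c j e \<nu> \<oplus>\<^bsub>L.D\<^esub> f e (Suc j) \<nu>) \<otimes>\<^bsub>B\<^esub> lam (rp e)) \<in> EE \<rightarrow> carrier B"
      proof
        fix e assume e: "e \<in> EE"
        show "Ph (\<lambda>\<nu>. c j e \<nu> \<oplus>\<^bsub>L.D\<^esub> f e (Suc j) \<nu>) \<otimes>\<^bsub>B\<^esub> lam (rp e) \<in> carrier B"
          by (rule B.m_closed [OF Ph_closed [OF LD.tate_add_closed [OF FX_carrier [OF funcset_mem [OF c e]]
            FX_carrier [OF funcset_mem [OF fX e]]]] lam_closed [OF rp]])
      qed
    qed
    also have "\<dots> = cmb (c j) \<oplus>\<^bsub>B\<^esub> cmb (\<lambda>e. f e (Suc j))" by (rule cmb_add [OF c fX])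
    finally show ?thesis .
  qed
  \<comment> \<open>The error after \<open>j\<close> rounds minus the combination of the coefficient
    tails. Both change by the same amount, so \<open>z j\<close> is constant; it also lies in
    arbitrarily deep steps of the filtration and hence vanishes, which for \<open>j = 0\<close> is
    the claim.\<close>
  define z where "z j = bs j \<ominus>\<^bsub>B\<^esub> cmb (\<lambda>e. f e j)" for j
  have minus2: "(x \<ominus>\<^bsub>B\<^esub> u) \<ominus>\<^bsub>B\<^esub> w = x \<ominus>\<^bsub>B\<^esub> (u \<oplus>\<^bsub>B\<^esub> w)"
    if "x \<in> carrier B" "u \<in> carrier B" "w \<in> carrier B" for x u w using that by algebra
  have zs: "z (Suc j) = z j" for j
    unfolding z_def bs_Suc c_def [symmetric] fs [of j]
    by (rule minus2 [OF B.Fil_carrier [OF bsF] cmb_closed [OF c] cmb_closed [OF fX]])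
  have z0: "z j = z 0" for j by (induction j) (use zs in auto)
  have "z 0 = \<zero>\<^bsub>B\<^esub>"
  proof (rule B.sep)
    show "z 0 \<in> carrier B" unfolding z_def using B.Fil_carrier [OF bsF [of 0]] cmb_closed [OF fX [of 0]] by simp
    fix m
    obtain j :: nat where j: "m - m0 \<le> int j" "m - m0 + M - l \<le> int j"
      using that [of "nat (max (m - m0) (m - m0 + M - l))"] by linarith
    have "bs j \<in> FB m" by (rule B.Fil_monoD [OF bsF]) (use j in linarith)
    moreover have "cmb (\<lambda>e. f e j) \<in> FB m" by (rule B.Fil_monoD [OF l [OF fX]]) (use j in linarith)
    ultimately have "z j \<in> FB m" unfolding z_def by (rule B.Fil_minus)
    thus "z 0 \<in> FB m" using z0 [of j] by simp
  qed
  moreover have "z 0 = b \<ominus>\<^bsub>B\<^esub> cmb (\<lambda>e. f e 0)" by (simp add: z_def bs_def)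
  ultimately have "b = cmb (\<lambda>e. f e 0)" using b cmb_closed [OF fX [of 0]] by (simp add: B.r_right_minus_eq)
  moreover have "(\<lambda>e. f e 0) \<in> EE \<rightarrow> carrier TX" using FX_carrier [OF funcset_mem [OF fX]] by blast
  ultimately show ?thesis by blast
qed

text \<open>\<open>module_finite\<close> sums over a set of generators, so distinct indices must
  yield distinct lifts for the sum to be reindexed; their classes modulo \<open>p\<close> already
  separate them.\<close>

lemma lam_rp_inj: "inj_on (\<lambda>e. lam (rp e)) EE"
proof (rule inj_onI)
  fix e e' assume e: "e \<in> EE" "e' \<in> EE" "lam (rp e) = lam (rp e')"
  have "lam (rp e \<ominus> rp e') = lam p \<otimes>\<^bsub>B\<^esub> \<zero>\<^bsub>B\<^esub>"
    unfolding lam_minus [OF rp rp] e(3) using lam_closed [OF rp [of e']] lam_closed [OF E.p_carrier]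
    by (simp add: B.r_right_minus_eq)
  then obtain z where z: "z \<in> carrier A" "rp e \<ominus> rp e' = p \<otimes> z"
    using lam_p_dvd [OF A.minus_closed [OF rp rp] B.zero_closed] by blast
  have "rp e = rp e' \<oplus> (rp e \<ominus> rp e')" using rp [of e] rp [of e'] by algebra
  hence "cl (rp e) = cl (rp e')" unfolding z(2) using cl_eq_iff [OF rp rp] z(1) by blast
  thus "e = e'" using cl_rp [OF EE_c [OF e(1)]] cl_rp [OF EE_c [OF e(2)]] by simp
qed

lemma Ph_finite: "module_finite TX B Ph"
  unfolding module_finite_def
proof (intro exI [of _ "(\<lambda>e. lam (rp e)) ` EE"] conjI ballI)
  let ?g = "\<lambda>e. lam (rp e)"
  show "finite (?g ` EE)" by simp
  show "?g ` EE \<subseteq> carrier B" using lam_closed [OF rp] by blast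
  fix y assume "y \<in> carrier B"
  then obtain f where f: "f \<in> EE \<rightarrow> carrier TX" "y = cmb f" using cmb_surj by blast
  let ?c = "\<lambda>x. f (inv_into EE ?g x)"
  have ci: "?c (?g e) = f e" if "e \<in> EE" for e by (simp only: inv_into_f_f [OF lam_rp_inj that])
  have cX: "?c \<in> ?g ` EE \<rightarrow> carrier TX"
  proof
    fix x assume "x \<in> ?g ` EE"
    then obtain e where e: "e \<in> EE" "x = ?g e" by blast
    show "?c x \<in> carrier TX" unfolding e(2) ci [OF e(1)] by (rule funcset_mem [OF f(1) e(1)])
  qed
  have "(\<Oplus>\<^bsub>B\<^esub>x\<in>?g ` EE. Ph (?c x) \<otimes>\<^bsub>B\<^esub> x) = (\<Oplus>\<^bsub>B\<^esub>e\<in>EE. Ph (?c (?g e)) \<otimes>\<^bsub>B\<^esub> ?g e)"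
  proof (rule B.finsum_reindex [OF _ lam_rp_inj])
    show "(\<lambda>x. Ph (?c x) \<otimes>\<^bsub>B\<^esub> x) \<in> ?g ` EE \<rightarrow> carrier B"
    proof
      fix x assume x: "x \<in> ?g ` EE"
      hence "x \<in> carrier B" using lam_closed [OF rp] by blast
      thus "Ph (?c x) \<otimes>\<^bsub>B\<^esub> x \<in> carrier B" by (rule B.m_closed [OF Ph_closed [OF funcset_mem [OF cX x]]])
    qed
  qed
  also have "\<dots> = cmb f" unfolding cmb_def
  proof (rule B.finsum_cong' [OF HOL.refl])
    show "Ph (?c (?g e)) \<otimes>\<^bsub>B\<^esub> ?g e = Ph (f e) \<otimes>\<^bsub>B\<^esub> ?g e" if "e \<in> EE" for e by (simp only: ci [OF that])
    show "(\<lambda>e. Ph (f e) \<otimes>\<^bsub>B\<^esub> ?g e) \<in> EE \<rightarrow> carrier B"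
      using B.m_closed [OF Ph_closed [OF funcset_mem [OF f(1)]] lam_closed [OF rp]] by blast
  qed
  finally show "\<exists>c. c \<in> ?g ` EE \<rightarrow> carrier TX \<and> y = (\<Oplus>\<^bsub>B\<^esub>x\<in>?g ` EE. Ph (c x) \<otimes>\<^bsub>B\<^esub> x)"
    using cX f(2) by (intro exI [of _ ?c]) simp
qed

lemma Ph_finite_injection:
  "finite_injection OK (DX_ring K v \<pi> n r) (DX_structure K v \<pi> n) B (\<lambda>x. lam (\<eta> x)) Ph"
  unfolding finite_injection_def using Ph_algebra Ph_inj Ph_finite unfolding DX_ring_def by blast

end

theorem proposition2:
  fixes K :: "'k ring" and v :: "'k \<Rightarrow> int" and \<pi> :: 'k
    and A :: "'a top_ring" and \<eta> :: "'k \<Rightarrow> 'a" and T :: 'a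
    and r :: nat
    and \<sigma> :: "(int \<Rightarrow> 'k set) \<Rightarrow> 'a set"
    and \<phi> :: "((nat \<Rightarrow>\<^sub>0 nat) \<Rightarrow> int \<Rightarrow> 'k set) \<Rightarrow> 'a set"
  assumes "complete_discretely_valued_field K v"
    and "uniformiser K v \<pi>"
    and "pseudoaffinoid (ring_of_integers K v) A \<eta>"
    and "flat_via (ring_of_integers K v) A \<eta>"
    and "\<eta> \<pi> \<notin> Units A"
    and "T \<in> Units A" and "top_nilpotent A T"
    and "is_laurent_structure_map K v \<pi> A \<eta> T \<sigma>"
    and "finite_injection (laurent_series_ring (residue_field K v))
           (tate_algebra r (laurent_series_ring (residue_field K v)))
           (series_const (laurent_series_ring (residue_field K v)))
           (mod_ring A (\<eta> \<pi>)) \<sigma> \<phi>"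
  shows "\<exists>N\<ge>1. \<forall>n\<ge>N. \<exists>\<Phi>.
           finite_injection (ring_of_integers K v)
             (DX_ring K v \<pi> n r) (DX_structure K v \<pi> n)
             (loc_ring A (\<eta> \<pi>) T n) (\<lambda>x. loc_map A (\<eta> \<pi>) T n (\<eta> x)) \<Phi> \<and>
           lifts K v \<pi> r A \<eta> T n \<phi> \<Phi>"
proof -
  interpret lifting K v \<pi> A \<eta> T r \<sigma> \<phi> by unfold_locales (use assms in auto)
  obtain n0 c0 where n0: "c0 \<le> 0" "\<And>n \<nu>. n \<ge> n0 \<Longrightarrow> level A Fil p n c0 (xp \<nu>)" using xp_bounded by blast
  obtain M n1 where n1: "0 \<le> M" "\<And>n a. n \<ge> n1 \<Longrightarrow> a \<in> Fil 0 \<Longrightarrow>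
      \<exists>q\<in>EE \<rightarrow> QQ. level A Fil p n 1 (a \<ominus>\<^bsub>A\<^esub> tpow A T (- M) \<otimes>\<^bsub>A\<^esub> comb q)"
    using K2 by blast
  \<comment> \<open>\<open>nat\<close> truncates the integer bounds \<open>n0\<close> and
    \<open>n1\<close>, and \<open>Suc\<close> makes the threshold positive, as
    \<open>lift_level\<close> requires.\<close>
  show ?thesis
  proof (intro exI [of _ "Suc (nat (max n0 n1))"] conjI allI impI)
    fix n assume "Suc (nat (max n0 n1)) \<le> n"
    then have n: "1 \<le> n" "n0 \<le> int n" "n1 \<le> int n" by simp_all
    interpret lift_level K v \<pi> A \<eta> T r \<sigma> \<phi> n c0 M
      by unfold_locales (use n n0(1) n0(2) [OF n(2)] n1(1) n1(2) [OF n(3)] in simp_all)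
    show "\<exists>\<Phi>. finite_injection OK (DX_ring K v \<pi> n r) (DX_structure K v \<pi> n) B (\<lambda>x. lam (\<eta> x)) \<Phi> \<and>
        lifts K v \<pi> r A \<eta> T n \<phi> \<Phi>"
      using Ph_finite_injection Ph_lifts' by blast
  qed simp
qed

end
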